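(* Let $\phi=\tilde p/p$ be a degree $(n,1)$ rational inner function as in the context and let $\alpha\in\mathbb{T}$. Then: (i) for every $f\in K_\phi$, $(J_\alpha f)(\zeta)=f^*(\zeta)$ for $\sigma_\alpha$-almost every $\zeta\in\mathbb{T}^2$, where $f^*$ denotes the non-tangential boundary value of $f$; (ii) $J_\alpha:K_\phi\to L^2(\sigma_\alpha)$ is unitary if and only if $\alpha$ is a generic value for $\phi$.
   Context: $\mathbb{D}$ is the open unit disk, $\mathbb{T}$ the unit circle. Fix $n\ge1$. Let $p\in\mathbb{C}[z_1,z_2]$ have no zeros on $\mathbb{D}^2$, degree at most $n$ in $z_1$ and at most $1$ in $z_2$, and let $\tilde p(z)=z_1^nz_2\overline{p(1/\bar z_1,1/\bar z_2)}$; assume $\tilde p$ has degree exactly $(n,1)$ and $p,\tilde p$ have no common factor, so $\phi=\tilde p/p$ is a rational inner function of degree $(n,1)$. The zeros of $p$ on $\mathbb{T}^2$ are finitely many points $(\tau_1,\lambda_1),\dots,(\tau_m,\lambda_m)$; the non-tangential limit $\phi^*(\zeta)$ exists and is unimodular at every $\zeta\in\mathbb{T}^2$. A value $\alpha\in\mathbb{T}$ is exceptional if $\phi^*(\tau_k,\lambda_k)=\alpha$ for some $k$, and generic otherwise. The Clark measure $\sigma_\alpha$ is the unique positive Borel measure on $\mathbb{T}^2$ with $\frac{1-|\phi(z)|^2}{|\alpha-\phi(z)|^2}=\int_{\mathbb{T}^2}\frac{(1-|z_1|^2)(1-|z_2|^2)}{|\zeta_1-z_1|^2|\zeta_2-z_2|^2}\,d\sigma_\alpha(\zeta)$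 for $z\in\mathbb{D}^2$. $H^2(\mathbb{D}^2)$ is the Hardy space of the bidisk with reproducing kernel $C_w(z)=\frac{1}{(1-z_1\bar w_1)(1-z_2\bar w_2)}$; $K_\phi=H^2(\mathbb{D}^2)\ominus\phi H^2(\mathbb{D}^2)$ is the model space, with reproducing kernel $k_w(z)=(1-\overline{\phi(w)}\phi(z))C_w(z)$. $J_\alpha:K_\phi\to L^2(\sigma_\alpha)$ is the isometry determined by $J_\alpha[k_w](\zeta)=(1-\alpha\overline{\phi(w)})C_w(\zeta)$ for $w\in\mathbb{D}^2$, $\zeta\in\mathbb{T}^2$, extended by linearity and continuity. *)

theory Defs
  imports "HOL-Analysis.Analysis" "HOL-Computational_Algebra.Polynomial_Factorial"
begin

definition bidisk :: "(complex \<times> complex) set" where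
  "bidisk = {z. cmod (fst z) < 1 \<and> cmod (snd z) < 1}"

definition torus2 :: "(complex \<times> complex) set" where
  "torus2 = {z. cmod (fst z) = 1 \<and> cmod (snd z) = 1}"

text \<open>Bivariate polynomials in C[z1,z2] = C[z1][z2], represented as complex poly poly:
  a polynomial in z2 whose coefficients are polynomials in z1.\<close>

definition eval2 :: "complex poly poly \<Rightarrow> complex \<times> complex \<Rightarrow> complex" where
  "eval2 P z = poly (map_poly (\<lambda>c. poly c (fst z)) P) (snd z)"

text \<open>Reflection P~(z) = z1^n z2 conj(P(1/conj z1, 1/conj z2)) for P of degree at most (n,1):
  the coefficient of z1^i z2^j of P~ is conj of the coefficient of z1^(n-i) z2^(1-j) of P.\<close>

definition reflect2 :: "nat \<Rightarrow> complex poly poly \<Rightarrow> complex poly poly" where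
  "reflect2 n P = (\<Sum>j\<le>1. \<Sum>i\<le>n. monom (monom (cnj (coeff (coeff P (1 - j)) (n - i))) i) j)"

definition nt_region :: "real \<Rightarrow> complex \<times> complex \<Rightarrow> (complex \<times> complex) set" where
  "nt_region c \<zeta> = {z \<in> bidisk. cmod (fst \<zeta> - fst z) < c * (1 - cmod (fst z))
                                \<and> cmod (snd \<zeta> - snd z) < c * (1 - cmod (snd z))}"

definition nt_limit :: "(complex \<times> complex \<Rightarrow> complex) \<Rightarrow> complex \<times> complex \<Rightarrow> complex \<Rightarrow> bool" where
  "nt_limit f \<zeta> L \<longleftrightarrow> (\<forall>c>1. (f \<longlongrightarrow> L) (at \<zeta> within nt_region c \<zeta>))"

definition h2_series :: "(nat \<times> nat \<Rightarrow> complex) \<Rightarrow> (complex \<times> complex \<Rightarrow> complex) \<Rightarrow> bool" where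
  "h2_series c f \<longleftrightarrow> (\<lambda>ij. (cmod (c ij))\<^sup>2) summable_on UNIV \<and>
     (\<forall>z\<in>bidisk. ((\<lambda>(i,j). c (i,j) * fst z ^ i * snd z ^ j) has_sum f z) UNIV)"

definition H2 :: "(complex \<times> complex \<Rightarrow> complex) set" where
  "H2 = {f. \<exists>c. h2_series c f}"

definition h2_coeff :: "(complex \<times> complex \<Rightarrow> complex) \<Rightarrow> nat \<times> nat \<Rightarrow> complex" where
  "h2_coeff f = (SOME c. h2_series c f)"

definition h2_inner :: "(complex \<times> complex \<Rightarrow> complex) \<Rightarrow> (complex \<times> complex \<Rightarrow> complex) \<Rightarrow> complex" where
  "h2_inner f g = infsum (\<lambda>ij. h2_coeff f ij * cnj (h2_coeff g ij)) UNIV"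

definition h2_norm :: "(complex \<times> complex \<Rightarrow> complex) \<Rightarrow> real" where
  "h2_norm f = sqrt (infsum (\<lambda>ij. (cmod (h2_coeff f ij))\<^sup>2) UNIV)"

definition model_space :: "(complex \<times> complex \<Rightarrow> complex) \<Rightarrow> (complex \<times> complex \<Rightarrow> complex) set" where
  "model_space \<phi> = {f \<in> H2. \<forall>g\<in>H2. h2_inner f (\<lambda>z. \<phi> z * g z) = 0}"

definition szego :: "complex \<times> complex \<Rightarrow> complex \<times> complex \<Rightarrow> complex" where
  "szego w z = 1 / ((1 - fst z * cnj (fst w)) * (1 - snd z * cnj (snd w)))"

definition model_kernel :: "(complex \<times> complex \<Rightarrow> complex) \<Rightarrow> complex \<times> complex \<Rightarrow> complex \<times> complex \<Rightarrow> complex" where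
  "model_kernel \<phi> w z = (1 - cnj (\<phi> w) * \<phi> z) * szego w z"

definition poisson2 :: "complex \<times> complex \<Rightarrow> complex \<times> complex \<Rightarrow> real" where
  "poisson2 z \<zeta> = (1 - (cmod (fst z))\<^sup>2) * (1 - (cmod (snd z))\<^sup>2) /
                    ((cmod (fst \<zeta> - fst z))\<^sup>2 * (cmod (snd \<zeta> - snd z))\<^sup>2)"

definition is_clark_measure :: "(complex \<times> complex \<Rightarrow> complex) \<Rightarrow> complex \<Rightarrow> (complex \<times> complex) measure \<Rightarrow> bool" where
  "is_clark_measure \<phi> \<alpha> \<sigma> \<longleftrightarrow> sets \<sigma> = sets borel \<and> emeasure \<sigma> (UNIV - torus2) = 0 \<and>
     (\<forall>z\<in>bidisk. ennreal ((1 - (cmod (\<phi> z))\<^sup>2) / (cmod (\<alpha> - \<phi> z))\<^sup>2)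
                  = (\<integral>\<^sup>+ \<zeta>. ennreal (poisson2 z \<zeta>) \<partial>\<sigma>))"

definition L2 :: "(complex \<times> complex) measure \<Rightarrow> (complex \<times> complex \<Rightarrow> complex) set" where
  "L2 \<sigma> = {h. h \<in> borel_measurable \<sigma> \<and> integrable \<sigma> (\<lambda>\<zeta>. (cmod (h \<zeta>))\<^sup>2)}"

text \<open>J is the (linear, isometric) map K_phi \<rightarrow> L2(sigma) determined by its values on
  the reproducing kernels; equalities in L2 are up to sigma-null sets.\<close>

definition is_clark_embedding ::
  "(complex \<times> complex \<Rightarrow> complex) \<Rightarrow> complex \<Rightarrow> (complex \<times> complex) measure
    \<Rightarrow> ((complex \<times> complex \<Rightarrow> complex) \<Rightarrow> (complex \<times> complex \<Rightarrow> complex)) \<Rightarrow> bool" where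
  "is_clark_embedding \<phi> \<alpha> \<sigma> J \<longleftrightarrow>
     (\<forall>f\<in>model_space \<phi>. J f \<in> L2 \<sigma>) \<and>
     (\<forall>f\<in>model_space \<phi>. \<forall>g\<in>model_space \<phi>.
        AE \<zeta> in \<sigma>. J (\<lambda>z. f z + g z) \<zeta> = J f \<zeta> + J g \<zeta>) \<and>
     (\<forall>f\<in>model_space \<phi>. \<forall>a. AE \<zeta> in \<sigma>. J (\<lambda>z. a * f z) \<zeta> = a * J f \<zeta>) \<and>
     (\<forall>f\<in>model_space \<phi>. (\<integral>\<zeta>. (cmod (J f \<zeta>))\<^sup>2 \<partial>\<sigma>) = (h2_norm f)\<^sup>2) \<and>
     (\<forall>w\<in>bidisk. AE \<zeta> in \<sigma>.
        J (model_kernel \<phi> w) \<zeta> = (1 - \<alpha> * cnj (\<phi> w)) * szego w \<zeta>)"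

end

theory Submission
  imports Defs "HOL-Complex_Analysis.Complex_Analysis" "HOL-Computational_Algebra.Field_as_Ring"
    "HOL-Computational_Algebra.Fundamental_Theorem_Algebra"
begin

text \<open>
  Write \<open>dd = \<alpha> p - p~ = bb(z1) - \<alpha> z2 bt(z1)\<close>. The Clark measure \<open>\<sigma>\<close> lives on the zero set of \<open>dd\<close>
  in the torus, a graph \<open>z2 = bb / (\<alpha> bt)\<close> over \<open>z1\<close> together with the vertical lines \<open>z1 = \<tau>\<close>,
  \<open>bb \<tau> = 0\<close>; such lines exist exactly when \<open>\<alpha>\<close> is exceptional.

  Boundary values: on reproducing kernels the claim is the continuity of \<open>phi\<close> off the zeros of \<open>p\<close>,
  which are \<open>\<sigma>\<close>-null. To pass to limits, every \<open>f\<close> in the model space is written as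
  \<open>p f = a(z1) + (\<Sum>i<n. z1^i b_i(z2))\<close> with \<open>a\<close>, \<open>b_i\<close> in the Hardy space of the disk, of norm at most a
  constant times that of \<open>f\<close>. At points where a marginal of \<open>\<sigma>\<close> has at most linear mass on small
  disks a weak-type maximal inequality controls \<open>a\<close> and \<open>b_i\<close>; at the remaining finitely many
  points of a marginal they are bounded on Stolz regions. Hence fast norm convergence gives
  convergence of the non-tangential limits almost everywhere.

  Surjectivity: on a vertical line in the support \<open>\<sigma>\<close> is a multiple of Lebesgue measure, and
  \<open>cnj z2\<close> restricted to the line is orthogonal to the range. Without such lines, the bounded
  multipliers of the annihilator of the Szego kernels contain the coordinates and their conjugates
  (\<open>z2\<close> is antianalytic in \<open>z1\<close> on the graph), hence all bounded Borel functions.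
\<close>

section \<open>The Hilbert space of square-summable families\<close>

text \<open>A maximal function for Lebesgue measure on the torus says nothing about
  \<open>\<sigma>\<close>, which is singular. The way out is algebraic: \<open>f\<close> is
  orthogonal to \<open>phi\<close> times \<open>p\<close> times any monomial, that is, to monomial
  multiples of \<open>p~\<close>, and this says precisely that \<open>p f\<close> has no monomial
  with exponent at least \<open>n\<close> in \<open>z1\<close> and at least \<open>1\<close> in
  \<open>z2\<close>. So \<open>p f\<close> is built from functions of one variable, and only the
  marginals of \<open>\<sigma>\<close> matter.

  The Clark measure is never computed. What is known of it comes from its Poisson integral and from
  the Gram matrix of the Szego kernels, which the isometry \<open>J\<close> supplies. Likewise
  multiplication by \<open>phi\<close> is obtained without boundary values: \<open>p x\<close> and
  \<open>p~ x\<close> have the same norm by a symmetry of coefficients, and the multiples of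
  \<open>p\<close> are dense.\<close>

typedef 'i ell2 = "{c :: 'i \<Rightarrow> complex. (\<lambda>i. (cmod (c i))\<^sup>2) summable_on UNIV}"
  morphisms coef Abs_ell2
  by (rule exI[of _ "\<lambda>_. 0"]) simp

setup_lifting type_definition_ell2

lemma coef_summable: "(\<lambda>i. (cmod (coef x i))\<^sup>2) summable_on UNIV"
  using coef[of x] by simp

lemma ell2_eqI: "(\<And>i. coef x i = coef y i) \<Longrightarrow> x = y"
  by (meson coef_inject ext)

lemma sq_summable_add:
  fixes c d :: "'i \<Rightarrow> complex"
  assumes "(\<lambda>i. (cmod (c i))\<^sup>2) summable_on A" "(\<lambda>i. (cmod (d i))\<^sup>2) summable_on A"
  shows "(\<lambda>i. (cmod (c i + d i))\<^sup>2) summable_on A"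
proof (rule summable_on_comparison_test)
  show "(\<lambda>i. 2 * (cmod (c i))\<^sup>2 + 2 * (cmod (d i))\<^sup>2) summable_on A"
    by (intro summable_on_add summable_on_cmult_right assms)
  fix i
  have "(cmod (c i + d i))\<^sup>2 \<le> (cmod (c i) + cmod (d i))\<^sup>2"
    by (intro power_mono norm_triangle_ineq) auto
  also have "\<dots> \<le> 2 * (cmod (c i))\<^sup>2 + 2 * (cmod (d i))\<^sup>2"
    using sum_squares_bound[of "cmod (c i)" "cmod (d i)"] by (simp add: power2_sum)
  finally show "(cmod (c i + d i))\<^sup>2 \<le> 2 * (cmod (c i))\<^sup>2 + 2 * (cmod (d i))\<^sup>2" .
qed auto

lemma sq_summable_cmult:
  fixes c :: "'i \<Rightarrow> complex"
  assumes "(\<lambda>i. (cmod (c i))\<^sup>2) summable_on A"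
  shows "(\<lambda>i. (cmod (a * c i))\<^sup>2) summable_on A"
  using summable_on_cmult_right[OF assms, of "(cmod a)\<^sup>2"] by (simp add: norm_mult power_mult_distrib)

lemma sq_summable_mult:
  fixes c d :: "'i \<Rightarrow> complex"
  assumes "(\<lambda>i. (cmod (c i))\<^sup>2) summable_on A" "(\<lambda>i. (cmod (d i))\<^sup>2) summable_on A"
  shows "(\<lambda>i. norm (c i * d i)) summable_on A"
  using abs_summable_product[of c A d] assms by (simp add: norm_mult power2_eq_square)

lemma coef_mult_summable: "(\<lambda>i. norm (coef x i * cnj (coef y i))) summable_on UNIV"
  by (rule sq_summable_mult) (simp_all add: coef_summable)

instantiation ell2 :: (type) real_vector
begin

lift_definition zero_ell2 :: "'a ell2" is "\<lambda>_. 0" by simp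

lift_definition plus_ell2 :: "'a ell2 \<Rightarrow> 'a ell2 \<Rightarrow> 'a ell2" is "\<lambda>c d i. c i + d i"
  by (rule sq_summable_add)

lift_definition uminus_ell2 :: "'a ell2 \<Rightarrow> 'a ell2" is "\<lambda>c i. - c i" by simp

lift_definition minus_ell2 :: "'a ell2 \<Rightarrow> 'a ell2 \<Rightarrow> 'a ell2" is "\<lambda>c d i. c i - d i"
  using sq_summable_add[of _ UNIV "\<lambda>i. - _ i"] by simp

lift_definition scaleR_ell2 :: "real \<Rightarrow> 'a ell2 \<Rightarrow> 'a ell2" is "\<lambda>r c i. of_real r * c i"
  by (rule sq_summable_cmult)

instance
proof
  fix x y z :: "'a ell2" and a b :: real
  show "x + y + z = x + (y + z)" by transfer (simp add: algebra_simps)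
  show "x + y = y + x" by transfer (simp add: algebra_simps)
  show "0 + x = x" by transfer simp
  show "- x + x = 0" by transfer simp
  show "x - y = x + - y" by transfer simp
  show "a *\<^sub>R (x + y) = a *\<^sub>R x + a *\<^sub>R y" by transfer (simp add: algebra_simps)
  show "(a + b) *\<^sub>R x = a *\<^sub>R x + b *\<^sub>R x" by transfer (simp add: algebra_simps)
  show "a *\<^sub>R b *\<^sub>R x = (a * b) *\<^sub>R x" by transfer (simp add: algebra_simps)
  show "1 *\<^sub>R x = x" by transfer simp
qed

end

lemma coef_Re_summable: "(\<lambda>i. Re (coef x i * cnj (coef y i))) summable_on UNIV"
  by (rule summable_on_Re[OF abs_summable_summable[OF coef_mult_summable]])

instantiation ell2 :: (type) real_inner
begin

text \<open>The class \<open>real_inner\<close> wants a real form, hence the real part of the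
  Hermitian product; complex scalars return through \<open>csc\<close> and
  \<open>cip\<close>.\<close>

definition inner_ell2 :: "'a ell2 \<Rightarrow> 'a ell2 \<Rightarrow> real" where
  "inner_ell2 x y = (\<Sum>\<^sub>\<infinity>i. Re (coef x i * cnj (coef y i)))"

definition norm_ell2 :: "'a ell2 \<Rightarrow> real" where "norm_ell2 x = sqrt (inner x x)"
definition sgn_ell2 :: "'a ell2 \<Rightarrow> 'a ell2" where "sgn_ell2 x = x /\<^sub>R norm x"
definition dist_ell2 :: "'a ell2 \<Rightarrow> 'a ell2 \<Rightarrow> real" where "dist_ell2 x y = norm (x - y)"
definition uniformity_ell2 :: "('a ell2 \<times> 'a ell2) filter"
  where "uniformity_ell2 = (INF e\<in>{0 <..}. principal {(x, y). dist x y < e})"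
definition open_ell2 :: "'a ell2 set \<Rightarrow> bool"
  where "open_ell2 S = (\<forall>x\<in>S. \<forall>\<^sub>F (x', y) in uniformity. x' = x \<longrightarrow> y \<in> S)"

instance
proof
  fix x y z :: "'a ell2" and r :: real and U :: "'a ell2 set"
  show "dist x y = norm (x - y)" by (rule dist_ell2_def)
  show "sgn x = x /\<^sub>R norm x" by (rule sgn_ell2_def)
  show "uniformity = (INF e\<in>{0 <..}. principal {(x, y :: 'a ell2). dist x y < e})"
    by (rule uniformity_ell2_def)
  show "open U \<longleftrightarrow> (\<forall>x\<in>U. \<forall>\<^sub>F (x', y) in uniformity. x' = x \<longrightarrow> y \<in> U)"
    by (rule open_ell2_def)
  show "inner x y = inner y x" unfolding inner_ell2_def
    by (rule infsum_cong) (simp add: mult.commute)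
  show "inner (x + y) z = inner x z + inner y z"
    unfolding inner_ell2_def plus_ell2.rep_eq distrib_right plus_complex.sel
    by (rule infsum_add) (rule coef_Re_summable)+
  have "inner (r *\<^sub>R x) y = (\<Sum>\<^sub>\<infinity>i. r * Re (coef x i * cnj (coef y i)))"
    unfolding inner_ell2_def scaleR_ell2.rep_eq by (rule infsum_cong) (simp add: algebra_simps)
  then show "inner (r *\<^sub>R x) y = r * inner x y"
    by (simp add: inner_ell2_def infsum_cmult_right')
  have sq: "Re (coef x i * cnj (coef x i)) = (cmod (coef x i))\<^sup>2" for i
    by (simp only: complex_norm_square[symmetric] Re_complex_of_real)
  show pos: "0 \<le> inner x x" unfolding inner_ell2_def sq by (rule infsum_nonneg) simp
  show "inner x x = 0 \<longleftrightarrow> x = 0"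
  proof
    assume "inner x x = 0"
    then have "(cmod (coef x i))\<^sup>2 = 0" for i
      unfolding inner_ell2_def sq
      by (intro nonneg_infsum_le_0D[of "\<lambda>i. (cmod (coef x i))\<^sup>2" UNIV]) (use coef_summable in auto)
    then show "x = 0" by (intro ell2_eqI) (simp add: zero_ell2.rep_eq)
  qed (simp add: inner_ell2_def zero_ell2.rep_eq)
  show "norm x = sqrt (inner x x)" by (rule norm_ell2_def)
qed

end

lemmas coef_simps [simp] = zero_ell2.rep_eq plus_ell2.rep_eq uminus_ell2.rep_eq
  minus_ell2.rep_eq scaleR_ell2.rep_eq

lemma norm_ell2_sq: "(norm x)\<^sup>2 = (\<Sum>\<^sub>\<infinity>i. (cmod (coef x i))\<^sup>2)"
  unfolding power2_norm_eq_inner[of x] inner_ell2_def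
  by (simp only: complex_norm_square[symmetric] Re_complex_of_real)

lemma sum_coef_le_norm: "finite I \<Longrightarrow> (\<Sum>i\<in>I. (cmod (coef x i))\<^sup>2) \<le> (norm x)\<^sup>2"
  unfolding norm_ell2_sq by (rule finite_sum_le_infsum) (auto simp: coef_summable)

lemma coef_le_norm: "cmod (coef x i) \<le> norm x"
  by (rule power2_le_imp_le) (use sum_coef_le_norm[of "{i}" x] in simp_all)

lemma coef_Abs_ell2:
  "(\<lambda>i. (cmod (c i))\<^sup>2) summable_on UNIV \<Longrightarrow> coef (Abs_ell2 c) = c"
  by (simp add: Abs_ell2_inverse)

lemma sq_summable_bound:
  fixes c :: "'i \<Rightarrow> complex"
  assumes "\<And>I. finite I \<Longrightarrow> (\<Sum>i\<in>I. (cmod (c i))\<^sup>2) \<le> B"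
  shows "(\<lambda>i. (cmod (c i))\<^sup>2) summable_on UNIV" "(\<Sum>\<^sub>\<infinity>i. (cmod (c i))\<^sup>2) \<le> B"
proof -
  show s: "(\<lambda>i. (cmod (c i))\<^sup>2) summable_on UNIV"
    by (rule nonneg_bdd_above_summable_on) (use assms in \<open>auto intro!: bdd_aboveI[of _ B]\<close>)
  show "(\<Sum>\<^sub>\<infinity>i. (cmod (c i))\<^sup>2) \<le> B"
    by (rule infsum_le_finite_sums[OF s]) (use assms in auto)
qed

text \<open>Coordinates are 1-Lipschitz, so a Cauchy sequence has a coordinatewise limit. A bound on
  finite partial sums that is uniform in the index set (\<open>key\<close>) shows both that this
  limit is square-summable and that the convergence is in norm.\<close>

instance ell2 :: (type) complete_space
proof
  fix X :: "nat \<Rightarrow> 'a ell2" assume X: "Cauchy X"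
  have "Cauchy (\<lambda>n. coef (X n) i)" for i
  proof (rule metric_CauchyI)
    fix e :: real assume "e > 0"
    with X obtain M where M: "\<And>m n. m \<ge> M \<Longrightarrow> n \<ge> M \<Longrightarrow> dist (X m) (X n) < e"
      by (metis metric_CauchyD)
    have "dist (coef (X m) i) (coef (X n) i) < e" if "m \<ge> M" "n \<ge> M" for m n
      using M[OF that] coef_le_norm[of "X m - X n" i] by (simp add: dist_norm)
    then show "\<exists>M. \<forall>m\<ge>M. \<forall>n\<ge>M. dist (coef (X m) i) (coef (X n) i) < e" by blast
  qed
  then have "\<forall>i. \<exists>l. (\<lambda>n. coef (X n) i) \<longlonglongrightarrow> l" using Cauchy_convergent convergent_def by blast
  then obtain c where c: "\<And>i. (\<lambda>n. coef (X n) i) \<longlonglongrightarrow> c i" by metis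
  have key: "\<exists>M. \<forall>m\<ge>M. \<forall>I. finite I \<longrightarrow> (\<Sum>i\<in>I. (cmod (coef (X m) i - c i))\<^sup>2) \<le> e\<^sup>2"
    if e: "e > 0" for e
  proof -
    from X e obtain M where M: "\<And>m n. m \<ge> M \<Longrightarrow> n \<ge> M \<Longrightarrow> dist (X m) (X n) < e"
      by (metis metric_CauchyD)
    have "(\<Sum>i\<in>I. (cmod (coef (X m) i - c i))\<^sup>2) \<le> e\<^sup>2" if "m \<ge> M" "finite I" for m I
    proof (rule Lim_bounded)
      show "(\<lambda>n. \<Sum>i\<in>I. (cmod (coef (X m) i - coef (X n) i))\<^sup>2)
          \<longlonglongrightarrow> (\<Sum>i\<in>I. (cmod (coef (X m) i - c i))\<^sup>2)"
        by (intro tendsto_intros c)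
      show "\<forall>n\<ge>M. (\<Sum>i\<in>I. (cmod (coef (X m) i - coef (X n) i))\<^sup>2) \<le> e\<^sup>2"
      proof (intro allI impI)
        fix n assume "n \<ge> M"
        then have "norm (X m - X n) < e" using M[of m n] that by (simp add: dist_norm)
        then have "(norm (X m - X n))\<^sup>2 \<le> e\<^sup>2" by (intro power_mono) auto
        then show "(\<Sum>i\<in>I. (cmod (coef (X m) i - coef (X n) i))\<^sup>2) \<le> e\<^sup>2"
          using sum_coef_le_norm[OF that(2), of "X m - X n"] by simp
      qed
    qed
    then show ?thesis by blast
  qed
  obtain M where "\<And>I. finite I \<Longrightarrow> (\<Sum>i\<in>I. (cmod (coef (X M) i - c i))\<^sup>2) \<le> 1\<^sup>2"
    using key[of 1] by force
  then have "(\<lambda>i. (cmod (coef (X M) i - c i))\<^sup>2) summable_on UNIV" by (rule sq_summable_bound)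
  note sq_summable_add[OF coef_summable[of "X M"] sq_summable_cmult[OF this, of "-1"]]
  moreover have "coef (X M) i + (- 1) * (coef (X M) i - c i) = c i" for i by (simp add: algebra_simps)
  ultimately have cs: "(\<lambda>i. (cmod (c i))\<^sup>2) summable_on UNIV" by (simp only:)
  define L where "L = Abs_ell2 c"
  have L: "coef L = c" unfolding L_def by (rule coef_Abs_ell2[OF cs])
  have "X \<longlonglongrightarrow> L"
  proof (rule metric_LIMSEQ_I)
    fix e :: real assume e: "e > 0"
    obtain M where M: "\<And>m I. m \<ge> M \<Longrightarrow> finite I \<Longrightarrow> (\<Sum>i\<in>I. (cmod (coef (X m) i - c i))\<^sup>2) \<le> (e/2)\<^sup>2"
      using key[OF half_gt_zero[OF e]] by blast
    have "dist (X m) L < e" if "m \<ge> M" for m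
    proof -
      have "(norm (X m - L))\<^sup>2 \<le> (e/2)\<^sup>2"
        using sq_summable_bound(2)[OF M[OF that]] by (simp add: norm_ell2_sq L)
      then have "norm (X m - L) \<le> e/2" by (rule power2_le_imp_le) (use e in simp)
      then show ?thesis using e by (simp add: dist_norm)
    qed
    then show "\<exists>M. \<forall>m\<ge>M. dist (X m) L < e" by blast
  qed
  then show "convergent X" by (auto simp: convergent_def)
qed

section \<open>Hermitian product and complex scalars\<close>

definition cip :: "'i ell2 \<Rightarrow> 'i ell2 \<Rightarrow> complex" where
  "cip x y = (\<Sum>\<^sub>\<infinity>i. coef x i * cnj (coef y i))"

lift_definition csc :: "complex \<Rightarrow> 'i ell2 \<Rightarrow> 'i ell2" is "\<lambda>a c i. a * c i"
  by (rule sq_summable_cmult)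

lemma coef_csc [simp]: "coef (csc a x) i = a * coef x i"
  by (simp add: csc.rep_eq)

lemma coef_mult_summable': "(\<lambda>i. coef x i * cnj (coef y i)) summable_on UNIV"
  by (rule abs_summable_summable[OF coef_mult_summable])

lemma cip_cnj: "cnj (cip x y) = cip y x"
  unfolding cip_def infsum_cnj[symmetric] by (rule infsum_cong) simp

lemma Re_cip: "Re (cip x y) = inner x y"
  unfolding cip_def inner_ell2_def using infsum_Re[OF coef_mult_summable'[of x y]] by simp

lemma cip_add_left: "cip (x + y) z = cip x z + cip y z"
  unfolding cip_def by (simp add: distrib_right infsum_add coef_mult_summable')

lemma cip_csc_left: "cip (csc a x) y = a * cip x y"
  unfolding cip_def by (simp add: mult.assoc infsum_cmult_right')

lemma cip_add_right: "cip x (y + z) = cip x y + cip x z"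
  by (metis cip_add_left cip_cnj complex_cnj_add)

lemma cip_csc_right: "cip x (csc a y) = cnj a * cip x y"
  by (metis cip_csc_left cip_cnj complex_cnj_mult)

lemma csc_scaleR: "r *\<^sub>R x = csc (of_real r) x"
  by (rule ell2_eqI) simp

lemma csc_neg1: "csc (-1) x = - x"
  by (rule ell2_eqI) simp

lemma csc_add: "csc a (x + y) = csc a x + csc a y"
  by (rule ell2_eqI) (simp add: algebra_simps)

lemma csc_csc: "csc a (csc b x) = csc (a * b) x"
  by (rule ell2_eqI) (simp add: algebra_simps)

lemma csc_1 [simp]: "csc 1 x = x" and csc_0 [simp]: "csc 0 x = 0"
  by (rule ell2_eqI; simp)+

lemma cip_minus_left: "cip (x - y) z = cip x z - cip y z"
  using cip_add_left[of x "- y" z] cip_csc_left[of "-1" y z] by (simp add: csc_neg1)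

lemma cip_minus_right: "cip x (y - z) = cip x y - cip x z"
  by (metis cip_minus_left cip_cnj complex_cnj_diff)

lemma cip_self: "cip x x = of_real ((norm x)\<^sup>2)"
proof (rule complex_eqI)
  show "Re (cip x x) = Re (of_real ((norm x)\<^sup>2))" by (simp add: Re_cip power2_norm_eq_inner)
  have "cnj (cip x x) = cip x x" by (rule cip_cnj)
  then show "Im (cip x x) = Im (of_real ((norm x)\<^sup>2))" by (simp add: complex_eq_iff)
qed

lemma norm_csc: "norm (csc a x) = cmod a * norm x"
proof -
  have "complex_of_real ((norm (csc a x))\<^sup>2) = of_real ((cmod a * norm x)\<^sup>2)"
    unfolding cip_self[symmetric] cip_csc_left cip_csc_right
    by (simp add: cip_self power_mult_distrib complex_norm_square mult.assoc[symmetric] del: of_real_power)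
  then have "(norm (csc a x))\<^sup>2 = (cmod a * norm x)\<^sup>2" using of_real_eq_iff by blast
  then show ?thesis by simp
qed

text \<open>Multiplying the second argument by \<open>\<i>\<close> turns the imaginary part into a
  real inner product. This is how the real Riesz theorem and real isometry statements are lifted to
  complex ones.\<close>

lemma cip_eq_inner: "cip x y = Complex (inner x y) (inner x (csc \<i> y))"
  by (rule complex_eqI) (simp_all add: Re_cip[symmetric] cip_csc_right)

lemma cip_le: "cmod (cip x y) \<le> norm x * norm y"
proof (cases "cip x y = 0")
  case False
  define u where "u = cnj (cip x y) / cmod (cip x y)"
  have u: "cmod u = 1" using False by (simp add: u_def norm_divide)
  have "cmod (cip x y) = Re (cip (csc u x) y)"
  proof -
    have "cip x y * cnj (cip x y) = complex_of_real (cmod (cip x y)) * complex_of_real (cmod (cip x y))"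
      using complex_norm_square[of "cip x y"] by (simp only: power2_eq_square of_real_mult)
    then have "u * cip x y = complex_of_real (cmod (cip x y))"
      using False by (simp add: u_def nonzero_divide_eq_eq mult.commute)
    then show ?thesis by (simp add: cip_csc_left)
  qed
  also have "\<dots> \<le> norm (csc u x) * norm y" by (simp add: Re_cip norm_cauchy_schwarz)
  finally show ?thesis using u by (simp add: norm_csc)
qed simp

lemma bounded_linear_csc: "bounded_linear (csc a)"
  by (rule bounded_linear_intro[where K = "cmod a"])
    (simp_all add: csc_add csc_scaleR csc_csc norm_csc mult.commute)

lemma bounded_linear_cip_left: "bounded_linear (\<lambda>x. cip x y)"
  by (rule bounded_linear_intro[where K = "norm y"])
    (simp_all add: cip_add_left csc_scaleR cip_csc_left cip_le scaleR_conv_of_real)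

lemma bounded_linear_cip_right: "bounded_linear (\<lambda>y. cip x y)"
  by (rule bounded_linear_intro[where K = "norm x"])
    (use cip_le[of x] in \<open>simp_all add: cip_add_right csc_scaleR cip_csc_right scaleR_conv_of_real mult.commute\<close>)

text \<open>The functional \<open>Q\<close> is minimised on \<open>S\<close>: the parallelogram law
  makes a minimising sequence Cauchy, and the vanishing first variation at the minimum is the
  representation. Linearity is stated on \<open>S\<close> alone because later \<open>l\<close> is an
  integral against \<open>J\<close>, which is additive only on the model space.\<close>

lemma riesz_representation_closed_subspace:
  fixes S :: "'a :: {real_inner, complete_space} set"
  assumes S: "closed S" "subspace S"
    and l_add: "\<And>x y. x \<in> S \<Longrightarrow> y \<in> S \<Longrightarrow> l (x + y) = l x + l y"
    and l_scale: "\<And>r x. x \<in> S \<Longrightarrow> l (r *\<^sub>R x) = r * l x"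
    and l_bound: "\<And>x. x \<in> S \<Longrightarrow> \<bar>l x\<bar> \<le> M * norm x"
  obtains f where "f \<in> S" "\<And>g. g \<in> S \<Longrightarrow> l g = inner f g"
proof -
  define Q where "Q x = (norm x)\<^sup>2 - 2 * l x" for x
  \<comment> \<open>Completing the square: \<open>l x\<close> is at most \<open>M * norm x\<close>,
    so \<open>Q x\<close> is at least \<open>(norm x - M)\<^sup>2 - M\<^sup>2\<close>.\<close>
  have Q_lower: "- M\<^sup>2 \<le> Q x" if "x \<in> S" for x
  proof -
    have "0 \<le> (norm x - M)\<^sup>2" by simp
    also have "\<dots> \<le> Q x + M\<^sup>2" using l_bound[OF that] by (simp add: Q_def power2_diff abs_le_iff mult.commute)
    finally show ?thesis by simp
  qed
  have S0: "0 \<in> S" using S(2) by (rule subspace_0)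
  have bdd: "bdd_below (Q ` S)" using Q_lower by (auto intro!: bdd_belowI[of _ "- M\<^sup>2"])
  define m where "m = Inf (Q ` S)"
  have m_le: "m \<le> Q x" if "x \<in> S" for x unfolding m_def using bdd that by (simp add: cInf_lower)
  have "\<exists>x\<in>S. Q x < m + 1 / real (Suc k)" for k
    using cInf_lessD[of "Q ` S" "m + 1 / real (Suc k)"] S0 m_def by auto
  then obtain X where X: "\<And>k. X k \<in> S" "\<And>k. Q (X k) < m + 1 / real (Suc k)" by metis
  have para: "(norm (x - y))\<^sup>2 \<le> 2 * Q x + 2 * Q y - 4 * m" if "x \<in> S" "y \<in> S" for x y
  proof -
    define z where "z = (1/2) *\<^sub>R (x + y)"
    have z: "z \<in> S" unfolding z_def using S(2) that by (intro subspace_scale subspace_add)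
    have lz: "l z = (1/2) * (l x + l y)"
      unfolding z_def using that S(2) by (subst l_scale) (auto intro: subspace_add simp: l_add)
    have "(norm (x - y))\<^sup>2 + 4 * (norm z)\<^sup>2 = 2 * (norm x)\<^sup>2 + 2 * (norm y)\<^sup>2"
      unfolding z_def by (simp add: power2_norm_eq_inner inner_simps algebra_simps inner_commute)
    moreover have "m \<le> Q z" using m_le[OF z] .
    ultimately show ?thesis unfolding Q_def lz by argo
  qed
  have "Cauchy X"
  proof (rule metric_CauchyI)
    fix e :: real assume e: "e > 0"
    obtain N where N: "4 / real (Suc N) < e\<^sup>2"
      using e reals_Archimedean[of "e\<^sup>2 / 4"] by (auto simp: field_simps)
    have "dist (X i) (X j) < e" if "i \<ge> N" "j \<ge> N" for i j
    proof -
      have "1 / real (Suc i) \<le> 1 / real (Suc N)" "1 / real (Suc j) \<le> 1 / real (Suc N)"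
        using that by (simp_all add: frac_le)
      then have "(norm (X i - X j))\<^sup>2 \<le> 4 * (1 / real (Suc N))"
        using para[OF X(1) X(1), of i j] X(2)[of i] X(2)[of j] by linarith
      also have "\<dots> < e\<^sup>2" using N by simp
      finally have "norm (X i - X j) < e" by (rule power2_less_imp_less) (use e in simp)
      then show ?thesis by (simp add: dist_norm)
    qed
    then show "\<exists>N. \<forall>i\<ge>N. \<forall>j\<ge>N. dist (X i) (X j) < e" by blast
  qed
  then obtain f where f: "X \<longlonglongrightarrow> f" using Cauchy_convergent convergent_def by blast
  have fS: "f \<in> S" using closed_sequentially[OF S(1)] X(1) f by blast
  have l_diff: "l (x - y) = l x - l y" if "x \<in> S" "y \<in> S" for x y
    using l_add[OF that(1) subspace_neg[OF S(2) that(2)]] l_scale[OF that(2), of "-1"] by simp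
  have lX: "(\<lambda>k. l (X k)) \<longlonglongrightarrow> l f"
  proof (rule Lim_transform_bound[where g = "\<lambda>k. M * norm (X k - f)", THEN LIM_zero_cancel])
    show "\<forall>\<^sub>F k in sequentially. norm (l (X k) - l f) \<le> norm (M * norm (X k - f))"
      using l_bound l_diff X(1) fS subspace_diff[OF S(2)]
      by (intro always_eventually allI) (smt (verit, best) real_norm_def)
    show "(\<lambda>k. M * norm (X k - f)) \<longlonglongrightarrow> 0"
      using tendsto_mult_right_zero[OF tendsto_norm_zero[OF LIM_zero[OF f]]] by simp
  qed
  have "(\<lambda>k. Q (X k)) \<longlonglongrightarrow> Q f" unfolding Q_def by (intro tendsto_intros f lX)
  moreover have "(\<lambda>k. m + 1 / real (Suc k)) \<longlonglongrightarrow> m + 0"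
    by (intro tendsto_intros LIMSEQ_Suc[OF lim_1_over_n])
  ultimately have Qf: "Q f \<le> m"
    using LIMSEQ_le[of "\<lambda>k. Q (X k)" "Q f" "\<lambda>k. m + 1 / real (Suc k)" "m + 0"] X(2)
    by (auto intro: less_imp_le)
  show thesis
  proof (rule that[OF fS])
    fix g assume g: "g \<in> S"
    define d where "d = inner f g - l g"
    have var: "0 \<le> 2 * t * d + t\<^sup>2 * (norm g)\<^sup>2" for t
    proof -
      have "f + t *\<^sub>R g \<in> S" using S(2) fS g by (intro subspace_add subspace_scale)
      then have "m \<le> Q (f + t *\<^sub>R g)" by (rule m_le)
      also have "Q (f + t *\<^sub>R g) = Q f + (2 * t * d + t\<^sup>2 * (norm g)\<^sup>2)"
        unfolding Q_def d_def using l_add[OF fS subspace_scale[OF S(2) g]] l_scale[OF g]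
        by (simp add: power2_norm_eq_inner inner_simps inner_commute algebra_simps power2_eq_square[of t])
      finally show ?thesis using Qf by simp
    qed
    have "d = 0"
    proof (rule ccontr)
      assume d: "d \<noteq> 0"
      \<comment> \<open>Close to the minimiser of the quadratic \<open>var\<close>; the
        \<open>+ 1\<close> makes the denominator positive also for \<open>g = 0\<close>.\<close>
      define t where "t = - d / ((norm g)\<^sup>2 + 1)"
      have pos: "(norm g)\<^sup>2 + 1 > 0" by (simp add: add_nonneg_pos)
      then have tD: "t * ((norm g)\<^sup>2 + 1) = - d" by (simp add: t_def)
      have "2 * t * d + t\<^sup>2 * (norm g)\<^sup>2 \<le> 2 * t * d + t * (t * ((norm g)\<^sup>2 + 1))"
        by (simp add: algebra_simps power2_eq_square[of t])
      also have "\<dots> = - (d * d) / ((norm g)\<^sup>2 + 1)" unfolding tD by (simp add: t_def)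
      also have "\<dots> < 0" using d pos by (simp add: not_square_less_zero less_le)
      finally show False using var[of t] by simp
    qed
    then show "l g = inner f g" by (simp add: d_def)
  qed
qed

section \<open>The Hardy space of the bidisk as a sequence space\<close>

text \<open>After division by the power of the first nonzero coefficient the sum vanishes on the
  punctured disk, while continuity at \<open>0\<close> makes its value there that
  coefficient.\<close>

lemma powser_coeffs_zero:
  fixes a :: "nat \<Rightarrow> complex"
  assumes "\<And>z. cmod z < 1 \<Longrightarrow> (\<lambda>n. a n * z ^ n) sums 0"
  shows "a n = 0"
proof (rule ccontr)
  define m where "m = (LEAST n. a n \<noteq> 0)"
  assume "a n \<noteq> 0"
  then have am: "a m \<noteq> 0" and lt: "\<And>k. k < m \<Longrightarrow> a k = 0"
    unfolding m_def by (metis (mono_tags, lifting) LeastI) (use not_less_Least in blast)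
  have sm: "(\<lambda>k. a (k + m) * z ^ k) sums 0" if "cmod z < 1" "z \<noteq> 0" for z
  proof -
    have "(\<lambda>k. a (k + m) * z ^ (k + m)) sums (0 - (\<Sum>k<m. a k * z ^ k))"
      using assms[OF that(1)] by (rule sums_split_initial_segment)
    then have "(\<lambda>k. a (k + m) * z ^ (k + m)) sums 0" using lt by simp
    then have "(\<lambda>k. a (k + m) * z ^ (k + m) / z ^ m) sums (0 / z ^ m)" by (rule sums_divide)
    then show ?thesis using that(2) by (simp add: power_add)
  qed
  define f where "f z = (\<Sum>k. a (k + m) * z ^ k)" for z
  have "summable (\<lambda>k. a (k + m) * (1/2) ^ k)"
    using sm[of "1/2"] by (auto simp: sums_iff)
  then have "isCont f 0" unfolding f_def by (rule isCont_powser) simp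
  then have "(f \<longlongrightarrow> f 0) (at 0)" by (simp add: isCont_def)
  moreover have "\<forall>\<^sub>F z in at 0. f z = 0"
    using eventually_at_ball'[of 1 0 UNIV] by (rule eventually_mono; simp) (use sm in \<open>auto simp: f_def sums_iff\<close>)
  then have "(f \<longlongrightarrow> 0) (at 0)" by (rule tendsto_eventually)
  ultimately have "f 0 = 0" by (rule tendsto_unique[OF at_neq_bot])
  then show False using am by (simp add: f_def)
qed

lemma geometric_has_sum:
  fixes a :: "'a :: {real_normed_field, banach}"
  assumes "norm a < 1"
  shows "((\<lambda>i. a ^ i) has_sum (1 / (1 - a))) UNIV"
  using assms by (intro norm_summable_imp_has_sum) (auto simp: norm_power geometric_sums)

lemma bidisk_powers_summable:
  assumes "z \<in> bidisk"
  shows "((\<lambda>ij. (cmod (fst z) ^ fst ij * cmod (snd z) ^ snd ij)\<^sup>2) has_sum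
           1 / ((1 - (cmod (fst z))\<^sup>2) * (1 - (cmod (snd z))\<^sup>2))) UNIV"
proof -
  define a b where "a = (cmod (fst z))\<^sup>2" and "b = (cmod (snd z))\<^sup>2"
  have ab: "norm a < 1" "norm b < 1" "0 \<le> a" "0 \<le> b"
    using assms by (auto simp: a_def b_def bidisk_def abs_square_less_1)
  have inner: "((\<lambda>j. a ^ i * b ^ j) has_sum a ^ i * (1 / (1 - b))) UNIV" for i
    by (intro has_sum_cmult_right geometric_has_sum ab)
  have outer: "((\<lambda>i. a ^ i * (1 / (1 - b))) has_sum (1 / (1 - a)) * (1 / (1 - b))) UNIV"
    by (intro has_sum_cmult_left geometric_has_sum ab)
  have "(\<lambda>(i, j). a ^ i * b ^ j) summable_on Sigma UNIV (\<lambda>_. UNIV)"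
    using inner outer ab(3,4)
    by (intro summable_on_SigmaI[where g = "\<lambda>i. a ^ i * (1 / (1 - b))"]) (auto simp: has_sum_iff)
  then have "((\<lambda>(i, j). a ^ i * b ^ j) has_sum (1 / (1 - a)) * (1 / (1 - b))) (Sigma UNIV (\<lambda>_. UNIV))"
    using inner outer by (intro has_sum_SigmaI[where g = "\<lambda>i. a ^ i * (1 / (1 - b))"]) auto
  moreover have "(\<lambda>ij. (cmod (fst z) ^ fst ij * cmod (snd z) ^ snd ij)\<^sup>2) = (\<lambda>(i, j). a ^ i * b ^ j)"
    by (auto simp: a_def b_def power_mult_distrib power_mult[symmetric] mult.commute)
  ultimately show ?thesis by (simp add: a_def b_def)
qed

type_synonym hardy = "(nat \<times> nat) ell2"

definition mon :: "complex \<times> complex \<Rightarrow> nat \<times> nat \<Rightarrow> complex" where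
  "mon z ij = fst z ^ fst ij * snd z ^ snd ij"

text \<open>The Szego kernel as a coefficient vector, so that evaluation at a point of the bidisk
  becomes an inner product.\<close>

definition szv :: "complex \<times> complex \<Rightarrow> hardy" where
  "szv w = Abs_ell2 (\<lambda>ij. cnj (mon w ij))"

lemma mon_sq: "(cmod (mon z ij))\<^sup>2 = (cmod (fst z) ^ fst ij * cmod (snd z) ^ snd ij)\<^sup>2"
  by (simp add: mon_def norm_mult norm_power)

lemma mon_sq_summable: "z \<in> bidisk \<Longrightarrow> (\<lambda>ij. (cmod (mon z ij))\<^sup>2) summable_on UNIV"
  unfolding mon_sq using bidisk_powers_summable by (auto simp: has_sum_iff)

lemma coef_szv: "w \<in> bidisk \<Longrightarrow> coef (szv w) = (\<lambda>ij. cnj (mon w ij))"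
  unfolding szv_def using mon_sq_summable by (intro coef_Abs_ell2) simp

lemma norm_szv_sq:
  "w \<in> bidisk \<Longrightarrow> (norm (szv w))\<^sup>2 = 1 / ((1 - (cmod (fst w))\<^sup>2) * (1 - (cmod (snd w))\<^sup>2))"
  unfolding norm_ell2_sq by (simp add: coef_szv mon_sq infsumI[OF bidisk_powers_summable])

definition h2fun :: "hardy \<Rightarrow> complex \<times> complex \<Rightarrow> complex" where
  "h2fun x z = (\<Sum>\<^sub>\<infinity>ij. coef x ij * mon z ij)"

lemma h2fun_eq_cip: "z \<in> bidisk \<Longrightarrow> h2fun x z = cip x (szv z)"
  unfolding h2fun_def cip_def by (simp add: coef_szv)

lemma h2fun_has_sum:
  assumes "z \<in> bidisk"
  shows "((\<lambda>ij. coef x ij * mon z ij) has_sum h2fun x z) UNIV"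
  unfolding h2fun_def using coef_mult_summable'[of x "szv z"] assms
  by (intro has_sum_infsum) (simp add: coef_szv)

lemma h2fun_add: "z \<in> bidisk \<Longrightarrow> h2fun (x + y) z = h2fun x z + h2fun y z"
  and h2fun_minus: "z \<in> bidisk \<Longrightarrow> h2fun (x - y) z = h2fun x z - h2fun y z"
  and h2fun_csc: "z \<in> bidisk \<Longrightarrow> h2fun (csc a x) z = a * h2fun x z"
  by (simp_all add: h2fun_eq_cip cip_add_left cip_minus_left cip_csc_left)

lemma h2fun_0 [simp]: "h2fun 0 z = 0"
  by (simp add: h2fun_def)

lemma h2fun_le: "z \<in> bidisk \<Longrightarrow> cmod (h2fun x z) \<le> norm x * norm (szv z)"
  by (simp add: h2fun_eq_cip cip_le)

lemma h2fun_tendsto: "z \<in> bidisk \<Longrightarrow> (X \<longlongrightarrow> x) G \<Longrightarrow> ((\<lambda>k. h2fun (X k) z) \<longlongrightarrow> h2fun x z) G"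
  by (simp add: h2fun_eq_cip bounded_linear.tendsto[OF bounded_linear_cip_left])

lemma h2fun_szv:
  assumes "w \<in> bidisk" "z \<in> bidisk"
  shows "h2fun (szv w) z = szego w z"
proof -
  define a b where "a = fst z * cnj (fst w)" and "b = snd z * cnj (snd w)"
  have prod_lt: "cmod u * cmod v < 1" if "cmod u < 1" "cmod v < 1" for u v :: complex
    using mult_strict_mono[of "cmod u" 1 "cmod v" 1] that by simp
  have ab: "cmod a < 1" "cmod b < 1"
    using assms by (auto simp: a_def b_def bidisk_def norm_mult prod_lt)
  have inner: "((\<lambda>j. a ^ i * b ^ j) has_sum a ^ i * (1 / (1 - b))) UNIV" for i
    by (intro has_sum_cmult_right geometric_has_sum ab)
  have outer: "((\<lambda>i. a ^ i * (1 / (1 - b))) has_sum (1 / (1 - a)) * (1 / (1 - b))) UNIV"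
    by (intro has_sum_cmult_left geometric_has_sum ab)
  have eq: "(\<lambda>ij. coef (szv w) ij * mon z ij) = (\<lambda>(i, j). a ^ i * b ^ j)"
    using assms by (auto simp: coef_szv mon_def a_def b_def power_mult_distrib)
  have "(\<lambda>(i, j). a ^ i * b ^ j) summable_on Sigma UNIV (\<lambda>_. UNIV)"
    using h2fun_has_sum[OF assms(2), of "szv w"] by (auto simp: eq has_sum_iff)
  then have "((\<lambda>(i, j). a ^ i * b ^ j) has_sum (1 / (1 - a)) * (1 / (1 - b))) (Sigma UNIV (\<lambda>_. UNIV))"
    using inner outer by (intro has_sum_SigmaI[where g = "\<lambda>i. a ^ i * (1 / (1 - b))"]) auto
  then show ?thesis using h2fun_has_sum[OF assms(2), of "szv w"] has_sum_unique
    by (fastforce simp: eq szego_def a_def b_def)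
qed

text \<open>Two applications of the one-variable statement: for fixed \<open>z2\<close> the row sums
  \<open>r i\<close> are the coefficients of a vanishing power series in \<open>z1\<close>, and each
  row sum is then a vanishing power series in \<open>z2\<close>.\<close>

lemma double_powser_zero:
  fixes c :: "nat \<times> nat \<Rightarrow> complex"
  assumes "\<And>z. z \<in> bidisk \<Longrightarrow> ((\<lambda>ij. c ij * mon z ij) has_sum 0) UNIV"
  shows "c (i, j) = 0"
proof -
  have row: "(\<lambda>j. c (i, j) * z2 ^ j) sums 0" if z2: "cmod z2 < 1" for i z2
  proof -
    have sm: "(\<lambda>ij. c ij * mon (z1, z2) ij) summable_on UNIV" if "cmod z1 < 1" for z1
      using assms[of "(z1, z2)"] that z2 by (auto simp: bidisk_def has_sum_iff)
    have rs: "(\<lambda>j. c (i, j) * z2 ^ j) summable_on UNIV" for i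
    proof -
      \<comment> \<open>Any nonzero first coordinate in the disk would do; the factor
        \<open>(1/2) ^ i\<close> is divided out afterwards.\<close>
      have "(\<lambda>ij. c ij * mon (1/2, z2) ij) summable_on range (Pair i)"
        by (rule summable_on_subset_banach[OF sm]) (auto simp: norm_divide)
      then have "(\<lambda>j. c (i, j) * ((1/2) ^ i * z2 ^ j)) summable_on UNIV"
        by (subst (asm) summable_on_reindex) (auto simp: inj_def o_def mon_def)
      then have "(\<lambda>j. 2 ^ i * (c (i, j) * ((1/2) ^ i * z2 ^ j))) summable_on UNIV"
        by (rule summable_on_cmult_right)
      moreover have "2 ^ i * (c (i, j) * ((1/2) ^ i * z2 ^ j)) = c (i, j) * z2 ^ j" for j
        by (simp add: power_divide field_simps)
      ultimately show ?thesis by simp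
    qed
    define r where "r i = (\<Sum>\<^sub>\<infinity>j. c (i, j) * z2 ^ j)" for i
    have r: "((\<lambda>j. c (i, j) * z2 ^ j) has_sum r i) UNIV" for i
      unfolding r_def using rs by (rule has_sum_infsum)
    have "(\<lambda>i. r i * z1 ^ i) sums 0" if z1: "cmod z1 < 1" for z1
    proof -
      have "((\<lambda>ij. c ij * mon (z1, z2) ij) has_sum 0) (Sigma UNIV (\<lambda>_. UNIV))"
        using assms[of "(z1, z2)"] z1 z2 by (simp add: bidisk_def)
      then have "((\<lambda>i. r i * z1 ^ i) has_sum 0) UNIV"
      proof (rule has_sum_SigmaD)
        fix i
        show "((\<lambda>j. c (i, j) * mon (z1, z2) (i, j)) has_sum r i * z1 ^ i) UNIV"
          using has_sum_cmult_left[OF r[of i], of "z1 ^ i"] by (simp add: mon_def mult_ac)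
      qed
      then show ?thesis by (rule has_sum_imp_sums)
    qed
    then have "r i = 0" by (rule powser_coeffs_zero)
    then show ?thesis using has_sum_imp_sums[OF r[of i]] by simp
  qed
  show ?thesis using powser_coeffs_zero[OF row] .
qed

lemma h2fun_eqD:
  assumes "\<And>z. z \<in> bidisk \<Longrightarrow> h2fun x z = h2fun y z"
  shows "x = y"
proof -
  have "((\<lambda>ij. coef (x - y) ij * mon z ij) has_sum 0) UNIV" if "z \<in> bidisk" for z
    using h2fun_has_sum[OF that, of "x - y"] assms[OF that] by (simp add: h2fun_minus[OF that])
  then have "coef (x - y) (i, j) = 0" for i j by (rule double_powser_zero)
  then show ?thesis by (intro ell2_eqI) auto
qed

lemma h2_series_iff: "h2_series c f \<longleftrightarrow> (\<exists>x. c = coef x \<and> (\<forall>z\<in>bidisk. f z = h2fun x z))"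
proof
  assume c: "h2_series c f"
  define x where "x = Abs_ell2 c"
  have x: "coef x = c" unfolding x_def using c by (intro coef_Abs_ell2) (simp add: h2_series_def)
  have "f z = h2fun x z" if "z \<in> bidisk" for z
  proof -
    have "((\<lambda>ij. coef x ij * mon z ij) has_sum f z) UNIV"
      using c that by (simp add: h2_series_def x mon_def case_prod_unfold mult.assoc)
    then show ?thesis using h2fun_has_sum[OF that] has_sum_unique by blast
  qed
  with x show "\<exists>x. c = coef x \<and> (\<forall>z\<in>bidisk. f z = h2fun x z)" by blast
next
  assume "\<exists>x. c = coef x \<and> (\<forall>z\<in>bidisk. f z = h2fun x z)"
  then obtain x where x: "c = coef x" "\<And>z. z \<in> bidisk \<Longrightarrow> f z = h2fun x z" by blast
  then show "h2_series c f" using coef_summable[of x] h2fun_has_sum[of _ x]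
    by (simp add: h2_series_def mon_def case_prod_unfold mult.assoc)
qed

lemma H2_iff: "f \<in> H2 \<longleftrightarrow> (\<exists>x. \<forall>z\<in>bidisk. f z = h2fun x z)"
  unfolding H2_def h2_series_iff by blast

text \<open>Uniqueness of coefficients forces the choice made in \<open>h2_coeff\<close>. From here
  on a function matters only through its vector, and its values off the bidisk are irrelevant to
  norms and inner products.\<close>

lemma h2_coeff_eq:
  assumes "\<And>z. z \<in> bidisk \<Longrightarrow> f z = h2fun x z"
  shows "h2_coeff f = coef x"
  unfolding h2_coeff_def
proof (rule some_equality)
  show "h2_series (coef x) f" using assms by (auto simp: h2_series_iff)
  fix c assume "h2_series c f"
  then obtain y where "c = coef y" "\<And>z. z \<in> bidisk \<Longrightarrow> f z = h2fun y z" by (auto simp: h2_series_iff)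
  then show "c = coef x" using h2fun_eqD[of x y] assms by auto
qed

lemma h2_inner_eq:
  assumes "\<And>z. z \<in> bidisk \<Longrightarrow> f z = h2fun x z" "\<And>z. z \<in> bidisk \<Longrightarrow> g z = h2fun y z"
  shows "h2_inner f g = cip x y"
  unfolding h2_inner_def cip_def using h2_coeff_eq[of f x] h2_coeff_eq[of g y] assms by simp

lemma h2_norm_eq:
  assumes "\<And>z. z \<in> bidisk \<Longrightarrow> f z = h2fun x z"
  shows "h2_norm f = norm x"
  unfolding h2_norm_def using h2_coeff_eq[of f x] assms by (simp add: norm_ell2_sq[symmetric])

section \<open>Monomial shifts and unit vectors\<close>

lemma shift_has_sum:
  "((\<lambda>ij. if a \<le> fst ij \<and> b \<le> snd ij then g (fst ij - a, snd ij - b) else 0) has_sum S) UNIV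
    \<longleftrightarrow> (g has_sum S) (UNIV :: (nat \<times> nat) set)"
proof -
  define h where "h ij = (fst ij + a, snd ij + b)" for ij :: "nat \<times> nat"
  define G where "G ij = (if a \<le> fst ij \<and> b \<le> snd ij then g (fst ij - a, snd ij - b) else 0)" for ij
  have im: "ij \<in> range h" if "a \<le> fst ij" "b \<le> snd ij" for ij
    using that by (intro image_eqI[of _ _ "(fst ij - a, snd ij - b)"]) (auto simp: h_def prod_eq_iff)
  have "(G has_sum S) UNIV \<longleftrightarrow> (G has_sum S) (range h)"
    by (rule has_sum_cong_neutral) (use im in \<open>auto simp: G_def\<close>)
  also have "\<dots> \<longleftrightarrow> ((G \<circ> h) has_sum S) UNIV"
    by (rule has_sum_reindex) (auto simp: inj_on_def h_def prod_eq_iff)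
  also have "G \<circ> h = g" by (auto simp: G_def h_def)
  finally show ?thesis by (simp add: G_def)
qed

lift_definition shift :: "nat \<times> nat \<Rightarrow> hardy \<Rightarrow> hardy" is
  "\<lambda>s c ij. if fst s \<le> fst ij \<and> snd s \<le> snd ij then c (fst ij - fst s, snd ij - snd s) else 0"
proof -
  fix s :: "nat \<times> nat" and c :: "nat \<times> nat \<Rightarrow> complex"
  assume "(\<lambda>i. (cmod (c i))\<^sup>2) summable_on UNIV"
  then obtain S where "((\<lambda>i. (cmod (c i))\<^sup>2) has_sum S) UNIV" by (auto simp: summable_on_def)
  then have "((\<lambda>ij. if fst s \<le> fst ij \<and> snd s \<le> snd ij
      then (cmod (c (fst ij - fst s, snd ij - snd s)))\<^sup>2 else 0) has_sum S) UNIV"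
    using shift_has_sum[of "fst s" "snd s" "\<lambda>i. (cmod (c i))\<^sup>2" S] by simp
  then have "(\<lambda>ij. if fst s \<le> fst ij \<and> snd s \<le> snd ij
      then (cmod (c (fst ij - fst s, snd ij - snd s)))\<^sup>2 else 0) summable_on UNIV"
    by (auto simp: summable_on_def)
  then show "(\<lambda>ij. (cmod (if fst s \<le> fst ij \<and> snd s \<le> snd ij
      then c (fst ij - fst s, snd ij - snd s) else 0))\<^sup>2) summable_on UNIV"
    by (rule summable_on_cong[THEN iffD1, rotated]) auto
qed

lemma coef_shift: "coef (shift s x) ij =
  (if fst s \<le> fst ij \<and> snd s \<le> snd ij then coef x (fst ij - fst s, snd ij - snd s) else 0)"
  by (simp add: shift.rep_eq)

lemma cip_shift: "cip (shift s x) (shift s y) = cip x y"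
proof -
  have "((\<lambda>ij. coef x ij * cnj (coef y ij)) has_sum cip x y) UNIV"
    unfolding cip_def using coef_mult_summable' by (rule has_sum_infsum)
  then have "((\<lambda>ij. if fst s \<le> fst ij \<and> snd s \<le> snd ij then
     coef x (fst ij - fst s, snd ij - snd s) * cnj (coef y (fst ij - fst s, snd ij - snd s)) else 0)
     has_sum cip x y) UNIV"
    using shift_has_sum[of "fst s" "snd s" "\<lambda>ij. coef x ij * cnj (coef y ij)"] by simp
  then have "((\<lambda>ij. coef (shift s x) ij * cnj (coef (shift s y) ij)) has_sum cip x y) UNIV"
    by (rule has_sum_cong[THEN iffD1, rotated]) (auto simp: coef_shift)
  then show ?thesis by (simp add: cip_def infsumI)
qed

lemma shift_shift: "shift s (shift t x) = shift (fst s + fst t, snd s + snd t) x"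
  by (rule ell2_eqI) (auto simp: coef_shift)

lemma shift_minus: "shift s (x - y) = shift s x - shift s y"
  by (rule ell2_eqI; simp add: coef_shift)

lemma norm_shift [simp]: "norm (shift s x) = norm x"
  using cip_shift[of s x x] by (simp add: cip_self) (metis norm_ge_zero power2_eq_imp_eq of_real_eq_iff of_real_power)

lemma h2fun_shift:
  assumes "z \<in> bidisk"
  shows "h2fun (shift s x) z = mon z s * h2fun x z"
proof -
  have "((\<lambda>ij. mon z s * (coef x ij * mon z ij)) has_sum mon z s * h2fun x z) UNIV"
    by (intro has_sum_cmult_right h2fun_has_sum assms)
  then have "((\<lambda>ij. if fst s \<le> fst ij \<and> snd s \<le> snd ij then
     mon z s * (coef x (fst ij - fst s, snd ij - snd s) * mon z (fst ij - fst s, snd ij - snd s)) else 0)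
     has_sum mon z s * h2fun x z) UNIV"
    using shift_has_sum[of "fst s" "snd s" "\<lambda>ij. mon z s * (coef x ij * mon z ij)"] by simp
  then have "((\<lambda>ij. coef (shift s x) ij * mon z ij) has_sum mon z s * h2fun x z) UNIV"
  proof (rule has_sum_cong[THEN iffD1, rotated])
    fix ij
    show "(if fst s \<le> fst ij \<and> snd s \<le> snd ij then
     mon z s * (coef x (fst ij - fst s, snd ij - snd s) * mon z (fst ij - fst s, snd ij - snd s)) else 0)
      = coef (shift s x) ij * mon z ij"
    proof (cases "fst s \<le> fst ij \<and> snd s \<le> snd ij")
      case True
      then have "fst z ^ fst ij = fst z ^ fst s * fst z ^ (fst ij - fst s)"
        "snd z ^ snd ij = snd z ^ snd s * snd z ^ (snd ij - snd s)"
        by (simp_all add: power_add[symmetric])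
      then show ?thesis using True by (simp add: coef_shift mon_def)
    qed (auto simp: coef_shift)
  qed
  then show ?thesis using h2fun_has_sum[OF assms, of "shift s x"] has_sum_unique by blast
qed

lift_definition unitv :: "'i \<Rightarrow> 'i ell2" is "\<lambda>i j. if j = i then 1 else 0"
proof -
  fix i :: 'i
  show "(\<lambda>j. (cmod (if j = i then 1 else 0))\<^sup>2) summable_on UNIV"
    by (rule finite_nonzero_values_imp_summable_on) (auto intro: finite_subset[of _ "{i}"])
qed

lemma coef_unitv: "coef (unitv i) j = (if j = i then 1 else 0)"
  by (simp add: unitv.rep_eq)

lemma cip_unitv: "cip x (unitv i) = coef x i"
proof -
  have "((\<lambda>j. coef x j * cnj (coef (unitv i) j)) has_sum coef x i) UNIV"
    by (rule has_sum_finite_neutralI[of "{i}"]) (auto simp: coef_unitv)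
  then show ?thesis by (simp add: cip_def infsumI)
qed

lemma shift_unitv: "shift s (unitv t) = unitv (fst s + fst t, snd s + snd t)"
  by (rule ell2_eqI) (auto simp: coef_shift coef_unitv prod_eq_iff)

lemma h2fun_unitv: "z \<in> bidisk \<Longrightarrow> h2fun (unitv ij) z = mon z ij"
  by (metis (no_types) cip_cnj cip_unitv coef_szv complex_cnj_cnj h2fun_eq_cip)

text \<open>The real Riesz theorem on \<open>S\<close> yields the projection \<open>f\<close> of
  \<open>x\<close>. The difference \<open>x - f\<close> is orthogonal to \<open>S\<close> for the
  real product, and invariance of \<open>S\<close> under \<open>csc\<close> makes it orthogonal for
  the Hermitian one.\<close>

lemma closed_subspace_eqI:
  assumes S: "closed S" "subspace S" "\<And>a x. x \<in> S \<Longrightarrow> csc a x \<in> S" "S \<subseteq> K" "subspace K"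
    and orth: "\<And>d. d \<in> K \<Longrightarrow> (\<And>g. g \<in> S \<Longrightarrow> cip d g = 0) \<Longrightarrow> d = 0"
  shows "S = K"
proof -
  have "x \<in> S" if x: "x \<in> K" for x
  proof -
    obtain f where f: "f \<in> S" "\<And>g. g \<in> S \<Longrightarrow> inner x g = inner f g"
      by (rule riesz_representation_closed_subspace[OF S(1,2), of "inner x" "norm x"])
        (auto simp: inner_add_right Cauchy_Schwarz_ineq2)
    have "x - f = 0"
    proof (rule orth)
      show "x - f \<in> K" using x f(1) S(4,5) by (auto intro: subspace_diff)
      fix g assume "g \<in> S"
      then have "inner (x - f) g = 0" "inner (x - f) (csc \<i> g) = 0"
        using f(2) S(3) by (simp_all add: inner_diff_left)
      then show "cip (x - f) g = 0" by (simp add: cip_eq_inner complex_eq_iff)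
    qed
    then show ?thesis using f(1) by simp
  qed
  then show ?thesis using S(4) by blast
qed

lemma closed_subspace_UNIV:
  assumes "closed S" "subspace S" "\<And>a x. x \<in> S \<Longrightarrow> csc a x \<in> S" "\<And>i. unitv i \<in> S"
  shows "S = UNIV"
proof (rule closed_subspace_eqI[OF assms(1-3)])
  fix d assume "\<And>g. g \<in> S \<Longrightarrow> cip d g = 0"
  then show "d = 0" using assms(4) by (intro ell2_eqI) (metis cip_unitv zero_ell2.rep_eq)
qed auto

section \<open>Bounded analytic functions on the disk\<close>

abbreviation rou :: "nat \<Rightarrow> nat \<Rightarrow> complex" where
  "rou N k \<equiv> cis (2 * pi * real k / real N)"

lemma rou_power: "rou N k ^ m = rou N m ^ k"
  by (simp add: Complex.DeMoivre mult.commute mult.left_commute)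

lemma rou_orthogonal:
  assumes "m < N" "l < N"
  shows "(\<Sum>k<N. rou N k ^ m * cnj (rou N k ^ l)) = (if m = l then of_nat N else 0)"
proof -
  have N: "N > 0" using assms by simp
  define q where "q = rou N m * cnj (rou N l)"
  have eq: "rou N k ^ m * cnj (rou N k ^ l) = q ^ k" for k
    by (simp only: q_def power_mult_distrib complex_cnj_power[symmetric] rou_power[of k N])
  have one: "rou N m ^ N = 1" for m using N by (simp add: Complex.DeMoivre)
  have qN: "q ^ N = 1"
    using one[of m] one[of l] by (simp add: q_def power_mult_distrib flip: complex_cnj_power)
  have inj: "inj_on (rou N) {..<N}" using Complex.bij_betw_roots_unity[OF N] by (rule bij_betw_imp_inj_on)
  show ?thesis
  proof (cases "m = l")
    case True
    then have "q = 1" by (simp add: q_def cis_cnj cis_mult)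
    then show ?thesis unfolding eq using True by simp
  next
    case False
    have "q \<noteq> 1"
    proof
      assume "q = 1"
      have "rou N m = rou N m * (cnj (rou N l) * rou N l)" by (simp add: cis_cnj cis_mult)
      also have "\<dots> = q * rou N l" by (simp only: q_def mult.assoc)
      also have "\<dots> = rou N l" using \<open>q = 1\<close> by simp
      finally have "rou N m = rou N l" .
      then show False using inj_onD[OF inj] False assms by auto
    qed
    then show ?thesis unfolding eq using False qN by (simp add: geometric_sum)
  qed
qed

lemma dft_coeff:
  assumes "i < N"
  shows "(\<Sum>k<N. (\<Sum>m<N. b m * rou N k ^ m) * cnj (rou N k ^ i)) = of_nat N * b i"
proof -
  have "(\<Sum>k<N. (\<Sum>m<N. b m * rou N k ^ m) * cnj (rou N k ^ i))
      = (\<Sum>k<N. \<Sum>m<N. b m * (rou N k ^ m * cnj (rou N k ^ i)))"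
    by (simp add: sum_distrib_right mult.assoc)
  also have "\<dots> = (\<Sum>m<N. b m * (\<Sum>k<N. rou N k ^ m * cnj (rou N k ^ i)))"
    by (subst sum.swap) (simp add: sum_distrib_left)
  also have "\<dots> = (\<Sum>m<N. if m = i then of_nat N * b i else 0)"
    using assms by (intro sum.cong refl) (subst rou_orthogonal; simp)
  finally show ?thesis using assms by simp
qed

lemma dft_parseval:
  "(\<Sum>k<N. (cmod (\<Sum>m<N. b m * rou N k ^ m))\<^sup>2) = real N * (\<Sum>m<N. (cmod (b m))\<^sup>2)"
proof -
  have "complex_of_real (\<Sum>k<N. (cmod (\<Sum>m<N. b m * rou N k ^ m))\<^sup>2)
      = (\<Sum>k<N. (\<Sum>m<N. b m * rou N k ^ m) * cnj (\<Sum>i<N. b i * rou N k ^ i))"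
    by (simp only: of_real_sum complex_norm_square)
  also have "\<dots> = (\<Sum>k<N. \<Sum>i<N. cnj (b i) * ((\<Sum>m<N. b m * rou N k ^ m) * cnj (rou N k ^ i)))"
    by (simp add: sum_distrib_left mult_ac)
  also have "\<dots> = (\<Sum>i<N. cnj (b i) * (\<Sum>k<N. (\<Sum>m<N. b m * rou N k ^ m) * cnj (rou N k ^ i)))"
    by (subst sum.swap) (simp add: sum_distrib_left)
  also have "\<dots> = (\<Sum>i<N. cnj (b i) * (of_nat N * b i))"
    by (intro sum.cong refl) (subst dft_coeff; simp)
  also have "\<dots> = of_nat N * (\<Sum>i<N. b i * cnj (b i))"
    by (simp add: sum_distrib_left mult_ac)
  also have "\<dots> = complex_of_real (real N * (\<Sum>m<N. (cmod (b m))\<^sup>2))"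
    by (simp only: of_real_mult of_real_sum complex_norm_square of_real_of_nat_eq)
  finally show ?thesis using of_real_eq_iff by blast
qed

text \<open>Discrete Parseval replaces integration over the circle: on radius \<open>r\<close> a
  long partial sum is bounded by \<open>B + e\<close> at all \<open>M\<close>-th roots of unity, and
  averaging its square over them gives the sum of squared coefficients. Then \<open>e\<close> tends
  to \<open>0\<close> and \<open>r\<close> to \<open>1\<close>.\<close>

lemma bounded_powser_coeffs:
  fixes a :: "nat \<Rightarrow> complex"
  assumes sums: "\<And>z. cmod z < 1 \<Longrightarrow> (\<lambda>n. a n * z ^ n) sums f z"
    and bound: "\<And>z. cmod z < 1 \<Longrightarrow> cmod (f z) \<le> B"
  shows "(\<Sum>n<N. (cmod (a n))\<^sup>2) \<le> B\<^sup>2"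
proof -
  have B0: "0 \<le> B" using bound[of 0] norm_ge_zero[of "f 0"] by (simp del: norm_ge_zero)
  have step: "(\<Sum>n<N. (cmod (a n))\<^sup>2 * (r\<^sup>2) ^ n) \<le> (B + e)\<^sup>2" if r: "0 < r" "r < 1" and e: "e > 0" for r e
  proof -
    \<comment> \<open>Convergence at the larger radius \<open>r'\<close> gives absolute convergence
      at \<open>r\<close>, hence a tail that is small uniformly on the circle of radius
      \<open>r\<close>.\<close>
    define r' where "r' = (1 + r) / 2"
    have r': "r < r'" "r' < 1" "0 < r'" using r by (auto simp: r'_def)
    have "summable (\<lambda>n. a n * of_real r' ^ n)" using sums[of "of_real r'"] r' by (auto simp: sums_iff)
    then have sm: "summable (\<lambda>n. norm (a n * of_real r ^ n))"
      by (rule powser_insidea) (use r r' in auto)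
    obtain M0 where M0: "\<And>M. M \<ge> M0 \<Longrightarrow> norm (\<Sum>i. norm (a (i + M) * of_real r ^ (i + M))) < e"
      using suminf_exist_split[OF e sm] by blast
    define M where "M = Suc (max N M0)"
    have M: "M > 0" "N \<le> M" "M0 \<le> M" by (auto simp: M_def)
    have part: "cmod (\<Sum>m<M. a m * of_real r ^ m * rou M k ^ m) \<le> B + e" for k
    proof -
      define w where "w = of_real r * rou M k"
      have w: "cmod w = r" using r by (simp add: w_def norm_mult)
      have "(\<lambda>m. a (m + M) * w ^ (m + M)) sums (f w - (\<Sum>m<M. a m * w ^ m))"
        by (rule sums_split_initial_segment[OF sums]) (use w r in simp)
      then have eq: "f w - (\<Sum>m<M. a m * w ^ m) = (\<Sum>m. a (m + M) * w ^ (m + M))" by (simp add: sums_iff)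
      have nm: "norm (a (m + M) * w ^ (m + M)) = norm (a (m + M) * of_real r ^ (m + M))" for m
        using r by (simp add: norm_mult norm_power w)
      have "cmod (\<Sum>m. a (m + M) * w ^ (m + M)) \<le> (\<Sum>m. norm (a (m + M) * w ^ (m + M)))"
        unfolding nm[abs_def] by (subst nm[symmetric], rule summable_norm, unfold nm) (rule summable_ignore_initial_segment[OF sm])
      also have "\<dots> \<le> e" unfolding nm using M0[OF M(3)] by simp
      finally have "cmod (f w - (\<Sum>m<M. a m * w ^ m)) \<le> e" by (simp add: eq)
      moreover have "cmod (f w) \<le> B" using bound w r by simp
      ultimately have "cmod (\<Sum>m<M. a m * w ^ m) \<le> B + e"
        using norm_triangle_sub[of "\<Sum>m<M. a m * w ^ m" "f w"] by (simp add: norm_minus_commute)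
      then show ?thesis by (simp add: w_def power_mult_distrib mult.assoc)
    qed
    have "real M * (\<Sum>m<M. (cmod (a m * of_real r ^ m))\<^sup>2) \<le> (\<Sum>k<M. (B + e)\<^sup>2)"
      unfolding dft_parseval[symmetric] by (intro sum_mono power_mono part) auto
    then have "(\<Sum>m<M. (cmod (a m * of_real r ^ m))\<^sup>2) \<le> (B + e)\<^sup>2" using M(1) by simp
    moreover have "(\<Sum>n<N. (cmod (a n))\<^sup>2 * (r\<^sup>2) ^ n) \<le> (\<Sum>m<M. (cmod (a m))\<^sup>2 * (r\<^sup>2) ^ m)"
      by (rule sum_mono2) (use M in auto)
    moreover have "(cmod (a m * of_real r ^ m))\<^sup>2 = (cmod (a m))\<^sup>2 * (r\<^sup>2) ^ m" for m
      using r by (simp add: norm_mult norm_power power_mult_distrib power_mult[symmetric] mult.commute)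
    ultimately show ?thesis by simp
  qed
  have step2: "(\<Sum>n<N. (cmod (a n))\<^sup>2 * (r\<^sup>2) ^ n) \<le> B\<^sup>2" if r: "0 < r" "r < 1" for r
  proof (rule tendsto_lowerbound)
    show "((\<lambda>e. (B + e)\<^sup>2) \<longlongrightarrow> B\<^sup>2) (at_right 0)" by (auto intro!: tendsto_eq_intros)
    show "\<forall>\<^sub>F e in at_right 0. (\<Sum>n<N. (cmod (a n))\<^sup>2 * (r\<^sup>2) ^ n) \<le> (B + e)\<^sup>2"
      using eventually_at_right_less[of 0] by eventually_elim (use step r in auto)
  qed simp
  show ?thesis
  proof (rule tendsto_upperbound)
    show "((\<lambda>r. \<Sum>n<N. (cmod (a n))\<^sup>2 * (r\<^sup>2) ^ n) \<longlongrightarrow> (\<Sum>n<N. (cmod (a n))\<^sup>2)) (at_left 1)"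
      by (auto intro!: tendsto_eq_intros sum.cong)
    show "\<forall>\<^sub>F r in at_left 1. (\<Sum>n<N. (cmod (a n))\<^sup>2 * (r\<^sup>2) ^ n) \<le> B\<^sup>2"
      using eventually_at_left_real[OF zero_less_one[where 'a = real]] by eventually_elim (use step2 in auto)
  qed simp
qed

lift_definition emb :: "nat ell2 \<Rightarrow> hardy" is "\<lambda>c ij. if snd ij = 0 then c (fst ij) else 0"
proof -
  fix c :: "nat \<Rightarrow> complex"
  assume c: "(\<lambda>i. (cmod (c i))\<^sup>2) summable_on UNIV"
  show "(\<lambda>ij :: nat \<times> nat. (cmod (if snd ij = 0 then c (fst ij) else 0))\<^sup>2) summable_on UNIV"
  proof -
    have "(\<lambda>ij :: nat \<times> nat. (cmod (c (fst ij)))\<^sup>2) summable_on range (\<lambda>i. (i, 0))"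
      by (subst summable_on_reindex) (use c in \<open>auto simp: inj_def o_def\<close>)
    moreover have "ij \<in> range (\<lambda>i. (i, 0))" if "snd ij = 0" for ij :: "nat \<times> nat"
      using that by (cases ij) auto
    ultimately show ?thesis
      by (subst summable_on_cong_neutral[where T = "range (\<lambda>i. (i, 0))"]) auto
  qed
qed

lemma coef_emb: "coef (emb a) ij = (if snd ij = 0 then coef a (fst ij) else 0)"
  by (simp add: emb.rep_eq)

lemma emb_has_sum:
  assumes "(g has_sum S) UNIV"
  shows "((\<lambda>ij :: nat \<times> nat. if snd ij = 0 then g (fst ij) else 0) has_sum S) UNIV"
proof -
  have "((\<lambda>ij. g (fst ij)) has_sum S) (range (\<lambda>i. (i, 0 :: nat)))"
    by (subst has_sum_reindex) (use assms in \<open>auto simp: inj_def o_def\<close>)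
  moreover have "ij \<in> range (\<lambda>i. (i, 0))" if "snd ij = 0" for ij :: "nat \<times> nat"
    using that by (cases ij) auto
  ultimately show ?thesis
    by (subst has_sum_cong_neutral[where T = "range (\<lambda>i. (i, 0))"]) auto
qed

lemma norm_emb: "norm (emb a) = norm a"
proof -
  have "((\<lambda>i. (cmod (coef a i))\<^sup>2) has_sum (norm a)\<^sup>2) UNIV"
    unfolding norm_ell2_sq by (rule has_sum_infsum[OF coef_summable])
  from emb_has_sum[OF this] have "((\<lambda>ij. (cmod (coef (emb a) ij))\<^sup>2) has_sum (norm a)\<^sup>2) UNIV"
    by (rule has_sum_cong[THEN iffD1, rotated]) (auto simp: coef_emb)
  then have "(norm (emb a))\<^sup>2 = (norm a)\<^sup>2" unfolding norm_ell2_sq[of "emb a"] by (rule infsumI)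
  then show ?thesis by simp
qed

definition h1fun :: "nat ell2 \<Rightarrow> complex \<Rightarrow> complex" where
  "h1fun a z = (\<Sum>\<^sub>\<infinity>i. coef a i * z ^ i)"

lemma h1fun_has_sum:
  assumes "cmod z < 1"
  shows "((\<lambda>i. coef a i * z ^ i) has_sum h1fun a z) UNIV"
proof -
  have "(\<lambda>i. (cmod z ^ 2) ^ i) summable_on UNIV"
    using geometric_has_sum[of "(cmod z)\<^sup>2"] assms by (auto simp: has_sum_iff abs_square_less_1)
  then have "(\<lambda>i. (cmod (z ^ i))\<^sup>2) summable_on UNIV"
    by (simp add: norm_power power_mult[symmetric] mult.commute)
  from abs_summable_summable[OF sq_summable_mult[OF coef_summable this]]
  show ?thesis unfolding h1fun_def by (rule has_sum_infsum)
qed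

lemma h2fun_emb: "z \<in> bidisk \<Longrightarrow> h2fun (emb a) z = h1fun a (fst z)"
proof -
  assume z: "z \<in> bidisk"
  then have "((\<lambda>i. coef a i * fst z ^ i) has_sum h1fun a (fst z)) UNIV"
    by (intro h1fun_has_sum) (simp add: bidisk_def)
  from emb_has_sum[OF this] have "((\<lambda>ij. coef (emb a) ij * mon z ij) has_sum h1fun a (fst z)) UNIV"
    by (rule has_sum_cong[THEN iffD1, rotated]) (simp add: coef_emb mon_def)
  then show ?thesis by (rule has_sum_unique[OF h2fun_has_sum[OF z]])
qed

lemma ell2_of_nat_bound:
  fixes a :: "nat \<Rightarrow> complex"
  assumes "\<And>N. (\<Sum>n<N. (cmod (a n))\<^sup>2) \<le> B\<^sup>2" "0 \<le> B"
  obtains x where "coef x = a" "norm x \<le> B"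
proof -
  have fin: "(\<Sum>n\<in>I. (cmod (a n))\<^sup>2) \<le> B\<^sup>2" if fI: "finite I" for I
  proof -
    obtain N where "I \<subseteq> {..<N}" using fI by (auto simp: finite_nat_iff_bounded)
    then have "(\<Sum>n\<in>I. (cmod (a n))\<^sup>2) \<le> (\<Sum>n<N. (cmod (a n))\<^sup>2)" by (intro sum_mono2) auto
    then show ?thesis using assms(1)[of N] by simp
  qed
  define x where "x = Abs_ell2 a"
  have x: "coef x = a" unfolding x_def by (rule coef_Abs_ell2) (rule sq_summable_bound[OF fin])
  have "(norm x)\<^sup>2 \<le> B\<^sup>2" unfolding norm_ell2_sq x by (rule sq_summable_bound[OF fin])
  then have "norm x \<le> B" using assms(2) by (rule power2_le_imp_le)
  with x show ?thesis by (rule that)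
qed

text \<open>Bounded analytic functions enter the sequence space with norm at most their supremum.
  This is what makes powers of \<open>beta\<close>, and their quotients by \<open>P0\<close>,
  available as vectors.\<close>

lemma bounded_holomorphic_h1fun:
  assumes "f holomorphic_on ball 0 1" "\<And>z. cmod z < 1 \<Longrightarrow> cmod (f z) \<le> B"
  obtains a where "norm a \<le> B" "\<And>z. cmod z < 1 \<Longrightarrow> h1fun a z = f z"
proof -
  define c where "c n = (deriv ^^ n) f 0 / fact n" for n
  have sums: "(\<lambda>n. c n * z ^ n) sums f z" if "cmod z < 1" for z
    using holomorphic_power_series[OF assms(1), of z] that by (simp add: c_def)
  have "0 \<le> B" using assms(2)[of 0] norm_ge_zero[of "f 0"] by (simp del: norm_ge_zero)
  then obtain a where a: "coef a = c" "norm a \<le> B"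
    using ell2_of_nat_bound[of c B] bounded_powser_coeffs[OF sums assms(2)] by blast
  have "h1fun a z = f z" if "cmod z < 1" for z
    using has_sum_imp_sums[OF h1fun_has_sum[OF that, of a]] sums[OF that] a(1) sums_unique2 by auto
  with a(2) show ?thesis by (rule that)
qed

lemma orthogonal_if_disjoint:
  assumes "\<And>i. coef x i = 0 \<or> coef y i = 0"
  shows "orthogonal x y"
proof -
  have "coef x i * cnj (coef y i) = 0" for i using assms[of i] by auto
  then show ?thesis unfolding orthogonal_def inner_ell2_def by (simp only: zero_complex.sel infsum_0_simp)
qed

section \<open>A weak-type maximal inequality\<close>

definition stolz :: "real \<Rightarrow> complex \<Rightarrow> complex set" where
  "stolz c x = {z. cmod z < 1 \<and> cmod (x - z) < c * (1 - cmod z)}"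

text \<open>The parameter runs over the unit interval, so integrals over it are averages over the
  circle.\<close>

definition upoint :: "real \<Rightarrow> complex" where "upoint t = exp (2 * of_real pi * \<i> * of_real t)"

lemma upoint_norm [simp]: "cmod (upoint t) = 1"
  by (simp add: upoint_def)

lemma upoint_continuous: "continuous_on A upoint"
  unfolding upoint_def by (intro continuous_intros)

lemma upoint_measurable [measurable]: "upoint \<in> borel_measurable borel"
  using upoint_continuous by (rule borel_measurable_continuous_onI)

lemma cauchy_upoint:
  assumes "F holomorphic_on S" "cball 0 1 \<subseteq> S" "open S" "cmod z < 1"
  shows "((\<lambda>t. F (upoint t) / (upoint t - z) * upoint t) has_integral F z) {0..1}"
proof -
  have "((\<lambda>u. F u / (u - z)) has_contour_integral (2 * of_real pi * \<i> * F z)) (circlepath 0 1)"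
  proof (rule Cauchy_integral_circlepath)
    show "continuous_on (cball 0 1) F" "F holomorphic_on ball 0 1"
      using assms(1,2) ball_subset_cball[of "0::complex" 1]
      by (blast intro: holomorphic_on_imp_continuous_on holomorphic_on_subset)+
  qed (use assms in simp)
  then have "((\<lambda>t. F (circlepath 0 1 t) / (circlepath 0 1 t - z)
      * vector_derivative (circlepath 0 1) (at t within {0..1})) has_integral 2 * of_real pi * \<i> * F z) {0..1}"
    by (simp add: has_contour_integral_def)
  then have "((\<lambda>t. F (upoint t) / (upoint t - z) * (2 * of_real pi * \<i> * upoint t))
      has_integral 2 * of_real pi * \<i> * F z) {0..1}"
  proof (rule has_integral_eq[rotated])
    fix t :: real assume t: "t \<in> {0..1}"
    have "vector_derivative (circlepath 0 1) (at t within {0..1}) = 2 * of_real pi * \<i> * upoint t"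
      using t vector_derivative_circlepath01[of t 0 1] by (simp add: upoint_def)
    moreover have "circlepath 0 1 t = upoint t" by (simp add: circlepath upoint_def)
    ultimately show "F (circlepath 0 1 t) / (circlepath 0 1 t - z)
        * vector_derivative (circlepath 0 1) (at t within {0..1})
      = F (upoint t) / (upoint t - z) * (2 * of_real pi * \<i> * upoint t)" by (simp only:)
  qed
  then have "((\<lambda>t. F (upoint t) / (upoint t - z) * (2 * of_real pi * \<i> * upoint t) / (2 * of_real pi * \<i>))
      has_integral (2 * of_real pi * \<i> * F z) / (2 * of_real pi * \<i>)) {0..1}"
    by (rule has_integral_divide)
  then show ?thesis by simp
qed

definition pois :: "complex \<Rightarrow> complex \<Rightarrow> real" where
  "pois z x = (1 - (cmod z)\<^sup>2) / (cmod (x - z))\<^sup>2"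

text \<open>Cauchy's formula for \<open>F\<close>, which is \<open>(f w)\<^sup>2\<close> times
  \<open>(1 - |z|^2) / (1 - cnj z * w)\<close>: at \<open>w = z\<close> the extra factor is
  \<open>1\<close>, and on the circle the modulus of the Cauchy integrand is \<open>|f|^2\<close>
  times the Poisson kernel.\<close>

lemma sq_le_poisson_integral:
  assumes f: "f holomorphic_on UNIV" and z: "cmod z < 1"
  shows "(cmod (f z))\<^sup>2 \<le> integral {0..1} (\<lambda>t. (cmod (f (upoint t)))\<^sup>2 * pois z (upoint t))"
    and "(\<lambda>t. (cmod (f (upoint t)))\<^sup>2 * pois z (upoint t)) integrable_on {0..1}"
proof -
  have nz: "upoint t \<noteq> z" for t using z upoint_norm[of t] by auto
  have cf: "continuous_on A f" for A using f holomorphic_on_imp_continuous_on continuous_on_subset by blast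
  show int: "(\<lambda>t. (cmod (f (upoint t)))\<^sup>2 * pois z (upoint t)) integrable_on {0..1}"
    unfolding pois_def using nz
    by (intro integrable_continuous_real continuous_intros continuous_on_compose2[OF cf] upoint_continuous) auto
  show "(cmod (f z))\<^sup>2 \<le> integral {0..1} (\<lambda>t. (cmod (f (upoint t)))\<^sup>2 * pois z (upoint t))"
  \<comment> \<open>The disk \<open>S\<close> below has radius \<open>1 / cmod z\<close>, which HOL
    evaluates to \<open>0\<close> for \<open>z = 0\<close>, so that case is treated apart.\<close>
  proof (cases "z = 0")
    case True
    have "((\<lambda>t. (f (upoint t))\<^sup>2 / (upoint t - 0) * upoint t) has_integral (f 0)\<^sup>2) {0..1}"
      by (rule cauchy_upoint[of "\<lambda>w. (f w)\<^sup>2" UNIV]) (auto intro!: holomorphic_intros f)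
    moreover have "(f (upoint t))\<^sup>2 / (upoint t - 0) * upoint t = (f (upoint t))\<^sup>2" for t
      using upoint_norm[of t] by (metis diff_zero divide_self_if mult.commute nonzero_eq_divide_eq norm_zero times_divide_eq_left zero_neq_one)
    ultimately have hi: "((\<lambda>t. (f (upoint t))\<^sup>2) has_integral (f 0)\<^sup>2) {0..1}" by simp
    have "norm (integral {0..1} (\<lambda>t. (f (upoint t))\<^sup>2)) \<le> integral {0..1} (\<lambda>t. (cmod (f (upoint t)))\<^sup>2 * pois z (upoint t))"
      by (rule integral_norm_bound_integral[OF has_integral_integrable[OF hi] int]) (simp add: True pois_def norm_power)
    then show ?thesis using integral_unique[OF hi] by (simp add: True norm_power)
  next
    case False
    define S where "S = ball (0::complex) (1 / cmod z)"
    define r where "r = 1 - (cmod z)\<^sup>2"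
    define F where "F w = (f w)\<^sup>2 * of_real r / (1 - cnj z * w)" for w
    have "1 < 1 / cmod z" using z False by simp
    then have S: "cball 0 1 \<subseteq> S" by (auto simp: S_def)
    have "F holomorphic_on S"
      unfolding F_def
    proof (intro holomorphic_intros holomorphic_on_subset[OF f])
      fix w assume "w \<in> S"
      then have "cmod (cnj z * w) < 1" using False by (simp add: S_def norm_mult field_simps)
      then show "1 - cnj z * w \<noteq> 0" by auto
    qed auto
    then have hi: "((\<lambda>t. F (upoint t) / (upoint t - z) * upoint t) has_integral F z) {0..1}"
      by (rule cauchy_upoint[OF _ S _ z]) (simp add: S_def)
    have zz: "1 - cnj z * z = of_real r"
      unfolding r_def of_real_diff complex_norm_square by (simp add: mult.commute)
    have pos: "r > 0" using z by (simp add: r_def abs_square_less_1)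
    have "F z = (f z)\<^sup>2" unfolding F_def zz using pos by simp
    moreover have "cmod (F (upoint t) / (upoint t - z) * upoint t) = (cmod (f (upoint t)))\<^sup>2 * pois z (upoint t)" for t
    proof -
      define e where "e = upoint t"
      have "cmod (1 - cnj z * e) = cmod (e - z)"
      proof -
        have "e * cnj e = 1" using complex_norm_square[of e] by (simp add: e_def)
        then have "1 - cnj z * e = e * cnj (e - z)" by (simp add: algebra_simps)
        then have "cmod (1 - cnj z * e) = cmod e * cmod (e - z)" by (simp only: norm_mult complex_mod_cnj)
        then show ?thesis by (simp add: e_def)
      qed
      moreover have "cmod e = 1" by (simp add: e_def)
      ultimately show ?thesis
        unfolding F_def e_def[symmetric] pois_def r_def[symmetric] using pos
        by (simp add: norm_mult norm_divide norm_power power2_eq_square)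
    qed
    then have "norm (integral {0..1} (\<lambda>t. F (upoint t) / (upoint t - z) * upoint t))
        \<le> integral {0..1} (\<lambda>t. (cmod (f (upoint t)))\<^sup>2 * pois z (upoint t))"
      by (intro integral_norm_bound_integral[OF has_integral_integrable[OF hi] int]) simp
    ultimately show ?thesis using integral_unique[OF hi] by (simp add: norm_power)
  qed
qed

text \<open>\<open>|f|^2\<close> times normalised arc length, carried to the plane as a Borel
  measure so that disks of the plane and the covering lemma for balls apply to it directly.\<close>

definition sqmeas :: "(complex \<Rightarrow> complex) \<Rightarrow> complex measure" where
  "sqmeas f = distr (density lborel (\<lambda>t. indicator {0..1} t * ennreal ((cmod (f (upoint t)))\<^sup>2))) borel upoint"

lemma nn_integral_sqmeas:
  assumes [measurable]: "f \<in> borel_measurable borel" "g \<in> borel_measurable borel"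
  shows "(\<integral>\<^sup>+ x. g x \<partial>sqmeas f)
    = (\<integral>\<^sup>+ t. indicator {0..1} t * (ennreal ((cmod (f (upoint t)))\<^sup>2) * g (upoint t)) \<partial>lborel)"
proof -
  have "(\<integral>\<^sup>+ x. g x \<partial>sqmeas f) = (\<integral>\<^sup>+ t. indicator {0..1} t * ennreal ((cmod (f (upoint t)))\<^sup>2) * g (upoint t) \<partial>lborel)"
    unfolding sqmeas_def by (subst nn_integral_distr) (auto simp: nn_integral_density)
  then show ?thesis by (simp add: mult.assoc)
qed

lemma sq_le_poisson_sqmeas:
  assumes f: "f holomorphic_on UNIV" and z: "cmod z < 1"
  shows "ennreal ((cmod (f z))\<^sup>2) \<le> (\<integral>\<^sup>+ x. ennreal (pois z x) \<partial>sqmeas f)"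
proof -
  have fm: "f \<in> borel_measurable borel"
    using f by (intro borel_measurable_continuous_onI holomorphic_on_imp_continuous_on)
  have pm: "(\<lambda>x. ennreal (pois z x)) \<in> borel_measurable borel" unfolding pois_def by measurable
  have p0: "0 \<le> pois z x" for x using z by (simp add: pois_def abs_square_le_1)
  have "(\<integral>\<^sup>+ x. ennreal (pois z x) \<partial>sqmeas f)
      = (\<integral>\<^sup>+ t. indicator {0..1} t * ennreal ((cmod (f (upoint t)))\<^sup>2 * pois z (upoint t)) \<partial>lborel)"
    by (simp add: nn_integral_sqmeas[OF fm pm] ennreal_mult p0)
  also have "\<dots> = integral {0..1} (\<lambda>t. (cmod (f (upoint t)))\<^sup>2 * pois z (upoint t))"
    using nn_integral_has_integral_lebesgue[OF _ integrable_integral[OF sq_le_poisson_integral(2)[OF f z]]] p0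
    by (simp add: ennreal_indicator[symmetric] ennreal_mult[symmetric] del: ennreal_indicator)
  finally show ?thesis using sq_le_poisson_integral(1)[OF f z] by (simp add: ennreal_leI)
qed

lemma has_integral_upoint_power:
  "((\<lambda>t. upoint t ^ i * cnj (upoint t ^ j)) has_integral (if i = j then 1 else 0)) {0..1}"
proof -
  have uu: "upoint t * cnj (upoint t) = 1" for t using complex_norm_square[of "upoint t"] by simp
  have base: "((\<lambda>t. upoint t ^ k) has_integral 0 ^ k) {0..1}" for k
  proof -
    have "((\<lambda>t. upoint t ^ k / (upoint t - 0) * upoint t) has_integral 0 ^ k) {0..1}"
      by (rule cauchy_upoint[of _ UNIV]) (auto intro!: holomorphic_intros)
    moreover have "upoint t ^ k / (upoint t - 0) * upoint t = upoint t ^ k" for t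
      using uu[of t] by auto
    ultimately show ?thesis by simp
  qed
  have red: "upoint t ^ (k + j) * cnj (upoint t ^ j) = upoint t ^ k" for t k j
  proof -
    have "upoint t ^ (k + j) * cnj (upoint t ^ j) = upoint t ^ k * (upoint t * cnj (upoint t)) ^ j"
      by (simp only: power_add power_mult_distrib complex_cnj_power mult.assoc)
    then show ?thesis by (simp add: uu)
  qed
  show ?thesis
  proof (cases "j \<le> i")
    case True
    then obtain k where k: "i = k + j" using le_Suc_ex by (metis add.commute)
    show ?thesis using base[of k] unfolding k red by (cases "k = 0") (auto simp: power_0_left)
  next
    case False
    then obtain k where k: "j = k + i" by (metis add.commute le_Suc_ex nat_le_linear)
    have "upoint t ^ i * cnj (upoint t ^ j) = cnj (upoint t ^ k)" for t
      using arg_cong[OF red[of t k i], of cnj] by (simp add: k mult.commute)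
    moreover have "((\<lambda>t. cnj (upoint t ^ k)) has_integral cnj (0 ^ k)) {0..1}"
      using has_integral_cnj[of "\<lambda>t. upoint t ^ k" "0 ^ k" "{0..1}"] base[of k] by (simp add: o_def)
    ultimately show ?thesis using False k by (auto simp: power_0_left)
  qed
qed

lemma emeasure_sqmeas_UNIV:
  fixes b :: "nat \<Rightarrow> complex" and N :: nat
  defines "f \<equiv> \<lambda>z. \<Sum>i<N. b i * z ^ i"
  shows "emeasure (sqmeas f) UNIV = ennreal (\<Sum>i<N. (cmod (b i))\<^sup>2)"
proof -
  have fm: "f \<in> borel_measurable borel"
    unfolding f_def by (intro borel_measurable_continuous_onI continuous_intros)
  have "((\<lambda>t. \<Sum>i<N. \<Sum>j<N. b i * cnj (b j) * (upoint t ^ i * cnj (upoint t ^ j)))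
      has_integral (\<Sum>i<N. \<Sum>j<N. b i * cnj (b j) * (if i = j then 1 else 0))) {0..1}"
    by (intro has_integral_sum has_integral_mult_right has_integral_upoint_power) auto
  moreover have "(\<Sum>i<N. \<Sum>j<N. b i * cnj (b j) * (upoint t ^ i * cnj (upoint t ^ j)))
      = of_real ((cmod (f (upoint t)))\<^sup>2)" for t
    unfolding complex_norm_square f_def by (simp add: sum_product mult_ac)
  moreover have "(\<Sum>i<N. \<Sum>j<N. b i * cnj (b j) * (if i = j then 1 else 0)) = of_real (\<Sum>i<N. (cmod (b i))\<^sup>2)"
    unfolding of_real_sum complex_norm_square by (intro sum.cong refl) (simp add: if_distrib[of "\<lambda>x. _ * x"] cong: if_cong)
  ultimately have "((\<lambda>t. complex_of_real ((cmod (f (upoint t)))\<^sup>2)) has_integral of_real (\<Sum>i<N. (cmod (b i))\<^sup>2)) {0..1}"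
    by simp
  from has_integral_linear[OF this bounded_linear_Re]
  have hi: "((\<lambda>t. (cmod (f (upoint t)))\<^sup>2) has_integral (\<Sum>i<N. (cmod (b i))\<^sup>2)) {0..1}"
    by (simp only: o_def Re_complex_of_real)
  have "emeasure (sqmeas f) UNIV = (\<integral>\<^sup>+ x. 1 \<partial>sqmeas f)" by (simp add: sqmeas_def)
  also have "\<dots> = (\<integral>\<^sup>+ t. indicator {0..1} t * ennreal ((cmod (f (upoint t)))\<^sup>2) \<partial>lborel)"
    by (subst nn_integral_sqmeas[OF fm]) simp_all
  also have "\<dots> = ennreal (\<Sum>i<N. (cmod (b i))\<^sup>2)"
    using nn_integral_has_integral_lebesgue[OF _ hi]
    by (simp add: ennreal_indicator[symmetric] ennreal_mult[symmetric] del: ennreal_indicator)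
  finally show ?thesis .
qed

text \<open>The annuli are centred at the boundary point \<open>x\<close>, not at \<open>z\<close>:
  in the Stolz region \<open>|x - y|\<close> is at most \<open>(1 + c) * |y - z|\<close>, so a point
  \<open>y\<close> of the \<open>k\<close>-th dyadic annulus about \<open>x\<close> has distance
  from \<open>z\<close> comparable with \<open>2 ^ k * d\<close>.\<close>

lemma pois_le_sum:
  assumes x: "z \<in> stolz c x" and c: "c > 0" and y: "cmod y = 1"
  defines "d \<equiv> 1 - cmod z"
  shows "ennreal (pois z y) \<le> (\<Sum>k. ennreal (8 * (1 + c)\<^sup>2 / (4 ^ k * d)) * indicator (cball x (2 ^ k * d)) y)"
proof -
  have z: "cmod z < 1" and xz: "cmod (x - z) < c * d" using x by (auto simp: stolz_def d_def)
  have d: "d > 0" "d \<le> 1" using z by (auto simp: d_def)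
  have yz: "d \<le> cmod (y - z)" using norm_triangle_ineq2[of y z] y by (simp add: d_def)
  have "cmod (x - y) \<le> cmod (x - z) + cmod (y - z)" using norm_triangle_ineq4[of "x - z" "y - z"] by simp
  also have "\<dots> \<le> c * cmod (y - z) + cmod (y - z)"
    using xz mult_left_mono[OF yz, of c] c by linarith
  finally have xy: "cmod (x - y) \<le> (1 + c) * cmod (y - z)" by (simp add: algebra_simps)
  have num: "1 - (cmod z)\<^sup>2 \<le> 2 * d"
  proof -
    have "1 - (cmod z)\<^sup>2 = d * (1 + cmod z)" by (simp add: d_def power2_eq_square algebra_simps)
    also have "\<dots> \<le> d * 2" using d z by (intro mult_left_mono) auto
    finally show ?thesis by simp
  qed
  have "\<exists>k. cmod (x - y) \<le> 2 ^ k * d"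
  proof -
    obtain k where "cmod (x - y) / d < 2 ^ k" using real_arch_pow[of 2 "cmod (x - y) / d"] by auto
    then show ?thesis using d by (intro exI[of _ k]) (simp add: field_simps)
  qed
  then obtain k where k: "cmod (x - y) \<le> 2 ^ k * d" "\<And>i. i < k \<Longrightarrow> \<not> cmod (x - y) \<le> 2 ^ i * d"
    using exists_least_iff[of "\<lambda>k. cmod (x - y) \<le> 2 ^ k * d"] by blast
  have c1: "1 \<le> (1 + c)\<^sup>2" using c by (simp add: one_le_power)
  have "pois z y \<le> 8 * (1 + c)\<^sup>2 / (4 ^ k * d)"
  proof (cases k)
    case 0
    have "pois z y \<le> 2 * d / d\<^sup>2"
      unfolding pois_def using num yz d by (intro frac_le power_mono) auto
    also have "\<dots> = 2 / d" using d by (simp add: power2_eq_square)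
    also have "\<dots> \<le> 8 * (1 + c)\<^sup>2 / d" using c1 d by (intro divide_right_mono) auto
    finally show ?thesis by (simp add: 0)
  next
    \<comment> \<open>Minimality of \<open>k\<close> bounds \<open>|x - y|\<close> from below by
      \<open>2 ^ i * d\<close>. Writing \<open>4 ^ i\<close> as \<open>4 ^ k / 4\<close> turns the
      constant \<open>2\<close> into \<open>8\<close>.\<close>
    case (Suc i)
    have "2 ^ i * d < cmod (x - y)" using k(2)[of i] Suc by simp
    then have lt: "2 ^ i * d \<le> (1 + c) * cmod (y - z)" using xy by linarith
    have "(2 ^ i * d)\<^sup>2 \<le> ((1 + c) * cmod (y - z))\<^sup>2" using lt d by (intro power_mono) auto
    then have sq: "4 ^ i * d\<^sup>2 \<le> (1 + c)\<^sup>2 * (cmod (y - z))\<^sup>2"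
      by (simp add: power_mult_distrib power_mult[symmetric] power_mult[of 2 2, simplified] mult.commute[of i])
    have "pois z y \<le> 2 * d / (cmod (y - z))\<^sup>2"
      unfolding pois_def using num by (intro divide_right_mono) auto
    also have "\<dots> \<le> 2 * d * (1 + c)\<^sup>2 / (4 ^ i * d\<^sup>2)"
    proof -
      have "2 * d * (4 ^ i * d\<^sup>2) \<le> 2 * d * ((1 + c)\<^sup>2 * (cmod (y - z))\<^sup>2)"
        using sq d by (intro mult_left_mono) auto
      moreover have "cmod (y - z) > 0" "4 ^ i * d\<^sup>2 > 0" using yz d by auto
      ultimately show ?thesis by (simp add: divide_le_eq pos_le_divide_eq mult_ac)
    qed
    also have "\<dots> = 8 * (1 + c)\<^sup>2 / (4 ^ k * d)" using d by (simp add: Suc power2_eq_square)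
    finally show ?thesis .
  qed
  then have "ennreal (pois z y) \<le> ennreal (8 * (1 + c)\<^sup>2 / (4 ^ k * d)) * indicator (cball x (2 ^ k * d)) y"
    using k(1) by (simp add: ennreal_leI dist_norm)
  also have "\<dots> \<le> (\<Sum>k. ennreal (8 * (1 + c)\<^sup>2 / (4 ^ k * d)) * indicator (cball x (2 ^ k * d)) y)"
    (is "_ \<le> (\<Sum>k. ?g k)")
  proof -
    have "sum ?g {k} \<le> (\<Sum>k. ?g k)" by (rule sum_le_suminf) auto
    then show ?thesis by (simp only: sum.insert sum.empty finite.emptyI empty_iff not_False_eq_True add_0_right)
  qed
  finally show ?thesis .
qed

lemma AE_sqmeas_unit:
  assumes [measurable]: "f \<in> borel_measurable borel"
  shows "AE y in sqmeas f. cmod y = 1"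
  unfolding sqmeas_def by (subst AE_distr_iff) auto

text \<open>If the \<open>|f|\<^sup>2\<close>-mass of every disk about \<open>x\<close> is at most \<open>L\<close> times its radius, then
  \<open>|f|\<^sup>2\<close> is bounded by a multiple of \<open>L\<close> on the Stolz region at \<open>x\<close>.\<close>

lemma stolz_bound:
  assumes f: "f holomorphic_on UNIV" and z: "z \<in> stolz c x" and c: "c > 0" and L: "L \<ge> 0"
    and ball: "\<And>s. s > 0 \<Longrightarrow> emeasure (sqmeas f) (cball x s) \<le> ennreal (L * s)"
  shows "(cmod (f z))\<^sup>2 \<le> 16 * (1 + c)\<^sup>2 * L"
proof -
  define d where "d = 1 - cmod z"
  have d: "d > 0" using z by (auto simp: d_def stolz_def)
  define C where "C = 8 * (1 + c)\<^sup>2"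
  have C: "C \<ge> 0" by (simp add: C_def)
  have fm: "f \<in> borel_measurable borel"
    using f by (intro borel_measurable_continuous_onI holomorphic_on_imp_continuous_on)
  have sts [measurable_cong]: "sets (sqmeas f) = sets borel" by (simp add: sqmeas_def)
  have "ennreal ((cmod (f z))\<^sup>2) \<le> (\<integral>\<^sup>+ y. ennreal (pois z y) \<partial>sqmeas f)"
    using z by (intro sq_le_poisson_sqmeas f) (simp add: stolz_def)
  also have "\<dots> \<le> (\<integral>\<^sup>+ y. (\<Sum>k. ennreal (C / (4 ^ k * d)) * indicator (cball x (2 ^ k * d)) y) \<partial>sqmeas f)"
    using AE_sqmeas_unit[OF fm] unfolding C_def d_def
    by (intro nn_integral_mono_AE) (auto elim!: eventually_mono intro!: pois_le_sum z c)
  also have "\<dots> = (\<Sum>k. ennreal (C / (4 ^ k * d)) * emeasure (sqmeas f) (cball x (2 ^ k * d)))"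
    by (subst nn_integral_suminf)
      (auto intro!: suminf_cong nn_integral_cmult_indicator borel_measurable_times_ennreal
        borel_measurable_indicator simp: sts)
  \<comment> \<open>The decay \<open>4 ^ k\<close> of the kernel against the growth
    \<open>2 ^ k\<close> of the masses leaves a geometric series of sum \<open>2\<close>, which
    accounts for \<open>16 = 8 * 2\<close>.\<close>
  also have "\<dots> \<le> (\<Sum>k. ennreal (C * L * (1/2) ^ k))"
  proof (rule suminf_le)
    fix k
    have "ennreal (C / (4 ^ k * d)) * emeasure (sqmeas f) (cball x (2 ^ k * d))
        \<le> ennreal (C / (4 ^ k * d)) * ennreal (L * (2 ^ k * d))"
      using d by (intro mult_left_mono ball) auto
    also have "\<dots> = ennreal (C / (4 ^ k * d) * (L * (2 ^ k * d)))"
      using d C L by (intro ennreal_mult[symmetric]) auto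
    also have "C / (4 ^ k * d) * (L * (2 ^ k * d)) = C * L * (1/2) ^ k"
    proof -
      have "(4::real) ^ k = 2 ^ k * 2 ^ k" by (simp flip: power_mult_distrib)
      then show ?thesis using d by (simp add: power_divide field_simps)
    qed
    finally show "ennreal (C / (4 ^ k * d)) * emeasure (sqmeas f) (cball x (2 ^ k * d)) \<le> ennreal (C * L * (1/2) ^ k)" .
  qed auto
  also have "\<dots> = ennreal (C * L * 2)"
  proof -
    have "(\<lambda>k. C * L * (1/2) ^ k) sums (C * L * (1 / (1 - 1/2)))"
      by (intro sums_mult geometric_sums) simp
    then show ?thesis using C L by (intro suminf_ennreal_eq) auto
  qed
  finally show ?thesis using C L by (simp add: C_def mult_ac ennreal_le_iff)
qed

text \<open>Subadditivity over an arbitrary countable index set, such as the set of centres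
  delivered by the covering lemma; the integral over counting measure avoids an enumeration.\<close>

lemma emeasure_UN_countable_le:
  assumes X [measurable]: "\<And>i. i \<in> I \<Longrightarrow> X i \<in> sets M" and I: "countable I"
  shows "emeasure M (\<Union>i\<in>I. X i) \<le> (\<integral>\<^sup>+ i. emeasure M (X i) \<partial>count_space I)"
proof -
  have [measurable]: "(\<Union>i\<in>I. X i) \<in> sets M" using X I by (intro sets.countable_UN') auto
  have "emeasure M (\<Union>i\<in>I. X i) = (\<integral>\<^sup>+ x. indicator (\<Union>i\<in>I. X i) x \<partial>M)" by simp
  also have "\<dots> \<le> (\<integral>\<^sup>+ x. \<integral>\<^sup>+ i. indicator (X i) x \<partial>count_space I \<partial>M)"
  proof (rule nn_integral_mono)
    fix x
    show "indicator (\<Union>i\<in>I. X i) x \<le> (\<integral>\<^sup>+ i. indicator (X i) x \<partial>count_space I :: ennreal)"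
    proof (cases "x \<in> (\<Union>i\<in>I. X i)")
      case True
      then obtain j where j: "j \<in> I" "x \<in> X j" by blast
      have "indicator (\<Union>i\<in>I. X i) x = (1 :: ennreal)" using True by simp
      also have "\<dots> = (\<integral>\<^sup>+ i. indicator {j} i \<partial>count_space I)" using j by (simp add: one_ennreal_def)
      also have "\<dots> \<le> (\<integral>\<^sup>+ i. indicator (X i) x \<partial>count_space I)"
        using j by (intro nn_integral_mono) (auto simp: indicator_def)
      finally show ?thesis .
    qed simp
  qed
  also have "\<dots> = (\<integral>\<^sup>+ i. \<integral>\<^sup>+ x. indicator (X i) x \<partial>M \<partial>count_space I)"
    by (rule nn_integral_count_space_nn_integral[OF I]) measurable
  also have "\<dots> = (\<integral>\<^sup>+ i. emeasure M (X i) \<partial>count_space I)"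
    by (rule nn_integral_cong) simp
  finally show ?thesis .
qed

text \<open>Linear growth is recorded point by point rather than for the whole measure: a marginal
  of the Clark measure can have an atom, and the constant may blow up near it.\<close>

definition frostman :: "complex measure \<Rightarrow> real \<Rightarrow> complex set" where
  "frostman \<mu> M = {x. \<forall>s>0. emeasure \<mu> (cball x s) \<le> ennreal (M * s)}"

text \<open>By \<open>stolz_bound\<close> every bad point is the centre of a disk whose
  \<open>|f|^2\<close>-mass exceeds \<open>L\<close> times its radius. The covering lemma picks
  disjoint ones whose fivefold enlargements cover the bad set, and linear growth of
  \<open>\<mu>\<close> at the centres compares the two masses; \<open>80\<close> is
  \<open>5 * 16\<close>. The bad set itself need not be Borel, hence the cover
  \<open>U\<close>.\<close>

lemma weak_type_polynomial:
  fixes b :: "nat \<Rightarrow> complex" and N :: nat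
  defines "f \<equiv> \<lambda>z. \<Sum>i<N. b i * z ^ i"
  assumes c: "c > 0" and l: "l > 0" and \<mu>: "sets \<mu> = sets borel" and M: "M \<ge> 0"
  obtains U where "U \<in> sets borel"
    "{x \<in> frostman \<mu> M. \<exists>z\<in>stolz c x. l < (cmod (f z))\<^sup>2} \<subseteq> U"
    "emeasure \<mu> U \<le> ennreal (80 * (1 + c)\<^sup>2 * M / l * (\<Sum>i<N. (cmod (b i))\<^sup>2))"
proof -
  define S where "S = (\<Sum>i<N. (cmod (b i))\<^sup>2)"
  \<comment> \<open>Chosen so that the bound \<open>16 * (1 + c)\<^sup>2 * L\<close> of
    \<open>stolz_bound\<close> equals \<open>l\<close>.\<close>
  define L where "L = l / (16 * (1 + c)\<^sup>2)"
  define E where "E = {x \<in> frostman \<mu> M. \<exists>z\<in>stolz c x. l < (cmod (f z))\<^sup>2}"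
  have c1: "(1 + c)\<^sup>2 > 0" using c by simp
  have L: "L > 0" using l c1 by (simp add: L_def)
  have S0: "S \<ge> 0" unfolding S_def by (intro sum_nonneg) auto
  have f: "f holomorphic_on UNIV" unfolding f_def by (intro holomorphic_intros)
  have tot: "emeasure (sqmeas f) UNIV = ennreal S" unfolding f_def S_def by (rule emeasure_sqmeas_UNIV)
  have sts: "sets (sqmeas f) = sets borel" "space (sqmeas f) = UNIV" by (simp_all add: sqmeas_def)
  have "\<exists>s>0. ennreal (L * s) < emeasure (sqmeas f) (cball x s)" if x: "x \<in> E" for x
  proof (rule ccontr)
    assume "\<not> ?thesis"
    then have ball: "emeasure (sqmeas f) (cball x s) \<le> ennreal (L * s)" if "s > 0" for s
      using that by (meson not_le)
    obtain z where z: "z \<in> stolz c x" "l < (cmod (f z))\<^sup>2" using x by (auto simp: E_def)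
    have "(cmod (f z))\<^sup>2 \<le> 16 * (1 + c)\<^sup>2 * L" using L by (intro stolz_bound[OF f z(1) c _ ball]) auto
    also have "\<dots> = l" using c1 by (simp add: L_def)
    finally show False using z(2) by simp
  qed
  then obtain r where r: "\<And>x. x \<in> E \<Longrightarrow> r x > 0"
    "\<And>x. x \<in> E \<Longrightarrow> ennreal (L * r x) < emeasure (sqmeas f) (cball x (r x))" by metis
  have rb: "r x \<le> S / L" if "x \<in> E" for x
  proof -
    have "ennreal (L * r x) \<le> emeasure (sqmeas f) (cball x (r x))" using r(2)[OF that] by simp
    also have "\<dots> \<le> ennreal S" unfolding tot[symmetric] by (rule emeasure_mono) (simp_all add: sts)
    finally have "L * r x \<le> S" using S0 by (simp add: ennreal_le_iff)
    then show ?thesis using L by (simp add: pos_le_divide_eq mult.commute)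
  qed
  obtain C where C: "countable C" "C \<subseteq> E"
     "pairwise (\<lambda>i j. disjnt (cball i (r i)) (cball j (r j))) C"
     "E \<subseteq> (\<Union>i\<in>C. cball i (5 * r i))"
  proof (rule Vitali_covering_lemma_cballs[where S = E and K = E and a = "\<lambda>x. x" and r = r and B = "S / L"])
    show "E \<subseteq> (\<Union>i\<in>E. cball i (r i))" using r(1) by (force intro: less_imp_le)
    show "\<And>i. i \<in> E \<Longrightarrow> 0 < r i \<and> r i \<le> S / L" using r(1) rb by blast
  qed blast
  define U where "U = (\<Union>i\<in>C. cball i (5 * r i))"
  have U: "U \<in> sets borel" unfolding U_def using C(1) by (intro sets.countable_UN') auto
  have disj: "disjoint_family_on (\<lambda>i. cball i (r i)) C"
    using C(3) by (auto simp: disjoint_family_on_def pairwise_def disjnt_def)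
  have "emeasure \<mu> U \<le> (\<integral>\<^sup>+ i. emeasure \<mu> (cball i (5 * r i)) \<partial>count_space C)"
    unfolding U_def using C(1) by (intro emeasure_UN_countable_le) (simp_all add: \<mu>)
  also have "\<dots> \<le> (\<integral>\<^sup>+ i. ennreal (5 * M / L) * emeasure (sqmeas f) (cball i (r i)) \<partial>count_space C)"
  proof (rule nn_integral_mono)
    fix i assume "i \<in> space (count_space C)"
    then have i: "i \<in> E" using C(2) by auto
    have "emeasure \<mu> (cball i (5 * r i)) \<le> ennreal (M * (5 * r i))"
      using i r(1)[OF i] by (auto simp: E_def frostman_def)
    also have "M * (5 * r i) = 5 * M / L * (L * r i)" using L by simp
    also have "ennreal (5 * M / L * (L * r i)) = ennreal (5 * M / L) * ennreal (L * r i)"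
      using M L r(1)[OF i] by (intro ennreal_mult) auto
    also have "\<dots> \<le> ennreal (5 * M / L) * emeasure (sqmeas f) (cball i (r i))"
      using r(2)[OF i] by (intro mult_left_mono) auto
    finally show "emeasure \<mu> (cball i (5 * r i)) \<le> ennreal (5 * M / L) * emeasure (sqmeas f) (cball i (r i))" .
  qed
  also have "\<dots> = ennreal (5 * M / L) * emeasure (sqmeas f) (\<Union>i\<in>C. cball i (r i))"
    using C(1) disj by (subst emeasure_UN_countable) (auto simp: sts nn_integral_cmult)
  also have "\<dots> \<le> ennreal (5 * M / L) * ennreal S"
    unfolding tot[symmetric] by (intro mult_left_mono emeasure_mono) (simp_all add: sts)
  also have "\<dots> = ennreal (5 * M / L * S)" using M L S0 by (intro ennreal_mult[symmetric]) auto
  also have "5 * M / L * S = 80 * (1 + c)\<^sup>2 * M / l * S"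
    using l c1 by (simp add: L_def field_simps)
  finally have "emeasure \<mu> U \<le> ennreal (80 * (1 + c)\<^sup>2 * M / l * S)" .
  moreover have "E \<subseteq> U" using C(4) by (simp add: U_def)
  ultimately show ?thesis using U by (intro that[of U]) (simp_all add: E_def S_def)
qed

text \<open>Boundary values exist for the Taylor polynomials, not yet for the function itself.
  Strict inequality at one point \<open>z\<close> persists for all late partial sums, so the bad set
  lies in the lower limit of their covers, an increasing union of sets of the same bounded
  measure.\<close>

lemma weak_type_h1fun:
  assumes c: "c > 0" and l: "l > 0" and \<mu>: "sets \<mu> = sets borel" and M: "M \<ge> 0"
  obtains U where "U \<in> sets borel"
    "{x \<in> frostman \<mu> M. \<exists>z\<in>stolz c x. l < (cmod (h1fun a z))\<^sup>2} \<subseteq> U"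
    "emeasure \<mu> U \<le> ennreal (80 * (1 + c)\<^sup>2 * M / l * (norm a)\<^sup>2)"
proof -
  define f where "f N z = (\<Sum>i<N. coef a i * z ^ i)" for N z
  define B where "B = ennreal (80 * (1 + c)\<^sup>2 * M / l * (norm a)\<^sup>2)"
  have "\<exists>U. U \<in> sets borel \<and> {x \<in> frostman \<mu> M. \<exists>z\<in>stolz c x. l < (cmod (f N z))\<^sup>2} \<subseteq> U \<and> emeasure \<mu> U \<le> B" for N
  proof -
    obtain U where U: "U \<in> sets borel" "{x \<in> frostman \<mu> M. \<exists>z\<in>stolz c x. l < (cmod (f N z))\<^sup>2} \<subseteq> U"
      "emeasure \<mu> U \<le> ennreal (80 * (1 + c)\<^sup>2 * M / l * (\<Sum>i<N. (cmod (coef a i))\<^sup>2))"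
      unfolding f_def by (rule weak_type_polynomial[OF c l \<mu> M])
    have "80 * (1 + c)\<^sup>2 * M / l * (\<Sum>i<N. (cmod (coef a i))\<^sup>2) \<le> 80 * (1 + c)\<^sup>2 * M / l * (norm a)\<^sup>2"
      using M l by (intro mult_left_mono sum_coef_le_norm) auto
    then have "emeasure \<mu> U \<le> B" unfolding B_def by (rule order_trans[OF U(3) ennreal_leI])
    with U show ?thesis by blast
  qed
  then have "\<exists>U. \<forall>N. U N \<in> sets borel \<and>
      {x \<in> frostman \<mu> M. \<exists>z\<in>stolz c x. l < (cmod (f N z))\<^sup>2} \<subseteq> U N \<and> emeasure \<mu> (U N) \<le> B"
    by (intro choice allI)
  then obtain U where Uall: "\<forall>N. U N \<in> sets borel \<and>
      {x \<in> frostman \<mu> M. \<exists>z\<in>stolz c x. l < (cmod (f N z))\<^sup>2} \<subseteq> U N \<and> emeasure \<mu> (U N) \<le> B"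
    by (rule exE)
  note U = conjunct1[OF spec[OF Uall]] conjunct1[OF conjunct2[OF spec[OF Uall]]]
    conjunct2[OF conjunct2[OF spec[OF Uall]]]
  define V where "V N = (\<Inter>k\<in>{N..}. U k)" for N
  have V: "V N \<in> sets borel" for N unfolding V_def using U(1) by (intro sets.countable_INT') auto
  have VB: "emeasure \<mu> (V N) \<le> B" for N
    by (rule order_trans[OF emeasure_mono U(3)[of N]]) (auto simp: V_def \<mu> U(1))
  have "incseq V" by (auto simp: incseq_def V_def)
  then have "(SUP N. emeasure \<mu> (V N)) = emeasure \<mu> (\<Union>N. V N)"
    by (intro SUP_emeasure_incseq) (auto simp: \<mu> V)
  then have "emeasure \<mu> (\<Union>N. V N) \<le> B" unfolding eq_commute[of "Sup _"] by (simp add: SUP_le_iff VB)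
  moreover have "{x \<in> frostman \<mu> M. \<exists>z\<in>stolz c x. l < (cmod (h1fun a z))\<^sup>2} \<subseteq> (\<Union>N. V N)"
  proof
    fix x assume "x \<in> {x \<in> frostman \<mu> M. \<exists>z\<in>stolz c x. l < (cmod (h1fun a z))\<^sup>2}"
    then obtain z where z: "x \<in> frostman \<mu> M" "z \<in> stolz c x" "l < (cmod (h1fun a z))\<^sup>2" by blast
    have "(\<lambda>i. coef a i * z ^ i) sums h1fun a z"
      using z(2) by (intro has_sum_imp_sums h1fun_has_sum) (simp add: stolz_def)
    then have "(\<lambda>N. (cmod (f N z))\<^sup>2) \<longlonglongrightarrow> (cmod (h1fun a z))\<^sup>2"
      unfolding sums_def f_def by (intro tendsto_intros)
    then have "\<forall>\<^sub>F N in sequentially. l < (cmod (f N z))\<^sup>2" using z(3) by (rule order_tendstoD(1))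
    then obtain N where "\<And>k. k \<ge> N \<Longrightarrow> l < (cmod (f k z))\<^sup>2" by (auto simp: eventually_sequentially)
    then have "x \<in> U k" if "k \<ge> N" for k using U(2)[of k] z(1,2) that by blast
    then show "x \<in> (\<Union>N. V N)" by (auto simp: V_def)
  qed
  ultimately show ?thesis using V by (intro that[of "\<Union>N. V N"]) (auto simp: B_def)
qed

text \<open>Borel--Cantelli: squared norms of order \<open>(1/8) ^ m\<close> against the threshold
  \<open>(1/4) ^ m\<close> leave covers of measure of order \<open>(1/2) ^ m\<close>. Growth
  constants and apertures are first restricted to natural numbers, so that only countably many null
  sets are united.\<close>

lemma maximal_AE:
  fixes a :: "nat \<Rightarrow> nat ell2"
  assumes \<mu>: "sets \<mu> = sets borel" and a: "\<And>m. (norm (a m))\<^sup>2 \<le> D * (1/8) ^ m" and D: "D \<ge> 0"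
  shows "AE x in \<mu>. \<forall>M. x \<in> frostman \<mu> M \<longrightarrow>
           (\<forall>c. \<forall>\<^sub>F m in sequentially. \<forall>z\<in>stolz c x. (cmod (h1fun (a m) z))\<^sup>2 \<le> (1/4) ^ m)"
proof -
  have main: "AE x in \<mu>. x \<in> frostman \<mu> (real M) \<longrightarrow>
           (\<forall>\<^sub>F m in sequentially. \<forall>z\<in>stolz (real (Suc c)) x. (cmod (h1fun (a m) z))\<^sup>2 \<le> (1/4) ^ m)" for M c :: nat
  proof -
    define K where "K = 80 * (1 + real (Suc c))\<^sup>2 * real M * D"
    have K: "K \<ge> 0" using D by (simp add: K_def)
    have "\<exists>U. U \<in> sets borel \<and> {x \<in> frostman \<mu> (real M). \<exists>z\<in>stolz (real (Suc c)) x. (1/4) ^ m < (cmod (h1fun (a m) z))\<^sup>2} \<subseteq> U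
       \<and> emeasure \<mu> U \<le> ennreal (K * (1/2) ^ m)" for m
    proof -
      obtain U where U: "U \<in> sets borel"
        "{x \<in> frostman \<mu> (real M). \<exists>z\<in>stolz (real (Suc c)) x. (1/4) ^ m < (cmod (h1fun (a m) z))\<^sup>2} \<subseteq> U"
        "emeasure \<mu> U \<le> ennreal (80 * (1 + real (Suc c))\<^sup>2 * real M / (1/4) ^ m * (norm (a m))\<^sup>2)"
        by (rule weak_type_h1fun[of "real (Suc c)" "(1/4) ^ m" \<mu> "real M" "a m"]) (auto simp: \<mu>)
      have "80 * (1 + real (Suc c))\<^sup>2 * real M / (1/4) ^ m * (norm (a m))\<^sup>2
          \<le> 80 * (1 + real (Suc c))\<^sup>2 * real M / (1/4) ^ m * (D * (1/8) ^ m)"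
        by (intro mult_left_mono a) auto
      also have "\<dots> = K * ((1/8) ^ m / (1/4) ^ m)" by (simp add: K_def)
      also have "(1/8 :: real) ^ m / (1/4) ^ m = (1/2) ^ m" by (simp flip: power_divide)
      finally have "emeasure \<mu> U \<le> ennreal (K * (1/2) ^ m)" by (rule order_trans[OF U(3) ennreal_leI])
      with U show ?thesis by blast
    qed
    then have "\<exists>U. \<forall>m. U m \<in> sets borel \<and> {x \<in> frostman \<mu> (real M). \<exists>z\<in>stolz (real (Suc c)) x. (1/4) ^ m < (cmod (h1fun (a m) z))\<^sup>2} \<subseteq> U m
       \<and> emeasure \<mu> (U m) \<le> ennreal (K * (1/2) ^ m)"
      by (intro choice allI)
    then obtain U where Uall: "\<forall>m. U m \<in> sets borel \<and> {x \<in> frostman \<mu> (real M). \<exists>z\<in>stolz (real (Suc c)) x. (1/4) ^ m < (cmod (h1fun (a m) z))\<^sup>2} \<subseteq> U m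
       \<and> emeasure \<mu> (U m) \<le> ennreal (K * (1/2) ^ m)"
      by (rule exE)
    note U = conjunct1[OF spec[OF Uall]] conjunct1[OF conjunct2[OF spec[OF Uall]]]
    conjunct2[OF conjunct2[OF spec[OF Uall]]]
    have "AE x in \<mu>. \<forall>\<^sub>F m in sequentially. x \<in> space \<mu> - U m"
    proof (rule borel_cantelli_AE1)
      show "emeasure \<mu> (U m) < \<infinity>" for m by (rule le_less_trans[OF U(3)]) simp
      have bnd: "norm (measure \<mu> (U m)) \<le> K * (1/2) ^ m" for m
        using enn2real_mono[OF U(3)[of m]] K by (simp add: measure_def)
      have "summable (\<lambda>m. K * (1/2) ^ m)" by (intro summable_mult summable_geometric) simp
      then show "summable (\<lambda>m. measure \<mu> (U m))" by (rule summable_comparison_test'[OF _ bnd])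
    qed (simp add: \<mu> U(1))
    then show ?thesis
    proof (rule AE_mp, intro AE_I2 impI)
      fix x assume ev: "\<forall>\<^sub>F m in sequentially. x \<in> space \<mu> - U m" and x: "x \<in> frostman \<mu> (real M)"
      from ev show "\<forall>\<^sub>F m in sequentially. \<forall>z\<in>stolz (real (Suc c)) x. (cmod (h1fun (a m) z))\<^sup>2 \<le> (1/4) ^ m"
      proof eventually_elim
        case (elim m)
        then have "x \<notin> {x \<in> frostman \<mu> (real M). \<exists>z\<in>stolz (real (Suc c)) x. (1/4) ^ m < (cmod (h1fun (a m) z))\<^sup>2}"
          using U(2)[of m] by blast
        then show ?case using x by (auto simp: not_less)
      qed
    qed
  qed
  have "AE x in \<mu>. \<forall>M c. x \<in> frostman \<mu> (real M) \<longrightarrow>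
           (\<forall>\<^sub>F m in sequentially. \<forall>z\<in>stolz (real (Suc c)) x. (cmod (h1fun (a m) z))\<^sup>2 \<le> (1/4) ^ m)"
    unfolding AE_all_countable using main by blast
  then show ?thesis
  proof (rule AE_mp, intro AE_I2 impI allI)
    fix x M c
    assume x: "\<forall>M c. x \<in> frostman \<mu> (real M) \<longrightarrow>
           (\<forall>\<^sub>F m in sequentially. \<forall>z\<in>stolz (real (Suc c)) x. (cmod (h1fun (a m) z))\<^sup>2 \<le> (1/4) ^ m)"
      and M: "x \<in> frostman \<mu> M"
    obtain M' where M': "M \<le> real M'" using real_arch_simple by blast
    obtain c' where c': "c \<le> real c'" using real_arch_simple by blast
    have "x \<in> frostman \<mu> (real M')"
      unfolding frostman_def
    proof (intro CollectI allI impI)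
      fix s :: real assume s: "s > 0"
      have "emeasure \<mu> (cball x s) \<le> ennreal (M * s)" using M s by (simp add: frostman_def)
      also have "\<dots> \<le> ennreal (real M' * s)" using M' s by (intro ennreal_leI mult_right_mono) auto
      finally show "emeasure \<mu> (cball x s) \<le> ennreal (real M' * s)" .
    qed
    then have "\<forall>\<^sub>F m in sequentially. \<forall>z\<in>stolz (real (Suc c')) x. (cmod (h1fun (a m) z))\<^sup>2 \<le> (1/4) ^ m"
      using x by blast
    moreover have "stolz c x \<subseteq> stolz (real (Suc c')) x"
    proof
      fix z assume z: "z \<in> stolz c x"
      then have z': "cmod z < 1" "cmod (x - z) < c * (1 - cmod z)" by (auto simp: stolz_def)
      have "c * (1 - cmod z) \<le> real (Suc c') * (1 - cmod z)"
        using c' z'(1) by (intro mult_right_mono) auto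
      with z'(2) have "cmod (x - z) < real (Suc c') * (1 - cmod z)" by (rule less_le_trans)
      with z'(1) show "z \<in> stolz (real (Suc c')) x" unfolding stolz_def by blast
    qed
    ultimately show "\<forall>\<^sub>F m in sequentially. \<forall>z\<in>stolz c x. (cmod (h1fun (a m) z))\<^sup>2 \<le> (1/4) ^ m"
      by (elim eventually_mono) blast
  qed
qed

section \<open>The rational inner function and multiplication by it\<close>

lemma eval2_linear:
  assumes "degree P \<le> 1"
  shows "eval2 P z = poly (coeff P 0) (fst z) + snd z * poly (coeff P 1) (fst z)"
proof -
  have "coeff P m = coeff [:coeff P 0, coeff P 1:] m" for m
  proof (cases "m \<le> 1")
    case True
    then consider "m = 0" | "m = 1" by linarith
    then show ?thesis by cases simp_all
  next
    case False
    then show ?thesis using assms coeff_eq_0[of P m] coeff_eq_0[of "[:coeff P 0, coeff P 1:]" m]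
      by (simp add: coeff_pCons split: nat.split)
  qed
  then have P: "P = [:coeff P 0, coeff P 1:]" by (rule poly_eqI)
  have "eval2 [:a, b:] z = poly a (fst z) + snd z * poly b (fst z)" for a b :: "complex poly"
    by (simp add: eval2_def map_poly_pCons)
  then show ?thesis by (subst P)
qed

lemma poly_altdef_le:
  fixes q :: "'a :: comm_semiring_1 poly"
  assumes "degree q \<le> n"
  shows "poly q x = (\<Sum>i\<le>n. coeff q i * x ^ i)"
proof -
  have "(\<Sum>i\<le>n. coeff q i * x ^ i) = (\<Sum>i\<le>degree q. coeff q i * x ^ i)"
    by (rule sum.mono_neutral_right) (use assms in \<open>auto simp: coeff_eq_0\<close>)
  then show ?thesis by (simp add: poly_altdef)
qed

definition rev_poly :: "nat \<Rightarrow> complex poly \<Rightarrow> complex poly" where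
  "rev_poly n q = (\<Sum>i\<le>n. monom (cnj (coeff q (n - i))) i)"

lemma coeff_rev_poly: "coeff (rev_poly n q) i = (if i \<le> n then cnj (coeff q (n - i)) else 0)"
  by (simp add: rev_poly_def coeff_sum)

lemma degree_rev_poly: "degree (rev_poly n q) \<le> n"
  by (rule degree_le) (simp add: coeff_rev_poly)

lemma poly_rev_poly:
  assumes "degree q \<le> n" "z \<noteq> 0"
  shows "poly (rev_poly n q) z = z ^ n * cnj (poly q (1 / cnj z))"
proof -
  have "poly (rev_poly n q) z = (\<Sum>i\<le>n. cnj (coeff q (n - i)) * z ^ i)"
    unfolding poly_altdef_le[OF degree_rev_poly] by (rule sum.cong) (auto simp: coeff_rev_poly)
  also have "\<dots> = (\<Sum>i\<le>n. cnj (coeff q i) * z ^ (n - i))"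
    by (rule sum.reindex_bij_witness[of _ "\<lambda>i. n - i" "\<lambda>i. n - i"]) auto
  also have "\<dots> = (\<Sum>i\<le>n. z ^ n * (cnj (coeff q i) * (1 / z) ^ i))"
    by (rule sum.cong) (use assms(2) in \<open>auto simp: power_diff field_simps\<close>)
  also have "\<dots> = z ^ n * cnj (poly q (1 / cnj z))"
    unfolding poly_altdef_le[OF assms(1)] by (simp add: sum_distrib_left)
  finally show ?thesis .
qed

lemma inverse_cnj_unit: "cmod z = 1 \<Longrightarrow> 1 / cnj z = z"
proof -
  assume z: "cmod z = 1"
  then have "z * cnj z = 1" using complex_norm_square[of z] by simp
  moreover have "cnj z \<noteq> 0" using z by auto
  ultimately show ?thesis by (metis nonzero_eq_divide_eq)
qed

lemma poly_rev_poly_unit: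
  assumes "degree q \<le> n" "cmod z = 1"
  shows "poly (rev_poly n q) z = z ^ n * cnj (poly q z)"
proof -
  have "z \<noteq> 0" using assms(2) by auto
  from poly_rev_poly[OF assms(1) this] show ?thesis by (simp only: inverse_cnj_unit[OF assms(2)])
qed

lemma atMost_1_nat: "{..1::nat} = {0, 1}"
  by auto

text \<open>Keeps the index in \<open>coeff p 1\<close> from being rewritten to
  \<open>Suc 0\<close>.\<close>

declare One_nat_def [simp del]

locale rif =
  fixes n :: nat and p :: "complex poly poly"
  assumes n_pos: "n \<ge> 1"
    and deg_p2: "degree p \<le> 1"
    and deg_p1: "\<forall>j. degree (coeff p j) \<le> n"
    and no_zeros: "\<forall>z\<in>bidisk. eval2 p z \<noteq> 0"
    and deg_pt2: "degree (reflect2 n p) = 1"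
    and deg_pt1: "\<exists>j. degree (coeff (reflect2 n p) j) = n"
    and coprime: "coprime p (reflect2 n p)"
begin

abbreviation "P0 \<equiv> coeff p 0"
abbreviation "P1 \<equiv> coeff p 1"
abbreviation "R0 \<equiv> rev_poly n P0"
abbreviation "R1 \<equiv> rev_poly n P1"
definition "pe z = eval2 p z"
definition "qe z = eval2 (reflect2 n p) z"
definition "phi z = qe z / pe z"

lemma phi_eq: "(\<lambda>z. eval2 (reflect2 n p) z / eval2 p z) = phi"
  by (simp add: phi_def pe_def qe_def fun_eq_iff)

lemma pe_eq: "pe z = poly P0 (fst z) + snd z * poly P1 (fst z)"
  unfolding pe_def by (rule eval2_linear[OF deg_p2])

lemma coeff_reflect2: "coeff (reflect2 n p) j = (if j = 0 then R1 else if j = 1 then R0 else 0)"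
proof -
  have sm: "{..1::nat} = {0, 1}" by auto
  show ?thesis
    unfolding reflect2_def rev_poly_def sm by (auto simp: coeff_sum)
qed

lemma qe_eq: "qe z = poly R1 (fst z) + snd z * poly R0 (fst z)"
  unfolding qe_def using eval2_linear[of "reflect2 n p"] deg_pt2 by (simp add: coeff_reflect2)

lemma pe_nz: "z \<in> bidisk \<Longrightarrow> pe z \<noteq> 0"
  using no_zeros by (simp add: pe_def)

lemma P0_nz_disk: "cmod z < 1 \<Longrightarrow> poly P0 z \<noteq> 0"
  using pe_nz[of "(z, 0)"] by (simp add: pe_eq bidisk_def)

lemma degP [simp]: "degree P0 \<le> n" "degree P1 \<le> n"
  using deg_p1 by auto

text \<open>For fixed \<open>z1\<close> the root of \<open>p\<close> in the second variable is
  \<open>- P0 / P1\<close>; it may not lie in the disk.\<close>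

lemma P1_le_P0_disk:
  assumes "cmod z < 1"
  shows "cmod (poly P1 z) \<le> cmod (poly P0 z)"
proof (rule ccontr)
  assume "\<not> ?thesis"
  then have lt: "cmod (poly P0 z) < cmod (poly P1 z)" by simp
  then have nz: "poly P1 z \<noteq> 0" by auto
  define w where "w = - poly P0 z / poly P1 z"
  have "(z, w) \<in> bidisk" using lt assms nz by (simp add: bidisk_def w_def norm_divide)
  moreover have "pe (z, w) = 0" using nz by (simp add: pe_eq w_def)
  ultimately show False using pe_nz by blast
qed

lemma P1_le_P0:
  assumes "cmod z \<le> 1"
  shows "cmod (poly P1 z) \<le> cmod (poly P0 z)"
proof (rule tendsto_le)
  show "((\<lambda>r. cmod (poly P0 (of_real r * z))) \<longlongrightarrow> cmod (poly P0 z)) (at_left 1)"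
    "((\<lambda>r. cmod (poly P1 (of_real r * z))) \<longlongrightarrow> cmod (poly P1 z)) (at_left 1)"
    by (auto intro!: tendsto_eq_intros)
  show "\<forall>\<^sub>F r in at_left 1. cmod (poly P1 (of_real r * z)) \<le> cmod (poly P0 (of_real r * z))"
    using eventually_at_left_real[OF zero_less_one[where 'a = real]]
  proof eventually_elim
    case (elim r)
    have "r * cmod z \<le> r" using elim assms by (simp add: mult_left_le)
    moreover have "cmod (of_real r * z) = r * cmod z" using elim by (simp add: norm_mult)
    moreover have "r < 1" using elim by simp
    ultimately have "cmod (of_real r * z) < 1" by linarith
    then show ?case by (rule P1_le_P0_disk)
  qed
qed simp

lemma R0_nz: "R0 \<noteq> 0"
  using deg_pt2 coeff_reflect2[of 1] by (metis One_nat_def coeff_eq_0 degree_0 leading_coeff_0_iff zero_neq_one)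

text \<open>At a zero of \<open>P0\<close> on the circle \<open>P1\<close> vanishes by domination,
  and both reflections vanish with them, so \<open>z1 - \<tau>\<close> would be a common factor of
  \<open>p\<close> and its reflection.\<close>

lemma P0_nz_circle:
  assumes "cmod \<tau> = 1"
  shows "poly P0 \<tau> \<noteq> 0"
proof
  assume 0: "poly P0 \<tau> = 0"
  then have 1: "poly P1 \<tau> = 0" using P1_le_P0[of \<tau>] assms by simp
  define c where "c = [:- \<tau>, 1:]"
  have cP: "c dvd P0" "c dvd P1" using 0 1 by (simp_all add: c_def poly_eq_0_iff_dvd[symmetric])
  have "poly R0 \<tau> = 0" "poly R1 \<tau> = 0" using 0 1 assms by (simp_all add: poly_rev_poly_unit)
  then have cR: "c dvd R0" "c dvd R1" by (simp_all add: c_def poly_eq_0_iff_dvd[symmetric])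
  have "c dvd coeff p j" for j
  proof -
    consider "j = 0" | "j = 1" | "degree p < j" using deg_p2 by linarith
    then show ?thesis by cases (use cP in \<open>auto simp: coeff_eq_0\<close>)
  qed
  then have "[:c:] dvd p" by (simp add: const_poly_dvd_iff)
  moreover have "[:c:] dvd reflect2 n p"
    unfolding const_poly_dvd_iff coeff_reflect2 using cR by auto
  ultimately have "is_unit [:c:]" using coprime by (meson coprime_common_divisor)
  then have "is_unit c" by (simp add: is_unit_const_poly_iff)
  then show False by (simp add: c_def is_unit_iff_degree)
qed

lemma P0_nz: "cmod z \<le> 1 \<Longrightarrow> poly P0 z \<noteq> 0"
  using P0_nz_circle[of z] P0_nz_disk[of z] by linarith

lemma P0_lower: obtains m where "m > 0" "\<And>z. cmod z \<le> 1 \<Longrightarrow> m \<le> cmod (poly P0 z)"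
proof -
  have "continuous_on (cball 0 1) (\<lambda>z. cmod (poly P0 z))" by (intro continuous_intros)
  then obtain z0 where z0: "z0 \<in> cball 0 1" "\<And>z. z \<in> cball 0 1 \<Longrightarrow> cmod (poly P0 z0) \<le> cmod (poly P0 z)"
    using continuous_attains_inf[of "cball (0::complex) 1" "\<lambda>z. cmod (poly P0 z)"] by auto
  show ?thesis by (rule that[of "cmod (poly P0 z0)"]) (use z0 P0_nz in auto)
qed

text \<open>The reciprocal of the root of \<open>p\<close> in the second variable:
  \<open>p = P0 * (1 - z2 * beta)\<close>, with \<open>beta\<close> of modulus at most one on the
  closed disk.\<close>

definition beta :: "complex \<Rightarrow> complex" where "beta z = - poly P1 z / poly P0 z"

lemma beta_le: "cmod z \<le> 1 \<Longrightarrow> cmod (beta z) \<le> 1"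
  using P1_le_P0[of z] P0_nz[of z] by (simp add: beta_def norm_divide)

lemma pe_beta: "cmod (fst z) \<le> 1 \<Longrightarrow> pe z = poly P0 (fst z) * (1 - snd z * beta (fst z))"
  using P0_nz[of "fst z"] by (simp add: pe_eq beta_def algebra_simps)

section \<open>Multiplication by \<open>p\<close>, by its reflection and by \<open>phi\<close> on
  coefficient vectors\<close>

definition "pcf ij = coeff (coeff p (snd ij)) (fst ij)"
definition "qcf ij = cnj (coeff (coeff p (1 - snd ij)) (n - fst ij))"

definition "pset = {..n} \<times> {..1::nat}"
definition pm :: "hardy \<Rightarrow> hardy" where "pm x = (\<Sum>s\<in>pset. csc (pcf s) (shift s x))"
definition qm :: "hardy \<Rightarrow> hardy" where "qm x = (\<Sum>s\<in>pset. csc (qcf s) (shift s x))"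

lemma finite_pset [simp]: "finite pset"
  by (simp add: pset_def)

lemma sum_pset: "(\<Sum>s\<in>pset. f s) = (\<Sum>i\<le>n. f (i, 0)) + (\<Sum>i\<le>n. f (i, 1))"
proof -
  have "(\<Sum>s\<in>pset. f s) = (\<Sum>i\<le>n. \<Sum>j\<le>1. f (i, j))"
    by (simp add: pset_def sum.cartesian_product)
  also have "\<dots> = (\<Sum>i\<le>n. f (i, 0) + f (i, 1))" by (simp add: atMost_1_nat)
  finally show ?thesis by (simp add: sum.distrib)
qed

lemma pe_sum: "pe z = (\<Sum>s\<in>pset. pcf s * mon z s)"
  unfolding pe_eq sum_pset
  by (simp add: poly_altdef_le[of _ n] pcf_def mon_def sum_distrib_left sum_distrib_right mult_ac)

lemma qe_sum: "qe z = (\<Sum>s\<in>pset. qcf s * mon z s)"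
  unfolding qe_eq sum_pset
  by (simp add: poly_altdef_le[OF degree_rev_poly] coeff_rev_poly qcf_def mon_def sum_distrib_left mult_ac)

lemma coef_sum: "coef (\<Sum>i\<in>I. f i) j = (\<Sum>i\<in>I. coef (f i) j)"
  by (induction I rule: infinite_finite_induct) auto

lemma h2fun_sum: "z \<in> bidisk \<Longrightarrow> h2fun (\<Sum>i\<in>I. f i) z = (\<Sum>i\<in>I. h2fun (f i) z)"
  by (induction I rule: infinite_finite_induct) (auto simp: h2fun_add)

lemma h2fun_pm: "z \<in> bidisk \<Longrightarrow> h2fun (pm x) z = pe z * h2fun x z"
  by (simp add: pm_def h2fun_sum h2fun_csc h2fun_shift pe_sum sum_distrib_right mult.assoc)

lemma h2fun_qm: "z \<in> bidisk \<Longrightarrow> h2fun (qm x) z = qe z * h2fun x z"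
  by (simp add: qm_def h2fun_sum h2fun_csc h2fun_shift qe_sum sum_distrib_right mult.assoc)

lemma cip_sum_left: "cip (\<Sum>i\<in>I. f i) y = (\<Sum>i\<in>I. cip (f i) y)"
  by (rule linear_sum[OF bounded_linear.linear[OF bounded_linear_cip_left]])

lemma cip_sum_right: "cip y (\<Sum>i\<in>I. f i) = (\<Sum>i\<in>I. cip y (f i))"
  by (rule linear_sum[OF bounded_linear.linear[OF bounded_linear_cip_right]])

lemma cip_combination:
  "cip (\<Sum>s\<in>A. csc (a s) (X s)) (\<Sum>t\<in>B. csc (b t) (Y t))
    = (\<Sum>s\<in>A. \<Sum>t\<in>B. a s * (cnj (b t) * cip (X s) (Y t)))"
  unfolding cip_sum_left cip_csc_left by (simp add: cip_sum_right cip_csc_right sum_distrib_left)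

text \<open>The coefficient form of \<open>|p~| = |p|\<close> on the torus. The map \<open>r\<close>
  reflects the box of exponents and conjugates coefficients. Shifts preserve inner products, so
  shifting both entries of the pair \<open>(r t, r s)\<close> by \<open>s + t\<close> gives the pair
  \<open>(s, t)\<close> shifted by \<open>(n, 1)\<close>: the Gram matrix of the shifted vectors is
  invariant under the reflection.\<close>

lemma norm_qm: "norm (qm x) = norm (pm x)"
proof -
  define r where "r s = (n - fst s, 1 - snd s)" for s :: "nat \<times> nat"
  have reidx: "(\<Sum>s\<in>pset. g (r s)) = (\<Sum>s\<in>pset. g s)" for g :: "nat \<times> nat \<Rightarrow> complex"
    by (rule sum.reindex_bij_witness[of _ r r]) (auto simp: r_def pset_def)
  have qcf: "qcf s = cnj (pcf (r s))" for s by (simp add: qcf_def pcf_def r_def)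
  have key: "cip (shift s x) (shift t x) = cip (shift (r t) x) (shift (r s) x)"
    if "s \<in> pset" "t \<in> pset" for s t
  proof -
    have e: "fst s + fst t + fst (r t) = n + fst s" "snd s + snd t + snd (r t) = 1 + snd s"
      "fst s + fst t + fst (r s) = n + fst t" "snd s + snd t + snd (r s) = 1 + snd t"
      using that by (auto simp: r_def pset_def)
    have "cip (shift (r t) x) (shift (r s) x)
        = cip (shift (fst s + fst t, snd s + snd t) (shift (r t) x))
              (shift (fst s + fst t, snd s + snd t) (shift (r s) x))" by (simp add: cip_shift)
    also have "\<dots> = cip (shift (n, 1) (shift s x)) (shift (n, 1) (shift t x))"
      unfolding shift_shift fst_conv snd_conv e ..
    finally show ?thesis by (simp only: cip_shift)
  qed
  have "cip (qm x) (qm x)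
      = (\<Sum>s\<in>pset. \<Sum>t\<in>pset. qcf s * (cnj (qcf t) * cip (shift s x) (shift t x)))"
    unfolding qm_def by (rule cip_combination)
  also have "\<dots> = (\<Sum>s\<in>pset. \<Sum>t\<in>pset. cnj (pcf (r s)) * (pcf (r t) * cip (shift (r t) x) (shift (r s) x)))"
    by (intro sum.cong refl) (simp add: qcf key)
  also have "\<dots> = (\<Sum>s\<in>pset. \<Sum>t\<in>pset. cnj (pcf (r s)) * (pcf t * cip (shift t x) (shift (r s) x)))"
    by (rule sum.cong[OF refl],
      rule reidx[of "\<lambda>t. cnj (pcf (r s)) * (pcf t * cip (shift t x) (shift (r s) x))" for s])
  also have "\<dots> = (\<Sum>s\<in>pset. \<Sum>t\<in>pset. cnj (pcf s) * (pcf t * cip (shift t x) (shift s x)))"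
    by (rule reidx[of "\<lambda>s. \<Sum>t\<in>pset. cnj (pcf s) * (pcf t * cip (shift t x) (shift s x))"])
  also have "\<dots> = (\<Sum>t\<in>pset. \<Sum>s\<in>pset. pcf t * (cnj (pcf s) * cip (shift t x) (shift s x)))"
    by (subst sum.swap) (simp add: mult_ac)
  also have "\<dots> = cip (pm x) (pm x)"
    unfolding pm_def by (rule cip_combination[symmetric])
  finally have "(norm (qm x))\<^sup>2 = (norm (pm x))\<^sup>2" unfolding cip_self using of_real_eq_iff by blast
  then show ?thesis by simp
qed

lemma pm_minus: "pm (x - y) = pm x - pm y"
  and pm_add: "pm (x + y) = pm x + pm y"
  and pm_csc: "pm (csc a x) = csc a (pm x)"
  and pm_shift: "pm (shift s x) = shift s (pm x)"
  and qm_minus: "qm (x - y) = qm x - qm y"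
  by (rule h2fun_eqD; simp add: h2fun_pm h2fun_qm h2fun_minus h2fun_add h2fun_csc h2fun_shift algebra_simps)+

lemma pm_norm_le: "norm (pm x) \<le> (\<Sum>s\<in>pset. cmod (pcf s)) * norm x"
  unfolding pm_def sum_distrib_right by (rule sum_norm_le) (simp add: norm_csc)

text \<open>Fejer means of \<open>1 / (1 - z2 beta)\<close> invert \<open>p\<close> approximately, with an error of norm
  \<open>1 / sqrt k\<close> since the powers \<open>z2^j beta^j\<close> are orthogonal and lie in the unit ball.\<close>

lemma fejer_identity:
  fixes t :: complex
  shows "(1 - t) * (\<Sum>j<k. of_nat (k - j) * t ^ j) = of_nat k - (\<Sum>j=1..k. t ^ j)"
proof (induction k)
  case (Suc k)
  have "(\<Sum>j<Suc k. of_nat (Suc k - j) * t ^ j) = (\<Sum>j<Suc k. (of_nat (k - j) * t ^ j + t ^ j))"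
    by (intro sum.cong refl) (simp add: Suc_diff_le algebra_simps)
  also have "\<dots> = (\<Sum>j<k. of_nat (k - j) * t ^ j) + (\<Sum>j<Suc k. t ^ j)"
    by (simp add: sum.distrib)
  finally have "(1 - t) * (\<Sum>j<Suc k. of_nat (Suc k - j) * t ^ j)
      = of_nat k - (\<Sum>j=1..k. t ^ j) + (1 - t ^ Suc k)"
    by (simp only: distrib_left Suc.IH one_diff_power_eq)
  then show ?case by simp
qed simp

lemma approx_inverse:
  assumes k: "k > 0"
  obtains q where "norm (unitv (0, 0) - pm q) \<le> 1 / sqrt (real k)"
proof -
  obtain m where m: "m > 0" "\<And>z. cmod z \<le> 1 \<Longrightarrow> m \<le> cmod (poly P0 z)" using P0_lower by blast
  have holb: "beta holomorphic_on ball 0 1" unfolding beta_def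
    by (intro holomorphic_intros) (use P0_nz in auto)
  have "\<exists>a. norm a \<le> 1 \<and> (\<forall>z. cmod z < 1 \<longrightarrow> h1fun a z = beta z ^ j)" for j
  proof (rule bounded_holomorphic_h1fun[of "\<lambda>z. beta z ^ j" 1])
    show "(\<lambda>z. beta z ^ j) holomorphic_on ball 0 1" by (intro holomorphic_intros holb)
    show "cmod (beta z ^ j) \<le> 1" if "cmod z < 1" for z
      using beta_le[of z] that by (simp add: norm_power power_le_one)
  qed blast
  then obtain b where b: "\<And>j. norm (b j) \<le> 1" "\<And>j z. cmod z < 1 \<Longrightarrow> h1fun (b j) z = beta z ^ j"
    by metis
  have "\<exists>a. \<forall>z. cmod z < 1 \<longrightarrow> h1fun a z = beta z ^ j / poly P0 z" for j
  proof (rule bounded_holomorphic_h1fun[of "\<lambda>z. beta z ^ j / poly P0 z" "1 / m"])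
    show "(\<lambda>z. beta z ^ j / poly P0 z) holomorphic_on ball 0 1"
      by (intro holomorphic_intros holb) (use P0_nz in auto)
    show "cmod (beta z ^ j / poly P0 z) \<le> 1 / m" if "cmod z < 1" for z
      using beta_le[of z] that m(1) m(2)[of z] unfolding norm_divide norm_power
      by (intro frac_le power_le_one) auto
  qed blast
  then obtain g where g: "\<And>j z. cmod z < 1 \<Longrightarrow> h1fun (g j) z = beta z ^ j / poly P0 z" by metis
  \<comment> \<open>Cesaro weights \<open>(k - j) / k\<close> on the geometric series of
    \<open>1 / p\<close>; the factor \<open>1 / P0\<close> is absorbed in \<open>g\<close>.\<close>
  define q where "q = (\<Sum>j<k. csc (of_nat (k - j) / of_nat k) (shift (0, j) (emb (g j))))"
  define e where "e = (\<Sum>j=1..k. csc (1 / of_nat k) (shift (0, j) (emb (b j))))"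
  have "unitv (0, 0) - pm q = e"
  proof (rule h2fun_eqD)
    fix z assume z: "z \<in> bidisk"
    define t where "t = snd z * beta (fst z)"
    have z1: "cmod (fst z) < 1" using z by (simp add: bidisk_def)
    have P0: "poly P0 (fst z) \<noteq> 0" using z1 P0_nz by simp
    have hq: "h2fun q z = (\<Sum>j<k. of_nat (k - j) * t ^ j) / (of_nat k * poly P0 (fst z))"
      using z z1 by (simp add: q_def h2fun_sum h2fun_csc h2fun_shift h2fun_emb g mon_def t_def
        power_mult_distrib sum_divide_distrib mult_ac)
    have he: "h2fun e z = (\<Sum>j=1..k. t ^ j) / of_nat k"
      using z z1 by (simp add: e_def h2fun_sum h2fun_csc h2fun_shift h2fun_emb b mon_def t_def
        power_mult_distrib sum_divide_distrib mult_ac)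
    have "pe z * h2fun q z = ((1 - t) * (\<Sum>j<k. of_nat (k - j) * t ^ j)) / of_nat k"
      using pe_beta[of z] z1 P0 by (simp add: hq t_def)
    also have "\<dots> = 1 - h2fun e z"
      unfolding fejer_identity he using k by (simp add: diff_divide_distrib)
    finally show "h2fun (unitv (0, 0) - pm q) z = h2fun e z"
      using z by (simp add: h2fun_minus h2fun_unitv h2fun_pm mon_def)
  qed
  moreover have "(norm e)\<^sup>2 \<le> 1 / real k"
  proof -
    have "(norm e)\<^sup>2 = (\<Sum>j=1..k. (norm (csc (1 / of_nat k) (shift (0, j) (emb (b j)))))\<^sup>2)"
      unfolding e_def
    proof (rule norm_sum_Pythagorean)
      show "pairwise (\<lambda>i j. orthogonal (csc (1 / of_nat k) (shift (0, i) (emb (b i))))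
          (csc (1 / of_nat k) (shift (0, j) (emb (b j))))) {1..k}"
        by (intro pairwiseI orthogonal_if_disjoint) (auto simp: coef_shift coef_emb)
    qed simp
    also have "\<dots> \<le> (\<Sum>j=1..k. (1 / real k)\<^sup>2)"
      using b(1) k by (intro sum_mono power_mono) (auto simp: norm_csc norm_emb norm_divide divide_right_mono)
    also have "\<dots> = 1 / real k" using k by (simp add: power2_eq_square)
    finally show ?thesis .
  qed
  then have "norm e \<le> 1 / sqrt (real k)"
    by (metis real_le_rsqrt real_sqrt_divide real_sqrt_one)
  ultimately show ?thesis using that by metis
qed

lemma closure_seqI:
  fixes f :: "nat \<Rightarrow> 'a :: metric_space"
  assumes "\<And>k. f k \<in> S" "f \<longlonglongrightarrow> x"
  shows "x \<in> closure S"
  unfolding closure_sequential using assms by (intro exI[of _ f]) simp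

lemma closure_seqE:
  fixes x :: "'a :: metric_space"
  assumes "x \<in> closure S"
  obtains f where "\<And>k. f k \<in> S" "f \<longlonglongrightarrow> x"
proof -
  obtain f where "(\<forall>k. f k \<in> S) \<and> f \<longlonglongrightarrow> x" using assms unfolding closure_sequential by (rule exE)
  then show ?thesis by (intro that[of f]) auto
qed

lemma subspace_closure_csc:
  fixes S :: "'i ell2 set"
  assumes "\<And>x y. x \<in> S \<Longrightarrow> y \<in> S \<Longrightarrow> x + y \<in> S" "\<And>a x. x \<in> S \<Longrightarrow> csc a x \<in> S" "S \<noteq> {}"
  shows "subspace (closure S)" "\<And>a x. x \<in> closure S \<Longrightarrow> csc a x \<in> closure S"
proof -
  show csc: "csc a x \<in> closure S" if "x \<in> closure S" for a x
  proof -
    obtain f where f: "\<And>k. f k \<in> S" "f \<longlonglongrightarrow> x" by (rule closure_seqE[OF \<open>x \<in> closure S\<close>]) blast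
    then have "(\<lambda>k. csc a (f k)) \<longlonglongrightarrow> csc a x" by (intro bounded_linear.tendsto[OF bounded_linear_csc])
    then show ?thesis by (rule closure_seqI[rotated]) (rule assms(2)[OF f(1)])
  qed
  show "subspace (closure S)"
  proof (rule subspaceI)
    obtain s where "s \<in> S" using assms(3) by blast
    then have "0 \<in> S" using assms(2)[of s 0] by simp
    then show "0 \<in> closure S" using closure_subset by blast
    show "c *\<^sub>R x \<in> closure S" if "x \<in> closure S" for c x using csc[OF that] by (simp add: csc_scaleR)
    fix x y assume xy: "x \<in> closure S" "y \<in> closure S"
    obtain f where f: "\<And>k. f k \<in> S" "f \<longlonglongrightarrow> x" by (rule closure_seqE[OF xy(1)]) blast
    obtain g where g: "\<And>k. g k \<in> S" "g \<longlonglongrightarrow> y" by (rule closure_seqE[OF xy(2)]) blast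
    have "(\<lambda>k. f k + g k) \<longlonglongrightarrow> x + y" by (intro tendsto_intros f g)
    then show "x + y \<in> closure S" by (rule closure_seqI[rotated]) (rule assms(1)[OF f(1) g(1)])
  qed
qed

text \<open>Cyclicity of \<open>p\<close>. It may vanish on the torus, so \<open>1 / p\<close> is
  only approximated; shifts are isometries commuting with \<open>pm\<close>, which carries the
  approximation of the constant \<open>1\<close> to every monomial.\<close>

lemma range_pm_dense: "closure (range pm) = UNIV"
proof (rule closed_subspace_UNIV)
  have "x + y \<in> range pm" if "x \<in> range pm" "y \<in> range pm" for x y
    using that by (auto simp: pm_add[symmetric])
  moreover have "csc a x \<in> range pm" if "x \<in> range pm" for a x
    using that by (auto simp: pm_csc[symmetric])
  ultimately show "subspace (closure (range pm))" "\<And>a x. x \<in> closure (range pm) \<Longrightarrow> csc a x \<in> closure (range pm)"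
    using subspace_closure_csc[of "range pm"] by auto
  fix ij :: "nat \<times> nat"
  have "\<exists>q. norm (unitv (0, 0) - pm q) \<le> 1 / sqrt (real (Suc k))" for k
    by (rule approx_inverse[of "Suc k"]) auto
  then obtain q where q: "\<And>k. norm (unitv (0, 0) - pm (q k)) \<le> 1 / sqrt (real (Suc k))" by metis
  have "(\<lambda>k. pm (shift ij (q k))) \<longlonglongrightarrow> unitv ij"
  proof (rule LIM_zero_cancel, rule Lim_null_comparison)
    show "\<forall>\<^sub>F k in sequentially. norm (pm (shift ij (q k)) - unitv ij) \<le> 1 / sqrt (real (Suc k))"
    proof (intro always_eventually allI)
      fix k
      have "pm (shift ij (q k)) - unitv ij = shift ij (pm (q k) - unitv (0, 0))"
        by (simp add: pm_shift shift_minus shift_unitv)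
      then have "norm (pm (shift ij (q k)) - unitv ij) = norm (pm (q k) - unitv (0, 0))" by simp
      then show "norm (pm (shift ij (q k)) - unitv ij) \<le> 1 / sqrt (real (Suc k))"
        using q[of k] by (simp add: norm_minus_commute)
    qed
    have "(\<lambda>k. sqrt (1 / real (Suc k))) \<longlonglongrightarrow> sqrt 0"
      by (intro tendsto_real_sqrt LIMSEQ_Suc[OF lim_1_over_n])
    then show "(\<lambda>k. 1 / sqrt (real (Suc k))) \<longlonglongrightarrow> 0" by (simp add: real_sqrt_divide)
  qed
  then show "unitv ij \<in> closure (range pm)" by (rule closure_seqI[rotated]) simp
qed simp

text \<open>On multiples of \<open>p\<close> multiplication by \<open>phi\<close> is
  \<open>pm x\<close> going to \<open>qm x\<close>, an isometry by \<open>norm_qm\<close>. Density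
  and completeness extend it, and continuity of point evaluations identifies the extension.\<close>

lemma mult_phi_exists: "\<exists>y. norm y = norm x \<and> (\<forall>z\<in>bidisk. h2fun y z = phi z * h2fun x z)"
proof -
  have "x \<in> closure (range pm)" by (simp add: range_pm_dense)
  then obtain f where fr: "\<And>k. f k \<in> range pm" and f: "f \<longlonglongrightarrow> x" by (rule closure_seqE) (rule that)
  have "\<exists>q. f k = pm q" for k using fr[of k] by (simp add: image_iff)
  then obtain q where q: "\<And>k. f k = pm (q k)" by metis
  define Y where "Y k = qm (q k)" for k
  have "dist (Y i) (Y j) = dist (f i) (f j)" for i j
    by (simp add: dist_norm Y_def q qm_minus[symmetric] pm_minus[symmetric] norm_qm)
  moreover have "Cauchy f" using f by (rule LIMSEQ_imp_Cauchy)
  ultimately have "Cauchy Y" by (simp add: Cauchy_def)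
  then obtain y where y: "Y \<longlonglongrightarrow> y" by (auto simp: Cauchy_convergent_iff convergent_def)
  have "(\<lambda>k. norm (f k)) \<longlonglongrightarrow> norm y"
    using tendsto_norm[OF y] by (simp add: Y_def q norm_qm)
  then have "norm y = norm x" using tendsto_norm[OF f] by (rule LIMSEQ_unique)
  moreover have "h2fun y z = phi z * h2fun x z" if z: "z \<in> bidisk" for z
  proof (rule LIMSEQ_unique)
    show "(\<lambda>k. h2fun (Y k) z) \<longlonglongrightarrow> h2fun y z" by (rule h2fun_tendsto[OF z y])
    have "h2fun (Y k) z = phi z * h2fun (f k) z" for k
      using pe_nz[OF z] z by (simp add: Y_def q h2fun_qm h2fun_pm phi_def)
    then show "(\<lambda>k. h2fun (Y k) z) \<longlonglongrightarrow> phi z * h2fun x z"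
      by (simp add: tendsto_mult_left h2fun_tendsto[OF z f])
  qed
  ultimately show ?thesis by blast
qed

definition mphi :: "hardy \<Rightarrow> hardy" where
  "mphi x = (SOME y. norm y = norm x \<and> (\<forall>z\<in>bidisk. h2fun y z = phi z * h2fun x z))"

lemma norm_mphi [simp]: "norm (mphi x) = norm x"
  and h2fun_mphi: "z \<in> bidisk \<Longrightarrow> h2fun (mphi x) z = phi z * h2fun x z"
  using someI_ex[OF mult_phi_exists[of x]] by (simp_all add: mphi_def)

lemma mphi_add: "mphi (x + y) = mphi x + mphi y"
  and mphi_csc: "mphi (csc a x) = csc a (mphi x)"
  by (rule h2fun_eqD; simp add: h2fun_mphi h2fun_add h2fun_csc algebra_simps)+

lemma mphi_pm: "mphi (pm x) = qm x"
  by (rule h2fun_eqD) (use pe_nz in \<open>simp add: h2fun_mphi h2fun_pm h2fun_qm phi_def\<close>)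

lemma inner_mphi: "inner (mphi x) (mphi y) = inner x y"
proof -
  have "(norm (mphi (x + y)))\<^sup>2 = (norm (x + y))\<^sup>2" by simp
  then have "(norm (mphi x))\<^sup>2 + 2 * inner (mphi x) (mphi y) + (norm (mphi y))\<^sup>2
      = (norm x)\<^sup>2 + 2 * inner x y + (norm y)\<^sup>2"
    unfolding mphi_add power2_norm_eq_inner by (simp add: inner_simps inner_commute)
  then show ?thesis by simp
qed

lemma cip_mphi: "cip (mphi x) (mphi y) = cip x y"
  by (simp add: cip_eq_inner mphi_csc[symmetric] inner_mphi)

end

section \<open>The model space\<close>

lemma cip_0_left [simp]: "cip 0 x = 0"
  by (simp add: cip_def)

lift_definition swapv :: "hardy \<Rightarrow> hardy" is "\<lambda>c ij. c (snd ij, fst ij)"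
proof -
  fix c :: "nat \<times> nat \<Rightarrow> complex"
  assume c: "(\<lambda>i. (cmod (c i))\<^sup>2) summable_on UNIV"
  have "(\<lambda>i. (cmod (c i))\<^sup>2) summable_on range prod.swap" by (rule summable_on_subset_banach[OF c]) simp
  then show "(\<lambda>i. (cmod (c (snd i, fst i)))\<^sup>2) summable_on UNIV"
    by (subst (asm) summable_on_reindex) (auto simp: inj_on_def o_def prod.swap_def)
qed

lemma coef_swapv: "coef (swapv x) ij = coef x (snd ij, fst ij)"
  by (simp add: swapv.rep_eq)

lemma h2fun_swapv: "z \<in> bidisk \<Longrightarrow> h2fun (swapv x) z = h2fun x (snd z, fst z)"
proof -
  assume z: "z \<in> bidisk"
  then have z': "(snd z, fst z) \<in> bidisk" by (simp add: bidisk_def)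
  have r: "range (prod.swap :: nat \<times> nat \<Rightarrow> nat \<times> nat) = UNIV" by simp
  have "((\<lambda>ij. coef x ij * mon (snd z, fst z) ij) has_sum h2fun x (snd z, fst z)) (range prod.swap)"
    unfolding r by (rule h2fun_has_sum[OF z'])
  then have "((\<lambda>ij. coef x (snd ij, fst ij) * mon (snd z, fst z) (snd ij, fst ij)) has_sum h2fun x (snd z, fst z)) UNIV"
    by (subst (asm) has_sum_reindex) (auto simp: inj_on_def o_def prod.swap_def)
  then have "((\<lambda>ij. coef (swapv x) ij * mon z ij) has_sum h2fun x (snd z, fst z)) UNIV"
    by (simp add: coef_swapv mon_def mult.commute)
  from has_sum_unique[OF h2fun_has_sum[OF z] this] show ?thesis .
qed

lemma poly_eqI_disk:
  fixes a b :: "complex poly"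
  assumes "\<And>z. cmod z < 1 \<Longrightarrow> poly a z = poly b z"
  shows "a = b"
proof (rule ccontr)
  assume "a \<noteq> b"
  then have "finite {z. poly (a - b) z = 0}" by (intro poly_roots_finite) simp
  moreover have "ball 0 1 \<subseteq> {z. poly (a - b) z = 0}" using assms by auto
  ultimately have "finite (ball (0::complex) 1)" by (rule rev_finite_subset)
  then show False using uncountable_ball[of 1 "0::complex"] countable_finite by auto
qed

context rif
begin

text \<open>The model space in coefficient form, as the orthogonal complement of the range of the
  isometry \<open>mphi\<close>.\<close>

definition Kc :: "hardy set" where "Kc = {x. \<forall>y. cip x (mphi y) = 0}"

lemma Kc_subspace: "subspace Kc"
  by (rule subspaceI) (auto simp: Kc_def cip_add_left csc_scaleR cip_csc_left)

lemma Kc_csc: "x \<in> Kc \<Longrightarrow> csc a x \<in> Kc"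
  by (simp add: Kc_def cip_csc_left)

lemma Kc_closed: "closed Kc"
proof -
  have "Kc = (\<Inter>y. {x. cip x (mphi y) = 0})" by (auto simp: Kc_def)
  moreover have "closed {x. cip x (mphi y) = 0}" for y
    by (intro closed_Collect_eq continuous_intros bounded_linear.continuous_on[OF bounded_linear_cip_left])
  ultimately show ?thesis by auto
qed

lemmas Kc_add = subspace_add[OF Kc_subspace]
lemmas Kc_diff = subspace_diff[OF Kc_subspace]

definition kv :: "complex \<times> complex \<Rightarrow> hardy" where
  "kv w = szv w - csc (cnj (phi w)) (mphi (szv w))"

lemma cip_szv_left: "w \<in> bidisk \<Longrightarrow> cip (szv w) y = cnj (h2fun y w)"
  by (simp add: h2fun_eq_cip cip_cnj)

lemma kv_in_Kc: "w \<in> bidisk \<Longrightarrow> kv w \<in> Kc"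
  by (simp add: Kc_def kv_def cip_minus_left cip_csc_left cip_mphi cip_szv_left h2fun_mphi)

lemma cip_kv:
  assumes "x \<in> Kc" "w \<in> bidisk"
  shows "cip x (kv w) = h2fun x w"
  using assms by (simp add: Kc_def kv_def cip_minus_right cip_csc_right h2fun_eq_cip)

lemma h2fun_kv:
  assumes "w \<in> bidisk" "z \<in> bidisk"
  shows "h2fun (kv w) z = (1 - cnj (phi w) * phi z) * szego w z"
  using assms by (simp add: kv_def h2fun_minus h2fun_csc h2fun_mphi h2fun_szv algebra_simps)

lemma h2fun_kv_model: "w \<in> bidisk \<Longrightarrow> z \<in> bidisk \<Longrightarrow> h2fun (kv w) z = model_kernel phi w z"
  by (simp add: h2fun_kv model_kernel_def)

lemma norm_szv_pos: "w \<in> bidisk \<Longrightarrow> 0 < (norm (szv w))\<^sup>2"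
  by (auto simp: norm_szv_sq bidisk_def abs_square_less_1 intro!: divide_pos_pos mult_pos_pos)

lemma szego_diag: "w \<in> bidisk \<Longrightarrow> szego w w = of_real ((norm (szv w))\<^sup>2)"
  using h2fun_szv[of w w] by (simp add: h2fun_eq_cip cip_self)

lemma norm_kv_sq:
  assumes w: "w \<in> bidisk"
  shows "(norm (kv w))\<^sup>2 = (1 - (cmod (phi w))\<^sup>2) * (norm (szv w))\<^sup>2"
proof -
  have "complex_of_real ((norm (kv w))\<^sup>2) = h2fun (kv w) w"
    using cip_kv[OF kv_in_Kc[OF w] w] by (simp add: cip_self)
  also have "\<dots> = of_real ((1 - (cmod (phi w))\<^sup>2) * (norm (szv w))\<^sup>2)"
    unfolding h2fun_kv[OF w w] szego_diag[OF w] of_real_mult of_real_diff complex_norm_square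
    by (simp add: mult.commute)
  finally show ?thesis using of_real_eq_iff by blast
qed

text \<open>Positivity of the reproducing kernel on the diagonal: the norm of \<open>kv w\<close> is
  computed in \<open>norm_kv_sq\<close> and cannot be negative.\<close>

lemma phi_le_1: "w \<in> bidisk \<Longrightarrow> cmod (phi w) \<le> 1"
proof -
  assume w: "w \<in> bidisk"
  have "0 \<le> (1 - (cmod (phi w))\<^sup>2) * (norm (szv w))\<^sup>2" using norm_kv_sq[OF w] by (metis zero_le_power2)
  then have "(cmod (phi w))\<^sup>2 \<le> 1" using norm_szv_pos[OF w] by (simp add: zero_le_mult_iff)
  then show ?thesis by (simp add: abs_square_le_1)
qed

text \<open>At a point with unimodular value the kernel vector \<open>kv w\<close> is zero, which
  makes \<open>phi\<close> a constant \<open>c\<close> on the bidisk. Comparing coefficients,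
  \<open>p~ = c * p\<close>; coprimality makes \<open>p\<close> a unit, so \<open>P1 = 0\<close> and
  \<open>R0 = c * P1 = 0\<close>, against the degree of \<open>p~\<close> in
  \<open>z2\<close>.\<close>

lemma phi_lt_1:
  assumes w: "w \<in> bidisk"
  shows "cmod (phi w) < 1"
proof (rule ccontr)
  assume "\<not> ?thesis"
  then have one: "cmod (phi w) = 1" using phi_le_1[OF w] by simp
  then have "(norm (kv w))\<^sup>2 = 0" using norm_kv_sq[OF w] by simp
  then have kv0: "kv w = 0" by simp
  define c where "c = phi w"
  have cc: "c * cnj c = 1" using complex_norm_square[of c] one by (simp add: c_def)
  have pq: "qe z = c * pe z" if z: "z \<in> bidisk" for z
  proof -
    have "(1 - cnj c * phi z) * szego w z = 0" using h2fun_kv[OF w z] kv0 by (simp add: c_def)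
    moreover have "szego w z \<noteq> 0"
    proof -
      have "cmod (u * cnj v) < 1" if "cmod u < 1" "cmod v < 1" for u v :: complex
        using mult_strict_mono[of "cmod u" 1 "cmod v" 1] that by (simp add: norm_mult)
      then have "fst z * cnj (fst w) \<noteq> 1" "snd z * cnj (snd w) \<noteq> 1"
        using w z unfolding bidisk_def by (metis (no_types, lifting) mem_Collect_eq norm_one order_less_irrefl)+
      then show ?thesis by (simp add: szego_def)
    qed
    ultimately have "cnj c * phi z = 1" by simp
    then have "c * cnj c * phi z = c" by (simp add: mult.assoc)
    then have "phi z = c" using cc by simp
    then show ?thesis using pe_nz[OF z] by (simp add: phi_def field_simps)
  qed
  have R1: "poly R1 z = c * poly P0 z" if "cmod z < 1" for z
    using pq[of "(z, 0)"] that by (simp add: bidisk_def pe_eq qe_eq)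
  have R0: "poly R0 z = c * poly P1 z" if "cmod z < 1" for z
    using pq[of "(z, 1/2)"] that R1[OF that] by (simp add: bidisk_def pe_eq qe_eq algebra_simps norm_divide)
  have R: "R1 = smult c P0" "R0 = smult c P1"
    by (rule poly_eqI_disk; simp add: R1 R0)+
  have "reflect2 n p = smult [:c:] p"
    by (rule poly_eqI) (use deg_p2 in \<open>auto simp: coeff_reflect2 R coeff_eq_0\<close>)
  then have "p dvd reflect2 n p" by (simp add: dvd_smult)
  then have "is_unit p" by (rule coprime_common_divisor[OF coprime dvd_refl])
  then obtain q where q: "1 = p * q" by (rule dvdE)
  then have "p \<noteq> 0" "q \<noteq> 0" by auto
  then have "degree p = 0" using degree_mult_eq[of p q] by (simp flip: q)
  then have "P1 = 0" by (simp add: coeff_eq_0)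
  then have "R0 = 0" using R by simp
  then show False using R0_nz by simp
qed

text \<open>Cauchy--Schwarz against \<open>kv w\<close>. Compared with the bound for the whole Hardy
  space there is the factor \<open>1 - |phi|^2\<close>, which cancels a singular denominator where
  \<open>phi\<close> tends to \<open>\<alpha>\<close> fast enough.\<close>

lemma h2fun_Kc_le:
  assumes "x \<in> Kc" "w \<in> bidisk"
  shows "(cmod (h2fun x w))\<^sup>2 \<le> (norm x)\<^sup>2 * ((1 - (cmod (phi w))\<^sup>2) /
           ((1 - (cmod (fst w))\<^sup>2) * (1 - (cmod (snd w))\<^sup>2)))"
proof -
  have "cmod (h2fun x w) \<le> norm x * norm (kv w)"
    using cip_le[of x "kv w"] by (simp add: cip_kv[OF assms])
  then have "(cmod (h2fun x w))\<^sup>2 \<le> (norm x * norm (kv w))\<^sup>2" by (intro power_mono) auto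
  then show ?thesis by (simp add: power_mult_distrib norm_kv_sq[OF assms(2)] norm_szv_sq[OF assms(2)])
qed

text \<open>A Schwarz--Pick type bound: \<open>kv 0\<close> is a test function for the norm of \<open>kv w\<close>.\<close>

lemma one_minus_phi_lower:
  obtains c0 where "c0 > 0"
    "\<And>w. w \<in> bidisk \<Longrightarrow> c0 * ((1 - (cmod (fst w))\<^sup>2) * (1 - (cmod (snd w))\<^sup>2)) \<le> 1 - (cmod (phi w))\<^sup>2"
proof -
  have o: "(0, 0) \<in> bidisk" by (simp add: bidisk_def)
  define d where "d = 1 - cmod (phi (0, 0))"
  have d: "d > 0" using phi_lt_1[OF o] by (simp add: d_def)
  have nk: "(norm (kv (0, 0)))\<^sup>2 \<le> 1"
    by (simp add: norm_kv_sq[OF o] norm_szv_sq[OF o])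
  show ?thesis
  proof (rule that[of "d\<^sup>2"])
    fix w :: "complex \<times> complex" assume w: "w \<in> bidisk"
    let ?P = "(1 - (cmod (fst w))\<^sup>2) * (1 - (cmod (snd w))\<^sup>2)"
    have P: "?P > 0" using w by (auto simp: bidisk_def abs_square_less_1 intro!: mult_pos_pos)
    have "d \<le> 1 - cmod (cnj (phi (0, 0)) * phi w)"
      using mult_left_mono[OF phi_le_1[OF w], of "cmod (phi (0, 0))"] by (simp add: d_def norm_mult)
    also have "\<dots> \<le> cmod (1 - cnj (phi (0, 0)) * phi w)" by (metis norm_one norm_triangle_ineq2)
    also have "\<dots> = cmod (h2fun (kv (0, 0)) w)" by (simp add: h2fun_kv[OF o w] szego_def)
    finally have "d\<^sup>2 \<le> (cmod (h2fun (kv (0, 0)) w))\<^sup>2" using d by (intro power_mono) auto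
    also have "\<dots> \<le> (norm (kv (0, 0)))\<^sup>2 * ((1 - (cmod (phi w))\<^sup>2) / ?P)"
      by (rule h2fun_Kc_le[OF kv_in_Kc[OF o] w])
    also have "\<dots> \<le> 1 * ((1 - (cmod (phi w))\<^sup>2) / ?P)"
      using nk P phi_le_1[OF w] by (intro mult_right_mono) (auto simp: abs_square_le_1)
    finally show "d\<^sup>2 * ?P \<le> 1 - (cmod (phi w))\<^sup>2" using P by (simp add: pos_le_divide_eq)
  qed (use d in simp)
qed

text \<open>The vector \<open>x\<close> is orthogonal to \<open>phi * p * z1^k * z2^l\<close>, which
  is \<open>p~ * z1^k * z2^l\<close>. Reflecting the exponents, this inner product is the
  coefficient of \<open>z1^(n+k) * z2^(1+l)\<close> in \<open>p\<close> times
  \<open>x\<close>.\<close>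

lemma coef_pm_zero:
  assumes x: "x \<in> Kc"
  shows "coef (pm x) (n + k, 1 + l) = 0"
proof -
  define r where "r s = (n - fst s, 1 - snd s)" for s :: "nat \<times> nat"
  have qcf: "cnj (qcf s) = pcf (r s)" for s by (simp add: qcf_def pcf_def r_def)
  have "0 = cip x (mphi (pm (unitv (k, l))))" using x by (simp add: Kc_def)
  also have "\<dots> = (\<Sum>s\<in>pset. cnj (qcf s) * cip x (shift s (unitv (k, l))))"
    by (simp add: mphi_pm qm_def cip_sum_right cip_csc_right)
  also have "\<dots> = (\<Sum>s\<in>pset. pcf (r s) * coef x (fst s + k, snd s + l))"
    by (simp add: shift_unitv cip_unitv qcf)
  also have "\<dots> = (\<Sum>s\<in>pset. pcf s * coef (shift s x) (n + k, 1 + l))"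
  proof (rule sum.reindex_bij_witness[of _ r r])
    fix s assume s: "s \<in> pset"
    show "r (r s) = s" using s by (auto simp: r_def pset_def)
    show "r s \<in> pset" using s by (auto simp: r_def pset_def)
  next
    fix s assume s: "s \<in> pset"
    show "r (r s) = s" "r s \<in> pset" using s by (auto simp: r_def pset_def)
    have "(n + k - (n - fst s), 1 + l - (1 - snd s)) = (fst s + k, snd s + l)"
      using s by (auto simp: pset_def)
    moreover have "n - fst s \<le> n + k" "1 - snd s \<le> 1 + l" by simp_all
    ultimately show "pcf (r s) * coef (shift (r s) x) (n + k, 1 + l) = pcf (r s) * coef x (fst s + k, snd s + l)"
      unfolding coef_shift by (simp add: r_def)
  qed
  also have "\<dots> = coef (pm x) (n + k, 1 + l)"
    unfolding pm_def by (simp add: coef_sum)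
  finally show ?thesis by simp
qed

lemma row_ell2:
  fixes y :: hardy
  assumes "inj f" "\<And>k. cmod (a k) \<le> cmod (coef y (f k))"
  obtains b :: "nat ell2" where "coef b = a" "norm b \<le> norm y"
proof (rule ell2_of_nat_bound[of a "norm y"])
  fix N
  have "(\<Sum>k<N. (cmod (a k))\<^sup>2) \<le> (\<Sum>k<N. (cmod (coef y (f k)))\<^sup>2)"
    by (intro sum_mono power_mono assms(2)) auto
  also have "\<dots> = (\<Sum>s\<in>f ` {..<N}. (cmod (coef y s))\<^sup>2)"
    using assms(1) by (subst sum.reindex) (auto intro: inj_on_subset)
  also have "\<dots> \<le> (norm y)\<^sup>2" by (rule sum_coef_le_norm) simp
  finally show "(\<Sum>k<N. (cmod (a k))\<^sup>2) \<le> (norm y)\<^sup>2" .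
qed (use that in auto)

text \<open>The exponents left by \<open>coef_pm_zero\<close> form the row \<open>l = 0\<close> and
  the \<open>n\<close> columns \<open>i < n\<close>. The row is collected in \<open>a\<close>, each
  column in one \<open>b i\<close>.\<close>

lemma model_decomposition:
  assumes x: "x \<in> Kc"
  obtains a b where "norm a \<le> norm (pm x)" "\<And>i. norm (b i) \<le> norm (pm x)"
    "\<And>z. z \<in> bidisk \<Longrightarrow> pe z * h2fun x z = h1fun a (fst z) + (\<Sum>i<n. fst z ^ i * h1fun (b i) (snd z))"
proof -
  obtain a where a: "coef a = (\<lambda>k. coef (pm x) (k, 0))" "norm a \<le> norm (pm x)"
    by (rule row_ell2[of "\<lambda>k. (k, 0)" "\<lambda>k. coef (pm x) (k, 0)" "pm x"]) (auto simp: inj_def)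
  \<comment> \<open>The entries with \<open>l = 0\<close> already belong to \<open>a\<close>, so
    they are removed from the columns.\<close>
  have "\<exists>b. coef b = (\<lambda>l. if l = 0 then 0 else coef (pm x) (i, l)) \<and> norm b \<le> norm (pm x)" for i
    by (rule row_ell2[of "\<lambda>l. (i, l)" "\<lambda>l. if l = 0 then 0 else coef (pm x) (i, l)" "pm x"])
      (auto simp: inj_def)
  then obtain b where b: "\<And>i. coef (b i) = (\<lambda>l. if l = 0 then 0 else coef (pm x) (i, l))"
    "\<And>i. norm (b i) \<le> norm (pm x)" by metis
  have eq: "pm x = emb a + (\<Sum>i<n. shift (i, 0) (swapv (emb (b i))))"
  proof (rule ell2_eqI)
    fix ij :: "nat \<times> nat"
    obtain k l where kl: "ij = (k, l)" by (cases ij)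
    have trm: "coef (shift (i, 0) (swapv (emb (b i)))) (k, l)
        = (if i = k then (if l = 0 then 0 else coef (pm x) (k, l)) else 0)" for i
      by (auto simp: coef_shift coef_swapv coef_emb b)
    have "(\<Sum>i<n. coef (shift (i, 0) (swapv (emb (b i)))) (k, l))
        = (if k < n then (if l = 0 then 0 else coef (pm x) (k, l)) else 0)"
      unfolding trm by simp
    moreover have "coef (pm x) (k, l) = 0" if "\<not> k < n" "l \<noteq> 0"
      using coef_pm_zero[OF x, of "k - n" "l - 1"] that by simp
    ultimately show "coef (pm x) ij = coef (emb a + (\<Sum>i<n. shift (i, 0) (swapv (emb (b i))))) ij"
      by (auto simp: kl coef_sum coef_emb a)
  qed
  have sw: "(snd z, fst z) \<in> bidisk" if "z \<in> bidisk" for z using that by (simp add: bidisk_def)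
  show ?thesis
  proof (rule that[OF a(2) b(2)])
    fix z assume z: "z \<in> bidisk"
    have "pe z * h2fun x z = h2fun (pm x) z" by (simp add: h2fun_pm z)
    also have "\<dots> = h1fun a (fst z) + (\<Sum>i<n. fst z ^ i * h1fun (b i) (snd z))"
      by (subst eq) (simp add: h2fun_add h2fun_sum h2fun_emb h2fun_shift h2fun_swapv z sw mon_def)
    finally show "pe z * h2fun x z = h1fun a (fst z) + (\<Sum>i<n. fst z ^ i * h1fun (b i) (snd z))" .
  qed
qed

lemma model_space_iff: "f \<in> model_space phi \<longleftrightarrow> (\<exists>x\<in>Kc. \<forall>z\<in>bidisk. f z = h2fun x z)"
proof
  assume f: "f \<in> model_space phi"
  then have "f \<in> H2" by (simp add: model_space_def)
  then obtain x where x: "\<And>z. z \<in> bidisk \<Longrightarrow> f z = h2fun x z" unfolding H2_iff by blast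
  have "cip x (mphi y) = 0" for y
  proof -
    have "h2fun y \<in> H2" by (auto simp: H2_iff)
    then have "h2_inner f (\<lambda>z. phi z * h2fun y z) = 0" using f by (simp add: model_space_def)
    moreover have "h2_inner f (\<lambda>z. phi z * h2fun y z) = cip x (mphi y)"
      by (rule h2_inner_eq) (simp_all add: x h2fun_mphi)
    ultimately show ?thesis by simp
  qed
  then show "\<exists>x\<in>Kc. \<forall>z\<in>bidisk. f z = h2fun x z" using x by (auto simp: Kc_def)
next
  assume "\<exists>x\<in>Kc. \<forall>z\<in>bidisk. f z = h2fun x z"
  then obtain x where x: "x \<in> Kc" "\<And>z. z \<in> bidisk \<Longrightarrow> f z = h2fun x z" by blast
  have "h2_inner f (\<lambda>z. phi z * g z) = 0" if g: "g \<in> H2" for g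
  proof -
    obtain y where y: "\<And>z. z \<in> bidisk \<Longrightarrow> g z = h2fun y z" using g unfolding H2_iff by blast
    have "h2_inner f (\<lambda>z. phi z * g z) = cip x (mphi y)"
      by (rule h2_inner_eq) (simp_all add: x y h2fun_mphi)
    then show ?thesis using x(1) by (simp add: Kc_def)
  qed
  then show "f \<in> model_space phi" using x by (auto simp: model_space_def H2_iff)
qed

end

section \<open>The Clark measure and the Clark embedding\<close>

lemma torus2_closed: "closed torus2"
  unfolding torus2_def by (intro closed_Collect_conj closed_Collect_eq continuous_intros)

lemma norm_mult_lt_1:
  fixes u v :: complex
  assumes "cmod u < 1" "cmod v \<le> 1"
  shows "cmod (u * v) < 1"
  using mult_left_mono[OF assms(2), of "cmod u"] assms(1) by (simp add: norm_mult)

lemma szego_denom_nz: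
  assumes "w \<in> bidisk" "cmod (fst z) \<le> 1" "cmod (snd z) \<le> 1"
  shows "1 - fst z * cnj (fst w) \<noteq> 0" "1 - snd z * cnj (snd w) \<noteq> 0"
proof -
  have "cmod (fst z * cnj (fst w)) < 1" "cmod (snd z * cnj (snd w)) < 1"
    using norm_mult_lt_1[of "cnj (fst w)" "fst z"] norm_mult_lt_1[of "cnj (snd w)" "snd z"] assms
    by (simp_all add: bidisk_def mult.commute)
  then show "1 - fst z * cnj (fst w) \<noteq> 0" "1 - snd z * cnj (snd w) \<noteq> 0" by auto
qed

lemma szego_bound:
  assumes "w \<in> bidisk" "\<zeta> \<in> torus2"
  shows "cmod (szego w \<zeta>) \<le> 1 / ((1 - cmod (fst w)) * (1 - cmod (snd w)))"
proof -
  have l: "1 - cmod u \<le> cmod (1 - v * cnj u)" if "cmod v = 1" for u v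
    using norm_triangle_ineq2[of 1 "v * cnj u"] that by (simp add: norm_mult)
  have "(1 - cmod (fst w)) * (1 - cmod (snd w)) \<le> cmod (1 - fst \<zeta> * cnj (fst w)) * cmod (1 - snd \<zeta> * cnj (snd w))"
    using assms by (intro mult_mono l) (auto simp: bidisk_def torus2_def)
  then show ?thesis
    using assms unfolding szego_def norm_divide norm_mult norm_one
    by (intro frac_le mult_pos_pos) (auto simp: bidisk_def)
qed

lemma borel_measurable_cnj [measurable (raw)]:
  "f \<in> borel_measurable M \<Longrightarrow> (\<lambda>x. cnj (f x)) \<in> borel_measurable M"
  by (rule measurable_compose[of f M borel cnj]) (auto intro!: borel_measurable_continuous_onI continuous_intros)

lemma szego_measurable [measurable]: "szego w \<in> borel_measurable borel"
proof -
  have "(\<lambda>z. (1 - fst z * cnj (fst w)) * (1 - snd z * cnj (snd w))) \<in> borel_measurable borel"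
    by (intro borel_measurable_continuous_onI continuous_intros)
  then show ?thesis unfolding szego_def by (intro borel_measurable_divide) auto
qed

lemma L2_mult_integrable:
  assumes "g \<in> L2 M" "h \<in> L2 M"
  shows "integrable M (\<lambda>\<zeta>. g \<zeta> * cnj (h \<zeta>))"
proof (rule Bochner_Integration.integrable_bound)
  show "integrable M (\<lambda>\<zeta>. (cmod (g \<zeta>))\<^sup>2 + (cmod (h \<zeta>))\<^sup>2)"
    using assms by (intro Bochner_Integration.integrable_add) (auto simp: L2_def)
  have [measurable]: "g \<in> borel_measurable M" "h \<in> borel_measurable M" using assms by (auto simp: L2_def)
  show "(\<lambda>\<zeta>. g \<zeta> * cnj (h \<zeta>)) \<in> borel_measurable M" by measurable
  have "cmod a * cmod b \<le> (cmod a)\<^sup>2 + (cmod b)\<^sup>2" for a b :: complex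
    using sum_squares_bound[of "cmod a" "cmod b"] mult_nonneg_nonneg[OF norm_ge_zero norm_ge_zero, of a b]
    unfolding mult.assoc by linarith
  then show "AE \<zeta> in M. norm (g \<zeta> * cnj (h \<zeta>)) \<le> norm ((cmod (g \<zeta>))\<^sup>2 + (cmod (h \<zeta>))\<^sup>2)"
    by (simp add: norm_mult)
qed

locale rif_clark = rif n p for n p +
  fixes \<alpha> :: complex and \<sigma> :: "(complex \<times> complex) measure"
    and J :: "(complex \<times> complex \<Rightarrow> complex) \<Rightarrow> (complex \<times> complex \<Rightarrow> complex)"
  assumes alpha: "cmod \<alpha> = 1"
    and clark: "is_clark_measure phi \<alpha> \<sigma>"
    and emb: "is_clark_embedding phi \<alpha> \<sigma> J"
begin

lemma sets_sigma [measurable_cong]: "sets \<sigma> = sets borel"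
  using clark by (simp add: is_clark_measure_def)

lemma space_sigma [simp]: "space \<sigma> = UNIV"
  using sets_eq_imp_space_eq[OF sets_sigma] by simp

lemma AE_torus: "AE \<zeta> in \<sigma>. \<zeta> \<in> torus2"
proof (rule AE_I)
  show "{\<zeta> \<in> space \<sigma>. \<zeta> \<notin> torus2} \<subseteq> UNIV - torus2" by auto
  show "emeasure \<sigma> (UNIV - torus2) = 0" using clark by (simp add: is_clark_measure_def)
  show "UNIV - torus2 \<in> sets \<sigma>" unfolding sets_sigma using torus2_closed by (intro sets.Diff) auto
qed

definition "uu w = (1 - (cmod (phi w))\<^sup>2) / (cmod (\<alpha> - phi w))\<^sup>2"

lemma clark_poisson: "w \<in> bidisk \<Longrightarrow> ennreal (uu w) = (\<integral>\<^sup>+ \<zeta>. ennreal (poisson2 w \<zeta>) \<partial>\<sigma>)"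
  using clark by (simp add: is_clark_measure_def uu_def)

lemma total_mass: "emeasure \<sigma> UNIV = ennreal (uu (0, 0))"
proof -
  have "ennreal (uu (0, 0)) = (\<integral>\<^sup>+ \<zeta>. ennreal (poisson2 (0, 0) \<zeta>) \<partial>\<sigma>)"
    by (rule clark_poisson) (simp add: bidisk_def)
  also have "\<dots> = (\<integral>\<^sup>+ \<zeta>. 1 \<partial>\<sigma>)"
  proof (rule nn_integral_cong_AE)
    from AE_torus show "AE \<zeta> in \<sigma>. ennreal (poisson2 (0, 0) \<zeta>) = 1"
      by eventually_elim (simp add: poisson2_def torus2_def)
  qed
  finally show ?thesis by simp
qed

sublocale fm: finite_measure \<sigma>
  by (rule finite_measureI) (simp add: total_mass)

lemma integrable_bounded:
  fixes f :: "complex \<times> complex \<Rightarrow> complex"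
  assumes "f \<in> borel_measurable \<sigma>" "\<And>\<zeta>. \<zeta> \<in> torus2 \<Longrightarrow> cmod (f \<zeta>) \<le> B"
  shows "integrable \<sigma> f"
  by (rule fm.integrable_const_bound[of _ B]) (use assms AE_torus in \<open>auto elim!: eventually_mono\<close>)

lemma J_L2: "f \<in> model_space phi \<Longrightarrow> J f \<in> L2 \<sigma>"
  and J_add: "f \<in> model_space phi \<Longrightarrow> g \<in> model_space phi \<Longrightarrow> AE \<zeta> in \<sigma>. J (\<lambda>z. f z + g z) \<zeta> = J f \<zeta> + J g \<zeta>"
  and J_scale: "f \<in> model_space phi \<Longrightarrow> AE \<zeta> in \<sigma>. J (\<lambda>z. a * f z) \<zeta> = a * J f \<zeta>"
  and J_norm: "f \<in> model_space phi \<Longrightarrow> (\<integral>\<zeta>. (cmod (J f \<zeta>))\<^sup>2 \<partial>\<sigma>) = (h2_norm f)\<^sup>2"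
  and J_kernel: "w \<in> bidisk \<Longrightarrow> AE \<zeta> in \<sigma>. J (model_kernel phi w) \<zeta> = (1 - \<alpha> * cnj (phi w)) * szego w \<zeta>"
  using emb unfolding is_clark_embedding_def by blast+

lemma L2_norm_zero_AE:
  assumes "g \<in> L2 \<sigma>" "(\<integral>\<zeta>. (cmod (g \<zeta>))\<^sup>2 \<partial>\<sigma>) = 0"
  shows "AE \<zeta> in \<sigma>. g \<zeta> = 0"
proof -
  have "AE \<zeta> in \<sigma>. (cmod (g \<zeta>))\<^sup>2 = 0"
    using assms integral_nonneg_eq_0_iff_AE[of \<sigma> "\<lambda>\<zeta>. (cmod (g \<zeta>))\<^sup>2"] by (simp add: L2_def)
  then show ?thesis by simp
qed

lemma model_spaceI: "x \<in> Kc \<Longrightarrow> (\<And>z. z \<in> bidisk \<Longrightarrow> f z = h2fun x z) \<Longrightarrow> f \<in> model_space phi"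
  unfolding model_space_iff by blast

text \<open>Members of the model space are functions on all pairs of complex numbers, and
  \<open>J\<close> might react to values off the bidisk. The difference of two representatives of
  one vector has Hardy norm zero, so the isometry makes its image vanish almost everywhere.\<close>

lemma J_cong:
  assumes x: "x \<in> Kc" and f: "\<And>z. z \<in> bidisk \<Longrightarrow> f z = h2fun x z" and g: "\<And>z. z \<in> bidisk \<Longrightarrow> g z = h2fun x z"
  shows "AE \<zeta> in \<sigma>. J f \<zeta> = J g \<zeta>"
proof -
  have F: "f \<in> model_space phi" and G: "g \<in> model_space phi" using x f g by (auto intro: model_spaceI)
  have G': "(\<lambda>z. -1 * g z) \<in> model_space phi"
    by (rule model_spaceI[OF Kc_csc[OF x, of "-1"]]) (simp add: g h2fun_csc)
  define d where "d z = f z + -1 * g z" for z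
  have d0: "d z = h2fun 0 z" if "z \<in> bidisk" for z using that by (simp add: d_def f g)
  have D: "d \<in> model_space phi" by (rule model_spaceI[OF subspace_0[OF Kc_subspace] d0])
  have "(\<integral>\<zeta>. (cmod (J d \<zeta>))\<^sup>2 \<partial>\<sigma>) = 0" using J_norm[OF D] h2_norm_eq[OF d0] by simp
  then have "AE \<zeta> in \<sigma>. J d \<zeta> = 0" by (rule L2_norm_zero_AE[OF J_L2[OF D]])
  moreover have "AE \<zeta> in \<sigma>. J d \<zeta> = J f \<zeta> + J (\<lambda>z. -1 * g z) \<zeta>" unfolding d_def by (rule J_add[OF F G'])
  moreover have "AE \<zeta> in \<sigma>. J (\<lambda>z. -1 * g z) \<zeta> = -1 * J g \<zeta>" by (rule J_scale[OF G])
  ultimately show ?thesis by eventually_elim simp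
qed

abbreviation "Jx x \<equiv> J (h2fun x)"

lemma h2fun_model: "x \<in> Kc \<Longrightarrow> h2fun x \<in> model_space phi"
  by (rule model_spaceI[OF _ refl])

lemma Jx_L2: "x \<in> Kc \<Longrightarrow> Jx x \<in> L2 \<sigma>"
  by (rule J_L2[OF h2fun_model])

lemma Jx_norm: "x \<in> Kc \<Longrightarrow> (\<integral>\<zeta>. (cmod (Jx x \<zeta>))\<^sup>2 \<partial>\<sigma>) = (norm x)\<^sup>2"
  using J_norm[OF h2fun_model] h2_norm_eq[of "h2fun x" x] by simp

lemma Jx_add:
  assumes "x \<in> Kc" "y \<in> Kc"
  shows "AE \<zeta> in \<sigma>. Jx (x + y) \<zeta> = Jx x \<zeta> + Jx y \<zeta>"
proof -
  have "AE \<zeta> in \<sigma>. Jx (x + y) \<zeta> = J (\<lambda>z. h2fun x z + h2fun y z) \<zeta>"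
    by (rule J_cong[OF Kc_add[OF assms]]) (simp_all add: h2fun_add)
  with J_add[OF h2fun_model[OF assms(1)] h2fun_model[OF assms(2)]] show ?thesis by eventually_elim simp
qed

lemma Jx_csc:
  assumes "x \<in> Kc"
  shows "AE \<zeta> in \<sigma>. Jx (csc a x) \<zeta> = a * Jx x \<zeta>"
proof -
  have "AE \<zeta> in \<sigma>. Jx (csc a x) \<zeta> = J (\<lambda>z. a * h2fun x z) \<zeta>"
    by (rule J_cong[OF Kc_csc[OF assms, of a]]) (simp_all add: h2fun_csc)
  with J_scale[OF h2fun_model[OF assms], of a] show ?thesis by eventually_elim simp
qed

lemma Jx_diff:
  assumes "x \<in> Kc" "y \<in> Kc"
  shows "AE \<zeta> in \<sigma>. Jx (x - y) \<zeta> = Jx x \<zeta> - Jx y \<zeta>"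
proof -
  have "AE \<zeta> in \<sigma>. Jx (x + csc (-1) y) \<zeta> = Jx x \<zeta> + Jx (csc (-1) y) \<zeta>"
    by (rule Jx_add[OF assms(1) Kc_csc[OF assms(2)]])
  with Jx_csc[OF assms(2), of "-1"] show ?thesis by eventually_elim (simp add: csc_neg1)
qed

lemma Jx_kv:
  assumes w: "w \<in> bidisk"
  shows "AE \<zeta> in \<sigma>. Jx (kv w) \<zeta> = (1 - \<alpha> * cnj (phi w)) * szego w \<zeta>"
proof -
  have "AE \<zeta> in \<sigma>. Jx (kv w) \<zeta> = J (model_kernel phi w) \<zeta>"
    by (rule J_cong[OF kv_in_Kc[OF w]]) (simp_all add: h2fun_kv_model[OF w])
  with J_kernel[OF w] show ?thesis by eventually_elim simp
qed

lemma Jx_measurable: "x \<in> Kc \<Longrightarrow> Jx x \<in> borel_measurable \<sigma>"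
  using Jx_L2 by (simp add: L2_def)

text \<open>Polarisation of the isometry gives the real parts; replacing \<open>y\<close> by
  \<open>\<i>\<close> times \<open>y\<close> gives the imaginary parts. Additivity of
  \<open>J\<close> holds only almost everywhere, so each step passes through an integral.\<close>

lemma Jx_polar:
  assumes x: "x \<in> Kc" and y: "y \<in> Kc"
  shows "(\<integral>\<zeta>. Jx x \<zeta> * cnj (Jx y \<zeta>) \<partial>\<sigma>) = cip x y"
proof -
  have re: "Re (\<integral>\<zeta>. Jx x \<zeta> * cnj (Jx y \<zeta>) \<partial>\<sigma>) = inner x y" if y: "y \<in> Kc" for y
  proof -
    note int = L2_mult_integrable[OF Jx_L2[OF x] Jx_L2[OF y]]
    have ix: "integrable \<sigma> (\<lambda>\<zeta>. (cmod (Jx x \<zeta>))\<^sup>2)" and iy: "integrable \<sigma> (\<lambda>\<zeta>. (cmod (Jx y \<zeta>))\<^sup>2)"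
      using Jx_L2[OF x] Jx_L2[OF y] by (auto simp: L2_def)
    have ir: "integrable \<sigma> (\<lambda>\<zeta>. 2 * Re (Jx x \<zeta> * cnj (Jx y \<zeta>)))" by (intro integrable_mult_right integrable_Re int)
    have ax: "(cmod (a + b))\<^sup>2 = (cmod a)\<^sup>2 + (cmod b)\<^sup>2 + 2 * Re (a * cnj b)" for a b :: complex
      unfolding cmod_power2 by (simp add: power2_eq_square algebra_simps)
    have "(norm (x + y))\<^sup>2 = (\<integral>\<zeta>. (cmod (Jx (x + y) \<zeta>))\<^sup>2 \<partial>\<sigma>)" by (simp add: Jx_norm Kc_add x y)
    also have "\<dots> = (\<integral>\<zeta>. (cmod (Jx x \<zeta>))\<^sup>2 + (cmod (Jx y \<zeta>))\<^sup>2 + 2 * Re (Jx x \<zeta> * cnj (Jx y \<zeta>)) \<partial>\<sigma>)"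
    proof (rule integral_cong_AE)
      show "(\<lambda>\<zeta>. (cmod (Jx (x + y) \<zeta>))\<^sup>2) \<in> borel_measurable \<sigma>"
        using Jx_measurable[OF Kc_add[OF x y]] by measurable
      show "(\<lambda>\<zeta>. (cmod (Jx x \<zeta>))\<^sup>2 + (cmod (Jx y \<zeta>))\<^sup>2 + 2 * Re (Jx x \<zeta> * cnj (Jx y \<zeta>))) \<in> borel_measurable \<sigma>"
        using ix iy ir by measurable
      show "AE \<zeta> in \<sigma>. (cmod (Jx (x + y) \<zeta>))\<^sup>2 = (cmod (Jx x \<zeta>))\<^sup>2 + (cmod (Jx y \<zeta>))\<^sup>2 + 2 * Re (Jx x \<zeta> * cnj (Jx y \<zeta>))"
        using Jx_add[OF x y] by eventually_elim (simp only: ax)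
    qed
    also have "\<dots> = (norm x)\<^sup>2 + (norm y)\<^sup>2 + (\<integral>\<zeta>. 2 * Re (Jx x \<zeta> * cnj (Jx y \<zeta>)) \<partial>\<sigma>)"
      using ix iy ir by (simp add: Jx_norm x y Bochner_Integration.integral_add del: integral_mult_right_zero)
    also have "(\<integral>\<zeta>. 2 * Re (Jx x \<zeta> * cnj (Jx y \<zeta>)) \<partial>\<sigma>) = 2 * Re (\<integral>\<zeta>. Jx x \<zeta> * cnj (Jx y \<zeta>) \<partial>\<sigma>)"
      unfolding integral_mult_right_zero using integral_Re[OF int] by (simp only:)
    finally show ?thesis by (simp add: power2_norm_eq_inner inner_simps inner_commute)
  qed
  note int = L2_mult_integrable[OF Jx_L2[OF x] Jx_L2[OF y]]
  have iy: "csc \<i> y \<in> Kc" by (rule Kc_csc[OF y])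
  have "(\<integral>\<zeta>. Jx x \<zeta> * cnj (Jx (csc \<i> y) \<zeta>) \<partial>\<sigma>) = (\<integral>\<zeta>. - \<i> * (Jx x \<zeta> * cnj (Jx y \<zeta>)) \<partial>\<sigma>)"
  proof (rule integral_cong_AE)
    show "(\<lambda>\<zeta>. Jx x \<zeta> * cnj (Jx (csc \<i> y) \<zeta>)) \<in> borel_measurable \<sigma>"
      using L2_mult_integrable[OF Jx_L2[OF x] Jx_L2[OF iy]] by (rule borel_measurable_integrable)
    show "(\<lambda>\<zeta>. - \<i> * (Jx x \<zeta> * cnj (Jx y \<zeta>))) \<in> borel_measurable \<sigma>" using int by measurable
    show "AE \<zeta> in \<sigma>. Jx x \<zeta> * cnj (Jx (csc \<i> y) \<zeta>) = - \<i> * (Jx x \<zeta> * cnj (Jx y \<zeta>))"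
      using Jx_csc[OF y, of \<i>] by eventually_elim simp
  qed
  also have "\<dots> = - \<i> * (\<integral>\<zeta>. Jx x \<zeta> * cnj (Jx y \<zeta>) \<partial>\<sigma>)" by (rule integral_mult_right_zero)
  finally have "Im (\<integral>\<zeta>. Jx x \<zeta> * cnj (Jx y \<zeta>) \<partial>\<sigma>) = inner x (csc \<i> y)" using re[OF iy] by simp
  with re[OF y] show ?thesis by (simp add: cip_eq_inner complex_eq_iff)
qed

text \<open>The normalised Cauchy transform that inverts \<open>J\<close>: evaluation at
  \<open>w\<close> is the product with \<open>kv w\<close>, and \<open>J\<close> carries it to an
  integral against a multiple of the Szego kernel.\<close>

lemma h2fun_representation:
  assumes x: "x \<in> Kc" and w: "w \<in> bidisk"
  shows "h2fun x w = (1 - cnj \<alpha> * phi w) * (\<integral>\<zeta>. Jx x \<zeta> * cnj (szego w \<zeta>) \<partial>\<sigma>)"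
proof -
  have "h2fun x w = (\<integral>\<zeta>. Jx x \<zeta> * cnj (Jx (kv w) \<zeta>) \<partial>\<sigma>)"
    using Jx_polar[OF x kv_in_Kc[OF w]] cip_kv[OF x w] by simp
  also have "\<dots> = (\<integral>\<zeta>. (1 - cnj \<alpha> * phi w) * (Jx x \<zeta> * cnj (szego w \<zeta>)) \<partial>\<sigma>)"
  proof (rule integral_cong_AE)
    show "(\<lambda>\<zeta>. Jx x \<zeta> * cnj (Jx (kv w) \<zeta>)) \<in> borel_measurable \<sigma>"
      using L2_mult_integrable[OF Jx_L2[OF x] Jx_L2[OF kv_in_Kc[OF w]]] by (rule borel_measurable_integrable)
    show "(\<lambda>\<zeta>. (1 - cnj \<alpha> * phi w) * (Jx x \<zeta> * cnj (szego w \<zeta>))) \<in> borel_measurable \<sigma>"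
      using Jx_measurable[OF x] by measurable
    show "AE \<zeta> in \<sigma>. Jx x \<zeta> * cnj (Jx (kv w) \<zeta>) = (1 - cnj \<alpha> * phi w) * (Jx x \<zeta> * cnj (szego w \<zeta>))"
      using Jx_kv[OF w] by eventually_elim simp
  qed
  also have "\<dots> = (1 - cnj \<alpha> * phi w) * (\<integral>\<zeta>. Jx x \<zeta> * cnj (szego w \<zeta>) \<partial>\<sigma>)"
    by (rule integral_mult_right_zero)
  finally show ?thesis .
qed

lemma alpha_phi_nz: "w \<in> bidisk \<Longrightarrow> 1 - \<alpha> * cnj (phi w) \<noteq> 0" "w \<in> bidisk \<Longrightarrow> 1 - cnj \<alpha> * phi w \<noteq> 0"
  "w \<in> bidisk \<Longrightarrow> \<alpha> - phi w \<noteq> 0"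
proof -
  assume w: "w \<in> bidisk"
  have "cmod (\<alpha> * cnj (phi w)) < 1" "cmod (cnj \<alpha> * phi w) < 1"
    using phi_lt_1[OF w] by (simp_all add: norm_mult alpha)
  then show "1 - \<alpha> * cnj (phi w) \<noteq> 0" "1 - cnj \<alpha> * phi w \<noteq> 0" by auto
  show "\<alpha> - phi w \<noteq> 0" using phi_lt_1[OF w] alpha by auto
qed

text \<open>The Cauchy transform of \<open>J\<close> applied to a kernel, whose value is known. The
  diagonal \<open>w = z\<close> is the Poisson identity defining \<open>\<sigma>\<close>; the mixed
  moments allow Cauchy integrals over parts of \<open>\<sigma>\<close> to be computed.\<close>

lemma szego_gram:
  assumes w: "w \<in> bidisk" and z: "z \<in> bidisk"
  shows "(\<integral>\<zeta>. szego w \<zeta> * cnj (szego z \<zeta>) \<partial>\<sigma>)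
    = (1 - cnj (phi w) * phi z) * szego w z / ((1 - \<alpha> * cnj (phi w)) * (1 - cnj \<alpha> * phi z))"
proof -
  have "(1 - cnj (phi w) * phi z) * szego w z = (1 - cnj \<alpha> * phi z) * (\<integral>\<zeta>. Jx (kv w) \<zeta> * cnj (szego z \<zeta>) \<partial>\<sigma>)"
    using h2fun_representation[OF kv_in_Kc[OF w] z] by (simp add: h2fun_kv[OF w z])
  also have "(\<integral>\<zeta>. Jx (kv w) \<zeta> * cnj (szego z \<zeta>) \<partial>\<sigma>)
      = (\<integral>\<zeta>. (1 - \<alpha> * cnj (phi w)) * (szego w \<zeta> * cnj (szego z \<zeta>)) \<partial>\<sigma>)"
  proof (rule integral_cong_AE)
    show "(\<lambda>\<zeta>. Jx (kv w) \<zeta> * cnj (szego z \<zeta>)) \<in> borel_measurable \<sigma>"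
      using Jx_measurable[OF kv_in_Kc[OF w]] by measurable
    show "AE \<zeta> in \<sigma>. Jx (kv w) \<zeta> * cnj (szego z \<zeta>) = (1 - \<alpha> * cnj (phi w)) * (szego w \<zeta> * cnj (szego z \<zeta>))"
      using Jx_kv[OF w] by eventually_elim simp
  qed measurable
  also have "\<dots> = (1 - \<alpha> * cnj (phi w)) * (\<integral>\<zeta>. szego w \<zeta> * cnj (szego z \<zeta>) \<partial>\<sigma>)"
    by (rule integral_mult_right_zero)
  finally have eq: "(1 - cnj (phi w) * phi z) * szego w z = (1 - cnj \<alpha> * phi z) *
      ((1 - \<alpha> * cnj (phi w)) * (\<integral>\<zeta>. szego w \<zeta> * cnj (szego z \<zeta>) \<partial>\<sigma>))" .
  show ?thesis unfolding eq using alpha_phi_nz(1)[OF w] alpha_phi_nz(2)[OF z] by simp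
qed

end

section \<open>Support and marginals of the Clark measure\<close>

lemma norm_cis_diff: "cmod (cis a - cis b) \<le> \<bar>a - b\<bar>"
proof -
  have "cis a = cis b * cis (a - b)" by (simp add: cis_mult)
  then have "cis a - cis b = cis b * (cis (a - b) - 1)" by (simp add: algebra_simps)
  then have "cis a - cis b = cis b * (exp (\<i> * of_real (a - b)) - 1)" by (simp only: cis_conv_exp[of "a - b"])
  then have "cmod (cis a - cis b) = 2 * \<bar>sin ((a - b) / 2)\<bar>"
    by (simp add: norm_mult dist_exp_i_1 del: of_real_diff)
  also have "\<dots> \<le> 2 * \<bar>(a - b) / 2\<bar>" by (intro mult_left_mono abs_sin_x_le_abs_x) auto
  finally show ?thesis by simp
qed

lemma circle_grid:
  assumes "cmod x = 1" "N > 0"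
  obtains k where "k < N" "cmod (x - rou N k) \<le> 2 * pi / real N"
proof -
  define t where "t = Arg2pi x"
  have t: "0 \<le> t" "t < 2 * pi" "x = cis t"
    using complex_norm_eq_1_exp[of x] assms(1) by (simp_all add: t_def Arg2pi_ge_0 Arg2pi_lt_2pi cis_conv_exp)
  define s where "s = t * real N / (2 * pi)"
  have s: "0 \<le> s" "s < real N" using t assms(2) by (auto simp: s_def field_simps)
  define k where "k = nat \<lfloor>s\<rfloor>"
  have k: "real k \<le> s" "s < real k + 1" using s by (auto simp: k_def)
  have kN: "k < N" using k(1) s(2) by linarith
  have ts: "t = 2 * pi * s / real N" using assms(2) by (simp add: s_def)
  have "cmod (x - rou N k) \<le> \<bar>t - 2 * pi * real k / real N\<bar>" unfolding t(3) by (rule norm_cis_diff)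
  also have "t - 2 * pi * real k / real N = (s - real k) * (2 * pi / real N)"
    unfolding ts by (simp add: diff_divide_distrib algebra_simps)
  also have "\<bar>\<dots>\<bar> \<le> 1 * (2 * pi / real N)"
    unfolding abs_mult using k by (intro mult_mono) auto
  finally have "cmod (x - rou N k) \<le> 2 * pi / real N" by (simp only: mult_1)
  with kN show ?thesis by (rule that)
qed

lemma pois_nonneg: "cmod z < 1 \<Longrightarrow> 0 \<le> pois z x"
  by (simp add: pois_def abs_square_le_1)

lemma poisson2_pois: "poisson2 w \<zeta> = pois (fst w) (fst \<zeta>) * pois (snd w) (snd \<zeta>)"
  by (simp add: poisson2_def pois_def)

text \<open>The test point at depth \<open>d\<close> under \<open>x\<close> sees every point of the
  circle within \<open>d\<close> of \<open>x\<close> at distance at most \<open>2 * d\<close>. This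
  converts bounds on Poisson integrals into bounds on masses of disks.\<close>

lemma pois_lower:
  assumes x: "cmod x = 1" and d: "0 < d" "d \<le> 1" and y: "cmod (y - x) \<le> d" "cmod y = 1"
  shows "1 / (4 * d) \<le> pois (of_real (1 - d) * x) y"
proof -
  define w where "w = of_real (1 - d) * x"
  have nw: "cmod w = 1 - d" using x d by (simp add: w_def norm_mult del: of_real_diff)
  have "cmod (y - w) \<le> cmod (y - x) + cmod (x - w)" using norm_triangle_ineq[of "y - x" "x - w"] by simp
  also have "x - w = of_real d * x" by (simp add: w_def algebra_simps)
  finally have yw: "cmod (y - w) \<le> 2 * d" using y d x by (simp add: norm_mult)
  have "y \<noteq> w" using y(2) nw d by auto
  then have pos: "0 < (cmod (y - w))\<^sup>2" by simp
  have "1 / (4 * d) = d / (2 * d)\<^sup>2" using d by (simp add: power2_eq_square)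
  also have "\<dots> \<le> (1 - (cmod w)\<^sup>2) / (cmod (y - w))\<^sup>2"
  proof (rule frac_le)
    have "1 - (1 - d)\<^sup>2 = d + d * (1 - d)" by (simp add: power2_eq_square algebra_simps)
    then show "d \<le> 1 - (cmod w)\<^sup>2" unfolding nw using d by simp
    then show "0 \<le> 1 - (cmod w)\<^sup>2" using d by linarith
    show "(cmod (y - w))\<^sup>2 \<le> (2 * d)\<^sup>2" using yw by (intro power_mono) auto
  qed (rule pos)
  finally show ?thesis by (simp add: pois_def w_def)
qed

context rif
begin

lemma pe_continuous: "continuous_on A pe"
  unfolding pe_eq[abs_def] by (intro continuous_intros)

lemma qe_continuous: "continuous_on A qe"
  unfolding qe_eq[abs_def] by (intro continuous_intros)

lemma qe_torus: "\<zeta> \<in> torus2 \<Longrightarrow> qe \<zeta> = fst \<zeta> ^ n * snd \<zeta> * cnj (pe \<zeta>)"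
proof -
  assume z: "\<zeta> \<in> torus2"
  have "snd \<zeta> * cnj (snd \<zeta>) = 1" using complex_norm_square[of "snd \<zeta>"] z by (simp add: torus2_def)
  moreover have "fst \<zeta> ^ n * snd \<zeta> * cnj (pe \<zeta>)
      = fst \<zeta> ^ n * (snd \<zeta> * cnj (poly P0 (fst \<zeta>)) + snd \<zeta> * cnj (snd \<zeta>) * cnj (poly P1 (fst \<zeta>)))"
    by (simp add: pe_eq algebra_simps)
  moreover have "qe \<zeta> = fst \<zeta> ^ n * (snd \<zeta> * cnj (poly P0 (fst \<zeta>)) + cnj (poly P1 (fst \<zeta>)))"
    using z by (simp add: qe_eq torus2_def poly_rev_poly_unit algebra_simps)
  ultimately show ?thesis by (simp only: mult_1)
qed

text \<open>Radial limit of \<open>phi_le_1\<close>. In particular \<open>p~\<close> vanishes at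
  every zero of \<open>p\<close> in the closed bidisk.\<close>

lemma qe_le_pe:
  assumes "cmod (fst z) \<le> 1" "cmod (snd z) \<le> 1"
  shows "cmod (qe z) \<le> cmod (pe z)"
proof (rule tendsto_le)
  have c: "((\<lambda>r::real. (of_real r * fst z, of_real r * snd z)) \<longlongrightarrow> z) (at_left 1)"
    by (auto intro!: tendsto_eq_intros)
  show "((\<lambda>r::real. cmod (pe (of_real r * fst z, of_real r * snd z))) \<longlongrightarrow> cmod (pe z)) (at_left 1)"
    using continuous_on_tendsto_compose[OF pe_continuous[of UNIV] c] by (auto intro: tendsto_norm)
  show "((\<lambda>r::real. cmod (qe (of_real r * fst z, of_real r * snd z))) \<longlongrightarrow> cmod (qe z)) (at_left 1)"
    using continuous_on_tendsto_compose[OF qe_continuous[of UNIV] c] by (auto intro: tendsto_norm)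
  show "\<forall>\<^sub>F r::real in at_left 1. cmod (qe (of_real r * fst z, of_real r * snd z)) \<le> cmod (pe (of_real r * fst z, of_real r * snd z))"
    using eventually_at_left_real[OF zero_less_one[where 'a = real]]
  proof eventually_elim
    case (elim r)
    define w where "w = (of_real r * fst z, of_real r * snd z)"
    have "w \<in> bidisk"
      using norm_mult_lt_1[of "of_real r" "fst z"] norm_mult_lt_1[of "of_real r" "snd z"] elim assms
      by (simp add: w_def bidisk_def)
    then show ?case using phi_le_1[of w] pe_nz[of w] by (simp add: phi_def norm_divide w_def)
  qed
qed simp

end

context rif_clark
begin

definition "dd z = \<alpha> * pe z - qe z"
definition "bb z = \<alpha> * poly P0 z - poly R1 z"
definition "bt z = cnj \<alpha> * poly R0 z - poly P1 z"

lemma alpha_cnj: "\<alpha> * cnj \<alpha> = 1" "cnj \<alpha> * \<alpha> = 1"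
  using complex_norm_square[of \<alpha>] alpha by (simp_all add: mult.commute)

text \<open>Since \<open>\<alpha>\<close> is unimodular, the coefficient of \<open>z2\<close> can be
  written with \<open>bt\<close>, the degree-\<open>n\<close> reflection of \<open>bb\<close>. On
  the circle both have the same modulus, so over a point with \<open>bb\<close> nonzero the zero of
  \<open>dd\<close> is a single unimodular \<open>z2\<close>.\<close>

lemma dd_eq: "dd z = bb (fst z) - \<alpha> * snd z * bt (fst z)"
proof -
  have "\<alpha> * snd z * (cnj \<alpha> * poly R0 (fst z)) = snd z * poly R0 (fst z)"
    using alpha_cnj(1) by (metis (no_types, opaque_lifting) mult.assoc mult.commute mult.left_neutral)
  then show ?thesis by (simp add: dd_def bb_def bt_def pe_eq qe_eq algebra_simps)
qed

lemma dd_continuous: "continuous_on A dd"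
  unfolding dd_def by (intro continuous_intros pe_continuous qe_continuous)

lemma alpha_minus_phi: "pe z \<noteq> 0 \<Longrightarrow> \<alpha> - phi z = dd z / pe z"
  by (simp add: phi_def dd_def field_simps)

lemma dd_nz: "w \<in> bidisk \<Longrightarrow> dd w \<noteq> 0"
  using alpha_minus_phi[of w] alpha_phi_nz(3)[of w] pe_nz[of w] by auto

lemma uu_eq: "w \<in> bidisk \<Longrightarrow> uu w = ((cmod (pe w))\<^sup>2 - (cmod (qe w))\<^sup>2) / (cmod (dd w))\<^sup>2"
  using pe_nz[of w] unfolding uu_def alpha_minus_phi[OF pe_nz]
  by (simp add: phi_def norm_divide power_divide divide_simps)

lemma uu_nonneg: "w \<in> bidisk \<Longrightarrow> 0 \<le> uu w"
  unfolding uu_def using phi_le_1[of w] by (simp add: abs_square_le_1)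

lemma box_bound:
  assumes w: "w \<in> bidisk" and S: "S \<in> sets borel" and c: "c > 0"
    and low: "\<And>\<zeta>. \<zeta> \<in> S \<Longrightarrow> \<zeta> \<in> torus2 \<Longrightarrow> c \<le> poisson2 w \<zeta>"
  shows "emeasure \<sigma> S \<le> ennreal (uu w / c)"
proof -
  have "ennreal c * emeasure \<sigma> S = (\<integral>\<^sup>+ \<zeta>. ennreal c * indicator S \<zeta> \<partial>\<sigma>)"
    using S by (simp add: nn_integral_cmult_indicator sets_sigma)
  also have "\<dots> \<le> (\<integral>\<^sup>+ \<zeta>. ennreal (poisson2 w \<zeta>) \<partial>\<sigma>)"
  proof (rule nn_integral_mono_AE)
    from AE_torus show "AE \<zeta> in \<sigma>. ennreal c * indicator S \<zeta> \<le> ennreal (poisson2 w \<zeta>)"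
      by eventually_elim (auto simp: indicator_def low intro!: ennreal_leI)
  qed
  also have "\<dots> = ennreal (uu w)" by (simp add: clark_poisson[OF w])
  finally have "ennreal c * emeasure \<sigma> S \<le> ennreal (uu w)" .
  then have "ennreal (1 / c) * (ennreal c * emeasure \<sigma> S) \<le> ennreal (1 / c) * ennreal (uu w)"
    by (rule mult_left_mono) simp
  then show ?thesis using c uu_nonneg[OF w] by (simp add: mult.assoc[symmetric] ennreal_mult[symmetric])
qed

text \<open>Where \<open>|dd|\<close> stays above \<open>\<eta>\<close>, the density
  \<open>uu = (|p|^2 - |p~|^2) / |dd|^2\<close> tends to zero at the torus. A grid of
  \<open>N * N\<close> boxes of size \<open>\<delta> = 2 * pi / N\<close>, each of mass at most
  \<open>16 * \<delta>\<^sup>2 * uu\<close> at its test point, bounds the mass of \<open>K\<close>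
  by a constant times an arbitrary \<open>e\<close>.\<close>

lemma AE_dd_zero: "AE \<zeta> in \<sigma>. dd \<zeta> = 0"
proof -
  define g where "g z = (cmod (pe z))\<^sup>2 - (cmod (qe z))\<^sup>2" for z
  have zero: "emeasure \<sigma> {\<zeta> \<in> torus2. \<eta> \<le> cmod (dd \<zeta>)} = 0" if eta: "\<eta> > 0" for \<eta>
  proof -
    define K where "K = {\<zeta> \<in> torus2. \<eta> \<le> cmod (dd \<zeta>)}"
    have bound: "emeasure \<sigma> K \<le> ennreal (256 * pi\<^sup>2 / \<eta>\<^sup>2 * e)" if e: "e > 0" for e
    proof -
      define B where "B = cball (0::complex) 1 \<times> cball (0::complex) 1"
      have B: "compact B" unfolding B_def by (intro compact_Times compact_cball)
      have "uniformly_continuous_on B dd"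
        by (rule compact_uniformly_continuous[OF dd_continuous B])
      then obtain d1 where d1: "d1 > 0" "\<And>z w. z \<in> B \<Longrightarrow> w \<in> B \<Longrightarrow> dist z w < d1 \<Longrightarrow> dist (dd z) (dd w) < \<eta> / 2"
        using eta unfolding uniformly_continuous_on_def by (meson half_gt_zero)
      have "continuous_on B g" unfolding g_def by (intro continuous_intros pe_continuous qe_continuous)
      then have "uniformly_continuous_on B g" by (rule compact_uniformly_continuous[OF _ B])
      then obtain d2 where d2: "d2 > 0" "\<And>z w. z \<in> B \<Longrightarrow> w \<in> B \<Longrightarrow> dist z w < d2 \<Longrightarrow> dist (g z) (g w) < e"
        using e unfolding uniformly_continuous_on_def by meson
      \<comment> \<open>A point of a box is within \<open>4 * \<delta>\<close> of the test point of
        that box, so \<open>N\<close> is taken with \<open>4 * \<delta>\<close> below both moduli of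
        continuity; the \<open>1\<close> keeps \<open>\<delta>\<close> an admissible depth.\<close>
      define M where "M = min (min d1 d2) 1"
      have mpos: "M > 0" using d1(1) d2(1) by (simp add: M_def)
      obtain N where N0: "8 * pi / M < real N" using reals_Archimedean2 by blast
      have "0 \<le> 8 * pi / M" using mpos by simp
      then have Np: "real N > 0" using N0 by linarith
      then have N: "N > 0" by simp
      define \<delta> where "\<delta> = 2 * pi / real N"
      have \<delta>: "\<delta> > 0" using N by (simp add: \<delta>_def)
      have "8 * pi < real N * M" using N0 mpos by (simp add: pos_divide_less_eq)
      then have "8 * pi / real N < M" using Np by (simp add: pos_divide_less_eq mult.commute)
      then have "4 * \<delta> < M" by (simp add: \<delta>_def)
      then have \<delta>s: "4 * \<delta> < d1" "4 * \<delta> < d2" "\<delta> \<le> 1" using \<delta> by (simp_all add: M_def)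
      define Q where "Q kl = cball (rou N (fst kl)) \<delta> \<times> cball (rou N (snd kl)) \<delta>" for kl
      define w where "w kl = (of_real (1 - \<delta>) * rou N (fst kl), of_real (1 - \<delta>) * rou N (snd kl))" for kl
      define I where "I = {kl \<in> {..<N} \<times> {..<N}. Q kl \<inter> K \<noteq> {}}"
      have I: "finite I" "card I \<le> N * N"
        using card_mono[of "{..<N} \<times> {..<N}" I] by (auto simp: I_def)
      have nw: "cmod (of_real (1 - \<delta>) * rou N k) = 1 - \<delta>" for k
        using \<delta>s by (simp add: norm_mult del: of_real_diff)
      have wb: "w kl \<in> bidisk" for kl using nw \<delta> by (simp add: w_def bidisk_def del: of_real_diff)
      have QK: "emeasure \<sigma> (Q kl) \<le> ennreal (64 * \<delta>\<^sup>2 / \<eta>\<^sup>2 * e)" if kl: "kl \<in> I" for kl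
      proof -
        obtain \<zeta> where z: "\<zeta> \<in> Q kl" "\<zeta> \<in> K" using kl by (auto simp: I_def)
        have zT: "\<zeta> \<in> torus2" using z(2) by (simp add: K_def)
        have near: "cmod (x - of_real (1 - \<delta>) * rou N k) \<le> 2 * \<delta>" if "cmod (rou N k - x) \<le> \<delta>" for x k
        proof -
          have "x - of_real (1 - \<delta>) * rou N k = (x - rou N k) + of_real \<delta> * rou N k" by (simp add: algebra_simps)
          then have "cmod (x - of_real (1 - \<delta>) * rou N k) \<le> cmod (x - rou N k) + cmod (of_real \<delta> * rou N k)"
            by (metis norm_triangle_ineq)
          then show ?thesis using that \<delta> by (simp add: norm_mult norm_minus_commute)
        qed
        have "dist \<zeta> (w kl) \<le> dist (fst \<zeta>) (fst (w kl)) + dist (snd \<zeta>) (snd (w kl))"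
          unfolding dist_prod_def by (rule sqrt_sum_squares_le_sum) auto
        also have "\<dots> \<le> 4 * \<delta>"
          using near[of "fst kl" "fst \<zeta>"] near[of "snd kl" "snd \<zeta>"] z(1)
          by (auto simp: Q_def w_def dist_norm)
        finally have dz: "dist \<zeta> (w kl) < d1" "dist \<zeta> (w kl) < d2" using \<delta>s by auto
        have Bm: "\<zeta> \<in> B" "w kl \<in> B" using zT wb[of kl] by (auto simp: B_def torus2_def bidisk_def mem_Times_iff)
        have "cmod (dd \<zeta>) \<le> cmod (dd (w kl)) + dist (dd \<zeta>) (dd (w kl))"
          by (simp add: dist_norm) (metis add.commute norm_triangle_sub)
        then have dw: "\<eta> / 2 \<le> cmod (dd (w kl))" using d1(2)[OF Bm dz(1)] z(2) by (simp add: K_def)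
        \<comment> \<open>On the torus \<open>|p~| = |p|\<close>, so uniform continuity makes the
          numerator \<open>g\<close> of \<open>uu\<close> small at the test point, while the
          denominator stays at least \<open>(\<eta> / 2)\<^sup>2\<close>.\<close>
        have "g \<zeta> = 0" using zT by (simp add: g_def qe_torus norm_mult norm_power torus2_def)
        then have gw: "g (w kl) \<le> e" using d2(2)[OF Bm dz(2)] by (simp add: dist_norm)
        have "g (w kl) \<ge> 0" using qe_le_pe[of "w kl"] wb[of kl] by (simp add: g_def bidisk_def power_mono)
        then have "uu (w kl) \<le> e / (\<eta> / 2)\<^sup>2"
          unfolding uu_eq[OF wb] g_def[symmetric] using gw dw eta e by (intro frac_le power_mono) auto
        moreover have "emeasure \<sigma> (Q kl) \<le> ennreal (uu (w kl) / (1 / (4 * \<delta>) * (1 / (4 * \<delta>))))"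
        proof (rule box_bound[OF wb])
          show "Q kl \<in> sets borel" unfolding Q_def by (intro borel_closed closed_Times) auto
          fix \<xi> assume "\<xi> \<in> Q kl" "\<xi> \<in> torus2"
          then show "1 / (4 * \<delta>) * (1 / (4 * \<delta>)) \<le> poisson2 (w kl) \<xi>"
            unfolding poisson2_pois w_def fst_conv snd_conv using \<delta> \<delta>s
            by (intro mult_mono pois_lower) (auto simp: Q_def torus2_def dist_norm norm_minus_commute pois_nonneg nw simp del: of_real_diff)
        qed (use \<delta> in simp)
        moreover have "uu (w kl) / (1 / (4 * \<delta>) * (1 / (4 * \<delta>))) = 16 * \<delta>\<^sup>2 * uu (w kl)"
          by (simp add: power2_eq_square)
        moreover have "16 * \<delta>\<^sup>2 * uu (w kl) \<le> 16 * \<delta>\<^sup>2 * (e / (\<eta> / 2)\<^sup>2)"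
          using calculation(1) by (intro mult_left_mono) auto
        moreover have "16 * \<delta>\<^sup>2 * (e / (\<eta> / 2)\<^sup>2) = 64 * \<delta>\<^sup>2 / \<eta>\<^sup>2 * e" by (simp add: power_divide)
        ultimately show ?thesis using order_trans ennreal_leI by metis
      qed
      have "K \<subseteq> (\<Union>kl\<in>I. Q kl)"
      proof
        fix \<zeta> assume z: "\<zeta> \<in> K"
        then have T: "cmod (fst \<zeta>) = 1" "cmod (snd \<zeta>) = 1" by (auto simp: K_def torus2_def)
        obtain k where k: "k < N" "cmod (fst \<zeta> - rou N k) \<le> \<delta>" unfolding \<delta>_def by (rule circle_grid[OF T(1) N])
        obtain l where l: "l < N" "cmod (snd \<zeta> - rou N l) \<le> \<delta>" unfolding \<delta>_def by (rule circle_grid[OF T(2) N])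
        have "\<zeta> \<in> Q (k, l)" using k l by (simp add: Q_def mem_Times_iff dist_norm norm_minus_commute)
        then show "\<zeta> \<in> (\<Union>kl\<in>I. Q kl)" using z k l by (intro UN_I[of "(k, l)"]) (auto simp: I_def)
      qed
      then have "emeasure \<sigma> K \<le> emeasure \<sigma> (\<Union>kl\<in>I. Q kl)"
        by (rule emeasure_mono) (auto simp: sets_sigma Q_def I intro!: sets.finite_UN borel_closed closed_Times)
      also have "\<dots> \<le> (\<Sum>kl\<in>I. emeasure \<sigma> (Q kl))"
        by (rule emeasure_subadditive_finite) (auto simp: I sets_sigma Q_def intro!: borel_closed closed_Times)
      also have "\<dots> \<le> (\<Sum>kl\<in>I. ennreal (64 * \<delta>\<^sup>2 / \<eta>\<^sup>2 * e))" by (rule sum_mono) (rule QK)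
      also have "\<dots> = ennreal (real (card I) * (64 * \<delta>\<^sup>2 / \<eta>\<^sup>2 * e))"
        using e by (subst sum_ennreal) auto
      also have "\<dots> \<le> ennreal (real (N * N) * (64 * \<delta>\<^sup>2 / \<eta>\<^sup>2 * e))"
        using I(2) e by (intro ennreal_leI mult_right_mono) (auto simp del: of_nat_mult)
      also have "real (N * N) * (64 * \<delta>\<^sup>2 / \<eta>\<^sup>2 * e) = 256 * pi\<^sup>2 / \<eta>\<^sup>2 * e"
        using N by (simp add: \<delta>_def power2_eq_square)
      finally show ?thesis .
    qed
    have "emeasure \<sigma> K \<le> 0"
    proof (rule ennreal_le_epsilon)
      fix e :: real assume e: "e > 0"
      define c0 where "c0 = 256 * pi\<^sup>2 / \<eta>\<^sup>2"
      have c: "c0 > 0" using eta by (simp add: c0_def)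
      have "emeasure \<sigma> K \<le> ennreal (c0 * (e / c0))"
        unfolding c0_def[symmetric] using bound[OF divide_pos_pos[OF e c]] by (simp only: c0_def)
      then show "emeasure \<sigma> K \<le> 0 + ennreal e" using c by simp
    qed
    then show ?thesis by (simp add: K_def)
  qed
  have "AE \<zeta> in \<sigma>. \<forall>m. \<not> 1 / real (Suc m) \<le> cmod (dd \<zeta>)"
    unfolding AE_all_countable
  proof
    fix m
    have "closed {\<zeta> \<in> torus2. 1 / real (Suc m) \<le> cmod (dd \<zeta>)}"
    proof -
      have "closed {\<zeta>. 1 / real (Suc m) \<le> cmod (dd \<zeta>)}"
        by (intro closed_Collect_le continuous_intros dd_continuous)
      from closed_Int[OF torus2_closed this] show ?thesis by (simp add: Int_def)
    qed
    then have "{\<zeta> \<in> torus2. 1 / real (Suc m) \<le> cmod (dd \<zeta>)} \<in> sets \<sigma>"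
      unfolding sets_sigma by (rule borel_closed)
    moreover have "emeasure \<sigma> {\<zeta> \<in> torus2. 1 / real (Suc m) \<le> cmod (dd \<zeta>)} = 0" by (rule zero) simp
    ultimately have "AE \<zeta> in \<sigma>. \<zeta> \<notin> {\<zeta> \<in> torus2. 1 / real (Suc m) \<le> cmod (dd \<zeta>)}"
      by (intro AE_not_in null_setsI)
    with AE_torus show "AE \<zeta> in \<sigma>. \<not> 1 / real (Suc m) \<le> cmod (dd \<zeta>)" by eventually_elim simp
  qed
  then show ?thesis
  proof eventually_elim
    case (elim \<zeta>)
    show ?case
    proof (rule ccontr)
      assume "dd \<zeta> \<noteq> 0"
      then obtain m where "inverse (real (Suc m)) < cmod (dd \<zeta>)" using reals_Archimedean[of "cmod (dd \<zeta>)"] by auto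
      then show False using elim by (metis inverse_eq_divide less_imp_le)
    qed
  qed
qed

end

lemma norm_h1fun_le:
  assumes z: "cmod z < 1"
  shows "cmod (h1fun a z) \<le> norm a / sqrt (1 - (cmod z)\<^sup>2)"
proof -
  have b: "(z, 0) \<in> bidisk" using z by (simp add: bidisk_def)
  have "cmod (h1fun a z) \<le> norm (emb a) * norm (szv (z, 0))"
    using h2fun_le[OF b, of "emb a"] by (simp add: h2fun_emb[OF b])
  also have "norm (szv (z, 0)) = sqrt (1 / (1 - (cmod z)\<^sup>2))"
    using norm_szv_sq[OF b] by (metis (no_types, lifting) fst_conv mult.right_neutral norm_ge_zero norm_zero power_zero_numeral diff_zero real_sqrt_unique snd_conv)
  finally show ?thesis by (simp add: norm_emb real_sqrt_divide)
qed

lemma poly_bounded_disk: obtains L where "L \<ge> 0" "\<And>z. cmod z \<le> 1 \<Longrightarrow> cmod (poly q z) \<le> L"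
proof -
  have "compact ((\<lambda>z. poly q z) ` cball 0 1)" by (intro compact_continuous_image continuous_intros compact_cball)
  then have "bounded ((\<lambda>z. poly q z) ` cball 0 1)" by (rule compact_imp_bounded)
  then obtain L where "\<forall>x\<in>(\<lambda>z. poly q z) ` cball 0 1. cmod x \<le> L" by (auto simp: bounded_iff)
  then have L: "cmod (poly q z) \<le> L" if "cmod z \<le> 1" for z using that by auto
  have "0 \<le> L" using order_trans[OF norm_ge_zero L[of 0]] by simp
  then show ?thesis using L by (rule that)
qed

section \<open>Linear mass bounds for the marginals, and bounds at the remaining points\<close>

context rif_clark
begin

lemma bb_nz_disk: "cmod z < 1 \<Longrightarrow> bb z \<noteq> 0"
  using dd_nz[of "(z, 0)"] by (simp add: dd_eq bidisk_def)

lemma uu_le: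
  assumes w: "w \<in> bidisk" and m: "m > 0" "m \<le> cmod (\<alpha> - phi w)"
  shows "uu w \<le> 1 / m\<^sup>2"
  unfolding uu_def using m phi_le_1[OF w] by (intro frac_le power_mono) (auto simp: abs_square_le_1)

text \<open>The map \<open>W\<close> puts \<open>v\<close> in one coordinate and \<open>0\<close> in
  the other, whose Poisson factor is then \<open>1\<close>. A bound \<open>B\<close> for
  \<open>uu\<close> on the radius gives mass at most \<open>4 * B * s\<close> for disks of radius
  \<open>s\<close> up to \<open>1\<close>; for larger \<open>s\<close> the total mass is
  enough.\<close>

lemma frostman_radial:
  assumes pr: "pr \<in> borel_measurable borel"
    and W: "\<And>v. cmod v < 1 \<Longrightarrow> W v \<in> bidisk"
    and P: "\<And>v \<zeta>. cmod v < 1 \<Longrightarrow> \<zeta> \<in> torus2 \<Longrightarrow> poisson2 (W v) \<zeta> = pois v (pr \<zeta>)"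
    and pr1: "\<And>\<zeta>. \<zeta> \<in> torus2 \<Longrightarrow> cmod (pr \<zeta>) = 1"
    and x: "cmod x = 1" and B: "B \<ge> 0" "\<And>r. 0 \<le> r \<Longrightarrow> r < 1 \<Longrightarrow> uu (W (of_real r * x)) \<le> B"
  shows "\<exists>M. x \<in> frostman (distr \<sigma> borel pr) M"
proof (rule exI[of _ "max (4 * B) (uu (0, 0))"], unfold frostman_def, intro CollectI allI impI)
  fix s :: real assume s: "s > 0"
  have S: "pr -` cball x s \<in> sets borel" using measurable_sets[OF pr, of "cball x s"] by simp
  have em: "emeasure (distr \<sigma> borel pr) (cball x s) = emeasure \<sigma> (pr -` cball x s)"
    by (subst emeasure_distr) (use pr in \<open>simp_all add: measurable_def sets_sigma\<close>)
  show "emeasure (distr \<sigma> borel pr) (cball x s) \<le> ennreal (max (4 * B) (uu (0, 0)) * s)"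
  proof (cases "s \<le> 1")
    case True
    define v where "v = of_real (1 - s) * x"
    have v: "cmod v < 1" using x s True by (simp add: v_def norm_mult del: of_real_diff)
    have "emeasure \<sigma> (pr -` cball x s) \<le> ennreal (uu (W v) / (1 / (4 * s)))"
    proof (rule box_bound[OF W[OF v] S])
      fix \<zeta> assume z: "\<zeta> \<in> pr -` cball x s" "\<zeta> \<in> torus2"
      have "1 / (4 * s) \<le> pois v (pr \<zeta>)" unfolding v_def
        using z s True pr1[OF z(2)] by (intro pois_lower x) (auto simp: dist_norm norm_minus_commute)
      then show "1 / (4 * s) \<le> poisson2 (W v) \<zeta>" by (simp only: P[OF v z(2)])
    qed (use s in simp)
    also have "uu (W v) / (1 / (4 * s)) = 4 * uu (W v) * s" by simp
    also have "ennreal \<dots> \<le> ennreal (max (4 * B) (uu (0, 0)) * s)"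
    proof -
      have "uu (W v) \<le> B" unfolding v_def using s True by (intro B(2)) auto
      then have "4 * uu (W v) \<le> max (4 * B) (uu (0, 0))" by simp
      then show ?thesis using s by (intro ennreal_leI mult_right_mono) auto
    qed
    finally show ?thesis by (simp add: em)
  next
    case False
    have "emeasure \<sigma> (pr -` cball x s) \<le> emeasure \<sigma> UNIV" by (rule emeasure_mono) (auto simp: sets_sigma)
    also have "\<dots> = ennreal (uu (0, 0) * 1)" by (simp add: total_mass)
    also have "\<dots> \<le> ennreal (max (4 * B) (uu (0, 0)) * s)"
    proof -
      have "0 \<le> max (4 * B) (uu (0, 0))" using B(1) by simp
      then have "uu (0, 0) * 1 \<le> max (4 * B) (uu (0, 0)) * s" using False by (intro mult_mono) auto
      then show ?thesis by (rule ennreal_leI)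
    qed
    finally show ?thesis by (simp add: em)
  qed
qed

lemma fst_borel: "(fst :: complex \<times> complex \<Rightarrow> complex) \<in> borel_measurable borel"
  and snd_borel: "(snd :: complex \<times> complex \<Rightarrow> complex) \<in> borel_measurable borel"
  by (intro borel_measurable_continuous_onI continuous_intros)+

lemma radial_lower_bound:
  fixes f :: "real \<Rightarrow> complex"
  assumes "continuous_on {0..1} f" "\<And>r. 0 \<le> r \<Longrightarrow> r \<le> 1 \<Longrightarrow> f r \<noteq> 0"
  obtains m where "m > 0" "\<And>r. 0 \<le> r \<Longrightarrow> r \<le> 1 \<Longrightarrow> m \<le> cmod (f r)"
proof -
  have "continuous_on {0..1} (\<lambda>r. cmod (f r))" by (rule continuous_on_norm[OF assms(1)])
  then have "\<exists>r0\<in>{0..1}. \<forall>r\<in>{0..1}. cmod (f r0) \<le> cmod (f r)"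
    by (intro continuous_attains_inf) auto
  then obtain r0 where r0: "r0 \<in> {0..1}" "\<And>r. r \<in> {0..1} \<Longrightarrow> cmod (f r0) \<le> cmod (f r)" by blast
  show ?thesis by (rule that[of "cmod (f r0)"]) (use r0 assms(2) in auto)
qed

text \<open>On the slice \<open>z2 = 0\<close> one has \<open>\<alpha> - phi = bb / P0\<close>, and
  \<open>bb\<close> has no zero on the closed radius ending at \<open>x\<close>, so compactness
  keeps \<open>phi\<close> away from \<open>\<alpha>\<close> there.\<close>

lemma frostman_fst:
  assumes x: "cmod x = 1" and bx: "bb x \<noteq> 0"
  shows "\<exists>M. x \<in> frostman (distr \<sigma> borel fst) M"
proof -
  have cx: "cmod (of_real r * x) = r" if "0 \<le> r" for r using x that by (simp add: norm_mult)
  have P0: "poly P0 (of_real r * x) \<noteq> 0" if "0 \<le> r" "r \<le> 1" for r using P0_nz[of "of_real r * x"] cx that by simp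
  obtain m where m: "m > 0" "\<And>r. 0 \<le> r \<Longrightarrow> r \<le> 1 \<Longrightarrow> m \<le> cmod (bb (of_real r * x) / poly P0 (of_real r * x))"
  proof (rule radial_lower_bound[of "\<lambda>r. bb (of_real r * x) / poly P0 (of_real r * x)"])
    show "continuous_on {0..1} (\<lambda>r. bb (complex_of_real r * x) / poly P0 (complex_of_real r * x))"
      unfolding bb_def using P0 by (intro continuous_intros) auto
    fix r :: real assume r: "0 \<le> r" "r \<le> 1"
    have "bb (of_real r * x) \<noteq> 0"
    proof (cases "r = 1")
      case False then show ?thesis using bb_nz_disk[of "of_real r * x"] cx r by simp
    qed (use bx in simp)
    then show "bb (of_real r * x) / poly P0 (of_real r * x) \<noteq> 0" using P0 r by simp
  qed blast
  show ?thesis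
  proof (rule frostman_radial[OF fst_borel, of "\<lambda>v. (v, 0)" x "1 / m\<^sup>2"])
    fix r :: real assume r: "0 \<le> r" "r < 1"
    have b: "(of_real r * x, 0) \<in> bidisk" using cx r by (simp add: bidisk_def)
    have "\<alpha> - phi (of_real r * x, 0) = bb (of_real r * x) / poly P0 (of_real r * x)"
      using alpha_minus_phi[OF pe_nz[OF b]] by (simp add: dd_eq pe_eq)
    then show "uu (of_real r * x, 0) \<le> 1 / m\<^sup>2" using m(2)[of r] r by (intro uu_le[OF b m(1)]) simp
  qed (use x in \<open>auto simp: bidisk_def poisson2_pois torus2_def pois_def\<close>)
qed

text \<open>If \<open>p\<close> does not vanish at \<open>(0, y)\<close>, the argument is
  compactness on the radius. If it does, so does \<open>p~\<close>; both are affine in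
  \<open>z2\<close> on the slice \<open>z1 = 0\<close> and share the root \<open>y\<close>, so
  \<open>phi\<close> is constant there, with a value in the open disk.\<close>

lemma frostman_snd:
  assumes y: "cmod y = 1" and yy: "pe (0, y) = 0 \<or> dd (0, y) \<noteq> 0"
  shows "\<exists>M. y \<in> frostman (distr \<sigma> borel snd) M"
proof -
  have cy: "cmod (of_real r * y) = r" if "0 \<le> r" for r using y that by (simp add: norm_mult)
  have b: "(0, of_real r * y) \<in> bidisk" if "0 \<le> r" "r < 1" for r using cy that by (simp add: bidisk_def)
  have "\<exists>m>0. \<forall>r. 0 \<le> r \<longrightarrow> r < 1 \<longrightarrow> m \<le> cmod (\<alpha> - phi (0, of_real r * y))"
  proof (cases "pe (0, y) = 0")
    case False
    have nz: "pe (0, of_real r * y) \<noteq> 0 \<and> dd (0, of_real r * y) \<noteq> 0" if "0 \<le> r" "r \<le> 1" for r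
    proof (cases "r = 1")
      case True then show ?thesis using False yy by simp
    next
      case F: False then show ?thesis using pe_nz[OF b[of r]] dd_nz[OF b[of r]] that by simp
    qed
    obtain m where m: "m > 0" "\<And>r. 0 \<le> r \<Longrightarrow> r \<le> 1 \<Longrightarrow> m \<le> cmod (dd (0, of_real r * y) / pe (0, of_real r * y))"
    proof (rule radial_lower_bound[of "\<lambda>r. dd (0, of_real r * y) / pe (0, of_real r * y)"])
      show "continuous_on {0..1} (\<lambda>r. dd (0, complex_of_real r * y) / pe (0, complex_of_real r * y))"
        using nz by (intro continuous_intros continuous_on_compose2[OF dd_continuous[of UNIV]]
          continuous_on_compose2[OF pe_continuous[of UNIV]]) auto
    qed (use nz in auto)
    show ?thesis
    proof (intro exI[of _ m] conjI allI impI m(1))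
      fix r :: real assume r: "0 \<le> r" "r < 1"
      show "m \<le> cmod (\<alpha> - phi (0, of_real r * y))"
        using m(2)[of r] r alpha_minus_phi[OF pe_nz[OF b[OF r]]] by simp
    qed
  next
    case True
    have "qe (0, y) = 0" using qe_le_pe[of "(0, y)"] y True by simp
    then have R: "poly R1 0 = - y * poly R0 0" by (simp add: qe_eq eq_neg_iff_add_eq_0)
    have P: "poly P0 0 = - y * poly P1 0" using True by (simp add: pe_eq eq_neg_iff_add_eq_0)
    have const: "phi (0, of_real r * y) = phi (0, 0)" if "0 \<le> r" "r < 1" for r
    proof -
      have "poly P1 0 \<noteq> 0" using P P0_nz[of 0] by auto
      moreover have "of_real r * y - y \<noteq> 0" "y \<noteq> 0"
        using y that by (auto simp: algebra_simps)
      moreover have "qe (0, of_real r * y) = (of_real r * y - y) * poly R0 0"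
        "pe (0, of_real r * y) = (of_real r * y - y) * poly P1 0"
        by (simp_all add: qe_eq pe_eq R P algebra_simps)
      ultimately show ?thesis by (simp add: phi_def qe_eq pe_eq R P)
    qed
    show ?thesis
      by (rule exI[of _ "cmod (\<alpha> - phi (0, 0))"]) (use alpha_phi_nz(3)[of "(0, 0)"] const in \<open>auto simp: bidisk_def\<close>)
  qed
  then obtain m where m: "m > 0" "\<And>r. 0 \<le> r \<Longrightarrow> r < 1 \<Longrightarrow> m \<le> cmod (\<alpha> - phi (0, of_real r * y))" by blast
  show ?thesis
  proof (rule frostman_radial[OF snd_borel, of "\<lambda>v. (0, v)" y "1 / m\<^sup>2"])
    show "uu (0, of_real r * y) \<le> 1 / m\<^sup>2" if "0 \<le> r" "r < 1" for r
      using that by (intro uu_le b m)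
  qed (use y in \<open>auto simp: bidisk_def poisson2_pois torus2_def pois_def\<close>)
qed

text \<open>At the atoms of the two marginals the one-variable functions in the decomposition of an
  element of the model space are bounded on Stolz regions, by the growth estimate for \<open>K\<^sub>\<phi>\<close>.\<close>

definition decomp :: "hardy \<Rightarrow> nat ell2 \<Rightarrow> (nat \<Rightarrow> nat ell2) \<Rightarrow> bool" where
  "decomp x a b \<longleftrightarrow> norm a \<le> norm (pm x) \<and> (\<forall>i. norm (b i) \<le> norm (pm x)) \<and>
     (\<forall>z\<in>bidisk. pe z * h2fun x z = h1fun a (fst z) + (\<Sum>i<n. fst z ^ i * h1fun (b i) (snd z)))"

lemma decomp_exists: "x \<in> Kc \<Longrightarrow> \<exists>a b. decomp x a b"
  by (rule model_decomposition[of x]) (auto simp: decomp_def)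

definition "kp = (\<Sum>s\<in>pset. cmod (pcf s))"

lemma kp_nonneg: "kp \<ge> 0"
  by (simp add: kp_def sum_nonneg)

lemma decomp_norms: "decomp x a b \<Longrightarrow> norm a \<le> kp * norm x" "decomp x a b \<Longrightarrow> norm (b i) \<le> kp * norm x"
  using pm_norm_le[of x] unfolding decomp_def kp_def by (meson order_trans)+

lemma one_minus_phi_le:
  assumes "w \<in> bidisk" "cmod (\<alpha> - phi w) \<le> e"
  shows "1 - (cmod (phi w))\<^sup>2 \<le> 2 * e"
proof -
  have "1 - cmod (phi w) \<le> e" using norm_triangle_ineq2[of \<alpha> "phi w"] alpha assms(2) by simp
  then have "(1 - cmod (phi w)) * (1 + cmod (phi w)) \<le> e * 2"
    using phi_le_1[OF assms(1)] by (intro mult_mono) (auto intro: order_trans[OF norm_ge_zero assms(2)])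
  then show ?thesis by (simp add: power2_eq_square algebra_simps)
qed

lemma one_minus_sq_ge: "0 \<le> r \<Longrightarrow> r \<le> 1 \<Longrightarrow> 1 - r \<le> 1 - r\<^sup>2" for r :: real
  by (simp add: power2_eq_square mult_left_le)

text \<open>Near a zero \<open>x\<close> of \<open>bb\<close> the slice
  \<open>\<alpha> - phi (z, 0) = bb z / P0 z\<close> is of order \<open>|z - x|\<close>, hence of
  order \<open>1 - |z|\<close> in a Stolz region. So \<open>1 - |phi|^2\<close> cancels the
  denominator in the growth estimate and \<open>f (z, 0)\<close> stays bounded; \<open>a z\<close>
  differs from \<open>p f\<close> there only by the values \<open>b_i(0)\<close>.\<close>

lemma decomp_fst_bound:
  assumes x: "cmod x = 1" "bb x = 0" and c: "c > 0"
  shows "\<exists>C. \<forall>y a b. y \<in> Kc \<longrightarrow> decomp y a b \<longrightarrow> (\<forall>z\<in>stolz c x. cmod (h1fun a z) \<le> C * norm y)"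
proof -
  define q where "q = smult \<alpha> P0 - R1"
  have q: "poly q z = bb z" for z by (simp add: q_def bb_def)
  obtain q' where q': "q = [:- x, 1:] * q'" using x(2) q[of x] by (metis poly_eq_0_iff_dvd dvdE)
  obtain L where L: "L \<ge> 0" "\<And>z. cmod z \<le> 1 \<Longrightarrow> cmod (poly q' z) \<le> L" using poly_bounded_disk[of q'] by blast
  obtain A where A: "A \<ge> 0" "\<And>z. cmod z \<le> 1 \<Longrightarrow> cmod (poly P0 z) \<le> A" using poly_bounded_disk[of P0] by blast
  obtain m where m: "m > 0" "\<And>z. cmod z \<le> 1 \<Longrightarrow> m \<le> cmod (poly P0 z)" using P0_lower by blast
  define G where "G = 2 * (L * c / m)"
  have G: "G \<ge> 0" using L m c by (simp add: G_def)
  show ?thesis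
  proof (intro exI[of _ "A * sqrt G + real n * kp"] allI impI ballI)
    fix y a b z assume y: "y \<in> Kc" and d: "decomp y a b" and z: "z \<in> stolz c x"
    have z1: "cmod z < 1" and zx: "cmod (x - z) < c * (1 - cmod z)" using z by (auto simp: stolz_def)
    have w: "(z, 0) \<in> bidisk" using z1 by (simp add: bidisk_def)
    have "\<alpha> - phi (z, 0) = bb z / poly P0 z" using alpha_minus_phi[OF pe_nz[OF w]] by (simp add: dd_eq pe_eq)
    also have "bb z = (z - x) * poly q' z" by (simp add: q[symmetric] q' algebra_simps)
    finally have "cmod (\<alpha> - phi (z, 0)) = cmod (x - z) * cmod (poly q' z) / cmod (poly P0 z)"
      by (simp add: norm_divide norm_mult norm_minus_commute)
    also have "\<dots> \<le> (c * (1 - cmod z)) * L / m"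
      using zx z1 L m c by (intro frac_le mult_mono) auto
    also have "\<dots> = L * c / m * (1 - cmod z)" by simp
    finally have "1 - (cmod (phi (z, 0)))\<^sup>2 \<le> 2 * (L * c / m * (1 - cmod z))" by (rule one_minus_phi_le[OF w])
    also have "\<dots> = G * (1 - cmod z)" by (simp add: G_def)
    also have "\<dots> \<le> G * (1 - (cmod z)\<^sup>2)" using G z1 by (intro mult_left_mono one_minus_sq_ge) auto
    finally have num: "1 - (cmod (phi (z, 0)))\<^sup>2 \<le> G * (1 - (cmod z)\<^sup>2)" .
    have pos: "1 - (cmod z)\<^sup>2 > 0" using z1 by (simp add: abs_square_less_1)
    have "(cmod (h2fun y (z, 0)))\<^sup>2 \<le> (norm y)\<^sup>2 * ((1 - (cmod (phi (z, 0)))\<^sup>2) / (1 - (cmod z)\<^sup>2))"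
      using h2fun_Kc_le[OF y w] by simp
    also have "\<dots> \<le> (norm y)\<^sup>2 * G" using num pos by (intro mult_left_mono) (auto simp: pos_divide_le_eq)
    finally have "(cmod (h2fun y (z, 0)))\<^sup>2 \<le> (norm y * sqrt G)\<^sup>2" using G by (simp add: power_mult_distrib)
    then have h: "cmod (h2fun y (z, 0)) \<le> norm y * sqrt G" by (rule power2_le_imp_le) (use G in simp)
    have "h1fun a z = poly P0 z * h2fun y (z, 0) - (\<Sum>i<n. z ^ i * h1fun (b i) 0)"
    proof -
      have "pe (z, 0) * h2fun y (z, 0) = h1fun a z + (\<Sum>i<n. z ^ i * h1fun (b i) 0)"
        using bspec[OF conjunct2[OF conjunct2[OF d[unfolded decomp_def]]] w] by (simp only: fst_conv snd_conv)
      then show ?thesis by (simp add: pe_eq algebra_simps)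
    qed
    then have "cmod (h1fun a z) \<le> cmod (poly P0 z * h2fun y (z, 0)) + cmod (\<Sum>i<n. z ^ i * h1fun (b i) 0)"
      by (metis norm_triangle_ineq4)
    also have "\<dots> \<le> A * (norm y * sqrt G) + (\<Sum>i<n. kp * norm y)"
    proof (rule add_mono)
      show "cmod (poly P0 z * h2fun y (z, 0)) \<le> A * (norm y * sqrt G)"
        unfolding norm_mult using A h z1 by (intro mult_mono) auto
      show "cmod (\<Sum>i<n. z ^ i * h1fun (b i) 0) \<le> (\<Sum>i<n. kp * norm y)"
      proof (rule sum_norm_le)
        fix i
        have "cmod (z ^ i * h1fun (b i) 0) \<le> 1 * norm (b i)"
          unfolding norm_mult norm_power using norm_h1fun_le[of 0 "b i"] z1
          by (intro mult_mono power_le_one) auto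
        also have "\<dots> \<le> kp * norm y" using decomp_norms(2)[OF d] by simp
        finally show "cmod (z ^ i * h1fun (b i) 0) \<le> kp * norm y" .
      qed
    qed
    finally show "cmod (h1fun a z) \<le> (A * sqrt G + real n * kp) * norm y" by (simp add: algebra_simps)
  qed
qed

text \<open>The quotient \<open>B = \<alpha> * bt / bb\<close> maps the disk to the closed disk,
  because \<open>dd\<close> has no zero in the bidisk. A zero of \<open>dd\<close> at
  \<open>(0, y)\<close> makes \<open>|B 0| = 1\<close>, so \<open>B\<close> is constant by the
  maximum principle, and the zero spreads over the disk at height \<open>y\<close>.\<close>

lemma dd_vanish:
  assumes y: "cmod y = 1" "dd (0, y) = 0" and z: "cmod z < 1"
  shows "dd (z, y) = 0"
proof -
  define B where "B z = \<alpha> * bt z / bb z" for z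
  have le: "cmod (B z) \<le> 1" if "cmod z < 1" for z
  proof (rule ccontr)
    assume "\<not> cmod (B z) \<le> 1"
    then have "cmod (bb z) < cmod (bt z)" using bb_nz_disk[OF that] by (simp add: B_def norm_divide norm_mult alpha pos_less_divide_eq not_le)
    moreover from this have nz: "bt z \<noteq> 0" by auto
    moreover have a0: "\<alpha> \<noteq> 0" using alpha by auto
    ultimately have "(z, bb z / (\<alpha> * bt z)) \<in> bidisk" using that by (simp add: bidisk_def norm_divide norm_mult alpha)
    moreover have "dd (z, bb z / (\<alpha> * bt z)) = 0" using nz a0 by (simp add: dd_eq)
    ultimately show False using dd_nz by blast
  qed
  have By: "y * B z = 1 \<longleftrightarrow> dd (z, y) = 0" if "cmod z < 1" for z
    using bb_nz_disk[OF that] by (auto simp: B_def dd_eq field_simps)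
  have B0: "y * B 0 = 1" using By[of 0] y by simp
  then have n0: "cmod (B 0) = 1" using y(1) by (metis mult_1 norm_mult norm_one)
  have hol: "B holomorphic_on ball 0 1" unfolding B_def bt_def bb_def
    using bb_nz_disk by (intro holomorphic_intros) (auto simp: bb_def)
  have "B constant_on ball 0 1"
    by (rule maximum_modulus_principle[OF hol, of "ball 0 1" 0]) (use le n0 in auto)
  then have "B z = B 0" using z unfolding constant_on_def by (metis dist_0_norm mem_ball norm_zero zero_less_one)
  then show ?thesis using By[OF z] B0 by simp
qed

text \<open>By \<open>dd_vanish\<close> the difference \<open>\<alpha> - phi (u, z)\<close> carries
  a factor \<open>y0 - z\<close> for every \<open>u\<close> in the disk. On the circle
  \<open>|u| = \<rho>\<close> the growth estimate therefore bounds the polynomial \<open>V u\<close>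
  with coefficients \<open>b_i(z)\<close>, and a discrete Fourier transform bounds each
  coefficient.\<close>

lemma decomp_snd_bound:
  assumes y0: "cmod y0 = 1" "dd (0, y0) = 0" "pe (0, y0) \<noteq> 0" and c: "c > 0"
  shows "\<exists>C e. e > 0 \<and> (\<forall>y a b i z. y \<in> Kc \<longrightarrow> decomp y a b \<longrightarrow> i < n \<longrightarrow> z \<in> stolz c y0 \<longrightarrow> cmod (z - y0) < e
     \<longrightarrow> cmod (h1fun (b i) z) \<le> C * norm y)"
proof -
  define m where "m = cmod (pe (0, y0)) / 2"
  have m: "m > 0" using y0 by (simp add: m_def)
  have "isCont pe (0, y0)" using pe_continuous[of UNIV] continuous_on_eq_continuous_at open_UNIV by blast
  then obtain e where e: "e > 0" "\<And>w. dist w (0, y0) < e \<Longrightarrow> dist (pe w) (pe (0, y0)) < m"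
    using m unfolding continuous_at_eps_delta by blast
  have pem: "m \<le> cmod (pe w)" if "dist w (0, y0) < e" for w
  proof -
    have "cmod (pe (0, y0)) - cmod (pe w) \<le> dist (pe w) (pe (0, y0))"
      using norm_triangle_ineq2[of "pe (0, y0)" "pe w"] by (simp add: dist_norm norm_minus_commute)
    then show ?thesis using e(2)[OF that] by (simp add: m_def)
  qed
  \<comment> \<open>The third of \<open>e\<close>, with another third for \<open>|z - y0|\<close>,
    keeps \<open>(u, z)\<close> where \<open>|pe|\<close> is at least \<open>m\<close>; the
    \<open>1 / 2\<close> keeps \<open>u\<close> away from the circle, so that \<open>a u\<close> is
    controlled by the norm.\<close>
  define \<rho> where "\<rho> = min (e / 3) (1 / 2)"
  have \<rho>: "0 < \<rho>" "\<rho> \<le> 1 / 2" "\<rho> \<le> e / 3" using e(1) by (auto simp: \<rho>_def)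
  obtain T where T: "T \<ge> 0" "\<And>z. cmod z \<le> 1 \<Longrightarrow> cmod (poly (smult (cnj \<alpha>) R0 - P1) z) \<le> T"
    using poly_bounded_disk[of "smult (cnj \<alpha>) R0 - P1"] by blast
  have T': "cmod (bt z) \<le> T" if "cmod z \<le> 1" for z using T(2)[OF that] by (simp add: bt_def)
  obtain A0 where A0: "A0 \<ge> 0" "\<And>z. cmod z \<le> 1 \<Longrightarrow> cmod (poly P0 z) \<le> A0" using poly_bounded_disk[of P0] by blast
  have peA: "cmod (pe w) \<le> 2 * A0" if "w \<in> bidisk" for w
  proof -
    have w: "cmod (fst w) \<le> 1" "cmod (snd w) \<le> 1" using that by (auto simp: bidisk_def)
    have "cmod (pe w) \<le> cmod (poly P0 (fst w)) + cmod (snd w) * cmod (poly P1 (fst w))"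
      unfolding pe_eq by (metis norm_mult norm_triangle_ineq)
    also have "\<dots> \<le> A0 + 1 * A0" using A0 w P1_le_P0[OF w(1)]
      by (intro add_mono mult_mono) (auto intro: order_trans)
    finally show ?thesis by simp
  qed
  define G where "G = 2 * (T * c / m) / (1 - \<rho>\<^sup>2)"
  have r2: "1 - \<rho>\<^sup>2 > 0" using \<rho> by (simp add: abs_square_less_1)
  have G: "G \<ge> 0" using T m c r2 by (simp add: G_def)
  define C1 where "C1 = 2 * A0 * sqrt G + kp / sqrt (1 - \<rho>\<^sup>2)"
  have C1: "C1 \<ge> 0" using A0 G kp_nonneg r2 by (simp add: C1_def)
  show ?thesis
  proof (rule exI[of _ "C1 / \<rho> ^ n"], rule exI[of _ "e / 3"], intro conjI allI impI)
    show "e / 3 > 0" using e by simp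
    fix y a b i z
    assume y: "y \<in> Kc" and d: "decomp y a b" and i: "i < n" and z: "z \<in> stolz c y0" and near: "cmod (z - y0) < e / 3"
    have z1: "cmod z < 1" and zy: "cmod (y0 - z) < c * (1 - cmod z)" using z by (auto simp: stolz_def)
    have zp: "1 - (cmod z)\<^sup>2 > 0" using z1 by (simp add: abs_square_less_1)
    define V where "V u = (\<Sum>i<n. u ^ i * h1fun (b i) z)" for u
    have V: "cmod (V u) \<le> C1 * norm y" if u: "cmod u = \<rho>" for u
    proof -
      have u1: "cmod u < 1" using u \<rho> by simp
      have w: "(u, z) \<in> bidisk" using u1 z1 by (simp add: bidisk_def)
      have "dist (u, z) (0, y0) \<le> dist u 0 + dist z y0"
        unfolding dist_prod_def by (simp add: sqrt_sum_squares_le_sum)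
      also have "\<dots> < e" using u \<rho>(3) near e(1) by (simp add: dist_norm)
      finally have pl: "m \<le> cmod (pe (u, z))" by (rule pem)
      have "dd (u, z) = \<alpha> * (y0 - z) * bt u"
        using dd_vanish[OF y0(1,2) u1] by (simp add: dd_eq algebra_simps)
      then have "cmod (\<alpha> - phi (u, z)) = cmod (y0 - z) * cmod (bt u) / cmod (pe (u, z))"
        using alpha_minus_phi[OF pe_nz[OF w]] by (simp add: norm_divide norm_mult alpha)
      also have "\<dots> \<le> (c * (1 - cmod z)) * T / m"
        using zy z1 T(1) T'[of u] u1 m c pl by (intro frac_le mult_mono) auto
      also have "\<dots> = T * c / m * (1 - cmod z)" by simp
      finally have "1 - (cmod (phi (u, z)))\<^sup>2 \<le> 2 * (T * c / m * (1 - cmod z))" by (rule one_minus_phi_le[OF w])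
      also have "\<dots> = 2 * (T * c / m) * (1 - cmod z)" by simp
      also have "\<dots> \<le> 2 * (T * c / m) * (1 - (cmod z)\<^sup>2)"
        using T m c z1 by (intro mult_left_mono one_minus_sq_ge) auto
      finally have num: "1 - (cmod (phi (u, z)))\<^sup>2 \<le> 2 * (T * c / m) * (1 - (cmod z)\<^sup>2)" .
      have "(cmod (h2fun y (u, z)))\<^sup>2 \<le> (norm y)\<^sup>2 * ((1 - (cmod (phi (u, z)))\<^sup>2) / ((1 - \<rho>\<^sup>2) * (1 - (cmod z)\<^sup>2)))"
        using h2fun_Kc_le[OF y w] by (simp add: u)
      also have "\<dots> \<le> (norm y)\<^sup>2 * G"
      proof (intro mult_left_mono)
        have "(1 - (cmod (phi (u, z)))\<^sup>2) / ((1 - \<rho>\<^sup>2) * (1 - (cmod z)\<^sup>2))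
            \<le> 2 * (T * c / m) * (1 - (cmod z)\<^sup>2) / ((1 - \<rho>\<^sup>2) * (1 - (cmod z)\<^sup>2))"
          using num r2 zp by (intro divide_right_mono) auto
        also have "\<dots> = G" using zp by (simp add: G_def)
        finally show "(1 - (cmod (phi (u, z)))\<^sup>2) / ((1 - \<rho>\<^sup>2) * (1 - (cmod z)\<^sup>2)) \<le> G" .
      qed simp
      finally have "(cmod (h2fun y (u, z)))\<^sup>2 \<le> (norm y * sqrt G)\<^sup>2" using G by (simp add: power_mult_distrib)
      then have h: "cmod (h2fun y (u, z)) \<le> norm y * sqrt G" by (rule power2_le_imp_le) (use G in simp)
      have "V u = pe (u, z) * h2fun y (u, z) - h1fun a u"
        using bspec[OF conjunct2[OF conjunct2[OF d[unfolded decomp_def]]] w] by (simp add: V_def algebra_simps)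
      then have "cmod (V u) \<le> cmod (pe (u, z) * h2fun y (u, z)) + cmod (h1fun a u)" by (metis norm_triangle_ineq4)
      also have "\<dots> \<le> 2 * A0 * (norm y * sqrt G) + kp * norm y / sqrt (1 - \<rho>\<^sup>2)"
      proof (rule add_mono)
        show "cmod (pe (u, z) * h2fun y (u, z)) \<le> 2 * A0 * (norm y * sqrt G)"
          unfolding norm_mult using A0 h peA[OF w] by (intro mult_mono) auto
        have "cmod (h1fun a u) \<le> norm a / sqrt (1 - \<rho>\<^sup>2)" using norm_h1fun_le[OF u1, of a] by (simp add: u)
        also have "\<dots> \<le> kp * norm y / sqrt (1 - \<rho>\<^sup>2)" using decomp_norms(1)[OF d] r2 by (intro divide_right_mono) auto
        finally show "cmod (h1fun a u) \<le> kp * norm y / sqrt (1 - \<rho>\<^sup>2)" .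
      qed
      finally show ?thesis by (simp add: C1_def algebra_simps)
    qed
    define B where "B j = of_real \<rho> ^ j * h1fun (b j) z" for j
    \<comment> \<open>Exactly \<open>n\<close> coefficients occur, so the values of \<open>V\<close>
      at the \<open>n\<close>-th roots of unity scaled by \<open>\<rho>\<close> determine
      them.\<close>
    have "of_nat n * B i = (\<Sum>k<n. (\<Sum>m<n. B m * rou n k ^ m) * cnj (rou n k ^ i))"
      by (rule dft_coeff[OF i, symmetric])
    also have "\<dots> = (\<Sum>k<n. V (of_real \<rho> * rou n k) * cnj (rou n k ^ i))"
      by (simp add: V_def B_def power_mult_distrib mult_ac)
    finally have "cmod (of_nat n * B i) \<le> (\<Sum>k<n. C1 * norm y)"
    proof (rule ssubst)
      show "cmod (\<Sum>k<n. V (of_real \<rho> * rou n k) * cnj (rou n k ^ i)) \<le> (\<Sum>k<n. C1 * norm y)"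
      proof (rule sum_norm_le)
        fix k
        have "cmod (V (of_real \<rho> * rou n k)) \<le> C1 * norm y" using \<rho> by (intro V) (simp add: norm_mult)
        then show "cmod (V (of_real \<rho> * rou n k) * cnj (rou n k ^ i)) \<le> C1 * norm y"
          by (simp add: norm_mult norm_power)
      qed
    qed
    then have "\<rho> ^ i * cmod (h1fun (b i) z) \<le> C1 * norm y"
      using n_pos \<rho> by (simp add: B_def norm_mult norm_power)
    moreover have "\<rho> ^ n \<le> \<rho> ^ i" using \<rho> i by (intro power_decreasing) auto
    ultimately have "\<rho> ^ n * cmod (h1fun (b i) z) \<le> C1 * norm y"
      using mult_right_mono[of "\<rho> ^ n" "\<rho> ^ i" "cmod (h1fun (b i) z)"] by simp
    then show "cmod (h1fun (b i) z) \<le> C1 / \<rho> ^ n * norm y"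
      using \<rho> by (simp add: field_simps)
  qed
qed

end

section \<open>Vertical lines in the support\<close>

lemma pois_eq_Re:
  assumes x: "cmod x = 1" and z: "cmod z < 1"
  shows "pois z x = 2 * Re (1 / (1 - z * cnj x)) - 1"
proof -
  define t where "t = z * cnj x"
  have xx: "x * cnj x = 1" using complex_norm_square[of x] x by simp
  have t1: "cmod t = cmod z" using x by (simp add: t_def norm_mult)
  have nz: "1 - t \<noteq> 0" using t1 z by auto
  have "cmod (x - z) = cmod (1 - t)"
  proof -
    have "(x - z) * cnj x = 1 - t" using xx by (simp add: t_def algebra_simps)
    then show ?thesis using x by (metis complex_mod_cnj mult.right_neutral norm_mult)
  qed
  moreover define D where "D = (cmod (1 - t))\<^sup>2"
  moreover have Re: "Re (1 / (1 - t)) = (1 - Re t) / D"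
    unfolding D_def by (simp add: Re_divide cmod_power2)
  have Deq: "1 - (cmod z)\<^sup>2 = 2 * (1 - Re t) - D"
    unfolding t1[symmetric] D_def cmod_power2 by (simp add: power2_eq_square algebra_simps)
  have "D > 0" using nz by (simp add: D_def)
  then have "(1 - (cmod z)\<^sup>2) / D = 2 * Re (1 / (1 - t)) - 1"
    unfolding Deq Re by (simp add: diff_divide_distrib)
  ultimately show ?thesis unfolding pois_def t_def[symmetric] by simp
qed

context rif_clark
begin

text \<open>If \<open>bb\<close> vanishes at \<open>\<tau>\<close> then so does \<open>bt\<close>, hence \<open>dd = (z1 - \<tau>) E\<close>. Along the slice over a fixed
  \<open>z2\<close>, \<open>phi\<close> maps the disk to itself and has the unimodular boundary value \<open>\<alpha>\<close> at \<open>\<tau>\<close>, so the angular derivative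
  \<open>q z2\<close> is real; being a Moebius function of \<open>z2\<close> it is constant.\<close>

lemma angular_derivative:
  assumes t: "cmod \<tau> = 1" "bb \<tau> = 0"
  obtains A Q where "A > 0"
    "\<And>z. z \<in> bidisk \<Longrightarrow> 1 - cnj \<alpha> * phi z = (1 - cnj \<tau> * fst z) * Q z"
    "\<And>z2. cmod z2 < 1 \<Longrightarrow> isCont Q (\<tau>, z2)" "\<And>z2. cmod z2 < 1 \<Longrightarrow> Q (\<tau>, z2) = of_real A"
proof -
  have tt: "\<tau> * cnj \<tau> = 1" using complex_norm_square[of \<tau>] t(1) by simp
  have aP: "\<alpha> * poly P0 \<tau> = \<tau> ^ n * cnj (poly P1 \<tau>)"
    using t by (simp add: bb_def poly_rev_poly_unit)
  have "bt \<tau> = 0"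
  proof -
    have "\<tau> ^ n * cnj (\<alpha> * poly P0 \<tau>) = (\<tau> * cnj \<tau>) ^ n * poly P1 \<tau>"
      unfolding aP by (simp add: power_mult_distrib mult.assoc)
    then have "cnj \<alpha> * (\<tau> ^ n * cnj (poly P0 \<tau>)) = poly P1 \<tau>" by (simp add: tt mult_ac)
    then show ?thesis using t(1) by (simp add: bt_def poly_rev_poly_unit)
  qed
  define b1 where "b1 = smult \<alpha> P0 - R1"
  define b2 where "b2 = smult (cnj \<alpha>) R0 - P1"
  have b: "poly b1 z = bb z" "poly b2 z = bt z" for z by (simp_all add: b1_def b2_def bb_def bt_def)
  obtain e1 where e1: "b1 = [:- \<tau>, 1:] * e1" using t(2) b(1)[of \<tau>] by (metis poly_eq_0_iff_dvd dvdE)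
  obtain e2 where e2: "b2 = [:- \<tau>, 1:] * e2" using \<open>bt \<tau> = 0\<close> b(2)[of \<tau>] by (metis poly_eq_0_iff_dvd dvdE)
  define E where "E z = poly e1 (fst z) - \<alpha> * snd z * poly e2 (fst z)" for z
  have ddE: "dd z = (fst z - \<tau>) * E z" for z
    by (simp add: dd_eq b[symmetric] e1 e2 E_def algebra_simps)
  define Q where "Q z = - (cnj \<alpha> * \<tau> * E z / pe z)" for z
  have pet: "pe (\<tau>, z2) \<noteq> 0" if "cmod z2 < 1" for z2
  proof -
    have "cmod (z2 * beta \<tau>) < 1" using that beta_le[of \<tau>] t(1) by (intro norm_mult_lt_1) auto
    then have "1 - z2 * beta \<tau> \<noteq> 0" by auto
    then show ?thesis using pe_beta[of "(\<tau>, z2)"] t(1) P0_nz[of \<tau>] by simp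
  qed
  have contE: "continuous_on UNIV E" unfolding E_def by (intro continuous_intros)
  have cont: "isCont Q (\<tau>, z2)" if "cmod z2 < 1" for z2
  proof -
    have "isCont E (\<tau>, z2)" using contE continuous_on_eq_continuous_at open_UNIV by blast
    moreover have "isCont pe (\<tau>, z2)" using pe_continuous[of UNIV] continuous_on_eq_continuous_at open_UNIV by blast
    ultimately show ?thesis unfolding Q_def using pet[OF that] by (intro continuous_intros)
  qed
  have Qeq: "1 - cnj \<alpha> * phi z = (1 - cnj \<tau> * fst z) * Q z" if z: "z \<in> bidisk" for z
  proof -
    have "1 - cnj \<alpha> * phi z = cnj \<alpha> * (\<alpha> - phi z)" by (simp add: right_diff_distrib alpha_cnj)
    also have "\<dots> = cnj \<alpha> * ((fst z - \<tau>) * E z / pe z)" by (simp add: alpha_minus_phi[OF pe_nz[OF z]] ddE)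
    also have "fst z - \<tau> = - (\<tau> * (1 - cnj \<tau> * fst z))"
      using tt by (simp add: right_diff_distrib mult.assoc[symmetric])
    finally show ?thesis by (simp add: Q_def)
  qed
  have radial: "((\<lambda>s. Q (\<tau> * (1 - of_real s * v), z2)) \<longlongrightarrow> Q (\<tau>, z2)) (at_right 0)" if "cmod z2 < 1" for v z2
  proof (rule isCont_tendsto_compose[OF cont[OF that]])
    show "((\<lambda>s. (\<tau> * (1 - complex_of_real s * v), z2)) \<longlongrightarrow> (\<tau>, z2)) (at_right 0)"
      by (auto intro!: tendsto_eq_intros)
  qed
  have small: "\<forall>\<^sub>F s in at_right 0. cmod (\<tau> * (1 - of_real s * v)) < 1" if v: "Re v > 0" for v
  proof -
    have "\<forall>\<^sub>F s in at_right 0. s < 2 * Re v / (cmod v)\<^sup>2"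
      using v by (intro order_tendstoD(2)[of "\<lambda>s. s" 0] tendsto_ident_at divide_pos_pos) auto
    then show ?thesis using eventually_at_right_less[of 0]
    proof eventually_elim
      case (elim s)
      have cv: "(cmod v)\<^sup>2 > 0" using v by auto
      have "s * (cmod v)\<^sup>2 < 2 * Re v" using elim cv by (simp add: pos_less_divide_eq)
      then have "s * (s * (cmod v)\<^sup>2) < s * (2 * Re v)" using elim by simp
      moreover have "(cmod (1 - of_real s * v))\<^sup>2 = 1 - s * (2 * Re v) + s * (s * (cmod v)\<^sup>2)"
        unfolding cmod_power2 by (simp add: power2_eq_square algebra_simps)
      ultimately have "(cmod (1 - of_real s * v))\<^sup>2 < 1" by simp
      then show ?case using t(1) by (simp add: norm_mult abs_square_less_1)
    qed
  qed
  have one_minus: "1 - cnj \<tau> * (\<tau> * (1 - of_real s * v)) = of_real s * v" for s v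
    using tt by (simp add: mult.assoc[symmetric] mult.commute[of "cnj \<tau>"])
  have key: "2 * Re u - (cmod u)\<^sup>2 = 1 - (cmod (phi z))\<^sup>2" if "u = 1 - cnj \<alpha> * phi z" for u z
  proof -
    have "cmod (phi z) = cmod (1 - u)" by (simp add: that norm_mult alpha)
    then have "(cmod (phi z))\<^sup>2 = (Re (1 - u))\<^sup>2 + (Im (1 - u))\<^sup>2" by (simp only: cmod_power2[of "1 - u"])
    moreover have "(cmod u)\<^sup>2 = (Re u)\<^sup>2 + (Im u)\<^sup>2" by (rule cmod_power2)
    ultimately show ?thesis by (simp add: power2_eq_square[of "1 - Re u"] power2_eq_square[of "Re u"] algebra_simps)
  qed
  \<comment> \<open>Approach to \<open>\<tau>\<close> in direction \<open>v\<close>: there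
    \<open>1 - cnj \<alpha> * phi\<close> equals \<open>s * v * Q\<close> and has nonnegative real
    part since \<open>|phi|\<close> is at most \<open>1\<close>. Every \<open>v\<close> in the right
    half plane is allowed, which is stronger than the radial case.\<close>
  have pos: "Re (v * Q (\<tau>, z2)) \<ge> 0" if v: "Re v > 0" and z2: "cmod z2 < 1" for v z2
  proof (rule tendsto_lowerbound)
    show "((\<lambda>s. Re (v * Q (\<tau> * (1 - of_real s * v), z2))) \<longlongrightarrow> Re (v * Q (\<tau>, z2))) (at_right 0)"
      by (intro tendsto_intros radial z2)
    show "\<forall>\<^sub>F s in at_right 0. 0 \<le> Re (v * Q (\<tau> * (1 - of_real s * v), z2))"
      using small[OF v] eventually_at_right_less[of 0]
    proof eventually_elim
      case (elim s)
      define z where "z = (\<tau> * (1 - of_real s * v), z2)"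
      have z: "z \<in> bidisk" using elim z2 by (simp add: bidisk_def z_def)
      define u where "u = 1 - cnj \<alpha> * phi z"
      have "0 \<le> 1 - (cmod (phi z))\<^sup>2" using phi_le_1[OF z] by (simp add: abs_square_le_1)
      then have "0 \<le> Re u" using key[OF u_def] zero_le_power2[of "cmod u"] by linarith
      also have "u = of_real s * (v * Q z)" unfolding u_def Qeq[OF z] by (simp add: z_def one_minus)
      finally have "0 \<le> s * Re (v * Q z)" by simp
      then show ?case using elim by (simp add: z_def zero_le_mult_iff)
    qed
  qed simp
  obtain c0 where c0: "c0 > 0"
    "\<And>w. w \<in> bidisk \<Longrightarrow> c0 * ((1 - (cmod (fst w))\<^sup>2) * (1 - (cmod (snd w))\<^sup>2)) \<le> 1 - (cmod (phi w))\<^sup>2"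
    using one_minus_phi_lower by blast
  \<comment> \<open>Strict positivity comes from \<open>one_minus_phi_lower\<close>: on the radius
    \<open>1 - |phi|^2\<close> is at least a multiple of the depth \<open>s\<close>, and it is at
    most \<open>2 * s\<close> times the real part of \<open>Q\<close>.\<close>
  have posQ: "Re (Q (\<tau>, z2)) > 0" if z2: "cmod z2 < 1" for z2
  proof -
    have zz: "1 - (cmod z2)\<^sup>2 > 0" using z2 by (simp add: abs_square_less_1)
    have "c0 * (1 - (cmod z2)\<^sup>2) / 2 \<le> Re (Q (\<tau>, z2))"
    proof (rule tendsto_lowerbound)
      show "((\<lambda>s. Re (Q (\<tau> * (1 - of_real s * 1), z2))) \<longlongrightarrow> Re (Q (\<tau>, z2))) (at_right 0)"
        by (intro tendsto_intros radial z2)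
      show "\<forall>\<^sub>F s in at_right 0. c0 * (1 - (cmod z2)\<^sup>2) / 2 \<le> Re (Q (\<tau> * (1 - of_real s * 1), z2))"
        using eventually_at_right_real[OF zero_less_one]
      proof eventually_elim
        case (elim s)
        define z where "z = (\<tau> * (1 - of_real s * 1), z2)"
        have nz: "cmod (fst z) = 1 - s"
        proof -
          have "fst z = \<tau> * of_real (1 - s)" by (simp add: z_def)
          then show ?thesis using t(1) elim by (simp add: norm_mult del: of_real_diff)
        qed
        have z: "z \<in> bidisk" using elim z2 nz by (simp add: bidisk_def z_def)
        define u where "u = 1 - cnj \<alpha> * phi z"
        have us: "u = of_real s * (1 * Q z)" unfolding u_def Qeq[OF z] using one_minus[of s 1] by (simp add: z_def)
        have "s \<le> 1 - (1 - s)\<^sup>2" using elim by (simp add: power2_eq_square algebra_simps mult_left_le)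
        then have "c0 * (s * (1 - (cmod z2)\<^sup>2)) \<le> c0 * ((1 - (1 - s)\<^sup>2) * (1 - (cmod z2)\<^sup>2))"
          using c0(1) zz by (intro mult_left_mono mult_right_mono) auto
        also have "\<dots> = c0 * ((1 - (cmod (fst z))\<^sup>2) * (1 - (cmod (snd z))\<^sup>2))"
          unfolding nz by (simp add: z_def)
        also have "\<dots> \<le> 2 * Re u - (cmod u)\<^sup>2" unfolding key[OF u_def] by (rule c0(2)[OF z])
        also have "\<dots> \<le> 2 * Re u" by simp
        also have "\<dots> = s * (2 * Re (Q z))" by (simp add: us)
        finally have "s * (c0 * (1 - (cmod z2)\<^sup>2)) \<le> s * (2 * Re (Q z))" by (simp add: mult_ac)
        then show ?case using elim by (simp add: z_def)
      qed
    qed simp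
    moreover have "c0 * (1 - (cmod z2)\<^sup>2) / 2 > 0" using c0(1) zz by simp
    ultimately show ?thesis by linarith
  qed
  have realQ: "Im (Q (\<tau>, z2)) = 0" if z2: "cmod z2 < 1" for z2
  proof (rule ccontr)
    define R I where "R = Re (Q (\<tau>, z2))" and "I = Im (Q (\<tau>, z2))"
    assume "Im (Q (\<tau>, z2)) \<noteq> 0"
    then have I: "I \<noteq> 0" by (simp add: I_def)
    have R: "R > 0" using posQ[OF z2] by (simp add: R_def)
    \<comment> \<open>A nearly tangential direction: its real part is small enough that the
      imaginary part of \<open>Q\<close> wins and makes the real part of \<open>v * Q\<close> equal
      to \<open>- \<bar>I\<bar> / 2\<close>.\<close>
    have "0 \<le> Re (Complex (\<bar>I\<bar> / (2 * R)) (sgn I) * Q (\<tau>, z2))"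
      using I R by (intro pos z2) simp
    also have "\<dots> = \<bar>I\<bar> / (2 * R) * R - sgn I * I" by (simp add: R_def I_def)
    also have "\<dots> = \<bar>I\<bar> / 2 - \<bar>I\<bar>" using R by (simp add: abs_sgn mult.commute)
    finally show False using I by simp
  qed
  define s0 s1 where "s0 = - (cnj \<alpha> * \<tau> * poly e1 \<tau>)" and "s1 = cnj \<alpha> * \<tau> * \<alpha> * poly e2 \<tau>"
  define p0 p1 where "p0 = poly P0 \<tau>" and "p1 = poly P1 \<tau>"
  have Qf: "Q (\<tau>, w) = (s0 + w * s1) / (p0 + w * p1)" for w
    by (simp add: Q_def E_def pe_eq s0_def s1_def p0_def p1_def algebra_simps diff_divide_distrib add_divide_distrib minus_divide_left)
  have p0: "p0 \<noteq> 0" using P0_nz[of \<tau>] t(1) by (simp add: p0_def)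
  have pw: "p0 + w * p1 \<noteq> 0" if "cmod w < 1" for w using pet[OF that] by (simp add: pe_eq p0_def p1_def)
  define A where "A = Re (Q (\<tau>, 0))"
  have A: "A > 0" using posQ[of 0] by (simp add: A_def)
  have QA: "Q (\<tau>, 0) = of_real A" using realQ[of 0] by (simp add: A_def complex_eq_iff)
  define k where "k = s1 - of_real A * p1"
  have s0A: "s0 = of_real A * p0" using QA Qf[of 0] p0 by (simp add: field_simps)
  have diff: "Q (\<tau>, w) - of_real A = w * k / (p0 + w * p1)" if "cmod w < 1" for w
    using pw[OF that] by (simp add: Qf k_def s0A field_simps)
  have k0: "k = 0"
  proof (rule ccontr)
    assume k: "k \<noteq> 0"
    have inv: "Im (p0 / (w * k) + p1 / k) = 0" if w: "cmod w < 1" "w \<noteq> 0" for w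
    proof -
      have "Q (\<tau>, w) - of_real A = of_real (Re (Q (\<tau>, w)) - A)"
        using realQ[OF w(1)] by (simp add: complex_eq_iff)
      then have "w * k / (p0 + w * p1) = of_real (Re (Q (\<tau>, w)) - A)" using diff[OF w(1)] by simp
      then have "inverse (w * k / (p0 + w * p1)) = of_real (inverse (Re (Q (\<tau>, w)) - A))" by (simp only: of_real_inverse)
      then have "(p0 + w * p1) / (w * k) = of_real (inverse (Re (Q (\<tau>, w)) - A))" by (simp only: inverse_divide)
      moreover have "(p0 + w * p1) / (w * k) = p0 / (w * k) + p1 / k" using w(2) by (simp add: add_divide_distrib)
      ultimately show ?thesis by (metis Im_complex_of_real)
    qed
    define X where "X = p0 / k"
    have "p0 / (w * k) = X / w" for w by (simp add: X_def)
    then have inv': "Im (X / w) + Im (p1 / k) = 0" if "cmod w < 1" "w \<noteq> 0" for w using inv[OF that] by simp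
    \<comment> \<open>If \<open>k\<close> were nonzero, \<open>X / w\<close> would have constant
      imaginary part on the punctured disk; opposite points on the real axis and on the imaginary
      axis give \<open>X = 0\<close>.\<close>
    have "Im X = 0" using inv'[of "1/2"] inv'[of "- 1/2"] by simp
    moreover have "Re X = 0" using inv'[of "\<i>/2"] inv'[of "- \<i>/2"] by (simp add: Im_divide norm_divide)
    ultimately have "X = 0" by (simp add: complex_eq_iff)
    then show False using p0 k by (simp add: X_def)
  qed
  have "Q (\<tau>, w) = of_real A" if "cmod w < 1" for w using diff[OF that] k0 by simp
  then show ?thesis using that[of A Q] A Qeq cont by blast
qed

definition line :: "complex \<Rightarrow> (complex \<times> complex) set" where "line \<tau> = {\<zeta>. fst \<zeta> = \<tau>}"

lemma line_borel [measurable]: "line \<tau> \<in> sets borel"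
  unfolding line_def by (intro borel_closed closed_Collect_eq continuous_intros)

text \<open>With both first coordinates equal to \<open>r * \<tau>\<close>, the product of two Szego
  kernels times \<open>(1 - r)\<^sup>2\<close> has a weight in \<open>z1\<close> that is at most
  \<open>1\<close> and tends to the indicator of the line. The Gram formula evaluates its integral,
  and \<open>1 - cnj \<alpha> * phi = (1 - cnj \<tau> * z1) * Q\<close> cancels the powers of
  \<open>1 - r\<close>; the limit is \<open>1 / A\<close> for every \<open>z2\<close>.\<close>

lemma line_cauchy:
  assumes t: "cmod \<tau> = 1" "bb \<tau> = 0"
  obtains c where "c > 0"
    "\<And>z2. cmod z2 < 1 \<Longrightarrow> (\<integral>\<zeta>. indicator (line \<tau>) \<zeta> * (1 / (1 - z2 * cnj (snd \<zeta>))) \<partial>\<sigma>) = complex_of_real c"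
proof -
  obtain A Q where A: "A > 0"
    and Q: "\<And>z. z \<in> bidisk \<Longrightarrow> 1 - cnj \<alpha> * phi z = (1 - cnj \<tau> * fst z) * Q z"
    and Qc: "\<And>z2. cmod z2 < 1 \<Longrightarrow> isCont Q (\<tau>, z2)" and QA: "\<And>z2. cmod z2 < 1 \<Longrightarrow> Q (\<tau>, z2) = of_real A"
    using angular_derivative[OF t] by blast
  have tt: "cnj \<tau> * \<tau> = 1" using complex_norm_square[of \<tau>] t(1) by (simp add: mult.commute)
  define r where "r k = 1 - 1 / real (k + 2)" for k
  have r: "0 \<le> r k" "r k < 1" for k by (auto simp: r_def)
  have rlim: "r \<longlonglongrightarrow> 1"
    unfolding r_def using tendsto_diff[OF tendsto_const[of 1] LIMSEQ_ignore_initial_segment[OF lim_1_over_n, of 2]] by simp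
  have main: "(\<integral>\<zeta>. indicator (line \<tau>) \<zeta> * (1 / (1 - z2 * cnj (snd \<zeta>))) \<partial>\<sigma>) = complex_of_real (1 / A)"
    if z2: "cmod z2 < 1" for z2
  proof -
    \<comment> \<open>The second coordinate of \<open>w\<close> is \<open>0\<close>, so that only
      the kernel of \<open>z2\<close> remains in the second variable.\<close>
    define w z where "w k = (of_real (r k) * \<tau>, 0 :: complex)" and "z k = (of_real (r k) * \<tau>, z2)" for k
    have b: "w k \<in> bidisk" "z k \<in> bidisk" for k using r[of k] z2 t(1) by (simp_all add: w_def z_def bidisk_def norm_mult)
    define F where "F k \<zeta> = of_real ((1 - r k)\<^sup>2) * (szego (w k) \<zeta> * cnj (szego (z k) \<zeta>))" for k \<zeta>
    have Feq: "F k \<zeta> = of_real ((1 - r k)\<^sup>2 / (cmod (1 - fst \<zeta> * cnj (of_real (r k) * \<tau>)))\<^sup>2) * (1 / (1 - z2 * cnj (snd \<zeta>)))" for k \<zeta>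
    proof -
      define a where "a = 1 - fst \<zeta> * cnj (of_real (r k) * \<tau>)"
      have "F k \<zeta> = of_real ((1 - r k)\<^sup>2) / (a * cnj a) * (1 / (1 - z2 * cnj (snd \<zeta>)))"
        by (simp add: F_def szego_def w_def z_def a_def)
      also have "a * cnj a = of_real ((cmod a)\<^sup>2)" by (simp only: complex_norm_square)
      finally show ?thesis unfolding a_def by (simp only: of_real_divide)
    qed
    have low: "1 - r k \<le> cmod (1 - fst \<zeta> * cnj (of_real (r k) * \<tau>))" if "\<zeta> \<in> torus2" for k \<zeta>
    proof -
      have "cmod (fst \<zeta> * cnj (of_real (r k) * \<tau>)) = r k" using that t(1) r[of k] by (simp add: torus2_def norm_mult)
      then show ?thesis using norm_triangle_ineq2[of 1 "fst \<zeta> * cnj (of_real (r k) * \<tau>)"] by simp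
    qed
    have low2: "1 - cmod z2 \<le> cmod (1 - z2 * cnj (snd \<zeta>))" if "\<zeta> \<in> torus2" for \<zeta>
      using norm_triangle_ineq2[of 1 "z2 * cnj (snd \<zeta>)"] that by (simp add: torus2_def norm_mult)
    have conv: "(\<lambda>k. F k \<zeta>) \<longlonglongrightarrow> indicator (line \<tau>) \<zeta> * (1 / (1 - z2 * cnj (snd \<zeta>)))" if zT: "\<zeta> \<in> torus2" for \<zeta>
    proof (cases "\<zeta> \<in> line \<tau>")
      case True
      have "F k \<zeta> = 1 / (1 - z2 * cnj (snd \<zeta>))" for k
      proof -
        have "1 - fst \<zeta> * cnj (of_real (r k) * \<tau>) = of_real (1 - r k)"
          using True tt by (simp add: line_def mult.commute[of \<tau>] mult.assoc mult.left_commute)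
        then have "cmod (1 - fst \<zeta> * cnj (of_real (r k) * \<tau>)) = 1 - r k" using r[of k] by (simp del: of_real_diff)
        then show ?thesis unfolding Feq using r[of k] by simp
      qed
      then show ?thesis using True by simp
    next
      case False
      have nz: "1 - fst \<zeta> * cnj \<tau> \<noteq> 0"
      proof
        assume "1 - fst \<zeta> * cnj \<tau> = 0"
        then have "\<tau> = fst \<zeta> * (cnj \<tau> * \<tau>)" by (simp add: mult.assoc[symmetric])
        then show False using False tt by (simp add: line_def)
      qed
      have "(\<lambda>k. F k \<zeta>) \<longlonglongrightarrow> of_real ((1 - 1)\<^sup>2 / (cmod (1 - fst \<zeta> * cnj (of_real 1 * \<tau>)))\<^sup>2) * (1 / (1 - z2 * cnj (snd \<zeta>)))"
        unfolding Feq using nz by (intro tendsto_intros rlim) auto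
      then show ?thesis using False by simp
    qed
    have bnd: "cmod (F k \<zeta>) \<le> 1 / (1 - cmod z2)" if zT: "\<zeta> \<in> torus2" for k \<zeta>
    proof -
      define X where "X = (1 - r k)\<^sup>2 / (cmod (1 - fst \<zeta> * cnj (of_real (r k) * \<tau>)))\<^sup>2"
      define Y where "Y = 1 - z2 * cnj (snd \<zeta>)"
      have X: "0 \<le> X" "X \<le> 1"
        using low[OF zT, of k] r[of k] by (auto simp: X_def divide_le_eq_1 intro!: power_mono)
      have Y: "1 - cmod z2 \<le> cmod Y" unfolding Y_def by (rule low2[OF zT])
      have "cmod (F k \<zeta>) = X * (1 / cmod Y)"
        unfolding Feq X_def[symmetric] Y_def[symmetric] using X by (simp add: norm_mult norm_divide)
      also have "\<dots> \<le> 1 * (1 / (1 - cmod z2))"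
        using X Y z2 by (intro mult_mono frac_le) auto
      finally show ?thesis by simp
    qed
    have Fm: "F k \<in> borel_measurable borel" for k unfolding F_def by measurable
    have lm: "(\<lambda>\<zeta>. indicator (line \<tau>) \<zeta> * (1 / (1 - z2 * cnj (snd \<zeta>)))) \<in> borel_measurable \<sigma>"
    proof -
      have "(\<lambda>\<zeta>. 1 - z2 * cnj (snd \<zeta>)) \<in> borel_measurable borel"
        by (intro borel_measurable_continuous_onI continuous_intros)
      then have "(\<lambda>\<zeta>. indicator (line \<tau>) \<zeta> * (1 / (1 - z2 * cnj (snd \<zeta>)))) \<in> borel_measurable borel"
        by (intro borel_measurable_times borel_measurable_divide borel_measurable_indicator) auto
      then show ?thesis by (simp add: measurable_cong_sets[OF sets_sigma refl])
    qed
    have lim1: "(\<lambda>k. \<integral>\<zeta>. F k \<zeta> \<partial>\<sigma>) \<longlonglongrightarrow> (\<integral>\<zeta>. indicator (line \<tau>) \<zeta> * (1 / (1 - z2 * cnj (snd \<zeta>))) \<partial>\<sigma>)"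
    proof (rule integral_dominated_convergence[where w = "\<lambda>_. 1 / (1 - cmod z2)"])
      show "AE \<zeta> in \<sigma>. (\<lambda>k. F k \<zeta>) \<longlonglongrightarrow> indicator (line \<tau>) \<zeta> * (1 / (1 - z2 * cnj (snd \<zeta>)))"
        using AE_torus by eventually_elim (rule conv)
      show "AE \<zeta> in \<sigma>. norm (F k \<zeta>) \<le> 1 / (1 - cmod z2)" for k
        using AE_torus by eventually_elim (rule bnd)
      show "F k \<in> borel_measurable \<sigma>" for k using Fm by (simp add: measurable_cong_sets[OF sets_sigma refl])
    qed (use lm in auto)
    have val: "(\<integral>\<zeta>. F k \<zeta> \<partial>\<sigma>) = (Q (z k) + cnj (Q (w k)) - of_real (1 - r k) * (Q (z k) * cnj (Q (w k))))
        / (Q (z k) * cnj (Q (w k)) * of_real (1 + r k))" for k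
    proof -
      define d where "d = complex_of_real (1 - r k)"
      have d0: "d \<noteq> 0" using r[of k] by (simp add: d_def del: of_real_diff)
      have one: "1 - cnj \<tau> * (of_real (r k) * \<tau>) = d" using tt by (simp add: d_def mult.left_commute)
      have sz: "1 - cnj \<alpha> * phi (z k) = d * Q (z k)" using Q[OF b(2), of k] one by (simp add: z_def)
      have sw: "1 - cnj \<alpha> * phi (w k) = d * Q (w k)" using Q[OF b(1), of k] one by (simp add: w_def)
      have sw': "1 - \<alpha> * cnj (phi (w k)) = d * cnj (Q (w k))"
        using arg_cong[OF sw, of cnj] by (simp add: d_def)
      \<comment> \<open>The identity \<open>1 - (1 - a) * (1 - b) = a + b - a * b\<close> with
        \<open>a\<close> and \<open>b\<close> the deviations of \<open>cnj \<alpha> * phi\<close>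
        from \<open>1\<close>; both are of order \<open>1 - r\<close>.\<close>
      have num: "1 - cnj (phi (w k)) * phi (z k) = d * Q (z k) + d * cnj (Q (w k)) - (d * Q (z k)) * (d * cnj (Q (w k)))"
      proof -
        have "phi (z k) * cnj (phi (w k)) = (cnj \<alpha> * phi (z k)) * (\<alpha> * cnj (phi (w k)))"
          using alpha_cnj(2) by (metis (no_types, opaque_lifting) mult.assoc mult.left_commute mult_1)
        also have "cnj \<alpha> * phi (z k) = 1 - d * Q (z k)" using sz by (simp add: algebra_simps)
        also have "\<alpha> * cnj (phi (w k)) = 1 - d * cnj (Q (w k))" using sw' by (simp add: algebra_simps)
        finally show ?thesis by (simp add: algebra_simps)
      qed
      have Qnz: "Q (z k) \<noteq> 0" "cnj (Q (w k)) \<noteq> 0"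
        using alpha_phi_nz(2)[OF b(2), of k] alpha_phi_nz(2)[OF b(1), of k] sz sw by auto
      have szg: "szego (w k) (z k) = 1 / (d * of_real (1 + r k))"
      proof -
        have "1 - of_real (r k) * \<tau> * cnj (of_real (r k) * \<tau>) = d * of_real (1 + r k)"
          using tt by (simp add: d_def algebra_simps)
        then show ?thesis by (simp add: szego_def w_def z_def)
      qed
      have r1: "complex_of_real (1 + r k) \<noteq> 0" using r(1)[of k] by (simp del: of_real_add)
      have "(\<integral>\<zeta>. F k \<zeta> \<partial>\<sigma>) = of_real ((1 - r k)\<^sup>2) * (\<integral>\<zeta>. szego (w k) \<zeta> * cnj (szego (z k) \<zeta>) \<partial>\<sigma>)"
        unfolding F_def by (rule integral_mult_right_zero)
      also have "\<dots> = d\<^sup>2 * ((d * Q (z k) + d * cnj (Q (w k)) - (d * Q (z k)) * (d * cnj (Q (w k)))) * (1 / (d * of_real (1 + r k)))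
          / ((d * cnj (Q (w k))) * (d * Q (z k))))"
        unfolding szego_gram[OF b(1) b(2)] num sw' sz szg by (simp only: d_def of_real_power)
      also have "\<dots> = (Q (z k) + cnj (Q (w k)) - d * (Q (z k) * cnj (Q (w k)))) / (Q (z k) * cnj (Q (w k)) * of_real (1 + r k))"
        using d0 Qnz r1 by (simp add: power2_eq_square field_simps del: of_real_add)
      finally show ?thesis by (simp only: d_def)
    qed
    have lz: "(\<lambda>k. Q (z k)) \<longlonglongrightarrow> of_real A"
      unfolding QA[OF z2, symmetric] z_def
      by (rule isCont_tendsto_compose[OF Qc[OF z2]]) (auto intro!: tendsto_eq_intros rlim)
    have lw: "(\<lambda>k. Q (w k)) \<longlonglongrightarrow> of_real A"
      unfolding QA[of 0, simplified, symmetric] w_def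
      by (rule isCont_tendsto_compose[OF Qc[of 0, simplified]]) (auto intro!: tendsto_eq_intros rlim)
    have "(\<lambda>k. (Q (z k) + cnj (Q (w k)) - of_real (1 - r k) * (Q (z k) * cnj (Q (w k))))
        / (Q (z k) * cnj (Q (w k)) * of_real (1 + r k))) \<longlonglongrightarrow>
        (of_real A + cnj (of_real A) - of_real (1 - 1) * (of_real A * cnj (of_real A)))
        / (of_real A * cnj (of_real A) * of_real (1 + 1))"
      using A by (intro tendsto_intros lz lw rlim) auto
    moreover have "(complex_of_real A + cnj (of_real A) - of_real (1 - 1) * (of_real A * cnj (of_real A)))
        / (of_real A * cnj (of_real A) * of_real (1 + 1)) = complex_of_real (1 / A)"
      using A by (simp add: field_simps)
    ultimately have "(\<lambda>k. \<integral>\<zeta>. F k \<zeta> \<partial>\<sigma>) \<longlonglongrightarrow> complex_of_real (1 / A)" unfolding val by simp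
    then show ?thesis by (rule LIMSEQ_unique[OF lim1])
  qed
  show ?thesis by (rule that[of "1 / A"]) (use A main in auto)
qed

end

lemma nt_limit_cong:
  assumes "\<And>z. z \<in> bidisk \<Longrightarrow> f z = g z"
  shows "nt_limit f \<zeta> L \<longleftrightarrow> nt_limit g \<zeta> L"
  unfolding nt_limit_def
  by (intro all_cong1 imp_cong refl Lim_cong_within) (auto simp: nt_region_def assms)

lemma ennreal_le_all_eps:
  assumes "\<And>s. 0 < s \<Longrightarrow> s \<le> 1 \<Longrightarrow> x \<le> ennreal (C * s)"
  shows "x = 0"
proof -
  have "x \<le> 0"
  proof (rule ennreal_le_epsilon)
    fix e :: real assume e: "e > 0"
    define s where "s = min 1 (e / (\<bar>C\<bar> + 1))"
    have s: "0 < s" "s \<le> 1" using e by (auto simp: s_def)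
    have "C * s \<le> \<bar>C\<bar> * s" using s by (intro mult_right_mono) auto
    also have "\<dots> \<le> (\<bar>C\<bar> + 1) * (e / (\<bar>C\<bar> + 1))"
      using s by (intro mult_mono) (auto simp: s_def)
    also have "\<dots> = e" by simp
    finally have "ennreal (C * s) \<le> ennreal e" by (rule ennreal_leI)
    then show "x \<le> 0 + ennreal e" using assms[OF s] by simp
  qed
  then show ?thesis by simp
qed

section \<open>Zeros of \<open>p\<close> on the torus and null sets of the Clark measure\<close>

context rif
begin

text \<open>Up to sign the resultant of \<open>p\<close> and \<open>p~\<close> in the second
  variable. If it vanished, \<open>P1 * p~ = R0 * p\<close>, so \<open>p\<close> would divide
  \<open>P1\<close> by coprimality; degrees then force \<open>P1 = 0\<close>, and
  \<open>P0 * R0 = 0\<close> follows.\<close>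

lemma P0R0_ne_P1R1: "P0 * R0 - P1 * R1 \<noteq> 0"
proof
  assume "P0 * R0 - P1 * R1 = 0"
  then have eq: "P0 * R0 = P1 * R1" by simp
  have "smult P1 (reflect2 n p) = smult R0 p"
    by (rule poly_eqI) (use deg_p2 in \<open>auto simp: coeff_reflect2 coeff_eq_0 eq mult.commute\<close>)
  then have "reflect2 n p * [:P1:] = smult R0 p" by simp
  then have "p dvd reflect2 n p * [:P1:]" by (simp only: dvd_smult[OF dvd_refl])
  then have "p dvd [:P1:]" by (rule iffD1[OF coprime_dvd_mult_right_iff[OF coprime]])
  show False
  proof (cases "P1 = 0")
    case True
    then have "P0 * R0 = 0" using eq by simp
    then have "P0 = 0" using R0_nz by simp
    then show False using P0_nz[of 0] by simp
  next
    case False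
    then have "degree p \<le> degree [:P1:]" using \<open>p dvd [:P1:]\<close> by (intro dvd_imp_degree_le) auto
    then have "P1 = 0" by (simp add: coeff_eq_0)
    then show False using False by simp
  qed
qed

text \<open>At a zero of \<open>p\<close> on the torus \<open>P0 = - z2 * P1\<close>, and the
  reflections are conjugates there, so the resultant vanishes at \<open>z1\<close>. The second
  coordinate is determined by the first because \<open>P1\<close> is nonzero there.\<close>

lemma finite_singularities: "finite {\<zeta> \<in> torus2. pe \<zeta> = 0}"
proof -
  let ?Z = "{\<zeta> \<in> torus2. pe \<zeta> = 0}"
  have P1: "poly P1 (fst \<zeta>) \<noteq> 0" if "\<zeta> \<in> ?Z" for \<zeta>
    using that P0_nz[of "fst \<zeta>"] by (auto simp: pe_eq torus2_def)
  have "fst ` ?Z \<subseteq> {z. poly (P0 * R0 - P1 * R1) z = 0}"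
  proof
    fix z assume "z \<in> fst ` ?Z"
    then obtain \<zeta> where z: "\<zeta> \<in> ?Z" "z = fst \<zeta>" by blast
    then have T: "cmod z = 1" "cmod (snd \<zeta>) = 1" by (auto simp: torus2_def)
    have P0: "poly P0 z = - snd \<zeta> * poly P1 z" using z by (simp add: pe_eq eq_neg_iff_add_eq_0)
    have ss: "snd \<zeta> * cnj (snd \<zeta>) = 1" using complex_norm_square[of "snd \<zeta>"] T by simp
    have "poly P0 z * poly R0 z = z ^ n * (snd \<zeta> * cnj (snd \<zeta>)) * poly P1 z * cnj (poly P1 z)"
      using T(1) by (simp add: poly_rev_poly_unit P0)
    also have "\<dots> = poly P1 z * poly R1 z" using T(1) by (simp only: ss) (simp add: poly_rev_poly_unit)
    finally show "z \<in> {z. poly (P0 * R0 - P1 * R1) z = 0}" by simp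
  qed
  then have "finite (fst ` ?Z)" using poly_roots_finite[OF P0R0_ne_P1R1] by (rule finite_subset)
  moreover have "inj_on fst ?Z"
  proof (rule inj_onI)
    fix x y assume xy: "x \<in> ?Z" "y \<in> ?Z" "fst x = fst y"
    have "snd x * poly P1 (fst x) = - poly P0 (fst x)" using xy(1) by (simp add: pe_eq add_eq_0_iff)
    moreover have "snd y * poly P1 (fst x) = - poly P0 (fst x)" using xy(2,3) by (simp add: pe_eq add_eq_0_iff)
    ultimately have "snd x * poly P1 (fst x) = snd y * poly P1 (fst x)" by simp
    then have "snd x = snd y" using P1[OF xy(1)] by simp
    then show "x = y" using xy(3) by (simp add: prod_eq_iff)
  qed
  ultimately show ?thesis by (rule finite_imageD)
qed

end

context rif_clark
begin

text \<open>Real parts of the Cauchy integrals in \<open>line_cauchy\<close> give constant Poisson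
  integrals. The three statements are the form in which later steps use that \<open>\<sigma>\<close>
  on the line is a multiple of arc length.\<close>

lemma line_mass:
  assumes t: "cmod \<tau> = 1" "bb \<tau> = 0"
  shows "measure \<sigma> (line \<tau>) > 0"
    and "cmod z < 1 \<Longrightarrow> (\<integral>\<^sup>+ \<zeta>. indicator (line \<tau>) \<zeta> * ennreal (pois z (snd \<zeta>)) \<partial>\<sigma>) = ennreal (measure \<sigma> (line \<tau>))"
    and "cmod z < 1 \<Longrightarrow> (\<integral>\<zeta>. indicator (line \<tau>) \<zeta> * (1 / (1 - z * cnj (snd \<zeta>))) \<partial>\<sigma>) = complex_of_real (measure \<sigma> (line \<tau>))"
proof -
  obtain c where c: "c > 0" and cau: "\<And>z. cmod z < 1 \<Longrightarrow>
      (\<integral>\<zeta>. indicator (line \<tau>) \<zeta> * (1 / (1 - z * cnj (snd \<zeta>))) \<partial>\<sigma>) = complex_of_real c"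
    using line_cauchy[OF t] by blast
  define h where "h z \<zeta> = indicator (line \<tau>) \<zeta> * (1 / (1 - z * cnj (snd \<zeta>)))" for z and \<zeta> :: "complex \<times> complex"
  have hm: "h z \<in> borel_measurable \<sigma>" for z
  proof -
    have "(\<lambda>\<zeta> :: complex \<times> complex. 1 - z * cnj (snd \<zeta>)) \<in> borel_measurable borel"
      by (intro borel_measurable_continuous_onI continuous_intros)
    then have "h z \<in> borel_measurable borel" unfolding h_def[abs_def]
      by (intro borel_measurable_times borel_measurable_divide borel_measurable_indicator) auto
    then show ?thesis by (simp add: measurable_cong_sets[OF sets_sigma refl])
  qed
  have hi: "integrable \<sigma> (h z)" if z: "cmod z < 1" for z
  proof (rule integrable_bounded[OF hm, of _ "1 / (1 - cmod z)"])
    fix \<zeta> assume "\<zeta> \<in> torus2"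
    then have "1 - cmod z \<le> cmod (1 - z * cnj (snd \<zeta>))"
      using norm_triangle_ineq2[of 1 "z * cnj (snd \<zeta>)"] by (simp add: torus2_def norm_mult)
    then have "cmod (1 / (1 - z * cnj (snd \<zeta>))) \<le> 1 / (1 - cmod z)"
      unfolding norm_divide norm_one using z by (intro frac_le) auto
    then show "cmod (h z \<zeta>) \<le> 1 / (1 - cmod z)"
      using z by (simp add: h_def indicator_def)
  qed
  have Rh: "(\<integral>\<zeta>. Re (h z \<zeta>) \<partial>\<sigma>) = c" if z: "cmod z < 1" for z
  proof -
    have "(\<integral>\<zeta>. h z \<zeta> \<partial>\<sigma>) = complex_of_real c" unfolding h_def by (rule cau[OF z])
    then show ?thesis using integral_Re[OF hi[OF z]] by simp
  qed
  have h0: "Re (h 0 \<zeta>) = indicator (line \<tau>) \<zeta>" for \<zeta> by (simp add: h_def indicator_def)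
  have pc: "(\<integral>\<^sup>+ \<zeta>. indicator (line \<tau>) \<zeta> * ennreal (pois z (snd \<zeta>)) \<partial>\<sigma>) = ennreal c" if z: "cmod z < 1" for z
  proof -
    define g where "g \<zeta> = 2 * Re (h z \<zeta>) - Re (h 0 \<zeta>)" for \<zeta>
    have gi: "integrable \<sigma> g" unfolding g_def
      by (intro Bochner_Integration.integrable_diff integrable_mult_right integrable_Re hi z) simp
    have gint: "(\<integral>\<zeta>. g \<zeta> \<partial>\<sigma>) = c"
      unfolding g_def using hi[OF z] hi[of 0] Rh[OF z] Rh[of 0] by (subst Bochner_Integration.integral_diff) auto
    have geq: "g \<zeta> = indicator (line \<tau>) \<zeta> * pois z (snd \<zeta>)" if "\<zeta> \<in> torus2" for \<zeta>
      using that z by (simp add: g_def h0 h_def indicator_def pois_eq_Re torus2_def)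
    have "(\<integral>\<^sup>+ \<zeta>. indicator (line \<tau>) \<zeta> * ennreal (pois z (snd \<zeta>)) \<partial>\<sigma>) = (\<integral>\<^sup>+ \<zeta>. ennreal (g \<zeta>) \<partial>\<sigma>)"
    proof (rule nn_integral_cong_AE)
      show "AE \<zeta> in \<sigma>. indicator (line \<tau>) \<zeta> * ennreal (pois z (snd \<zeta>)) = ennreal (g \<zeta>)"
        using AE_torus by eventually_elim (simp add: geq indicator_def)
    qed
    also have "\<dots> = ennreal (\<integral>\<zeta>. g \<zeta> \<partial>\<sigma>)"
    proof (rule nn_integral_eq_integral[OF gi])
      show "AE \<zeta> in \<sigma>. 0 \<le> g \<zeta>"
        using AE_torus by eventually_elim (simp add: geq pois_nonneg z)
    qed
    finally show ?thesis by (simp add: gint)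
  qed
  have "emeasure \<sigma> (line \<tau>) = (\<integral>\<^sup>+ \<zeta>. indicator (line \<tau>) \<zeta> \<partial>\<sigma>)" by (simp add: sets_sigma)
  also have "\<dots> = (\<integral>\<^sup>+ \<zeta>. indicator (line \<tau>) \<zeta> * ennreal (pois 0 (snd \<zeta>)) \<partial>\<sigma>)"
  proof (rule nn_integral_cong_AE)
    show "AE \<zeta> in \<sigma>. (indicator (line \<tau>) \<zeta> :: ennreal) = indicator (line \<tau>) \<zeta> * ennreal (pois 0 (snd \<zeta>))"
      using AE_torus by eventually_elim (simp add: pois_def torus2_def)
  qed
  also have "\<dots> = ennreal c" by (rule pc) simp
  finally have m: "measure \<sigma> (line \<tau>) = c" using c by (simp add: measure_def)
  show "measure \<sigma> (line \<tau>) > 0" using c m by simp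
  show "cmod z < 1 \<Longrightarrow> (\<integral>\<^sup>+ \<zeta>. indicator (line \<tau>) \<zeta> * ennreal (pois z (snd \<zeta>)) \<partial>\<sigma>) = ennreal (measure \<sigma> (line \<tau>))"
    unfolding m by (rule pc)
  show "cmod z < 1 \<Longrightarrow> (\<integral>\<zeta>. indicator (line \<tau>) \<zeta> * (1 / (1 - z * cnj (snd \<zeta>))) \<partial>\<sigma>) = complex_of_real (measure \<sigma> (line \<tau>))"
    unfolding m by (rule cau)
qed

text \<open>Only the mass on the line is kept in the Poisson integral; there the first Poisson
  factor is constant and the second integrates to the mass.\<close>

lemma uu_ge_line:
  assumes t: "cmod \<tau> = 1" "bb \<tau> = 0" and w: "w \<in> bidisk"
  shows "measure \<sigma> (line \<tau>) * pois (fst w) \<tau> \<le> uu w"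
proof -
  define c where "c = measure \<sigma> (line \<tau>)"
  have c: "c > 0" unfolding c_def by (rule line_mass(1)[OF t])
  have pc: "(\<integral>\<^sup>+ \<zeta>. indicator (line \<tau>) \<zeta> * ennreal (pois z (snd \<zeta>)) \<partial>\<sigma>) = ennreal c" if "cmod z < 1" for z
    unfolding c_def by (rule line_mass(2)[OF t that])
  have "c * pois (fst w) \<tau> \<le> uu w"
  proof -
    have w1: "cmod (fst w) < 1" "cmod (snd w) < 1" using w by (auto simp: bidisk_def)
    have [measurable]: "(\<lambda>\<zeta> :: complex \<times> complex. ennreal (pois (snd w) (snd \<zeta>))) \<in> borel_measurable borel"
    proof -
      have "(\<lambda>\<zeta> :: complex \<times> complex. (cmod (snd \<zeta> - snd w))\<^sup>2) \<in> borel_measurable borel"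
        by (intro borel_measurable_continuous_onI continuous_intros)
      then show ?thesis unfolding pois_def by measurable
    qed
    have "ennreal (c * pois (fst w) \<tau>) = ennreal (pois (fst w) \<tau>) * (\<integral>\<^sup>+ \<zeta>. indicator (line \<tau>) \<zeta> * ennreal (pois (snd w) (snd \<zeta>)) \<partial>\<sigma>)"
      using c pois_nonneg[OF w1(1)] by (simp add: pc[OF w1(2)] ennreal_mult mult.commute)
    also have "\<dots> = (\<integral>\<^sup>+ \<zeta>. ennreal (pois (fst w) \<tau>) * (indicator (line \<tau>) \<zeta> * ennreal (pois (snd w) (snd \<zeta>))) \<partial>\<sigma>)"
      by (rule nn_integral_cmult[symmetric]) measurable
    also have "\<dots> \<le> (\<integral>\<^sup>+ \<zeta>. ennreal (poisson2 w \<zeta>) \<partial>\<sigma>)"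
      by (rule nn_integral_mono) (auto simp: indicator_def line_def poisson2_pois ennreal_mult pois_nonneg w1)
    also have "\<dots> = ennreal (uu w)" by (rule clark_poisson[OF w, symmetric])
    finally show ?thesis using uu_nonneg[OF w] by (simp add: ennreal_le_iff)
  qed
  then show ?thesis by (simp only: c_def)
qed

text \<open>Since \<open>|\<alpha> - phi|^2 * uu\<close> is at most \<open>1\<close>, a lower bound
  for \<open>uu\<close> forces \<open>phi\<close> towards \<open>\<alpha>\<close>. In a Stolz region
  the Poisson kernel at \<open>\<tau>\<close> is at least \<open>1 / (c * |\<tau> - z1|)\<close>, so
  \<open>|\<alpha> - phi|^2\<close> is of order \<open>|\<tau> - z1|\<close>. Only the first
  coordinate matters, so singular points of the line are covered too.\<close>

lemma nt_limit_on_line: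
  assumes t: "cmod \<tau> = 1" "bb \<tau> = 0"
  shows "nt_limit phi (\<tau>, \<mu>) \<alpha>"
  unfolding nt_limit_def
proof (intro allI impI tendstoI)
  fix c e :: real assume c: "c > 1" and e: "e > 0"
  define k where "k = measure \<sigma> (line \<tau>)"
  have k: "k > 0" "\<And>w. w \<in> bidisk \<Longrightarrow> k * pois (fst w) \<tau> \<le> uu w"
    unfolding k_def by (rule line_mass(1)[OF t]) (rule uu_ge_line[OF t])
  have "dist (phi w) \<alpha> < e" if w: "w \<in> nt_region c (\<tau>, \<mu>)" and d: "dist w (\<tau>, \<mu>) < e\<^sup>2 * k / c" for w
  proof -
    have wb: "w \<in> bidisk" and st: "cmod (\<tau> - fst w) < c * (1 - cmod (fst w))" using w by (auto simp: nt_region_def)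
    have w1: "cmod (fst w) < 1" using wb by (simp add: bidisk_def)
    define N where "N = cmod (\<tau> - fst w)"
    have "\<tau> \<noteq> fst w" using t(1) w1 by auto
    then have N: "N > 0" by (simp add: N_def)
    have m: "1 - cmod (fst w) \<le> 1 - (cmod (fst w))\<^sup>2" using w1 by (intro one_minus_sq_ge) auto
    have "N * N \<le> N * (c * (1 - cmod (fst w)))" using st N by (simp add: N_def)
    also have "\<dots> \<le> N * (c * (1 - (cmod (fst w))\<^sup>2))" using N c m by (intro mult_left_mono) auto
    finally have "N \<le> c * (1 - (cmod (fst w))\<^sup>2)" using N by (simp only: mult_le_cancel_left_pos)
    then have "N / c \<le> 1 - (cmod (fst w))\<^sup>2" using c by (simp add: pos_divide_le_eq mult.commute)
    then have "N / c / N\<^sup>2 \<le> pois (fst w) \<tau>"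
      unfolding pois_def N_def[symmetric] by (rule divide_right_mono) simp
    moreover have "N / c / N\<^sup>2 = 1 / (c * N)" using N by (simp add: power2_eq_square)
    ultimately have "1 / (c * N) \<le> pois (fst w) \<tau>" by simp
    then have "k * (1 / (c * N)) \<le> uu w" using k(2)[OF wb] mult_left_mono[of "1 / (c * N)" "pois (fst w) \<tau>" k] k(1) by linarith
    then have "(cmod (\<alpha> - phi w))\<^sup>2 * (k * (1 / (c * N))) \<le> (cmod (\<alpha> - phi w))\<^sup>2 * uu w" by (intro mult_left_mono) auto
    also have "\<dots> = 1 - (cmod (phi w))\<^sup>2" using alpha_phi_nz(3)[OF wb] by (simp add: uu_def)
    also have "\<dots> \<le> 1" by simp
    finally have "(cmod (\<alpha> - phi w))\<^sup>2 * k \<le> c * N" using N c by (simp add: field_simps)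
    also have "N \<le> dist w (\<tau>, \<mu>)"
      using dist_fst_le[of w "(\<tau>, \<mu>)"] by (simp add: N_def dist_norm norm_minus_commute)
    also have "c * dist w (\<tau>, \<mu>) < c * (e\<^sup>2 * k / c)" using d c by (intro mult_strict_left_mono) auto
    also have "\<dots> = e\<^sup>2 * k" using c by simp
    finally have "(cmod (\<alpha> - phi w))\<^sup>2 < e\<^sup>2" using k(1) c by simp
    then have "cmod (\<alpha> - phi w) < e" by (rule power2_less_imp_less) (use e in simp)
    then show ?thesis by (simp add: dist_norm norm_minus_commute)
  qed
  moreover have "e\<^sup>2 * k / c > 0" using e k(1) c by simp
  ultimately show "\<forall>\<^sub>F w in at (\<tau>, \<mu>) within nt_region c (\<tau>, \<mu>). dist (phi w) \<alpha> < e"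
    unfolding eventually_at by blast
qed

text \<open>Either the first marginal has linear mass bounds at the point, or the point lies on a
  charged line. On such a line the Poisson integral in \<open>z2\<close> is constant, which gives a
  linear bound along the line.\<close>

lemma point_null:
  assumes z: "\<zeta> \<in> torus2"
  shows "emeasure \<sigma> {\<zeta>} = 0"
proof (cases "bb (fst \<zeta>) = 0")
  case False
  have z1: "cmod (fst \<zeta>) = 1" using z by (simp add: torus2_def)
  obtain M where M: "fst \<zeta> \<in> frostman (distr \<sigma> borel fst) M" using frostman_fst[OF z1 False] by blast
  show ?thesis
  proof (rule ennreal_le_all_eps[of _ M])
    fix s :: real assume s: "0 < s"
    have fm: "fst \<in> measurable \<sigma> borel" using fst_borel by (simp add: measurable_cong_sets[OF sets_sigma refl])
    have "emeasure \<sigma> {\<zeta>} \<le> emeasure \<sigma> (fst -` cball (fst \<zeta>) s \<inter> space \<sigma>)"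
      by (rule emeasure_mono) (use s measurable_sets[OF fm, of "cball (fst \<zeta>) s"] in auto)
    also have "\<dots> = emeasure (distr \<sigma> borel fst) (cball (fst \<zeta>) s)"
      by (rule emeasure_distr[OF fm, symmetric]) simp
    also have "\<dots> \<le> ennreal (M * s)" using M s by (simp add: frostman_def)
    finally show "emeasure \<sigma> {\<zeta>} \<le> ennreal (M * s)" .
  qed
next
  case True
  have z1: "cmod (fst \<zeta>) = 1" "cmod (snd \<zeta>) = 1" using z by (auto simp: torus2_def)
  define c where "c = measure \<sigma> (line (fst \<zeta>))"
  have c: "c > 0" unfolding c_def by (rule line_mass(1)[OF z1(1) True])
  have pc: "(\<integral>\<^sup>+ \<xi>. indicator (line (fst \<zeta>)) \<xi> * ennreal (pois z (snd \<xi>)) \<partial>\<sigma>) = ennreal c" if "cmod z < 1" for z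
    unfolding c_def by (rule line_mass(2)[OF z1(1) True that])
  show ?thesis
  proof (rule ennreal_le_all_eps[of _ "4 * c"])
    fix s :: real assume s: "0 < s" "s \<le> 1"
    define v where "v = of_real (1 - s) * snd \<zeta>"
    have v: "cmod v < 1" using z1 s by (simp add: v_def norm_mult del: of_real_diff)
    have low: "1 / (4 * s) \<le> pois v (snd \<zeta>)" unfolding v_def using z1 s by (intro pois_lower) auto
    have "ennreal (1 / (4 * s)) * emeasure \<sigma> {\<zeta>} = (\<integral>\<^sup>+ \<xi>. ennreal (1 / (4 * s)) * indicator {\<zeta>} \<xi> \<partial>\<sigma>)"
      by (simp add: nn_integral_cmult_indicator sets_sigma)
    also have "\<dots> \<le> (\<integral>\<^sup>+ \<xi>. indicator (line (fst \<zeta>)) \<xi> * ennreal (pois v (snd \<xi>)) \<partial>\<sigma>)"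
    proof (rule nn_integral_mono)
      fix \<xi> show "ennreal (1 / (4 * s)) * indicator {\<zeta>} \<xi> \<le> indicator (line (fst \<zeta>)) \<xi> * ennreal (pois v (snd \<xi>))"
        by (cases "\<xi> = \<zeta>") (use low in \<open>simp_all add: line_def ennreal_leI del: ennreal_le_iff\<close>)
    qed
    also have "\<dots> = ennreal c" by (rule pc[OF v])
    finally have "ennreal (4 * s) * (ennreal (1 / (4 * s)) * emeasure \<sigma> {\<zeta>}) \<le> ennreal (4 * s) * ennreal c"
      by (rule mult_left_mono) simp
    then show "emeasure \<sigma> {\<zeta>} \<le> ennreal (4 * c * s)"
      using s c by (simp add: mult.assoc[symmetric] ennreal_mult[symmetric]) (simp add: mult_ac)
  qed
qed

lemma AE_pe_nz: "AE \<zeta> in \<sigma>. pe \<zeta> \<noteq> 0"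
proof -
  have "AE \<zeta> in \<sigma>. \<forall>\<xi>\<in>{\<zeta> \<in> torus2. pe \<zeta> = 0}. \<zeta> \<noteq> \<xi>"
  proof (rule AE_finite_allI[OF finite_singularities])
    fix \<xi> assume "\<xi> \<in> {\<zeta> \<in> torus2. pe \<zeta> = 0}"
    then have "{\<xi>} \<in> null_sets \<sigma>" using point_null[of \<xi>] by (auto simp: null_sets_def sets_sigma)
    from AE_not_in[OF this] show "AE \<zeta> in \<sigma>. \<zeta> \<noteq> \<xi>" by simp
  qed
  with AE_torus show ?thesis by eventually_elim auto
qed

section \<open>Almost everywhere non-tangential limits\<close>

definition nt_space :: "hardy set" where
  "nt_space = {x \<in> Kc. AE \<zeta> in \<sigma>. nt_limit (h2fun x) \<zeta> (Jx x \<zeta>)}"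

lemma nt_space_kv:
  assumes w: "w \<in> bidisk"
  shows "kv w \<in> nt_space"
proof -
  have "AE \<zeta> in \<sigma>. nt_limit (h2fun (kv w)) \<zeta> (Jx (kv w) \<zeta>)"
    using AE_torus AE_pe_nz AE_dd_zero Jx_kv[OF w]
  proof eventually_elim
    case (elim \<zeta>)
    have "qe \<zeta> = \<alpha> * pe \<zeta>" using elim(3) by (simp add: dd_def)
    then have ph: "phi \<zeta> = \<alpha>" using elim(2) by (simp add: phi_def)
    have cp: "isCont pe \<zeta>" "isCont qe \<zeta>"
      using pe_continuous[of UNIV] qe_continuous[of UNIV] continuous_on_eq_continuous_at open_UNIV by blast+
    have "isCont phi \<zeta>" unfolding phi_def[abs_def] using elim(2) by (intro continuous_intros cp)
    moreover have "isCont (szego w) \<zeta>"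
      unfolding szego_def[abs_def] using szego_denom_nz[OF w, of \<zeta>] elim(1)
      by (intro continuous_intros) (auto simp: torus2_def)
    ultimately have "isCont (\<lambda>z. (1 - cnj (phi w) * phi z) * szego w z) \<zeta>" by (intro continuous_intros)
    then have "((\<lambda>z. (1 - cnj (phi w) * phi z) * szego w z) \<longlongrightarrow> (1 - cnj (phi w) * \<alpha>) * szego w \<zeta>) (at \<zeta>)"
      unfolding isCont_def ph .
    moreover have "(1 - cnj (phi w) * \<alpha>) * szego w \<zeta> = Jx (kv w) \<zeta>" unfolding elim(4) by (simp only: mult.commute)
    ultimately have "((\<lambda>z. (1 - cnj (phi w) * phi z) * szego w z) \<longlongrightarrow> Jx (kv w) \<zeta>) (at \<zeta> within S)" for S
      by (simp add: tendsto_within_subset[OF _ subset_UNIV])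
    then have "nt_limit (\<lambda>z. (1 - cnj (phi w) * phi z) * szego w z) \<zeta> (Jx (kv w) \<zeta>)" by (simp add: nt_limit_def)
    then show ?case by (subst nt_limit_cong[OF h2fun_kv[OF w]])
  qed
  then show ?thesis using kv_in_Kc[OF w] by (simp add: nt_space_def)
qed

lemma nt_space_add:
  assumes "x \<in> nt_space" "y \<in> nt_space"
  shows "x + y \<in> nt_space"
proof -
  have xy: "x \<in> Kc" "y \<in> Kc" using assms by (auto simp: nt_space_def)
  have "AE \<zeta> in \<sigma>. nt_limit (h2fun x) \<zeta> (Jx x \<zeta>)" "AE \<zeta> in \<sigma>. nt_limit (h2fun y) \<zeta> (Jx y \<zeta>)"
    using assms by (auto simp: nt_space_def)
  with Jx_add[OF xy] have "AE \<zeta> in \<sigma>. nt_limit (h2fun (x + y)) \<zeta> (Jx (x + y) \<zeta>)"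
  proof eventually_elim
    case (elim \<zeta>)
    have "nt_limit (\<lambda>z. h2fun x z + h2fun y z) \<zeta> (Jx x \<zeta> + Jx y \<zeta>)"
      using elim(2,3) by (auto simp: nt_limit_def intro: tendsto_add)
    then show ?case unfolding elim(1) by (subst nt_limit_cong[OF h2fun_add])
  qed
  then show ?thesis using Kc_add[OF xy] by (simp add: nt_space_def)
qed

lemma nt_space_csc:
  assumes "x \<in> nt_space"
  shows "csc a x \<in> nt_space"
proof -
  have x: "x \<in> Kc" using assms by (auto simp: nt_space_def)
  have "AE \<zeta> in \<sigma>. nt_limit (h2fun x) \<zeta> (Jx x \<zeta>)"
    using assms by (auto simp: nt_space_def)
  with Jx_csc[OF x, of a] have "AE \<zeta> in \<sigma>. nt_limit (h2fun (csc a x)) \<zeta> (Jx (csc a x) \<zeta>)"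
  proof eventually_elim
    case (elim \<zeta>)
    have "nt_limit (\<lambda>z. a * h2fun x z) \<zeta> (a * Jx x \<zeta>)"
      using elim(2) by (auto simp: nt_limit_def intro: tendsto_mult_left)
    then show ?case unfolding elim(1) by (subst nt_limit_cong[OF h2fun_csc])
  qed
  then show ?thesis using Kc_csc[OF x] by (simp add: nt_space_def)
qed

lemma nt_region_stolz:
  "w \<in> nt_region c \<zeta> \<Longrightarrow> w \<in> bidisk \<and> fst w \<in> stolz c (fst \<zeta>) \<and> snd w \<in> stolz c (snd \<zeta>)"
  by (auto simp: nt_region_def stolz_def bidisk_def)

text \<open>At almost every point each marginal offers one of two controls: linear growth, where
  \<open>maximal_AE\<close> applies, or a zero of \<open>dd\<close> where the bound is
  \<open>decomp_fst_bound\<close> or \<open>decomp_snd_bound\<close>. In all cases the pieces of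
  \<open>p * y m\<close> decay like \<open>(1/2) ^ m\<close> on approach regions.\<close>

lemma fast_convergence_AE:
  assumes y: "\<And>m. y m \<in> Kc" and ny: "\<And>m. (norm (y m))\<^sup>2 \<le> (1/8) ^ m"
  shows "AE \<zeta> in \<sigma>. \<forall>c>1. \<exists>r>0. \<exists>C. \<forall>\<^sub>F m in sequentially.
           \<forall>w\<in>nt_region c \<zeta>. dist w \<zeta> < r \<longrightarrow> cmod (h2fun (y m) w) \<le> C * (1/2) ^ m"
proof -
  have "\<forall>m. \<exists>ab. decomp (y m) (fst ab) (snd ab)" using decomp_exists[OF y] by auto
  then obtain ab where ab: "\<And>m. decomp (y m) (fst (ab m)) (snd (ab m))" by metis
  define a b where "a m = fst (ab m)" and "b m = snd (ab m)" for m
  have d: "decomp (y m) (a m) (b m)" for m using ab by (simp add: a_def b_def)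
  have kk: "kp\<^sup>2 \<ge> 0" by simp
  have nle: "(norm v)\<^sup>2 \<le> kp\<^sup>2 * (1/8) ^ m" if "norm v \<le> kp * norm (y m)" for v :: "nat ell2" and m
  proof -
    have "(norm v)\<^sup>2 \<le> (kp * norm (y m))\<^sup>2" using that by (intro power_mono) auto
    also have "\<dots> \<le> kp\<^sup>2 * (1/8) ^ m" using ny[of m] by (simp add: power_mult_distrib mult_left_mono)
    finally show ?thesis .
  qed
  have ny2: "norm (y m) \<le> (1/2) ^ m" for m
  proof (rule power2_le_imp_le)
    have "(1/8 :: real) ^ m \<le> (1/4) ^ m" by (intro power_mono) auto
    also have "(1/4 :: real) ^ m = ((1/2) ^ m)\<^sup>2" by (simp add: power_mult[symmetric] mult.commute[of m] power_mult power_divide)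
    finally show "(norm (y m))\<^sup>2 \<le> ((1/2) ^ m)\<^sup>2" using ny[of m] by linarith
  qed simp
  have sq: "cmod v \<le> (1/2) ^ m" if "(cmod v)\<^sup>2 \<le> (1/4) ^ m" for v m
  proof (rule power2_le_imp_le)
    have "(1/4 :: real) ^ m = ((1/2) ^ m)\<^sup>2" by (simp add: power_mult[symmetric] mult.commute[of m] power_mult power_divide)
    then show "(cmod v)\<^sup>2 \<le> ((1/2) ^ m)\<^sup>2" using that by simp
  qed simp
  have fm: "fst \<in> measurable \<sigma> borel" using fst_borel by (simp add: measurable_cong_sets[OF sets_sigma refl])
  have sm: "snd \<in> measurable \<sigma> borel" using snd_borel by (simp add: measurable_cong_sets[OF sets_sigma refl])
  have A1: "AE \<zeta> in \<sigma>. \<forall>M. fst \<zeta> \<in> frostman (distr \<sigma> borel fst) M \<longrightarrow>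
     (\<forall>c. \<forall>\<^sub>F m in sequentially. \<forall>z\<in>stolz c (fst \<zeta>). (cmod (h1fun (a m) z))\<^sup>2 \<le> (1/4) ^ m)"
    by (rule AE_distrD[OF fm], rule maximal_AE[OF _ nle kk]) (use decomp_norms(1)[OF d] in auto)
  have A2: "AE \<zeta> in \<sigma>. \<forall>i. \<forall>M. snd \<zeta> \<in> frostman (distr \<sigma> borel snd) M \<longrightarrow>
     (\<forall>c. \<forall>\<^sub>F m in sequentially. \<forall>z\<in>stolz c (snd \<zeta>). (cmod (h1fun (b m i) z))\<^sup>2 \<le> (1/4) ^ m)"
    unfolding AE_all_countable
    by (intro allI, rule AE_distrD[OF sm], rule maximal_AE[OF _ nle kk]) (use decomp_norms(2)[OF d] in auto)
  from AE_torus AE_pe_nz A1 A2 show ?thesis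
  proof eventually_elim
    case (elim \<zeta>)
    have T: "cmod (fst \<zeta>) = 1" "cmod (snd \<zeta>) = 1" using elim(1) by (auto simp: torus2_def)
    show ?case
    proof (intro allI impI)
      fix c :: real assume c: "c > 1"
      then have c0: "c > 0" by simp
      have "\<exists>Ca. \<forall>\<^sub>F m in sequentially. \<forall>z\<in>stolz c (fst \<zeta>). cmod (h1fun (a m) z) \<le> Ca * (1/2) ^ m"
      proof (cases "bb (fst \<zeta>) = 0")
        case True
        obtain Ca where Ca: "\<And>x a b z. x \<in> Kc \<Longrightarrow> decomp x a b \<Longrightarrow> z \<in> stolz c (fst \<zeta>) \<Longrightarrow> cmod (h1fun a z) \<le> Ca * norm x"
          using decomp_fst_bound[OF T(1) True c0] by blast
        have "cmod (h1fun (a m) z) \<le> \<bar>Ca\<bar> * (1/2) ^ m" if "z \<in> stolz c (fst \<zeta>)" for m z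
        proof -
          have "cmod (h1fun (a m) z) \<le> Ca * norm (y m)" by (rule Ca[OF y d that])
          also have "\<dots> \<le> \<bar>Ca\<bar> * (1/2) ^ m" using ny2[of m] by (intro mult_mono) auto
          finally show ?thesis .
        qed
        then show ?thesis by (intro exI[of _ "\<bar>Ca\<bar>"]) auto
      next
        case False
        obtain M where "fst \<zeta> \<in> frostman (distr \<sigma> borel fst) M" using frostman_fst[OF T(1) False] by blast
        then have "\<forall>\<^sub>F m in sequentially. \<forall>z\<in>stolz c (fst \<zeta>). (cmod (h1fun (a m) z))\<^sup>2 \<le> (1/4) ^ m" using elim(3) by blast
        then have "\<forall>\<^sub>F m in sequentially. \<forall>z\<in>stolz c (fst \<zeta>). cmod (h1fun (a m) z) \<le> 1 * (1/2) ^ m"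
          by (rule eventually_mono) (simp add: sq)
        then show ?thesis by blast
      qed
      then obtain Ca where Ca: "\<forall>\<^sub>F m in sequentially. \<forall>z\<in>stolz c (fst \<zeta>). cmod (h1fun (a m) z) \<le> Ca * (1/2) ^ m" by blast
      have "\<exists>Cb e. e > 0 \<and> (\<forall>\<^sub>F m in sequentially. \<forall>i<n. \<forall>z\<in>stolz c (snd \<zeta>). cmod (z - snd \<zeta>) < e \<longrightarrow> cmod (h1fun (b m i) z) \<le> Cb * (1/2) ^ m)"
      proof (cases "pe (0, snd \<zeta>) = 0 \<or> dd (0, snd \<zeta>) \<noteq> 0")
        case False
        then have "dd (0, snd \<zeta>) = 0" "pe (0, snd \<zeta>) \<noteq> 0" by auto
        from decomp_snd_bound[OF T(2) this c0] obtain Cb e where e: "e > 0"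
          and Cb: "\<And>x a b i z. x \<in> Kc \<Longrightarrow> decomp x a b \<Longrightarrow> i < n \<Longrightarrow> z \<in> stolz c (snd \<zeta>) \<Longrightarrow> cmod (z - snd \<zeta>) < e
            \<Longrightarrow> cmod (h1fun (b i) z) \<le> Cb * norm x" by blast
        have "cmod (h1fun (b m i) z) \<le> \<bar>Cb\<bar> * (1/2) ^ m"
          if "i < n" "z \<in> stolz c (snd \<zeta>)" "cmod (z - snd \<zeta>) < e" for m i z
        proof -
          have "cmod (h1fun (b m i) z) \<le> Cb * norm (y m)" by (rule Cb[OF y d that])
          also have "\<dots> \<le> \<bar>Cb\<bar> * (1/2) ^ m" using ny2[of m] by (intro mult_mono) auto
          finally show ?thesis .
        qed
        with e show ?thesis by (intro exI[of _ "\<bar>Cb\<bar>"] exI[of _ e]) auto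
      next
        case True
        obtain M where M: "snd \<zeta> \<in> frostman (distr \<sigma> borel snd) M" using frostman_snd[OF T(2) True] by blast
        have "\<forall>\<^sub>F m in sequentially. \<forall>i\<in>{..<n}. \<forall>z\<in>stolz c (snd \<zeta>). (cmod (h1fun (b m i) z))\<^sup>2 \<le> (1/4) ^ m"
          using elim(4) M by (intro eventually_ball_finite) auto
        then have "\<forall>\<^sub>F m in sequentially. \<forall>i<n. \<forall>z\<in>stolz c (snd \<zeta>). cmod (z - snd \<zeta>) < 1 \<longrightarrow> cmod (h1fun (b m i) z) \<le> 1 * (1/2) ^ m"
          by (rule eventually_mono) (simp add: sq)
        then show ?thesis by (intro exI[of _ 1]) auto
      qed
      then obtain Cb e where e: "e > 0" and Cb: "\<forall>\<^sub>F m in sequentially. \<forall>i<n. \<forall>z\<in>stolz c (snd \<zeta>). cmod (z - snd \<zeta>) < e \<longrightarrow> cmod (h1fun (b m i) z) \<le> Cb * (1/2) ^ m" by blast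
      \<comment> \<open>The point is not a zero of \<open>p\<close>, so the bound for
        \<open>p f\<close> becomes one for \<open>f\<close> on a small ball; this is why only
        \<open>w\<close> within \<open>r\<close> of \<open>\<zeta>\<close> is considered.\<close>
      define k where "k = cmod (pe \<zeta>) / 2"
      have k: "k > 0" using elim(2) by (simp add: k_def)
      have "isCont pe \<zeta>" using pe_continuous[of UNIV] continuous_on_eq_continuous_at open_UNIV by blast
      then obtain r where r: "r > 0" "\<And>w. dist w \<zeta> < r \<Longrightarrow> dist (pe w) (pe \<zeta>) < k"
        using k unfolding continuous_at_eps_delta by blast
      have pek: "k \<le> cmod (pe w)" if "dist w \<zeta> < r" for w
        using r(2)[OF that] norm_triangle_ineq2[of "pe \<zeta>" "pe w"] by (simp add: k_def dist_norm norm_minus_commute)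
      show "\<exists>r>0. \<exists>C. \<forall>\<^sub>F m in sequentially. \<forall>w\<in>nt_region c \<zeta>. dist w \<zeta> < r \<longrightarrow> cmod (h2fun (y m) w) \<le> C * (1/2) ^ m"
      proof (rule exI[of _ "min r e"], rule conjI[rotated], rule exI[of _ "(Ca + real n * Cb) / k"])
        show "min r e > 0" using r(1) e by simp
        from Ca Cb show "\<forall>\<^sub>F m in sequentially. \<forall>w\<in>nt_region c \<zeta>. dist w \<zeta> < min r e \<longrightarrow> cmod (h2fun (y m) w) \<le> (Ca + real n * Cb) / k * (1/2) ^ m"
        proof eventually_elim
          case (elim m)
          show ?case
          proof (intro ballI impI)
            fix w assume w: "w \<in> nt_region c \<zeta>" and dw: "dist w \<zeta> < min r e"
            note ws = nt_region_stolz[OF w]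
            have w1: "cmod (fst w) \<le> 1" using ws by (simp add: bidisk_def)
            have sw: "cmod (snd w - snd \<zeta>) < e" using dist_snd_le[of w \<zeta>] dw by (simp add: dist_norm)
            have "pe w * h2fun (y m) w = h1fun (a m) (fst w) + (\<Sum>i<n. fst w ^ i * h1fun (b m i) (snd w))"
              using d[of m] ws by (simp add: decomp_def)
            then have "cmod (pe w) * cmod (h2fun (y m) w) = cmod (h1fun (a m) (fst w) + (\<Sum>i<n. fst w ^ i * h1fun (b m i) (snd w)))"
              by (metis norm_mult)
            also have "\<dots> \<le> cmod (h1fun (a m) (fst w)) + cmod (\<Sum>i<n. fst w ^ i * h1fun (b m i) (snd w))"
              by (rule norm_triangle_ineq)
            also have "\<dots> \<le> Ca * (1/2) ^ m + (\<Sum>i<n. Cb * (1/2) ^ m)"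
            proof (rule add_mono)
              show "cmod (h1fun (a m) (fst w)) \<le> Ca * (1/2) ^ m" using elim(1) ws by blast
              show "cmod (\<Sum>i<n. fst w ^ i * h1fun (b m i) (snd w)) \<le> (\<Sum>i<n. Cb * (1/2) ^ m)"
              proof (rule sum_norm_le)
                fix i assume "i \<in> {..<n}"
                then have "cmod (h1fun (b m i) (snd w)) \<le> Cb * (1/2) ^ m" using elim(2) ws sw by blast
                moreover have "cmod (fst w ^ i) \<le> 1" using w1 by (simp add: norm_power power_le_one)
                ultimately have "cmod (fst w ^ i) * cmod (h1fun (b m i) (snd w)) \<le> 1 * (Cb * (1/2) ^ m)"
                  by (intro mult_mono) auto
                then show "cmod (fst w ^ i * h1fun (b m i) (snd w)) \<le> Cb * (1/2) ^ m" by (simp add: norm_mult)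
              qed
            qed
            finally have "cmod (pe w) * cmod (h2fun (y m) w) \<le> (Ca + real n * Cb) * (1/2) ^ m"
              by (simp add: algebra_simps)
            moreover have "k * cmod (h2fun (y m) w) \<le> cmod (pe w) * cmod (h2fun (y m) w)"
              using pek[of w] dw by (intro mult_right_mono) auto
            ultimately have "k * cmod (h2fun (y m) w) \<le> (Ca + real n * Cb) * (1/2) ^ m" by linarith
            then show "cmod (h2fun (y m) w) \<le> (Ca + real n * Cb) / k * (1/2) ^ m"
              using k by (simp add: pos_le_divide_eq mult.commute)
          qed
        qed
      qed
    qed
  qed
qed

text \<open>The squared norms are summable, so by monotone convergence the series of squared values
  is finite almost everywhere and its terms tend to zero.\<close>

lemma Jx_fast_AE:
  assumes y: "\<And>m. y m \<in> Kc" and ny: "\<And>m. (norm (y m))\<^sup>2 \<le> (1/8) ^ m"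
  shows "AE \<zeta> in \<sigma>. (\<lambda>m. Jx (y m) \<zeta>) \<longlonglongrightarrow> 0"
proof -
  have m: "(\<lambda>\<zeta>. ennreal ((cmod (Jx (y m) \<zeta>))\<^sup>2)) \<in> borel_measurable \<sigma>" for m
    using Jx_measurable[OF y] by measurable
  have "(\<integral>\<^sup>+ \<zeta>. (\<Sum>m. ennreal ((cmod (Jx (y m) \<zeta>))\<^sup>2)) \<partial>\<sigma>) = (\<Sum>m. \<integral>\<^sup>+ \<zeta>. ennreal ((cmod (Jx (y m) \<zeta>))\<^sup>2) \<partial>\<sigma>)"
    by (rule nn_integral_suminf[OF m])
  also have "\<dots> = (\<Sum>m. ennreal ((norm (y m))\<^sup>2))"
    using Jx_L2[OF y] Jx_norm[OF y] by (intro suminf_cong) (subst nn_integral_eq_integral; simp add: L2_def)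
  also have "\<dots> \<le> (\<Sum>m. ennreal ((1/8) ^ m))"
    by (intro suminf_le ennreal_leI ny) auto
  also have "\<dots> = ennreal (\<Sum>m. (1/8) ^ m)"
    by (rule suminf_ennreal2) (auto intro: summable_geometric)
  also have "\<dots> < \<infinity>" by simp
  finally have "(\<integral>\<^sup>+ \<zeta>. (\<Sum>m. ennreal ((cmod (Jx (y m) \<zeta>))\<^sup>2)) \<partial>\<sigma>) \<noteq> \<infinity>" by simp
  then have "AE \<zeta> in \<sigma>. (\<Sum>m. ennreal ((cmod (Jx (y m) \<zeta>))\<^sup>2)) \<noteq> \<infinity>"
    by (rule nn_integral_noteq_infinite[rotated]) (use m in measurable)
  then show ?thesis
  proof eventually_elim
    case (elim \<zeta>)
    then have "summable (\<lambda>m. (cmod (Jx (y m) \<zeta>))\<^sup>2)" by (intro summable_suminf_not_top) auto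
    then have "(\<lambda>m. (cmod (Jx (y m) \<zeta>))\<^sup>2) \<longlonglongrightarrow> 0" by (rule summable_LIMSEQ_zero)
    then have "(\<lambda>m. sqrt ((cmod (Jx (y m) \<zeta>))\<^sup>2)) \<longlonglongrightarrow> sqrt 0" by (rule tendsto_real_sqrt)
    then show ?case by (simp add: tendsto_norm_zero_iff)
  qed
qed

text \<open>A subsequence with rate \<open>(1/8) ^ m\<close> is compared with the limit vector. At a
  fixed point and aperture a single large \<open>m\<close> suffices: both error terms of
  \<open>y m\<close> are below \<open>e / 3\<close>, and the third part is the known limit of the
  approximating function.\<close>

lemma nt_space_closed: "closed nt_space"
  unfolding closed_sequential_limits
proof (intro allI impI, elim conjE)
  fix X x assume X: "\<forall>k. X k \<in> nt_space" and lim: "X \<longlonglongrightarrow> x"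
  have XK: "X k \<in> Kc" for k using X by (simp add: nt_space_def)
  have xK: "x \<in> Kc" using closed_sequentially[OF Kc_closed] XK lim by blast
  have "\<exists>k. (norm (x - X k))\<^sup>2 \<le> (1/8) ^ m" for m
  proof -
    have "(\<lambda>k. (norm (x - X k))\<^sup>2) \<longlonglongrightarrow> (norm (x - x))\<^sup>2" by (intro tendsto_intros lim)
    then have "\<forall>\<^sub>F k in sequentially. (norm (x - X k))\<^sup>2 < (1/8) ^ m" by (rule order_tendstoD(2)) simp
    then obtain k where "(norm (x - X k))\<^sup>2 < (1/8) ^ m" by (auto simp: eventually_sequentially)
    then show ?thesis by (intro exI[of _ k]) simp
  qed
  then obtain s where s: "\<And>m. (norm (x - X (s m)))\<^sup>2 \<le> (1/8) ^ m" by metis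
  define y where "y m = x - X (s m)" for m
  have yK: "y m \<in> Kc" for m using Kc_diff[OF xK XK] by (simp add: y_def)
  have ny: "(norm (y m))\<^sup>2 \<le> (1/8) ^ m" for m using s by (simp add: y_def)
  have "AE \<zeta> in \<sigma>. \<forall>m. nt_limit (h2fun (X (s m))) \<zeta> (Jx (X (s m)) \<zeta>)"
    unfolding AE_all_countable using X by (simp add: nt_space_def)
  moreover have "AE \<zeta> in \<sigma>. \<forall>m. Jx (y m) \<zeta> = Jx x \<zeta> - Jx (X (s m)) \<zeta>"
    unfolding AE_all_countable y_def using Jx_diff[OF xK XK] by blast
  moreover note fast_convergence_AE[OF yK ny] Jx_fast_AE[OF yK ny]
  ultimately have "AE \<zeta> in \<sigma>. nt_limit (h2fun x) \<zeta> (Jx x \<zeta>)"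
  proof eventually_elim
    case (elim \<zeta>)
    show ?case
      unfolding nt_limit_def
    proof (intro allI impI tendstoI)
      fix c e :: real assume c: "c > 1" and e: "e > 0"
      obtain r C where r: "r > 0" and C: "\<forall>\<^sub>F m in sequentially. \<forall>w\<in>nt_region c \<zeta>. dist w \<zeta> < r \<longrightarrow> cmod (h2fun (y m) w) \<le> C * (1/2) ^ m"
        using elim(3) c by blast
      have "(\<lambda>m. C * (1/2) ^ m) \<longlonglongrightarrow> C * 0" by (intro tendsto_intros LIMSEQ_power_zero) simp
      then have "\<forall>\<^sub>F m in sequentially. C * (1/2) ^ m < e / 3" using e by (intro order_tendstoD(2)) auto
      moreover have "\<forall>\<^sub>F m in sequentially. dist (Jx (y m) \<zeta>) 0 < e / 3" using elim(4) e by (intro tendstoD) auto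
      ultimately have "\<forall>\<^sub>F m in sequentially. (\<forall>w\<in>nt_region c \<zeta>. dist w \<zeta> < r \<longrightarrow> cmod (h2fun (y m) w) < e / 3) \<and> cmod (Jx (y m) \<zeta>) < e / 3"
        using C by eventually_elim fastforce
      then obtain m where m: "\<And>w. w \<in> nt_region c \<zeta> \<Longrightarrow> dist w \<zeta> < r \<Longrightarrow> cmod (h2fun (y m) w) < e / 3" "cmod (Jx (y m) \<zeta>) < e / 3"
        by (auto simp: eventually_sequentially)
      have "(h2fun (X (s m)) \<longlongrightarrow> Jx (X (s m)) \<zeta>) (at \<zeta> within nt_region c \<zeta>)" using elim(1) c by (simp add: nt_limit_def)
      then have "\<forall>\<^sub>F w in at \<zeta> within nt_region c \<zeta>. dist (h2fun (X (s m)) w) (Jx (X (s m)) \<zeta>) < e / 3"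
        using e by (intro tendstoD) auto
      moreover have "\<forall>\<^sub>F w in at \<zeta> within nt_region c \<zeta>. w \<in> nt_region c \<zeta> \<and> dist w \<zeta> < r"
        unfolding eventually_at using r by blast
      ultimately show "\<forall>\<^sub>F w in at \<zeta> within nt_region c \<zeta>. dist (h2fun x w) (Jx x \<zeta>) < e"
      proof eventually_elim
        case w: (elim w)
        have wb: "w \<in> bidisk" using w by (simp add: nt_region_def)
        have eq: "h2fun x w - Jx x \<zeta> = h2fun (y m) w + (h2fun (X (s m)) w - Jx (X (s m)) \<zeta>) - Jx (y m) \<zeta>"
          using elim(2) by (simp add: y_def h2fun_minus wb)
        have "cmod (h2fun x w - Jx x \<zeta>) \<le> cmod (h2fun (y m) w) + cmod (h2fun (X (s m)) w - Jx (X (s m)) \<zeta>) + cmod (Jx (y m) \<zeta>)"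
          unfolding eq by (rule order_trans[OF norm_triangle_ineq4 add_right_mono[OF norm_triangle_ineq]])
        moreover have "cmod (h2fun (y m) w) < e / 3" using m(1) w by blast
        ultimately show ?case using m(2) w(1) by (simp add: dist_norm)
      qed
    qed
  qed
  then show "x \<in> nt_space" using xK by (simp add: nt_space_def)
qed

lemma nt_space_eq: "nt_space = Kc"
proof (rule closed_subspace_eqI[OF nt_space_closed])
  have o: "(0, 0) \<in> bidisk" by (simp add: bidisk_def)
  show "subspace nt_space"
  proof (rule subspaceI)
    show "0 \<in> nt_space" using nt_space_csc[OF nt_space_kv[OF o], of 0] by simp
  qed (auto simp: nt_space_add nt_space_csc csc_scaleR)
  show "nt_space \<subseteq> Kc" by (auto simp: nt_space_def)
  fix d assume d: "d \<in> Kc" and orth: "\<And>g. g \<in> nt_space \<Longrightarrow> cip d g = 0"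
  show "d = 0"
  proof (rule h2fun_eqD)
    fix w assume w: "w \<in> bidisk"
    have "h2fun d w = cip d (kv w)" by (rule cip_kv[OF d w, symmetric])
    also have "\<dots> = 0" by (rule orth[OF nt_space_kv[OF w]])
    finally show "h2fun d w = h2fun 0 w" by simp
  qed
qed (auto simp: nt_space_csc Kc_subspace)

theorem J_is_nt_boundary_value:
  assumes f: "f \<in> model_space phi"
  shows "AE \<zeta> in \<sigma>. nt_limit f \<zeta> (J f \<zeta>)"
proof -
  obtain x where x: "x \<in> Kc" "\<And>z. z \<in> bidisk \<Longrightarrow> f z = h2fun x z" using f unfolding model_space_iff by blast
  have "AE \<zeta> in \<sigma>. nt_limit (h2fun x) \<zeta> (Jx x \<zeta>)" using x(1) nt_space_eq by (auto simp: nt_space_def)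
  moreover have "AE \<zeta> in \<sigma>. J f \<zeta> = Jx x \<zeta>" by (rule J_cong[OF x(1,2)]) auto
  ultimately show ?thesis
  proof eventually_elim
    case (elim \<zeta>)
    then show ?case using nt_limit_cong[OF x(2)] by simp
  qed
qed

end

section \<open>Exceptional values\<close>

context rif_clark
begin

lemma phi_radial:
  assumes "cmod \<tau> = 1" "cmod z2 < 1"
  shows "((\<lambda>r::real. phi (of_real r * \<tau>, z2)) \<longlongrightarrow> phi (\<tau>, z2)) (at_left 1)"
proof -
  have "pe (\<tau>, z2) \<noteq> 0"
  proof
    assume "pe (\<tau>, z2) = 0"
    then have "poly P0 \<tau> = - (z2 * poly P1 \<tau>)" by (simp add: pe_eq eq_neg_iff_add_eq_0)
    then have eq: "cmod (poly P0 \<tau>) = cmod z2 * cmod (poly P1 \<tau>)" by (simp add: norm_mult)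
    also have "\<dots> \<le> cmod z2 * cmod (poly P0 \<tau>)" using P1_le_P0[of \<tau>] assms by (intro mult_left_mono) auto
    also have "\<dots> < 1 * cmod (poly P0 \<tau>)" using P0_nz[of \<tau>] assms by (intro mult_strict_right_mono) auto
    finally show False by simp
  qed
  moreover have cp: "isCont pe \<zeta>" "isCont qe \<zeta>" for \<zeta>
    using pe_continuous[of UNIV] qe_continuous[of UNIV] continuous_on_eq_continuous_at open_UNIV by blast+
  ultimately have c: "isCont phi (\<tau>, z2)" unfolding phi_def[abs_def] by (intro continuous_intros) auto
  have "((\<lambda>r::real. (of_real r * \<tau>, z2)) \<longlongrightarrow> (of_real 1 * \<tau>, z2)) (at_left 1)" by (intro tendsto_intros)
  then have "((\<lambda>r::real. (of_real r * \<tau>, z2)) \<longlongrightarrow> (\<tau>, z2)) (at_left 1)" by simp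
  from isCont_tendsto_compose[OF c this] show ?thesis .
qed

lemma R1_unit: "cmod \<tau> = 1 \<Longrightarrow> poly R1 \<tau> = \<tau> ^ n * cnj (poly P1 \<tau>)"
  and R0_unit: "cmod \<tau> = 1 \<Longrightarrow> poly R0 \<tau> = \<tau> ^ n * cnj (poly P0 \<tau>)"
  by (rule poly_rev_poly_unit; simp)+

text \<open>On the line through a zero of \<open>p\<close>, \<open>phi\<close> is constant; an iterated limit, first in \<open>z1\<close>,
  stays within the approach regions.\<close>

lemma bb_zero_if_exceptional:
  assumes z: "\<zeta> \<in> torus2" "pe \<zeta> = 0" and lim: "nt_limit phi \<zeta> \<alpha>"
  shows "bb (fst \<zeta>) = 0"
proof -
  define \<tau> \<mu> where "\<tau> = fst \<zeta>" and "\<mu> = snd \<zeta>"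
  have t: "cmod \<tau> = 1" "cmod \<mu> = 1" using z(1) by (auto simp: torus2_def \<tau>_def \<mu>_def)
  have mm: "\<mu> * cnj \<mu> = 1" using complex_norm_square[of \<mu>] t(2) by simp
  have P: "poly P0 \<tau> = - \<mu> * poly P1 \<tau>"
    using z(2) by (simp add: pe_eq \<tau>_def \<mu>_def eq_neg_iff_add_eq_0)
  then have cP: "cnj (poly P0 \<tau>) = - (cnj \<mu> * cnj (poly P1 \<tau>))" by simp
  have P1: "poly P1 \<tau> = - (cnj \<mu> * poly P0 \<tau>)"
    using mm unfolding P by (simp add: algebra_simps)
  have const: "phi (\<tau>, of_real s * \<mu>) = poly R1 \<tau> / poly P0 \<tau>" if s: "0 \<le> s" "s < 1" for s :: real
  proof -
    have "qe (\<tau>, of_real s * \<mu>) = poly R1 \<tau> * (1 - of_real s)"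
      using mm by (simp add: qe_eq R1_unit R0_unit t(1) cP algebra_simps)
    moreover have "pe (\<tau>, of_real s * \<mu>) = poly P0 \<tau> * (1 - of_real s)"
      using mm by (simp add: pe_eq P1 algebra_simps)
    moreover have "(1 - of_real s :: complex) \<noteq> 0" using s by (metis less_irrefl of_real_1 of_real_eq_iff right_minus_eq)
    ultimately show ?thesis by (simp add: phi_def)
  qed
  have "dist (poly R1 \<tau> / poly P0 \<tau>) \<alpha> \<le> e" if e: "e > 0" for e
  proof -
    \<comment> \<open>Both coordinates move radially, where \<open>|u - r * u| = 1 - r\<close>, so
      aperture \<open>2\<close> contains all the test points however different the two depths
      are.\<close>
    have "(phi \<longlongrightarrow> \<alpha>) (at \<zeta> within nt_region 2 \<zeta>)" using lim by (simp add: nt_limit_def)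
    from tendstoD[OF this e] obtain d where d: "d > 0"
      and D: "\<And>w. w \<in> nt_region 2 \<zeta> \<Longrightarrow> w \<noteq> \<zeta> \<Longrightarrow> dist w \<zeta> < d \<Longrightarrow> dist (phi w) \<alpha> < e"
      unfolding eventually_at by blast
    \<comment> \<open>Depth below \<open>d / 2\<close> in the second variable leaves
      \<open>d / 2\<close> for the first, which tends to the circle before \<open>s\<close>
      does.\<close>
    define s where "s = max 0 (1 - d / 4)"
    have s: "0 \<le> s" "s < 1" "1 - s < d / 2" using d by (auto simp: s_def max_def)
    have nd: "cmod (of_real r * u - u) = 1 - r" "cmod (u - of_real r * u) = 1 - r" "cmod (of_real r * u) = r"
      if "cmod u = 1" "0 \<le> r" "r \<le> 1" for r u
    proof -
      have "of_real r * u - u = of_real (r - 1) * u" by (simp add: algebra_simps)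
      then have "cmod (of_real r * u - u) = \<bar>r - 1\<bar> * 1" using that(1) by (metis norm_mult norm_of_real)
      then show "cmod (of_real r * u - u) = 1 - r" "cmod (u - of_real r * u) = 1 - r" using that by (simp_all add: norm_minus_commute)
      show "cmod (of_real r * u) = r" using that by (simp add: norm_mult)
    qed
    have "\<forall>\<^sub>F r in at_left (1::real). s < r \<and> r < 1"
      using s(2) by (intro eventually_conj eventually_at_leftI[of s]) auto
    then have "\<forall>\<^sub>F r in at_left 1. dist (phi (of_real r * \<tau>, of_real s * \<mu>)) \<alpha> \<le> e"
    proof eventually_elim
      case (elim r)
      define w where "w = (of_real r * \<tau>, of_real s * \<mu>)"
      have r: "0 \<le> r" "r \<le> 1" "r < 1" using elim s by auto
      have "w \<in> nt_region 2 \<zeta>"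
        using r s nd[OF t(1) r(1,2)] nd[OF t(2) s(1)]
        by (simp add: w_def nt_region_def bidisk_def \<tau>_def[symmetric] \<mu>_def[symmetric])
      moreover have "w \<noteq> \<zeta>"
      proof
        assume "w = \<zeta>"
        then have "fst w = \<tau>" by (simp add: \<tau>_def)
        then have "cmod (of_real r * \<tau>) = cmod \<tau>" unfolding w_def fst_conv by (rule arg_cong)
        then show False using nd(3)[OF t(1) r(1,2)] t(1) r(3) by simp
      qed
      moreover have "dist w \<zeta> < d"
      proof -
        have "dist w \<zeta> \<le> dist (fst w) (fst \<zeta>) + dist (snd w) (snd \<zeta>)"
          unfolding dist_prod_def by (rule sqrt_sum_squares_le_sum) simp_all
        also have "\<dots> = (1 - r) + (1 - s)"
          using nd(1)[OF t(1) r(1,2)] nd(1)[OF t(2) s(1)] s by (simp add: w_def dist_norm \<tau>_def \<mu>_def)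
        also have "\<dots> < d" using elim s by linarith
        finally show ?thesis .
      qed
      ultimately show ?case using D[of w] by (simp add: w_def)
    qed
    moreover have "((\<lambda>r::real. dist (phi (of_real r * \<tau>, of_real s * \<mu>)) \<alpha>) \<longlongrightarrow> dist (phi (\<tau>, of_real s * \<mu>)) \<alpha>) (at_left 1)"
      using nd(3)[OF t(2) s(1)] s by (intro tendsto_dist tendsto_const phi_radial[OF t(1)]) simp
    ultimately have "dist (phi (\<tau>, of_real s * \<mu>)) \<alpha> \<le> e"
      by (intro tendsto_upperbound[of _ _ "at_left (1::real)"]) auto
    then show ?thesis using const[OF s(1,2)] by simp
  qed
  then have "\<And>e. e > 0 \<Longrightarrow> dist (poly R1 \<tau> / poly P0 \<tau>) \<alpha> \<le> 0 + e" by simp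
  then have "dist (poly R1 \<tau> / poly P0 \<tau>) \<alpha> \<le> 0" by (rule field_le_epsilon)
  then have "poly R1 \<tau> / poly P0 \<tau> = \<alpha>" by simp
  moreover have "poly P0 \<tau> \<noteq> 0" using P0_nz[of \<tau>] t by simp
  ultimately show ?thesis by (simp add: bb_def \<tau>_def divide_eq_eq)
qed

text \<open>A zero of \<open>bb\<close> on the circle makes \<open>|P0| = |P1|\<close> there, so the
  root of \<open>p\<close> over it is unimodular; \<open>nt_limit_on_line\<close> gives the limit
  \<open>\<alpha>\<close> at this singular point.\<close>

lemma exceptional_if_bb_zero:
  assumes t: "cmod \<tau> = 1" "bb \<tau> = 0"
  shows "\<exists>\<zeta>\<in>torus2. pe \<zeta> = 0 \<and> nt_limit phi \<zeta> \<alpha>"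
proof -
  have "\<alpha> * poly P0 \<tau> = \<tau> ^ n * cnj (poly P1 \<tau>)" using t by (simp add: bb_def R1_unit)
  then have "cmod (\<alpha> * poly P0 \<tau>) = cmod (\<tau> ^ n * cnj (poly P1 \<tau>))" by simp
  then have eq: "cmod (poly P0 \<tau>) = cmod (poly P1 \<tau>)" using alpha t by (simp add: norm_mult norm_power)
  have nz: "poly P1 \<tau> \<noteq> 0" using eq P0_nz[of \<tau>] t by auto
  define \<mu> where "\<mu> = - poly P0 \<tau> / poly P1 \<tau>"
  have "(\<tau>, \<mu>) \<in> torus2" using t eq nz by (simp add: torus2_def \<mu>_def norm_divide)
  moreover have "pe (\<tau>, \<mu>) = 0" using nz by (simp add: pe_eq \<mu>_def)
  ultimately show ?thesis using nt_limit_on_line[OF t] by blast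
qed

lemma exceptional_iff:
  "(\<exists>\<zeta>\<in>torus2. pe \<zeta> = 0 \<and> nt_limit phi \<zeta> \<alpha>) \<longleftrightarrow> (\<exists>\<tau>. cmod \<tau> = 1 \<and> bb \<tau> = 0)"
  using bb_zero_if_exceptional exceptional_if_bb_zero by (fastforce simp: torus2_def)

text \<open>The bound is asked on the torus, which carries \<open>\<sigma>\<close>; Szego kernels
  are bounded there but have poles elsewhere.\<close>

definition bdd_borel :: "(complex \<times> complex \<Rightarrow> complex) \<Rightarrow> bool" where
  "bdd_borel g \<longleftrightarrow> g \<in> borel_measurable borel \<and> (\<exists>B. \<forall>\<zeta>\<in>torus2. cmod (g \<zeta>) \<le> B)"

lemma bdd_borelI: "g \<in> borel_measurable borel \<Longrightarrow> (\<And>\<zeta>. \<zeta> \<in> torus2 \<Longrightarrow> cmod (g \<zeta>) \<le> B) \<Longrightarrow> bdd_borel g"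
  unfolding bdd_borel_def by blast

lemma borel_sigma: "g \<in> borel_measurable borel \<Longrightarrow> g \<in> borel_measurable \<sigma>"
  by (simp add: measurable_cong_sets[OF sets_sigma refl])

lemma integrable_mult_bdd:
  assumes e: "integrable \<sigma> e" and g: "bdd_borel g"
  shows "integrable \<sigma> (\<lambda>\<zeta>. e \<zeta> * g \<zeta>)"
proof -
  obtain B where B: "\<And>\<zeta>. \<zeta> \<in> torus2 \<Longrightarrow> cmod (g \<zeta>) \<le> B" using g by (auto simp: bdd_borel_def)
  have gm: "g \<in> borel_measurable \<sigma>" using g borel_sigma by (auto simp: bdd_borel_def)
  show ?thesis
  proof (rule Bochner_Integration.integrable_bound)
    show "integrable \<sigma> (\<lambda>\<zeta>. of_real B * e \<zeta>)" using e by simp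
    show "(\<lambda>\<zeta>. e \<zeta> * g \<zeta>) \<in> borel_measurable \<sigma>" by (intro borel_measurable_times gm borel_measurable_integrable e)
    show "AE \<zeta> in \<sigma>. norm (e \<zeta> * g \<zeta>) \<le> norm (of_real B * e \<zeta>)"
      using AE_torus
    proof eventually_elim
      case (elim \<zeta>)
      have "cmod (e \<zeta>) * cmod (g \<zeta>) \<le> cmod (e \<zeta>) * \<bar>B\<bar>" using B[OF elim] by (intro mult_left_mono) auto
      then show ?case by (simp add: norm_mult mult.commute)
    qed
  qed
qed

lemma integral_zero_limit:
  assumes e: "integrable \<sigma> e"
    and gk: "\<And>k. g k \<in> borel_measurable borel" "\<And>k \<zeta>. \<zeta> \<in> torus2 \<Longrightarrow> cmod (g k \<zeta>) \<le> B"
    and g: "g' \<in> borel_measurable borel" "\<And>\<zeta>. \<zeta> \<in> torus2 \<Longrightarrow> (\<lambda>k. g k \<zeta>) \<longlonglongrightarrow> g' \<zeta>"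
    and zero: "\<And>k. (\<integral>\<zeta>. e \<zeta> * g k \<zeta> \<partial>\<sigma>) = 0"
  shows "(\<integral>\<zeta>. e \<zeta> * g' \<zeta> \<partial>\<sigma>) = 0"
proof -
  have "(\<lambda>k. \<integral>\<zeta>. e \<zeta> * g k \<zeta> \<partial>\<sigma>) \<longlonglongrightarrow> (\<integral>\<zeta>. e \<zeta> * g' \<zeta> \<partial>\<sigma>)"
  proof (rule integral_dominated_convergence[where w = "\<lambda>\<zeta>. \<bar>B\<bar> * cmod (e \<zeta>)"])
    show "integrable \<sigma> (\<lambda>\<zeta>. \<bar>B\<bar> * cmod (e \<zeta>))" using e by simp
    show "AE \<zeta> in \<sigma>. (\<lambda>k. e \<zeta> * g k \<zeta>) \<longlonglongrightarrow> e \<zeta> * g' \<zeta>"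
      using AE_torus by eventually_elim (intro tendsto_intros g)
    show "AE \<zeta> in \<sigma>. norm (e \<zeta> * g k \<zeta>) \<le> \<bar>B\<bar> * cmod (e \<zeta>)" for k
      using AE_torus
    proof eventually_elim
      case (elim \<zeta>)
      have "cmod (e \<zeta>) * cmod (g k \<zeta>) \<le> cmod (e \<zeta>) * \<bar>B\<bar>" using gk(2)[OF elim, of k] by (intro mult_left_mono) auto
      then show ?case by (simp add: norm_mult mult.commute)
    qed
  qed (intro borel_measurable_times borel_sigma gk g borel_measurable_integrable e)+
  then show ?thesis using zero by (simp add: LIMSEQ_const_iff)
qed

lemma L2_bounded:
  assumes "g \<in> borel_measurable borel" "\<And>\<zeta>. \<zeta> \<in> torus2 \<Longrightarrow> cmod (g \<zeta>) \<le> B"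
  shows "g \<in> L2 \<sigma>"
proof -
  have g: "g \<in> borel_measurable \<sigma>" by (rule borel_sigma[OF assms(1)])
  have "integrable \<sigma> (\<lambda>\<zeta>. (cmod (g \<zeta>))\<^sup>2)"
    by (rule fm.integrable_const_bound[of _ "B\<^sup>2"])
       (use g assms(2) AE_torus in \<open>auto elim!: eventually_mono intro!: power_mono\<close>)
  with g show ?thesis by (simp add: L2_def)
qed

lemma L2_integrable:
  assumes "g \<in> L2 \<sigma>"
  shows "integrable \<sigma> g"
proof -
  have "(\<lambda>_. 1) \<in> L2 \<sigma>" by (rule L2_bounded[of _ 1]) auto
  from L2_mult_integrable[OF assms this] show ?thesis by simp
qed

text \<open>The function \<open>cnj (snd \<zeta>)\<close> on a line contained in the support of \<open>\<sigma>\<close> is orthogonal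
  to all Szego kernels.\<close>

lemma not_onto_if_bb_zero:
  assumes t: "cmod \<tau> = 1" "bb \<tau> = 0"
  shows "\<exists>h\<in>L2 \<sigma>. \<forall>f\<in>model_space phi. \<not> (AE \<zeta> in \<sigma>. J f \<zeta> = h \<zeta>)"
proof -
  define h :: "complex \<times> complex \<Rightarrow> complex" where "h \<zeta> = indicator (line \<tau>) \<zeta> * cnj (snd \<zeta>)" for \<zeta>
  define e :: "complex \<times> complex \<Rightarrow> complex" where "e = indicator (line \<tau>)"
  have sb: "snd \<in> borel_measurable (borel :: (complex \<times> complex) measure)" by (rule snd_borel)
  have h: "h \<in> borel_measurable borel" "\<And>\<zeta>. \<zeta> \<in> torus2 \<Longrightarrow> cmod (h \<zeta>) \<le> 1"
    unfolding h_def by (intro borel_measurable_times borel_measurable_indicator line_borel borel_measurable_cnj sb)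
      (auto simp: torus2_def indicator_def)
  have hL: "h \<in> L2 \<sigma>" by (rule L2_bounded[OF h])
  have e: "integrable \<sigma> e"
    unfolding e_def by (rule integrable_bounded[of _ 1], rule borel_sigma, rule borel_measurable_indicator[OF line_borel]) (simp add: indicator_def)
  define I where "I z \<zeta> = cnj (snd \<zeta>) / (1 - z * cnj (snd \<zeta>))" for z and \<zeta> :: "complex \<times> complex"
  have nz: "1 - z * cnj (snd \<zeta>) \<noteq> 0" if "cmod z < 1" "\<zeta> \<in> torus2" for z \<zeta>
    using szego_denom_nz(2)[of "(0, cnj z)" "(0, cnj (snd \<zeta>))"] that by (simp add: bidisk_def torus2_def mult.commute)
  have Im: "I z \<in> borel_measurable borel" for z
    unfolding I_def[abs_def] by (intro borel_measurable_divide borel_measurable_diff borel_measurable_times borel_measurable_const borel_measurable_cnj sb)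
  have Jm: "(\<lambda>\<zeta> :: complex \<times> complex. 1 / (1 - z * cnj (snd \<zeta>))) \<in> borel_measurable borel" for z
    by (rule borel_measurable_divide borel_measurable_diff borel_measurable_times borel_measurable_const borel_measurable_cnj sb)+
  have I0: "(\<integral>\<zeta>. e \<zeta> * I z \<zeta> \<partial>\<sigma>) = 0" if z: "cmod z < 1" "z \<noteq> 0" for z
  proof -
    have int: "integrable \<sigma> (\<lambda>\<zeta>. e \<zeta> * (1 / (1 - z * cnj (snd \<zeta>))))" if z: "cmod z < 1" for z
    proof (rule integrable_mult_bdd[OF e], rule bdd_borelI)
      show "(\<lambda>\<zeta> :: complex \<times> complex. 1 / (1 - z * cnj (snd \<zeta>))) \<in> borel_measurable borel"
        using Jm[of z] .
      fix \<zeta> :: "complex \<times> complex" assume "\<zeta> \<in> torus2"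
      then have "1 - cmod z \<le> cmod (1 - z * cnj (snd \<zeta>))"
        using norm_triangle_ineq2[of 1 "z * cnj (snd \<zeta>)"] by (simp add: torus2_def norm_mult)
      then show "cmod (1 / (1 - z * cnj (snd \<zeta>))) \<le> 1 / (1 - cmod z)"
        using z by (simp add: norm_divide frac_le)
    qed
    \<comment> \<open>On the torus \<open>z * I z\<close> is
      \<open>1 / (1 - z * cnj z2) - 1\<close>, so its integral over the line is a difference of two
      Cauchy integrals, each equal to the mass of the line.\<close>
    have "z * (\<integral>\<zeta>. e \<zeta> * I z \<zeta> \<partial>\<sigma>) = (\<integral>\<zeta>. z * (e \<zeta> * I z \<zeta>) \<partial>\<sigma>)" by simp
    also have "\<dots> = (\<integral>\<zeta>. e \<zeta> * (1 / (1 - z * cnj (snd \<zeta>))) - e \<zeta> * (1 / (1 - 0 * cnj (snd \<zeta>))) \<partial>\<sigma>)"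
    proof (rule integral_cong_AE)
      show "(\<lambda>\<zeta>. z * (e \<zeta> * I z \<zeta>)) \<in> borel_measurable \<sigma>"
        by (intro borel_measurable_times borel_measurable_const borel_measurable_integrable[OF e] borel_sigma[OF Im])
      show "(\<lambda>\<zeta>. e \<zeta> * (1 / (1 - z * cnj (snd \<zeta>))) - e \<zeta> * (1 / (1 - 0 * cnj (snd \<zeta>)))) \<in> borel_measurable \<sigma>"
        by (intro borel_measurable_diff borel_measurable_integrable int z) simp
      show "AE \<zeta> in \<sigma>. z * (e \<zeta> * I z \<zeta>) = e \<zeta> * (1 / (1 - z * cnj (snd \<zeta>))) - e \<zeta> * (1 / (1 - 0 * cnj (snd \<zeta>)))"
        using AE_torus
      proof eventually_elim
        case (elim \<zeta>)
        then have "z * I z \<zeta> = 1 / (1 - z * cnj (snd \<zeta>)) - 1" using nz[OF z(1) elim] by (simp add: I_def field_simps)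
        then show ?case by (subst mult.left_commute) (simp add: right_diff_distrib)
      qed
    qed
    also have "\<dots> = (\<integral>\<zeta>. e \<zeta> * (1 / (1 - z * cnj (snd \<zeta>))) \<partial>\<sigma>) - (\<integral>\<zeta>. e \<zeta> * (1 / (1 - 0 * cnj (snd \<zeta>))) \<partial>\<sigma>)"
      by (rule Bochner_Integration.integral_diff) (intro int z; simp)+
    also have "\<dots> = 0" unfolding e_def line_mass(3)[OF t z(1)] by (subst line_mass(3)[OF t]) simp_all
    finally show ?thesis using z by simp
  qed
  have I0': "(\<integral>\<zeta>. e \<zeta> * I z \<zeta> \<partial>\<sigma>) = 0" if z: "cmod z < 1" for z
  proof (cases "z = 0")
    case True
    \<comment> \<open>Division by \<open>z\<close> fails at \<open>0\<close>; that value is reached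
      by bounded convergence along \<open>1 / (k + 2)\<close>, whose modulus is at most
      \<open>1 / 2\<close>.\<close>
    define v :: "nat \<Rightarrow> complex" where "v k = 1 / of_nat (k + 2)" for k
    have inv: "v \<longlonglongrightarrow> 0"
      using LIMSEQ_ignore_initial_segment[OF lim_1_over_n, of 2] unfolding v_def[abs_def] by simp
    have small: "cmod (v k) \<le> 1 / 2" for k
      unfolding v_def norm_divide norm_of_nat norm_one by (simp add: field_simps)
    have vnz: "v k \<noteq> 0" for k unfolding v_def divide_eq_0_iff of_nat_eq_0_iff by simp
    show ?thesis
    proof (rule integral_zero_limit[OF e, where g = "\<lambda>k. I (v k)" and B = 2])
      fix \<zeta> :: "complex \<times> complex" assume T: "\<zeta> \<in> torus2"
      show "cmod (I (v k) \<zeta>) \<le> 2" for k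
      proof -
        have "1 / 2 \<le> cmod (1 - v k * cnj (snd \<zeta>))"
          using norm_triangle_ineq2[of 1 "v k * cnj (snd \<zeta>)"] small[of k] T
          by (simp add: torus2_def norm_mult)
        then show ?thesis using T unfolding I_def norm_divide by (simp add: torus2_def divide_le_eq)
      qed
      have "(\<lambda>k. cnj (snd \<zeta>) / (1 - v k * cnj (snd \<zeta>))) \<longlonglongrightarrow> cnj (snd \<zeta>) / (1 - 0 * cnj (snd \<zeta>))"
        by (intro tendsto_intros inv) simp
      then show "(\<lambda>k. I (v k) \<zeta>) \<longlonglongrightarrow> I z \<zeta>" unfolding I_def True .
    next
      show "(\<integral>\<zeta>. e \<zeta> * I (v k) \<zeta> \<partial>\<sigma>) = 0" for k
        by (rule I0[OF _ vnz]) (use small[of k] in simp)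
    qed (rule Im)+
  qed (rule I0[OF z])
  have orth: "(\<integral>\<zeta>. h \<zeta> * cnj (szego w \<zeta>) \<partial>\<sigma>) = 0" if w: "w \<in> bidisk" for w
  proof -
    have "h \<zeta> * cnj (szego w \<zeta>) = 1 / (1 - fst w * cnj \<tau>) * (e \<zeta> * I (snd w) \<zeta>)" for \<zeta>
      by (auto simp: h_def e_def szego_def I_def indicator_def line_def mult.commute)
    then have "(\<integral>\<zeta>. h \<zeta> * cnj (szego w \<zeta>) \<partial>\<sigma>) = 1 / (1 - fst w * cnj \<tau>) * (\<integral>\<zeta>. e \<zeta> * I (snd w) \<zeta> \<partial>\<sigma>)"
      by simp
    then show ?thesis using I0'[of "snd w"] w by (simp add: bidisk_def)
  qed
  have "\<not> (AE \<zeta> in \<sigma>. J f \<zeta> = h \<zeta>)" if f: "f \<in> model_space phi" for f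
  proof
    assume ae: "AE \<zeta> in \<sigma>. J f \<zeta> = h \<zeta>"
    obtain x where x: "x \<in> Kc" "\<And>z. z \<in> bidisk \<Longrightarrow> f z = h2fun x z" using f unfolding model_space_iff by blast
    have "AE \<zeta> in \<sigma>. J f \<zeta> = Jx x \<zeta>" by (rule J_cong[OF x(1,2)]) auto
    with ae have eq: "AE \<zeta> in \<sigma>. Jx x \<zeta> = h \<zeta>" by eventually_elim simp
    have hm: "h \<in> borel_measurable \<sigma>" and jm: "Jx x \<in> borel_measurable \<sigma>"
      using borel_sigma[OF h(1)] Jx_measurable[OF x(1)] by auto
    have "h2fun x w = 0" if w: "w \<in> bidisk" for w
    proof -
      have "(\<integral>\<zeta>. Jx x \<zeta> * cnj (szego w \<zeta>) \<partial>\<sigma>) = (\<integral>\<zeta>. h \<zeta> * cnj (szego w \<zeta>) \<partial>\<sigma>)"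
        by (rule integral_cong_AE) (intro borel_measurable_times hm jm borel_measurable_cnj borel_sigma[OF szego_measurable], intro borel_measurable_times hm jm borel_measurable_cnj borel_sigma[OF szego_measurable], use eq in eventually_elim, simp)
      then show ?thesis using orth[OF w] h2fun_representation[OF x(1) w] by simp
    qed
    then have "x = 0" by (intro h2fun_eqD) simp
    then have z0: "(\<integral>\<zeta>. (cmod (Jx x \<zeta>))\<^sup>2 \<partial>\<sigma>) = 0" using Jx_norm[OF x(1)] by simp
    have "AE \<zeta> in \<sigma>. Jx x \<zeta> = 0" by (rule L2_norm_zero_AE[OF Jx_L2[OF x(1)] z0])
    \<comment> \<open>The function \<open>h\<close> has modulus one on the part of the line in the
      torus, so its vanishing almost everywhere would make the line a null set.\<close>
    with eq AE_torus have "AE \<zeta> in \<sigma>. \<zeta> \<notin> line \<tau>"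
      by eventually_elim (auto simp: h_def torus2_def)
    moreover have "line \<tau> \<in> sets \<sigma>" using line_borel sets_sigma by auto
    ultimately have "emeasure \<sigma> (line \<tau>) = 0" by (subst (asm) AE_iff_measurable[of "line \<tau>"]) auto
    then show False using line_mass(1)[OF t] by (simp add: measure_def)
  qed
  with hL show ?thesis by blast
qed

end

section \<open>Generic values\<close>

context rif_clark
begin

lemma bdd_borel_mult: "bdd_borel g \<Longrightarrow> bdd_borel h \<Longrightarrow> bdd_borel (\<lambda>\<zeta>. g \<zeta> * h \<zeta>)"
proof -
  assume g: "bdd_borel g" and h: "bdd_borel h"
  obtain A B where A: "\<And>\<zeta>. \<zeta> \<in> torus2 \<Longrightarrow> cmod (g \<zeta>) \<le> A" and B: "\<And>\<zeta>. \<zeta> \<in> torus2 \<Longrightarrow> cmod (h \<zeta>) \<le> B"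
    using g h unfolding bdd_borel_def by blast
  show ?thesis
  proof (rule bdd_borelI[of _ "\<bar>A\<bar> * \<bar>B\<bar>"])
    show "(\<lambda>\<zeta>. g \<zeta> * h \<zeta>) \<in> borel_measurable borel" using g h by (intro borel_measurable_times) (auto simp: bdd_borel_def)
    fix \<zeta> :: "complex \<times> complex" assume "\<zeta> \<in> torus2"
    then have "cmod (g \<zeta>) \<le> \<bar>A\<bar>" "cmod (h \<zeta>) \<le> \<bar>B\<bar>" using A B by fastforce+
    then show "cmod (g \<zeta> * h \<zeta>) \<le> \<bar>A\<bar> * \<bar>B\<bar>" by (simp add: norm_mult mult_mono)
  qed
qed

lemma bdd_borel_add: "bdd_borel g \<Longrightarrow> bdd_borel h \<Longrightarrow> bdd_borel (\<lambda>\<zeta>. g \<zeta> + h \<zeta>)"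
proof -
  assume g: "bdd_borel g" and h: "bdd_borel h"
  obtain A B where A: "\<And>\<zeta>. \<zeta> \<in> torus2 \<Longrightarrow> cmod (g \<zeta>) \<le> A" and B: "\<And>\<zeta>. \<zeta> \<in> torus2 \<Longrightarrow> cmod (h \<zeta>) \<le> B"
    using g h unfolding bdd_borel_def by blast
  show ?thesis
  proof (rule bdd_borelI[of _ "A + B"])
    show "(\<lambda>\<zeta>. g \<zeta> + h \<zeta>) \<in> borel_measurable borel" using g h by (intro borel_measurable_add) (auto simp: bdd_borel_def)
    show "cmod (g \<zeta> + h \<zeta>) \<le> A + B" if "\<zeta> \<in> torus2" for \<zeta>
      by (rule norm_triangle_le) (use A[OF that] B[OF that] in linarith)
  qed
qed

lemma bdd_borel_szego: "w \<in> bidisk \<Longrightarrow> bdd_borel (\<lambda>\<zeta>. cnj (szego w \<zeta>))"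
  by (rule bdd_borelI[OF borel_measurable_cnj[OF szego_measurable]]) (simp, erule (1) szego_bound)

lemma bdd_borel_const: "bdd_borel (\<lambda>_. c)"
  by (rule bdd_borelI[of _ "cmod c"]) auto

end

text \<open>Here \<open>e\<close> stands for the residual of a projection onto the range of
  \<open>J\<close>. Integrability of \<open>e\<close> is the right condition for testing it against
  bounded functions.\<close>

locale rif_clark_orth = rif_clark +
  fixes e :: "complex \<times> complex \<Rightarrow> complex"
  assumes e_int: "integrable \<sigma> e"
    and e_orth: "\<And>w. w \<in> bidisk \<Longrightarrow> (\<integral>\<zeta>. e \<zeta> * cnj (szego w \<zeta>) \<partial>\<sigma>) = 0"
    and generic: "\<And>\<tau>. cmod \<tau> = 1 \<Longrightarrow> bb \<tau> \<noteq> 0"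
begin

definition annih :: "(complex \<times> complex \<Rightarrow> complex) \<Rightarrow> bool" where
  "annih g \<longleftrightarrow> bdd_borel g \<and> (\<forall>w\<in>bidisk. (\<integral>\<zeta>. e \<zeta> * (g \<zeta> * cnj (szego w \<zeta>)) \<partial>\<sigma>) = 0)"

text \<open>The annihilator \<open>annih\<close> is only a linear space, whereas its multipliers
  form an algebra. Applied to the constant \<open>1\<close>, which is in \<open>annih\<close>, every
  multiplier lands in \<open>annih\<close>.\<close>

definition multiplier :: "(complex \<times> complex \<Rightarrow> complex) \<Rightarrow> bool" where
  "multiplier h \<longleftrightarrow> bdd_borel h \<and> (\<forall>g. annih g \<longrightarrow> annih (\<lambda>\<zeta>. h \<zeta> * g \<zeta>))"

lemma annih_int: "annih g \<Longrightarrow> w \<in> bidisk \<Longrightarrow> (\<integral>\<zeta>. e \<zeta> * (g \<zeta> * cnj (szego w \<zeta>)) \<partial>\<sigma>) = 0"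
  by (simp add: annih_def)

lemma annih_integrable: "bdd_borel g \<Longrightarrow> w \<in> bidisk \<Longrightarrow> integrable \<sigma> (\<lambda>\<zeta>. e \<zeta> * (g \<zeta> * cnj (szego w \<zeta>)))"
  by (rule integrable_mult_bdd[OF e_int bdd_borel_mult[OF _ bdd_borel_szego]])

lemma annih_1: "annih (\<lambda>_. 1)"
  using e_orth by (simp add: annih_def bdd_borel_const)

lemma annih_add:
  assumes "annih g" "annih h"
  shows "annih (\<lambda>\<zeta>. g \<zeta> + h \<zeta>)"
proof -
  have b: "bdd_borel g" "bdd_borel h" using assms by (auto simp: annih_def)
  have "(\<integral>\<zeta>. e \<zeta> * ((g \<zeta> + h \<zeta>) * cnj (szego w \<zeta>)) \<partial>\<sigma>) = 0" if w: "w \<in> bidisk" for w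
    using Bochner_Integration.integral_add[OF annih_integrable[OF b(1) w] annih_integrable[OF b(2) w]]
      annih_int[OF assms(1) w] annih_int[OF assms(2) w] by (simp add: distrib_left distrib_right)
  with bdd_borel_add[OF b] show ?thesis by (simp add: annih_def)
qed

lemma annih_cmult:
  assumes "annih g"
  shows "annih (\<lambda>\<zeta>. c * g \<zeta>)"
proof -
  have "(\<integral>\<zeta>. e \<zeta> * (c * g \<zeta> * cnj (szego w \<zeta>)) \<partial>\<sigma>) = 0" if w: "w \<in> bidisk" for w
  proof -
    have "(\<integral>\<zeta>. e \<zeta> * (c * g \<zeta> * cnj (szego w \<zeta>)) \<partial>\<sigma>) = (\<integral>\<zeta>. c * (e \<zeta> * (g \<zeta> * cnj (szego w \<zeta>))) \<partial>\<sigma>)"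
      by (rule arg_cong[of _ _ "integral\<^sup>L \<sigma>"], rule ext) (simp only: mult_ac)
    then show ?thesis using annih_int[OF assms w] by simp
  qed
  then show ?thesis using assms bdd_borel_mult[OF bdd_borel_const[of c]] by (simp add: annih_def)
qed

lemma multiplier_const: "multiplier (\<lambda>_. c)"
  by (simp add: multiplier_def bdd_borel_const annih_cmult)

lemma multiplier_add: "multiplier g \<Longrightarrow> multiplier h \<Longrightarrow> multiplier (\<lambda>\<zeta>. g \<zeta> + h \<zeta>)"
  by (simp add: multiplier_def bdd_borel_add distrib_right annih_add)

lemma multiplier_mult: "multiplier g \<Longrightarrow> multiplier h \<Longrightarrow> multiplier (\<lambda>\<zeta>. g \<zeta> * h \<zeta>)"
  by (simp add: multiplier_def bdd_borel_mult mult.assoc)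

lemma multiplier_diff: "multiplier g \<Longrightarrow> multiplier h \<Longrightarrow> multiplier (\<lambda>\<zeta>. g \<zeta> - h \<zeta>)"
  using multiplier_add[OF _ multiplier_mult[OF multiplier_const[of "-1"]], of g h] by simp

lemma multiplier_sum: "(\<And>i. i \<in> I \<Longrightarrow> multiplier (g i)) \<Longrightarrow> multiplier (\<lambda>\<zeta>. \<Sum>i\<in>I. g i \<zeta>)"
  by (induction I rule: infinite_finite_induct) (auto intro: multiplier_add multiplier_const)

lemma multiplier_prod: "(\<And>i. i \<in> I \<Longrightarrow> multiplier (g i)) \<Longrightarrow> multiplier (\<lambda>\<zeta>. \<Prod>i\<in>I. g i \<zeta>)"
  by (induction I rule: infinite_finite_induct) (auto intro: multiplier_mult multiplier_const)

lemma multiplier_power: "multiplier g \<Longrightarrow> multiplier (\<lambda>\<zeta>. g \<zeta> ^ k)"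
  by (induction k) (auto intro: multiplier_mult multiplier_const)

lemma multiplier_borel: "multiplier g \<Longrightarrow> g \<in> borel_measurable borel"
  by (simp add: multiplier_def bdd_borel_def)

lemma multiplier_cong_AE:
  assumes h: "multiplier h" and k: "bdd_borel k" and ae: "AE \<zeta> in \<sigma>. h \<zeta> = k \<zeta>"
  shows "multiplier k"
  unfolding multiplier_def
proof (intro conjI allI impI k)
  fix g assume g: "annih g"
  have hg: "annih (\<lambda>\<zeta>. h \<zeta> * g \<zeta>)" using h g by (simp add: multiplier_def)
  have b: "bdd_borel h" "bdd_borel g" using h g by (auto simp: multiplier_def annih_def)
  have "(\<integral>\<zeta>. e \<zeta> * (k \<zeta> * g \<zeta> * cnj (szego w \<zeta>)) \<partial>\<sigma>) = 0" if w: "w \<in> bidisk" for w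
  proof -
    have "(\<integral>\<zeta>. e \<zeta> * (k \<zeta> * g \<zeta> * cnj (szego w \<zeta>)) \<partial>\<sigma>) = (\<integral>\<zeta>. e \<zeta> * (h \<zeta> * g \<zeta> * cnj (szego w \<zeta>)) \<partial>\<sigma>)"
    proof (rule integral_cong_AE)
      show "(\<lambda>\<zeta>. e \<zeta> * (k \<zeta> * g \<zeta> * cnj (szego w \<zeta>))) \<in> borel_measurable \<sigma>"
        by (rule borel_measurable_integrable[OF annih_integrable[OF bdd_borel_mult[OF k b(2)] w]])
      show "(\<lambda>\<zeta>. e \<zeta> * (h \<zeta> * g \<zeta> * cnj (szego w \<zeta>))) \<in> borel_measurable \<sigma>"
        by (rule borel_measurable_integrable[OF annih_integrable[OF bdd_borel_mult[OF b] w]])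
      show "AE \<zeta> in \<sigma>. e \<zeta> * (k \<zeta> * g \<zeta> * cnj (szego w \<zeta>)) = e \<zeta> * (h \<zeta> * g \<zeta> * cnj (szego w \<zeta>))"
        using ae by eventually_elim simp
    qed
    then show ?thesis using annih_int[OF hg w] by simp
  qed
  then show "annih (\<lambda>\<zeta>. k \<zeta> * g \<zeta>)" using bdd_borel_mult[OF k b(2)] by (simp add: annih_def)
qed

lemma multiplier_limit:
  assumes m: "\<And>k. multiplier (h k)" and B: "\<And>k \<zeta>. \<zeta> \<in> torus2 \<Longrightarrow> cmod (h k \<zeta>) \<le> B"
    and h: "h' \<in> borel_measurable borel" and lim: "\<And>\<zeta>. \<zeta> \<in> torus2 \<Longrightarrow> (\<lambda>k. h k \<zeta>) \<longlonglongrightarrow> h' \<zeta>"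
  shows "multiplier h'"
  unfolding multiplier_def
proof (intro conjI allI impI)
  show bh: "bdd_borel h'"
    by (rule bdd_borelI[OF h, of B]) (rule Lim_bounded[OF tendsto_norm[OF lim]], use B in auto)
  fix g assume g: "annih g"
  have bg: "bdd_borel g" using g by (simp add: annih_def)
  have "(\<integral>\<zeta>. e \<zeta> * (h' \<zeta> * g \<zeta> * cnj (szego w \<zeta>)) \<partial>\<sigma>) = 0" if w: "w \<in> bidisk" for w
  proof -
    have b: "bdd_borel (\<lambda>\<zeta>. g \<zeta> * cnj (szego w \<zeta>))" by (rule bdd_borel_mult[OF bg bdd_borel_szego[OF w]])
    then have bm: "(\<lambda>\<zeta>. g \<zeta> * cnj (szego w \<zeta>)) \<in> borel_measurable borel" by (simp add: bdd_borel_def)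
    from b obtain C where C: "\<And>\<zeta>. \<zeta> \<in> torus2 \<Longrightarrow> cmod (g \<zeta> * cnj (szego w \<zeta>)) \<le> C" unfolding bdd_borel_def by blast
    show ?thesis
    proof (rule integral_zero_limit[OF e_int, where g = "\<lambda>k \<zeta>. h k \<zeta> * g \<zeta> * cnj (szego w \<zeta>)" and B = "\<bar>B\<bar> * \<bar>C\<bar>"])
      show "(\<lambda>\<zeta>. h k \<zeta> * g \<zeta> * cnj (szego w \<zeta>)) \<in> borel_measurable borel" for k
        unfolding mult.assoc by (rule borel_measurable_times[OF multiplier_borel[OF m] bm])
      show "(\<lambda>\<zeta>. h' \<zeta> * g \<zeta> * cnj (szego w \<zeta>)) \<in> borel_measurable borel"
        unfolding mult.assoc by (rule borel_measurable_times[OF h bm])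
      show "(\<lambda>k. h k \<zeta> * g \<zeta> * cnj (szego w \<zeta>)) \<longlonglongrightarrow> h' \<zeta> * g \<zeta> * cnj (szego w \<zeta>)" if "\<zeta> \<in> torus2" for \<zeta>
        by (intro tendsto_mult tendsto_const lim that)
      show "cmod (h k \<zeta> * g \<zeta> * cnj (szego w \<zeta>)) \<le> \<bar>B\<bar> * \<bar>C\<bar>" if "\<zeta> \<in> torus2" for \<zeta> k
        unfolding mult.assoc norm_mult[of "h k \<zeta>"]
        by (intro mult_mono order_trans[OF B[OF that] abs_ge_self] order_trans[OF C[OF that] abs_ge_self]) auto
      show "(\<integral>\<zeta>. e \<zeta> * (h k \<zeta> * g \<zeta> * cnj (szego w \<zeta>)) \<partial>\<sigma>) = 0" for k
        using m[of k] g annih_int[OF _ w] by (simp add: multiplier_def)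
    qed
  qed
  then show "annih (\<lambda>\<zeta>. h' \<zeta> * g \<zeta>)" using bdd_borel_mult[OF bh bg] by (simp add: annih_def)
qed

text \<open>The Neumann series. A bound strictly below \<open>1\<close>, uniform on the torus, keeps
  the partial sums bounded, as \<open>multiplier_limit\<close> demands.\<close>

lemma multiplier_geometric:
  assumes u: "multiplier u" and r: "r < 1" "\<And>\<zeta>. \<zeta> \<in> torus2 \<Longrightarrow> cmod (u \<zeta>) \<le> r"
  shows "multiplier (\<lambda>\<zeta>. 1 / (1 - u \<zeta>))"
proof (rule multiplier_limit[where h = "\<lambda>k \<zeta>. \<Sum>i<k. u \<zeta> ^ i" and B = "1 / (1 - r)"])
  show "multiplier (\<lambda>\<zeta>. \<Sum>i<k. u \<zeta> ^ i)" for k by (intro multiplier_sum multiplier_power u)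
  show "(\<lambda>\<zeta>. 1 / (1 - u \<zeta>)) \<in> borel_measurable borel"
    by (intro borel_measurable_divide borel_measurable_diff borel_measurable_const multiplier_borel u)
  fix \<zeta> :: "complex \<times> complex" assume T: "\<zeta> \<in> torus2"
  have r0: "0 \<le> r" using r(2)[OF T] norm_ge_zero order_trans by blast
  have "cmod (u \<zeta>) < 1" using r(1) r(2)[OF T] by simp
  from geometric_sums[OF this] show "(\<lambda>k. \<Sum>i<k. u \<zeta> ^ i) \<longlonglongrightarrow> 1 / (1 - u \<zeta>)" by (simp add: sums_def)
  fix k
  have "cmod (\<Sum>i<k. u \<zeta> ^ i) \<le> (\<Sum>i<k. r ^ i)"
    by (rule sum_norm_le) (simp add: norm_power power_mono r(2)[OF T])
  also have "\<dots> \<le> (\<Sum>i. r ^ i)" by (rule sum_le_suminf) (use r0 r(1) in \<open>auto intro: summable_geometric\<close>)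
  also have "\<dots> = 1 / (1 - r)" using r0 r(1) by (intro suminf_geometric) simp
  finally show "cmod (\<Sum>i<k. u \<zeta> ^ i) \<le> 1 / (1 - r)" .
qed

text \<open>Times the coordinate of \<open>w\<close>, the product of a conjugate coordinate and a
  conjugate Szego kernel is the difference of the kernels at \<open>w\<close> and at
  \<open>w0\<close>, where that coordinate of \<open>w\<close> is replaced by \<open>0\<close>. Both
  terms are annihilated. Division by the coordinate of \<open>w\<close> excludes the value
  \<open>0\<close>.\<close>

lemma multiplier_cnj_coord:
  assumes pr: "pr \<in> {fst, snd}"
  shows "multiplier (\<lambda>\<zeta>. cnj (pr \<zeta>))"
proof -
  have prm: "pr \<in> borel_measurable borel" using pr fst_borel snd_borel by auto
  have pT: "cmod (pr \<zeta>) = 1" if "\<zeta> \<in> torus2" for \<zeta> using pr that by (auto simp: torus2_def)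
  have b: "bdd_borel (\<lambda>\<zeta>. cnj (pr \<zeta>))"
    by (rule bdd_borelI[of _ 1], rule borel_measurable_cnj[OF prm]) (simp add: pT)
  have "annih (\<lambda>\<zeta>. cnj (pr \<zeta>) * g \<zeta>)" if g: "annih g" for g
  proof -
    have bg: "bdd_borel g" using g by (simp add: annih_def)
    have nz: "(\<integral>\<zeta>. e \<zeta> * (cnj (pr \<zeta>) * g \<zeta> * cnj (szego w \<zeta>)) \<partial>\<sigma>) = 0" if w: "w \<in> bidisk" "pr w \<noteq> 0" for w
    proof -
      define w0 where "w0 = (if pr = fst then (0, snd w) else (fst w, 0))"
      have w0: "w0 \<in> bidisk" using w by (simp add: w0_def bidisk_def)
      have fs: "fst \<noteq> (snd :: complex \<times> complex \<Rightarrow> complex)" by (metis fst_conv snd_conv zero_neq_one)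
      have eq: "pr w * (cnj (pr \<zeta>) * cnj (szego w \<zeta>)) = cnj (szego w \<zeta>) - cnj (szego w0 \<zeta>)" if T: "\<zeta> \<in> torus2" for \<zeta>
      proof -
        define D1 D2 where "D1 = 1 - cnj (fst \<zeta>) * fst w" and "D2 = 1 - cnj (snd \<zeta>) * snd w"
        have "cnj (1 - fst \<zeta> * cnj (fst w)) \<noteq> 0" "cnj (1 - snd \<zeta> * cnj (snd w)) \<noteq> 0"
          unfolding complex_cnj_zero_iff by (rule szego_denom_nz[OF w(1)]; use T in \<open>simp add: torus2_def\<close>)+
        then have D: "D1 \<noteq> 0" "D2 \<noteq> 0" by (simp_all add: D1_def D2_def)
        have sz: "cnj (szego w \<zeta>) = 1 / (D1 * D2)" by (simp add: szego_def D1_def D2_def)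
        have frac: "(1 - D1) * (1 / (D1 * D2)) = 1 / (D1 * D2) - 1 / D2"
          "(1 - D2) * (1 / (D1 * D2)) = 1 / (D1 * D2) - 1 / D1" using D by (simp_all add: field_simps)
        from pr consider "pr = fst" | "pr = snd" by blast
        then show ?thesis
        proof cases
          case 1
          have "cnj (szego w0 \<zeta>) = 1 / D2" by (simp add: 1 szego_def w0_def D2_def)
          moreover have "pr w * cnj (pr \<zeta>) = 1 - D1" by (simp add: 1 D1_def mult.commute)
          ultimately show ?thesis unfolding mult.assoc[symmetric] sz using frac(1) by simp
        next
          case 2
          have "cnj (szego w0 \<zeta>) = 1 / D1" using fs by (simp add: 2 szego_def w0_def D1_def)
          moreover have "pr w * cnj (pr \<zeta>) = 1 - D2" by (simp add: 2 D2_def mult.commute)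
          ultimately show ?thesis unfolding mult.assoc[symmetric] sz using frac(2) by simp
        qed
      qed
      have "pr w * (\<integral>\<zeta>. e \<zeta> * (cnj (pr \<zeta>) * g \<zeta> * cnj (szego w \<zeta>)) \<partial>\<sigma>)
          = (\<integral>\<zeta>. pr w * (e \<zeta> * (cnj (pr \<zeta>) * g \<zeta> * cnj (szego w \<zeta>))) \<partial>\<sigma>)" by simp
      also have "\<dots> = (\<integral>\<zeta>. e \<zeta> * (g \<zeta> * cnj (szego w \<zeta>)) - e \<zeta> * (g \<zeta> * cnj (szego w0 \<zeta>)) \<partial>\<sigma>)"
      proof (rule integral_cong_AE)
        show "(\<lambda>\<zeta>. pr w * (e \<zeta> * (cnj (pr \<zeta>) * g \<zeta> * cnj (szego w \<zeta>)))) \<in> borel_measurable \<sigma>"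
          by (intro borel_measurable_times[OF borel_measurable_const] borel_measurable_integrable annih_integrable bdd_borel_mult b bg w)
        show "(\<lambda>\<zeta>. e \<zeta> * (g \<zeta> * cnj (szego w \<zeta>)) - e \<zeta> * (g \<zeta> * cnj (szego w0 \<zeta>))) \<in> borel_measurable \<sigma>"
          by (intro borel_measurable_diff borel_measurable_integrable annih_integrable bg w w0)
        show "AE \<zeta> in \<sigma>. pr w * (e \<zeta> * (cnj (pr \<zeta>) * g \<zeta> * cnj (szego w \<zeta>)))
            = e \<zeta> * (g \<zeta> * cnj (szego w \<zeta>)) - e \<zeta> * (g \<zeta> * cnj (szego w0 \<zeta>))"
          using AE_torus
        proof eventually_elim
          case (elim \<zeta>)
          have "pr w * (e \<zeta> * (cnj (pr \<zeta>) * g \<zeta> * cnj (szego w \<zeta>))) = e \<zeta> * g \<zeta> * (pr w * (cnj (pr \<zeta>) * cnj (szego w \<zeta>)))"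
            by (simp only: mult_ac)
          also have "\<dots> = e \<zeta> * (g \<zeta> * cnj (szego w \<zeta>)) - e \<zeta> * (g \<zeta> * cnj (szego w0 \<zeta>))"
            unfolding eq[OF elim] by (simp only: right_diff_distrib mult.assoc)
          finally show ?case .
        qed
      qed
      also have "\<dots> = 0"
        using Bochner_Integration.integral_diff[OF annih_integrable[OF bg w(1)] annih_integrable[OF bg w0]]
          annih_int[OF g w(1)] annih_int[OF g w0] by simp
      finally show ?thesis using w(2) by simp
    qed
    have "(\<integral>\<zeta>. e \<zeta> * (cnj (pr \<zeta>) * g \<zeta> * cnj (szego w \<zeta>)) \<partial>\<sigma>) = 0" if w: "w \<in> bidisk" for w
    proof (cases "pr w = 0")
      case True
      \<comment> \<open>Points with vanishing coordinate are approached by the points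
        \<open>W k\<close>, on which the kernels are uniformly bounded.\<close>
      define v :: "nat \<Rightarrow> complex" where "v k = 1 / of_nat (k + 2)" for k
      have v: "v \<longlonglongrightarrow> 0"
        using LIMSEQ_ignore_initial_segment[OF lim_1_over_n, of 2] unfolding v_def[abs_def] by simp
      have small: "cmod (v k) \<le> 1 / 2" for k
        unfolding v_def norm_divide norm_of_nat norm_one by (simp add: field_simps)
      have vnz: "v k \<noteq> 0" for k unfolding v_def divide_eq_0_iff of_nat_eq_0_iff by simp
      define W where "W k = (if pr = fst then (v k, snd w) else (fst w, v k))" for k
      have fs: "fst \<noteq> (snd :: complex \<times> complex \<Rightarrow> complex)" by (metis fst_conv snd_conv zero_neq_one)
      have v1: "cmod (v k) < 1" for k using small[of k] by simp
      have W: "W k \<in> bidisk" "pr (W k) \<noteq> 0" for k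
        using w pr vnz[of k] v1[of k] fs by (auto simp: W_def bidisk_def)
      obtain G where G: "\<And>\<zeta>. \<zeta> \<in> torus2 \<Longrightarrow> cmod (g \<zeta>) \<le> G" using bg by (auto simp: bdd_borel_def)
      define C where "C = 2 / (1 - (if pr = fst then cmod (snd w) else cmod (fst w)))"
      have Cb: "cmod (szego (W k) \<zeta>) \<le> C" if T: "\<zeta> \<in> torus2" for k \<zeta>
      proof -
        have "cmod (szego (W k) \<zeta>) \<le> 1 / ((1 - cmod (fst (W k))) * (1 - cmod (snd (W k))))" by (rule szego_bound[OF W(1) T])
        also have "\<dots> = 1 / (1 - cmod (v k)) * (1 / (1 - (if pr = fst then cmod (snd w) else cmod (fst w))))"
          by (simp add: W_def)
        also have "\<dots> \<le> 2 * (1 / (1 - (if pr = fst then cmod (snd w) else cmod (fst w))))"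
          using small[of k] w by (intro mult_right_mono) (auto simp: bidisk_def divide_le_eq)
        finally show ?thesis by (simp add: C_def)
      qed
      have bgm: "g \<in> borel_measurable borel" using bg by (simp add: bdd_borel_def)
      have meas: "(\<lambda>\<zeta>. cnj (pr \<zeta>) * g \<zeta> * cnj (szego w \<zeta>)) \<in> borel_measurable borel" for w
        by (intro borel_measurable_times borel_measurable_cnj prm bgm szego_measurable)
      show ?thesis
      proof (rule integral_zero_limit[OF e_int, where g = "\<lambda>k \<zeta>. cnj (pr \<zeta>) * g \<zeta> * cnj (szego (W k) \<zeta>)" and B = "\<bar>G\<bar> * C"])
        fix \<zeta> :: "complex \<times> complex" assume T: "\<zeta> \<in> torus2"
        show "cmod (cnj (pr \<zeta>) * g \<zeta> * cnj (szego (W k) \<zeta>)) \<le> \<bar>G\<bar> * C" for k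
          using mult_mono[OF order_trans[OF G[OF T] abs_ge_self] Cb[OF T, of k]] pT[OF T] by (simp add: norm_mult)
        have wW: "W \<longlonglongrightarrow> w"
        proof -
          have "(\<lambda>k. if pr = fst then (v k, snd w) else (fst w, v k)) \<longlonglongrightarrow> (if pr = fst then (0, snd w) else (fst w, 0))"
            by (auto intro!: tendsto_intros v)
          moreover have "(if pr = fst then (0, snd w) else (fst w, 0)) = w"
            using True pr by (auto simp: prod_eq_iff)
          ultimately show ?thesis unfolding W_def[abs_def] by simp
        qed
        have "(\<lambda>k. szego (W k) \<zeta>) \<longlonglongrightarrow> szego w \<zeta>"
          unfolding szego_def using szego_denom_nz[OF w, of \<zeta>] T
          by (intro tendsto_intros tendsto_fst tendsto_snd wW) (auto simp: torus2_def)
        then show "(\<lambda>k. cnj (pr \<zeta>) * g \<zeta> * cnj (szego (W k) \<zeta>)) \<longlonglongrightarrow> cnj (pr \<zeta>) * g \<zeta> * cnj (szego w \<zeta>)"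
          by (intro tendsto_mult tendsto_const tendsto_cnj)
      qed (intro meas nz W)+
    qed (rule nz[OF w])
    then show ?thesis using bdd_borel_mult[OF b bg] by (simp add: annih_def)
  qed
  with b show ?thesis by (simp add: multiplier_def)
qed

end

lemma compact_torus2: "compact torus2"
proof -
  have T: "torus2 = sphere 0 1 \<times> sphere 0 1" by (auto simp: torus2_def)
  show ?thesis unfolding T by (intro compact_Times compact_sphere)
qed

section \<open>The coordinates as multipliers\<close>

context rif_clark
begin

definition "bbp = smult \<alpha> P0 - R1"
definition "btp = smult (cnj \<alpha>) R0 - P1"

lemma poly_bbp: "poly bbp z = bb z" and poly_btp: "poly btp z = bt z"
  by (simp_all add: bbp_def btp_def bb_def bt_def)

lemma bt_reflect:
  assumes z: "z \<noteq> 0"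
  shows "bt z = z ^ n * cnj (bb (1 / cnj z))"
proof -
  have "poly R1 (1 / cnj z) = (1 / cnj z) ^ n * cnj (poly P1 z)" using z by (subst poly_rev_poly) auto
  then have "z ^ n * cnj (poly R1 (1 / cnj z)) = poly P1 z" using z by (simp add: power_one_over)
  moreover have "poly R0 z = z ^ n * cnj (poly P0 (1 / cnj z))" using z by (intro poly_rev_poly) auto
  ultimately show ?thesis by (simp add: bt_def bb_def algebra_simps)
qed

text \<open>The coefficient of degree \<open>n\<close> is \<open>cnj (bb 0)\<close>, which is
  nonzero, so \<open>btp\<close> is not constant. By reflection a root outside the open disk would
  give a zero of \<open>bb\<close> in the closed disk: excluded inside since \<open>dd\<close> has
  no zeros in the bidisk, and on the circle by genericity.\<close>

lemma bt_root:
  assumes generic: "\<And>\<tau>. cmod \<tau> = 1 \<Longrightarrow> bb \<tau> \<noteq> 0"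
  obtains a where "cmod a < 1" "poly btp a = 0"
proof -
  have "coeff btp n = cnj (bb 0)" by (simp add: btp_def bb_def coeff_rev_poly poly_0_coeff_0)
  then have "coeff btp n \<noteq> 0" using bb_nz_disk[of 0] by simp
  then have "degree btp \<ge> n" by (rule le_degree)
  then have "\<not> constant (poly btp)" using n_pos by (simp add: constant_degree)
  then obtain a where a: "poly btp a = 0" using fundamental_theorem_of_algebra by blast
  have "cmod a < 1"
  proof (rule ccontr)
    assume "\<not> cmod a < 1"
    then have a1: "cmod a \<ge> 1" by simp
    then have "a \<noteq> 0" by auto
    then have "bb (1 / cnj a) = 0" using a bt_reflect[of a] by (simp add: poly_btp)
    moreover have "cmod (1 / cnj a) < 1 \<or> cmod (1 / cnj a) = 1" using a1 by (auto simp: norm_divide divide_le_eq less_le)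
    ultimately show False using bb_nz_disk[of "1 / cnj a"] generic[of "1 / cnj a"] by blast
  qed
  with a that show ?thesis by blast
qed

end

context rif_clark_orth
begin

lemma multiplier_cnj_fst: "multiplier (\<lambda>\<zeta>. cnj (fst \<zeta>))"
  and multiplier_cnj_snd: "multiplier (\<lambda>\<zeta>. cnj (snd \<zeta>))"
  by (rule multiplier_cnj_coord; simp)+

lemma multiplier_cnj_poly: "multiplier (\<lambda>\<zeta>. cnj (poly q (fst \<zeta>)))"
proof (induction q)
  case 0 show ?case using multiplier_const[of 0] by simp
next
  case (pCons a q)
  from multiplier_add[OF multiplier_const[of "cnj a"] multiplier_mult[OF multiplier_cnj_fst pCons(2)]]
  show ?case by simp
qed

text \<open>Roots are split off one at a time. Each lies outside the closed disk, so the reciprocal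
  of the corresponding linear factor is a geometric series in the conjugate coordinate.\<close>

lemma multiplier_inverse_cnj_poly:
  assumes "\<And>z. cmod z \<le> 1 \<Longrightarrow> poly q z \<noteq> 0"
  shows "multiplier (\<lambda>\<zeta>. 1 / cnj (poly q (fst \<zeta>)))"
  using assms
proof (induction "degree q" arbitrary: q)
  case 0
  then obtain c where "q = [:c:]" using degree_eq_zeroE by metis
  then show ?case using multiplier_const[of "1 / cnj c"] by simp
next
  case (Suc d)
  have "\<not> constant (poly q)" using Suc(2) by (simp add: constant_degree)
  then obtain a where a: "poly q a = 0" using fundamental_theorem_of_algebra by blast
  then obtain s where s: "q = [:- a, 1:] * s" using poly_eq_0_iff_dvd[of q a] by (auto elim: dvdE)
  have a1: "cmod a > 1" using a Suc(3)[of a] by force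
  then have a0: "a \<noteq> 0" by auto
  have "s \<noteq> 0" using Suc(2) s by auto
  then have "degree q = 1 + degree s" unfolding s by (subst degree_mult_eq) auto
  then have ds: "d = degree s" using Suc(2) by simp
  have "poly s z \<noteq> 0" if "cmod z \<le> 1" for z using Suc(3)[OF that] s by auto
  from Suc(1)[OF ds this] have ms: "multiplier (\<lambda>\<zeta>. 1 / cnj (poly s (fst \<zeta>)))" by simp
  have g: "multiplier (\<lambda>\<zeta>. 1 / (1 - 1 / cnj a * cnj (fst \<zeta>)))"
    by (rule multiplier_geometric[OF multiplier_mult[OF multiplier_const multiplier_cnj_fst], of "1 / cmod a"])
       (use a1 in \<open>auto simp: norm_mult norm_divide torus2_def divide_less_eq_1\<close>)
  have eq: "- 1 / cnj a * (1 / (1 - 1 / cnj a * cnj z)) = 1 / (cnj z - cnj a)" for z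
  proof -
    have frac: "- 1 / c * (1 / D) = 1 / (- c * D)" for c D :: complex by simp
    have "cnj z - cnj a = - cnj a * (1 - 1 / cnj a * cnj z)" using a0 by (simp add: algebra_simps)
    then show ?thesis by (simp only: frac)
  qed
  have eq2: "(\<lambda>\<zeta>. - 1 / cnj a * (1 / (1 - 1 / cnj a * cnj (fst \<zeta>))) * (1 / cnj (poly s (fst \<zeta>)))) = (\<lambda>\<zeta>. 1 / cnj (poly q (fst \<zeta>)))"
    unfolding eq s by (simp add: algebra_simps)
  from multiplier_mult[OF multiplier_mult[OF multiplier_const[of "- 1 / cnj a"] g] ms] show ?case unfolding eq2 .
qed

lemma bb_nz: "cmod z \<le> 1 \<Longrightarrow> bb z \<noteq> 0"
  using bb_nz_disk[of z] generic[of z] by (cases "cmod z = 1") auto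

text \<open>On the torus the equation \<open>dd = 0\<close> can be conjugated, using
  \<open>z2 * cnj z2 = 1\<close>. Solved for \<open>z2\<close> it is then the conjugate of a
  rational function of \<open>z1\<close>, and its denominator is \<open>bb\<close>.\<close>

lemma AE_support: "AE \<zeta> in \<sigma>. \<zeta> \<in> torus2 \<and> cnj (bt (fst \<zeta>)) = \<alpha> * snd \<zeta> * cnj (bb (fst \<zeta>))"
  using AE_torus AE_dd_zero
proof eventually_elim
  case (elim \<zeta>)
  have s: "snd \<zeta> * cnj (snd \<zeta>) = 1" using complex_norm_square[of "snd \<zeta>"] elim(1) by (simp add: torus2_def)
  have "bb (fst \<zeta>) = \<alpha> * snd \<zeta> * bt (fst \<zeta>)" using elim(2) by (simp add: dd_eq)
  then have "\<alpha> * snd \<zeta> * cnj (bb (fst \<zeta>)) = (\<alpha> * cnj \<alpha>) * (snd \<zeta> * cnj (snd \<zeta>)) * cnj (bt (fst \<zeta>))"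
    by (simp add: mult_ac)
  then show ?case using s elim(1) by (simp add: alpha_cnj)
qed

lemma multiplier_inverse_bb: "multiplier (\<lambda>\<zeta>. 1 / cnj (bb (fst \<zeta>)))"
  using multiplier_inverse_cnj_poly[of bbp] bb_nz by (simp add: poly_bbp)

lemma multiplier_snd: "multiplier snd"
proof (rule multiplier_cong_AE)
  show "multiplier (\<lambda>\<zeta>. cnj \<alpha> * cnj (poly btp (fst \<zeta>)) * (1 / cnj (bb (fst \<zeta>))))"
    by (intro multiplier_mult multiplier_const multiplier_cnj_poly multiplier_inverse_bb)
  show "bdd_borel snd" by (rule bdd_borelI[OF snd_borel, of 1]) (simp add: torus2_def)
  show "AE \<zeta> in \<sigma>. cnj \<alpha> * cnj (poly btp (fst \<zeta>)) * (1 / cnj (bb (fst \<zeta>))) = snd \<zeta>"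
    using AE_support
  proof eventually_elim
    case (elim \<zeta>)
    have nz: "cnj (bb (fst \<zeta>)) \<noteq> 0" using bb_nz[of "fst \<zeta>"] elim by (simp add: torus2_def)
    have "cnj \<alpha> * cnj (poly btp (fst \<zeta>)) = (cnj \<alpha> * \<alpha>) * snd \<zeta> * cnj (bb (fst \<zeta>))"
      using elim by (simp add: poly_btp mult.assoc)
    then show ?case using nz by (simp add: alpha_cnj)
  qed
qed

text \<open>A zero \<open>a\<close> of \<open>bt\<close> in the disk makes \<open>1 / (cnj z1 - cnj a)\<close> a multiplier; the
  coordinate \<open>z1\<close> is recovered from the Blaschke factor \<open>X\<close> of \<open>a\<close> by inverting it.\<close>

lemma multiplier_fst: "multiplier fst"
proof -
  obtain a where a: "cmod a < 1" "poly btp a = 0" using bt_root generic by blast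
  then obtain s where s: "btp = [:- a, 1:] * s" using poly_eq_0_iff_dvd[of btp a] by (auto elim: dvdE)
  \<comment> \<open>With \<open>bt = (z1 - a) * s\<close>, the support equation makes
    \<open>Y\<close> equal to \<open>1 / (cnj z1 - cnj a)\<close>; on the circle this is
    \<open>z1 / (1 - cnj a * z1)\<close>, the function \<open>k\<close>.\<close>
  define Y :: "complex \<times> complex \<Rightarrow> complex"
    where "Y \<zeta> = cnj \<alpha> * (cnj (snd \<zeta>) * cnj (poly s (fst \<zeta>)) * (1 / cnj (bb (fst \<zeta>))))" for \<zeta>
  define k :: "complex \<times> complex \<Rightarrow> complex" where "k \<zeta> = fst \<zeta> / (1 - cnj a * fst \<zeta>)" for \<zeta>
  have low: "1 - cmod a \<le> cmod (1 - cnj a * fst \<zeta>)" if "\<zeta> \<in> torus2" for \<zeta> :: "complex \<times> complex"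
    using norm_triangle_ineq2[of 1 "cnj a * fst \<zeta>"] that by (simp add: norm_mult torus2_def)
  then have nz: "1 - cnj a * fst \<zeta> \<noteq> 0" if "\<zeta> \<in> torus2" for \<zeta> :: "complex \<times> complex"
    using a(1) that by fastforce
  have unit: "fst \<zeta> * cnj (fst \<zeta>) = 1" if "\<zeta> \<in> torus2" for \<zeta> :: "complex \<times> complex"
    using complex_norm_square[of "fst \<zeta>"] that by (simp add: torus2_def)
  have mY: "multiplier Y"
    unfolding Y_def[abs_def] by (intro multiplier_mult multiplier_const multiplier_cnj_snd multiplier_cnj_poly multiplier_inverse_bb)
  have mk: "multiplier k"
  proof (rule multiplier_cong_AE[OF mY])
    show "bdd_borel k"
    proof (rule bdd_borelI[of _ "1 / (1 - cmod a)"])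
      show "k \<in> borel_measurable borel" unfolding k_def[abs_def]
        by (intro borel_measurable_divide borel_measurable_diff borel_measurable_times borel_measurable_const fst_borel)
      show "cmod (k \<zeta>) \<le> 1 / (1 - cmod a)" if "\<zeta> \<in> torus2" for \<zeta>
        using low[OF that] a(1) that unfolding k_def norm_divide by (intro frac_le) (auto simp: torus2_def)
    qed
    show "AE \<zeta> in \<sigma>. Y \<zeta> = k \<zeta>"
      using AE_support
    proof eventually_elim
      case (elim \<zeta>)
      then have T: "\<zeta> \<in> torus2" by simp
      have bn: "cnj (bb (fst \<zeta>)) \<noteq> 0" using bb_nz[of "fst \<zeta>"] T by (simp add: torus2_def)
      have sn: "snd \<zeta> * cnj (snd \<zeta>) = 1" using complex_norm_square[of "snd \<zeta>"] T by (simp add: torus2_def)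
      have "cnj (bt (fst \<zeta>)) = (cnj (fst \<zeta>) - cnj a) * cnj (poly s (fst \<zeta>))"
        unfolding poly_btp[symmetric] s by (simp add: algebra_simps)
      then have eq: "(cnj (fst \<zeta>) - cnj a) * cnj (poly s (fst \<zeta>)) = \<alpha> * snd \<zeta> * cnj (bb (fst \<zeta>))" using elim by simp
      have "(1 - cnj a * fst \<zeta>) * Y \<zeta> = fst \<zeta> * ((cnj (fst \<zeta>) - cnj a) * Y \<zeta>)"
        using unit[OF T] by (simp add: algebra_simps)
      also have "(cnj (fst \<zeta>) - cnj a) * Y \<zeta>
          = cnj \<alpha> * cnj (snd \<zeta>) * ((cnj (fst \<zeta>) - cnj a) * cnj (poly s (fst \<zeta>))) * (1 / cnj (bb (fst \<zeta>)))"
        unfolding Y_def by (simp only: mult_ac)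
      also have "\<dots> = (cnj \<alpha> * \<alpha>) * (snd \<zeta> * cnj (snd \<zeta>)) * (cnj (bb (fst \<zeta>)) * (1 / cnj (bb (fst \<zeta>))))"
        unfolding eq by (simp only: mult_ac)
      also have "\<dots> = 1" using bn sn by (simp add: alpha_cnj)
      finally show ?case using nz[OF T] by (simp add: k_def eq_divide_eq mult.commute)
    qed
  qed
  define X where "X \<zeta> = (1 - a * cnj (fst \<zeta>)) * k \<zeta>" for \<zeta> :: "complex \<times> complex"
  have mX: "multiplier X"
    unfolding X_def[abs_def] by (intro multiplier_mult multiplier_diff multiplier_const multiplier_cnj_fst mk)
  have X: "X \<zeta> = (fst \<zeta> - a) / (1 - cnj a * fst \<zeta>)" if T: "\<zeta> \<in> torus2" for \<zeta>
    using unit[OF T] by (simp add: X_def k_def algebra_simps)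
  have X1: "cmod (X \<zeta>) = 1" if T: "\<zeta> \<in> torus2" for \<zeta>
  proof -
    have "1 - cnj a * fst \<zeta> = fst \<zeta> * cnj (fst \<zeta> - a)" using unit[OF T] by (simp add: algebra_simps)
    then have "cmod (1 - cnj a * fst \<zeta>) = cmod (fst \<zeta>) * cmod (fst \<zeta> - a)" by (metis norm_mult complex_mod_cnj)
    then have eq: "cmod (1 - cnj a * fst \<zeta>) = cmod (fst \<zeta> - a)" using T by (simp add: torus2_def)
    show ?thesis unfolding X[OF T] norm_divide eq[symmetric] by (rule divide_self) (use nz[OF T] in simp)
  qed
  have mG: "multiplier (\<lambda>\<zeta>. 1 / (1 - (- cnj a) * X \<zeta>))"
    by (rule multiplier_geometric[OF multiplier_mult[OF multiplier_const mX] a(1)]) (simp add: norm_mult X1)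
  show ?thesis
  proof (rule multiplier_cong_AE)
    show "multiplier (\<lambda>\<zeta>. (X \<zeta> + a) * (1 / (1 - (- cnj a) * X \<zeta>)))"
      by (intro multiplier_mult multiplier_add mX multiplier_const mG)
    show "bdd_borel fst" by (rule bdd_borelI[OF fst_borel, of 1]) (simp add: torus2_def)
    show "AE \<zeta> in \<sigma>. (X \<zeta> + a) * (1 / (1 - (- cnj a) * X \<zeta>)) = fst \<zeta>"
      using AE_torus
    proof eventually_elim
      case T: (elim \<zeta>)
      define D where "D = 1 - cnj a * fst \<zeta>"
      have D: "D \<noteq> 0" using nz[OF T] by (simp add: D_def)
      have XD: "X \<zeta> * D = fst \<zeta> - a" using X[OF T] D by (simp add: D_def)
      have aa: "1 - a * cnj a \<noteq> 0"
      proof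
        assume "1 - a * cnj a = 0"
        then have "cmod a * cmod a = 1" by (metis complex_mod_cnj eq_iff_diff_eq_0 norm_mult norm_one)
        then show False using a(1) by (metis abs_norm_cancel less_irrefl abs_square_eq_1 power2_eq_square)
      qed
      have "(1 - (- cnj a) * X \<zeta>) * D = D + cnj a * (X \<zeta> * D)" by (simp add: algebra_simps)
      also have "\<dots> = 1 - a * cnj a" unfolding XD by (simp add: D_def algebra_simps)
      finally have n1: "(1 - (- cnj a) * X \<zeta>) * D = 1 - a * cnj a" .
      have "(X \<zeta> + a) * D = X \<zeta> * D + a * D" by (simp add: algebra_simps)
      also have "\<dots> = fst \<zeta> * (1 - a * cnj a)" unfolding XD by (simp add: D_def algebra_simps)
      also have "\<dots> = fst \<zeta> * (1 - (- cnj a) * X \<zeta>) * D" unfolding n1[symmetric] by (simp add: mult.assoc)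
      finally have "X \<zeta> + a = fst \<zeta> * (1 - (- cnj a) * X \<zeta>)" using D by simp
      moreover have "1 - (- cnj a) * X \<zeta> \<noteq> 0" using n1 aa by auto
      ultimately show ?case by simp
    qed
  qed
qed

section \<open>From the coordinates to indicators of Borel sets\<close>

lemma multiplier_Re: "multiplier f \<Longrightarrow> multiplier (\<lambda>\<zeta>. cnj (f \<zeta>)) \<Longrightarrow> multiplier (\<lambda>\<zeta>. of_real (Re (f \<zeta>)))"
  and multiplier_Im: "multiplier f \<Longrightarrow> multiplier (\<lambda>\<zeta>. cnj (f \<zeta>)) \<Longrightarrow> multiplier (\<lambda>\<zeta>. of_real (Im (f \<zeta>)))"
proof -
  assume f: "multiplier f" "multiplier (\<lambda>\<zeta>. cnj (f \<zeta>))"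
  have re: "of_real (Re z) = 1 / 2 * (z + cnj z)" and im: "of_real (Im z) = - \<i> / 2 * (z - cnj z)" for z
    by (simp_all add: complex_eq_iff)
  show "multiplier (\<lambda>\<zeta>. of_real (Re (f \<zeta>)))" unfolding re by (intro multiplier_mult multiplier_const multiplier_add f)
  show "multiplier (\<lambda>\<zeta>. of_real (Im (f \<zeta>)))" unfolding im by (intro multiplier_mult multiplier_const multiplier_diff f)
qed

lemma multiplier_real_polynomial:
  "real_polynomial_function g \<Longrightarrow> multiplier (\<lambda>\<zeta>. of_real (g \<zeta>))"
proof (induction rule: real_polynomial_function.induct)
  case (linear f)
  then interpret bounded_linear f .
  define c1 c2 c3 c4 where "c1 = f (1, 0)" and "c2 = f (\<i>, 0)" and "c3 = f (0, 1)" and "c4 = f (0, \<i>)"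
  have eq: "f \<zeta> = Re (fst \<zeta>) * c1 + Im (fst \<zeta>) * c2 + Re (snd \<zeta>) * c3 + Im (snd \<zeta>) * c4" for \<zeta>
  proof -
    have "\<zeta> = Re (fst \<zeta>) *\<^sub>R (1, 0) + Im (fst \<zeta>) *\<^sub>R (\<i>, 0) + Re (snd \<zeta>) *\<^sub>R (0, 1) + Im (snd \<zeta>) *\<^sub>R (0, \<i>)"
      by (simp add: prod_eq_iff complex_eq_iff)
    then have "f \<zeta> = f (Re (fst \<zeta>) *\<^sub>R (1, 0) + Im (fst \<zeta>) *\<^sub>R (\<i>, 0) + Re (snd \<zeta>) *\<^sub>R (0, 1) + Im (snd \<zeta>) *\<^sub>R (0, \<i>))" by simp
    then show ?thesis unfolding add scaleR c1_def c2_def c3_def c4_def by simp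
  qed
  show ?case unfolding eq of_real_add of_real_mult
    by (intro multiplier_add multiplier_mult multiplier_const multiplier_Re multiplier_Im
        multiplier_fst multiplier_snd multiplier_cnj_fst multiplier_cnj_snd)
qed (simp_all add: multiplier_const multiplier_add multiplier_mult)

lemma multiplier_continuous:
  fixes f :: "complex \<times> complex \<Rightarrow> real"
  assumes f: "continuous_on UNIV f"
  shows "multiplier (\<lambda>\<zeta>. of_real (f \<zeta>))"
proof -
  have ft: "continuous_on torus2 f" by (rule continuous_on_subset[OF f]) simp
  obtain M where M: "\<And>\<zeta>. \<zeta> \<in> torus2 \<Longrightarrow> \<bar>f \<zeta>\<bar> \<le> M"
    using compact_imp_bounded[OF compact_continuous_image[OF ft compact_torus2]] by (auto simp: bounded_iff)
  have "\<forall>k. \<exists>g. real_polynomial_function g \<and> (\<forall>\<zeta>\<in>torus2. \<bar>f \<zeta> - g \<zeta>\<bar> < 1 / real (Suc k))"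
  proof
    fix k
    obtain g where "real_polynomial_function g" "\<And>\<zeta>. \<zeta> \<in> torus2 \<Longrightarrow> \<bar>f \<zeta> - g \<zeta>\<bar> < 1 / real (Suc k)"
      by (rule Stone_Weierstrass_real_polynomial_function[OF compact_torus2 ft, of "1 / real (Suc k)"]) (simp, blast)
    then show "\<exists>g. real_polynomial_function g \<and> (\<forall>\<zeta>\<in>torus2. \<bar>f \<zeta> - g \<zeta>\<bar> < 1 / real (Suc k))" by blast
  qed
  from choice[OF this] obtain g where g: "\<And>k. real_polynomial_function (g k)"
    "\<And>k \<zeta>. \<zeta> \<in> torus2 \<Longrightarrow> \<bar>f \<zeta> - g k \<zeta>\<bar> < 1 / real (Suc k)" by blast
  show ?thesis
  proof (rule multiplier_limit[where h = "\<lambda>k \<zeta>. of_real (g k \<zeta>)" and B = "M + 1"])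
    show "multiplier (\<lambda>\<zeta>. of_real (g k \<zeta>))" for k by (rule multiplier_real_polynomial[OF g(1)])
    show "(\<lambda>\<zeta>. complex_of_real (f \<zeta>)) \<in> borel_measurable borel"
      by (intro borel_measurable_continuous_onI continuous_intros f)
    fix \<zeta> :: "complex \<times> complex" assume T: "\<zeta> \<in> torus2"
    show "cmod (of_real (g k \<zeta>)) \<le> M + 1" for k
    proof -
      have "1 / real (Suc k) \<le> 1" by simp
      then have "\<bar>g k \<zeta>\<bar> \<le> M + 1" using g(2)[OF T, of k] M[OF T] by linarith
      then show ?thesis by simp
    qed
    have "(\<lambda>k. g k \<zeta> - f \<zeta>) \<longlonglongrightarrow> 0"
    proof (rule Lim_null_comparison[OF _ LIMSEQ_inverse_real_of_nat])
      show "\<forall>\<^sub>F k in sequentially. norm (g k \<zeta> - f \<zeta>) \<le> inverse (real (Suc k))"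
        using g(2)[OF T] by (intro always_eventually allI) (simp add: abs_minus_commute inverse_eq_divide less_imp_le del: of_nat_Suc)
    qed
    then have "(\<lambda>k. g k \<zeta>) \<longlonglongrightarrow> f \<zeta>" by (rule LIM_zero_cancel)
    then show "(\<lambda>k. complex_of_real (g k \<zeta>)) \<longlonglongrightarrow> of_real (f \<zeta>)" by (rule tendsto_of_real)
  qed
qed

lemma multiplier_indicator_closed:
  assumes C: "closed C"
  shows "multiplier (indicator C)"
proof (cases "C = {}")
  \<comment> \<open>The distance \<open>infdist\<close> to the empty set is \<open>0\<close> by
    convention, so the approximation below would tend to \<open>1\<close>; the empty set is treated
    apart.\<close>
  case True
  then show ?thesis using multiplier_const[of 0] by (simp add: indicator_def[abs_def])
next
  case False
  show ?thesis
  proof (rule multiplier_limit[where h = "\<lambda>k \<zeta>. of_real (max 0 (1 - real k * infdist \<zeta> C))" and B = 1])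
    show "multiplier (\<lambda>\<zeta>. of_real (max 0 (1 - real k * infdist \<zeta> C)))" for k
      by (rule multiplier_continuous) (intro continuous_intros)
    show "(indicator C :: _ \<Rightarrow> complex) \<in> borel_measurable borel" using C by (intro borel_measurable_indicator) auto
    fix \<zeta> :: "complex \<times> complex"
    have "\<bar>max 0 (1 - real k * infdist \<zeta> C)\<bar> \<le> 1" for k
      using infdist_nonneg[of \<zeta> C] mult_nonneg_nonneg[of "real k" "infdist \<zeta> C"] by auto
    then show "cmod (of_real (max 0 (1 - real k * infdist \<zeta> C))) \<le> 1" for k by (metis norm_of_real)
    show "(\<lambda>k. complex_of_real (max 0 (1 - real k * infdist \<zeta> C))) \<longlonglongrightarrow> indicator C \<zeta>"
    proof (cases "\<zeta> \<in> C")
      case True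
      then show ?thesis by simp
    next
      case out: False
      have d: "infdist \<zeta> C > 0" by (rule infdist_pos_not_in_closed[OF C False out])
      obtain N :: nat where N: "real N > 1 / infdist \<zeta> C" using reals_Archimedean2 by blast
      have "max 0 (1 - real k * infdist \<zeta> C) = 0" if "k \<ge> N" for k
      proof -
        have "1 < real N * infdist \<zeta> C" using N d by (simp add: divide_less_eq)
        also have "\<dots> \<le> real k * infdist \<zeta> C" using that d by (intro mult_right_mono) auto
        finally show ?thesis by simp
      qed
      then have "\<forall>\<^sub>F k in sequentially. complex_of_real (max 0 (1 - real k * infdist \<zeta> C)) = 0"
        unfolding eventually_sequentially by (intro exI[of _ N]) simp
      then show ?thesis using out by (simp add: tendsto_eventually)
    qed
  qed
qed

text \<open>Induction over the generation of Borel sets from open ones. Unions need not be disjoint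
  here: the algebra contains \<open>1\<close> minus the product of the
  \<open>1 - indicator (A i)\<close>, which is the indicator of a finite union, and these converge
  boundedly.\<close>

lemma multiplier_indicator:
  assumes "A \<in> sets borel"
  shows "multiplier (indicator A)"
  using assms unfolding sets_borel
proof (induction rule: sigma_sets.induct)
  case (Basic U)
  have "(indicator U :: _ \<Rightarrow> complex) = (\<lambda>\<zeta>. 1 - indicator (- U) \<zeta>)" by (auto simp: indicator_def)
  with multiplier_diff[OF multiplier_const[of 1] multiplier_indicator_closed[of "- U"]] Basic show ?case
    by (simp add: closed_Compl)
next
  case Empty
  show ?case using multiplier_const[of 0] by (simp add: indicator_def[abs_def])
next
  case (Compl A)
  have "(indicator (UNIV - A) :: _ \<Rightarrow> complex) = (\<lambda>\<zeta>. 1 - indicator A \<zeta>)" by (auto simp: indicator_def)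
  with multiplier_diff[OF multiplier_const[of 1] Compl(2)] show ?case by simp
next
  case (Union A)
  have AB: "A i \<in> sets borel" for i using Union(1) unfolding sets_borel .
  show ?case
  proof (rule multiplier_limit[where h = "\<lambda>k \<zeta>. 1 - (\<Prod>i<k. 1 - indicator (A i) \<zeta>)" and B = 1])
    show "multiplier (\<lambda>\<zeta>. 1 - (\<Prod>i<k. 1 - indicator (A i) \<zeta>))" for k
      by (intro multiplier_diff multiplier_const multiplier_prod Union)
    show "(indicator (\<Union>i. A i) :: _ \<Rightarrow> complex) \<in> borel_measurable borel"
      using AB by (intro borel_measurable_indicator sets.countable_UN) auto
    fix \<zeta> :: "complex \<times> complex"
    have fin: "1 - (\<Prod>i<k. 1 - indicator (A i) \<zeta>) = (indicator (\<Union>i<k. A i) \<zeta> :: complex)" for k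
      by (auto simp: indicator_def prod_zero_iff intro!: prod.neutral)
    show "cmod (1 - (\<Prod>i<k. 1 - indicator (A i) \<zeta>)) \<le> 1" for k unfolding fin by (simp add: indicator_def)
    show "(\<lambda>k. 1 - (\<Prod>i<k. 1 - indicator (A i) \<zeta>)) \<longlonglongrightarrow> (indicator (\<Union>i. A i) \<zeta> :: complex)"
      unfolding fin by (rule LIMSEQ_indicator_UN)
  qed
qed

text \<open>At \<open>w = (0, 0)\<close> the Szego kernel is \<open>1\<close>, so indicator
  multipliers applied to the constant \<open>1\<close> show that \<open>e\<close> has integral zero
  over every Borel set.\<close>

lemma e_AE_zero: "AE \<zeta> in \<sigma>. e \<zeta> = 0"
proof (rule fm.density_zero[OF e_int])
  fix A assume "A \<in> sets \<sigma>"
  then have "multiplier (indicator A)" using sets_sigma by (intro multiplier_indicator) simp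
  then have "annih (\<lambda>\<zeta>. indicator A \<zeta> * 1)" using annih_1 unfolding multiplier_def by blast
  from annih_int[OF this, of "(0, 0)"] have "(\<integral>\<zeta>. e \<zeta> * indicator A \<zeta> \<partial>\<sigma>) = 0"
    by (simp add: bidisk_def szego_def)
  moreover have "indicator A \<zeta> *\<^sub>R e \<zeta> = e \<zeta> * indicator A \<zeta>" for \<zeta> by (simp add: indicator_def)
  ultimately show "set_lebesgue_integral \<sigma> A e = 0" by (simp add: set_lebesgue_integral_def)
qed

end

section \<open>Projection onto the range and surjectivity\<close>

context rif_clark
begin

text \<open>The projection of \<open>h\<close> onto the range of \<open>J\<close> is sought in
  \<open>Kc\<close>: the functional \<open>l\<close> is represented there by a vector
  \<open>x\<close>, and \<open>Jx_polar\<close> translates this into orthogonality of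
  \<open>h - Jx x\<close>.\<close>

lemma Jx_orthogonal_projection:
  assumes h: "h \<in> L2 \<sigma>"
  obtains x where "x \<in> Kc" "\<And>y. y \<in> Kc \<Longrightarrow> (\<integral>\<zeta>. (h \<zeta> - Jx x \<zeta>) * cnj (Jx y \<zeta>) \<partial>\<sigma>) = 0"
proof -
  define l where "l y = Re (\<integral>\<zeta>. h \<zeta> * cnj (Jx y \<zeta>) \<partial>\<sigma>)" for y
  have int: "integrable \<sigma> (\<lambda>\<zeta>. h \<zeta> * cnj (Jx y \<zeta>))" if "y \<in> Kc" for y
    by (rule L2_mult_integrable[OF h Jx_L2[OF that]])
  have hm: "h \<in> borel_measurable \<sigma>" using h by (simp add: L2_def)
  have csc: "(\<integral>\<zeta>. g \<zeta> * cnj (Jx (csc a y) \<zeta>) \<partial>\<sigma>) = cnj a * (\<integral>\<zeta>. g \<zeta> * cnj (Jx y \<zeta>) \<partial>\<sigma>)"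
    if y: "y \<in> Kc" and g: "g \<in> borel_measurable \<sigma>" for a y g
  proof -
    have "(\<integral>\<zeta>. g \<zeta> * cnj (Jx (csc a y) \<zeta>) \<partial>\<sigma>) = (\<integral>\<zeta>. cnj a * (g \<zeta> * cnj (Jx y \<zeta>)) \<partial>\<sigma>)"
    proof (rule integral_cong_AE)
      show "(\<lambda>\<zeta>. g \<zeta> * cnj (Jx (csc a y) \<zeta>)) \<in> borel_measurable \<sigma>"
        by (intro borel_measurable_times borel_measurable_cnj g Jx_measurable Kc_csc y)
      show "(\<lambda>\<zeta>. cnj a * (g \<zeta> * cnj (Jx y \<zeta>))) \<in> borel_measurable \<sigma>"
        by (intro borel_measurable_times borel_measurable_const borel_measurable_cnj g Jx_measurable y)
      show "AE \<zeta> in \<sigma>. g \<zeta> * cnj (Jx (csc a y) \<zeta>) = cnj a * (g \<zeta> * cnj (Jx y \<zeta>))"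
        using Jx_csc[OF y, of a] by eventually_elim (simp add: mult_ac)
    qed
    then show ?thesis by simp
  qed
  have "\<exists>x\<in>Kc. \<forall>y\<in>Kc. l y = inner x y"
  proof (rule riesz_representation_closed_subspace[OF Kc_closed Kc_subspace])
    fix y z assume yz: "y \<in> Kc" "z \<in> Kc"
    have "(\<integral>\<zeta>. h \<zeta> * cnj (Jx (y + z) \<zeta>) \<partial>\<sigma>) = (\<integral>\<zeta>. h \<zeta> * cnj (Jx y \<zeta>) + h \<zeta> * cnj (Jx z \<zeta>) \<partial>\<sigma>)"
    proof (rule integral_cong_AE)
      show "AE \<zeta> in \<sigma>. h \<zeta> * cnj (Jx (y + z) \<zeta>) = h \<zeta> * cnj (Jx y \<zeta>) + h \<zeta> * cnj (Jx z \<zeta>)"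
        using Jx_add[OF yz] by eventually_elim (simp add: distrib_left)
    qed (intro borel_measurable_integrable int Kc_add yz Bochner_Integration.integrable_add)+
    then show "l (y + z) = l y + l z" using int yz by (simp add: l_def)
  next
    fix r y assume "y \<in> Kc"
    then show "l (r *\<^sub>R y) = r * l y" using csc[OF _ hm] by (simp add: l_def csc_scaleR)
  next
    fix y assume y: "y \<in> Kc"
    define H where "H = (\<integral>\<zeta>. (cmod (h \<zeta>))\<^sup>2 \<partial>\<sigma>)"
    \<comment> \<open>In place of Cauchy--Schwarz, \<open>u * v\<close> is bounded by
      \<open>s * u\<^sup>2 + v\<^sup>2 / s\<close> with \<open>s = norm y\<close>; since
      \<open>J\<close> is isometric, integration gives \<open>s * H + s\<close>.\<close>
    show "\<bar>l y\<bar> \<le> (H + 1) * norm y"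
    proof (cases "y = 0")
      case True
      have "l (csc 0 y) = 0" unfolding l_def csc[OF y hm] by simp
      then show ?thesis using True by simp
    next
      case False
      define s where "s = norm y"
      have s: "s > 0" using False by (simp add: s_def)
      have ih: "integrable \<sigma> (\<lambda>\<zeta>. s * (cmod (h \<zeta>))\<^sup>2 + (cmod (Jx y \<zeta>))\<^sup>2 / s)"
        using h Jx_L2[OF y] by (simp add: L2_def)
      have ineq: "u * v \<le> s * u\<^sup>2 + v\<^sup>2 / s" if "u \<ge> 0" "v \<ge> 0" for u v :: real
      proof -
        have "2 * (s * u) * v \<le> (s * u)\<^sup>2 + v\<^sup>2" by (rule sum_squares_bound)
        moreover have "0 \<le> (s * u) * v" using s that by simp
        ultimately have "(s * u) * v \<le> (s * u)\<^sup>2 + v\<^sup>2" unfolding mult.assoc by linarith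
        then have "s * (u * v) \<le> s * (s * u\<^sup>2 + v\<^sup>2 / s)" using s by (simp add: power2_eq_square algebra_simps)
        then show ?thesis using s by simp
      qed
      have "\<bar>l y\<bar> \<le> cmod (\<integral>\<zeta>. h \<zeta> * cnj (Jx y \<zeta>) \<partial>\<sigma>)" unfolding l_def by (rule abs_Re_le_cmod)
      also have "\<dots> \<le> (\<integral>\<zeta>. cmod (h \<zeta> * cnj (Jx y \<zeta>)) \<partial>\<sigma>)" by (rule integral_norm_bound)
      also have "\<dots> \<le> (\<integral>\<zeta>. s * (cmod (h \<zeta>))\<^sup>2 + (cmod (Jx y \<zeta>))\<^sup>2 / s \<partial>\<sigma>)"
        by (intro integral_mono ih integrable_norm int y) (simp add: norm_mult ineq)
      also have "\<dots> = s * H + (norm y)\<^sup>2 / s"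
        using h Jx_L2[OF y] Jx_norm[OF y] by (simp add: L2_def H_def)
      also have "\<dots> = (H + 1) * norm y" using s by (simp add: s_def power2_eq_square algebra_simps)
      finally show ?thesis .
    qed
  next
    fix x assume "x \<in> Kc" "\<And>y. y \<in> Kc \<Longrightarrow> l y = inner x y"
    then show "\<exists>x\<in>Kc. \<forall>y\<in>Kc. l y = inner x y" by blast
  qed
  then obtain x where x: "x \<in> Kc" "\<And>y. y \<in> Kc \<Longrightarrow> l y = inner x y" by blast
  show ?thesis
  proof (rule that[OF x(1)])
    fix y assume y: "y \<in> Kc"
    have gm: "(\<lambda>\<zeta>. h \<zeta> - Jx x \<zeta>) \<in> borel_measurable \<sigma>" using hm Jx_measurable[OF x(1)] by (rule borel_measurable_diff)
    have re: "Re (\<integral>\<zeta>. (h \<zeta> - Jx x \<zeta>) * cnj (Jx z \<zeta>) \<partial>\<sigma>) = 0" if z: "z \<in> Kc" for z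
    proof -
      have "(\<integral>\<zeta>. (h \<zeta> - Jx x \<zeta>) * cnj (Jx z \<zeta>) \<partial>\<sigma>) = (\<integral>\<zeta>. h \<zeta> * cnj (Jx z \<zeta>) \<partial>\<sigma>) - cip x z"
        unfolding Jx_polar[OF x(1) z, symmetric] left_diff_distrib
        by (rule Bochner_Integration.integral_diff[OF int[OF z] L2_mult_integrable[OF Jx_L2[OF x(1)] Jx_L2[OF z]]])
      then show ?thesis using x(2)[OF z] by (simp add: l_def Re_cip)
    qed
    have "Im (\<integral>\<zeta>. (h \<zeta> - Jx x \<zeta>) * cnj (Jx y \<zeta>) \<partial>\<sigma>) = 0"
      using re[OF Kc_csc[OF y, of \<i>]] unfolding csc[OF y gm] by simp
    with re[OF y] show "(\<integral>\<zeta>. (h \<zeta> - Jx x \<zeta>) * cnj (Jx y \<zeta>) \<partial>\<sigma>) = 0" by (simp add: complex_eq_iff)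
  qed
qed

lemma onto_if_generic:
  assumes generic: "\<And>\<tau>. cmod \<tau> = 1 \<Longrightarrow> bb \<tau> \<noteq> 0" and h: "h \<in> L2 \<sigma>"
  shows "\<exists>f\<in>model_space phi. AE \<zeta> in \<sigma>. J f \<zeta> = h \<zeta>"
proof -
  obtain x where x: "x \<in> Kc" "\<And>y. y \<in> Kc \<Longrightarrow> (\<integral>\<zeta>. (h \<zeta> - Jx x \<zeta>) * cnj (Jx y \<zeta>) \<partial>\<sigma>) = 0"
    using Jx_orthogonal_projection[OF h] by blast
  define e where "e \<zeta> = h \<zeta> - Jx x \<zeta>" for \<zeta>
  have ei: "integrable \<sigma> e" unfolding e_def[abs_def]
    by (rule Bochner_Integration.integrable_diff[OF L2_integrable[OF h] L2_integrable[OF Jx_L2[OF x(1)]]])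
  have "(\<integral>\<zeta>. e \<zeta> * cnj (szego w \<zeta>) \<partial>\<sigma>) = 0" if w: "w \<in> bidisk" for w
  proof -
    \<comment> \<open>The image of \<open>kv w\<close> is a nonzero multiple of the Szego kernel, so
      orthogonality to the range of \<open>J\<close> is orthogonality to all Szego kernels.\<close>
    define c where "c = cnj (1 - \<alpha> * cnj (phi w))"
    have c: "c \<noteq> 0" unfolding c_def unfolding complex_cnj_zero_iff by (rule alpha_phi_nz(1)[OF w])
    have "(\<integral>\<zeta>. e \<zeta> * cnj (Jx (kv w) \<zeta>) \<partial>\<sigma>) = (\<integral>\<zeta>. c * (e \<zeta> * cnj (szego w \<zeta>)) \<partial>\<sigma>)"
    proof (rule integral_cong_AE)
      show "(\<lambda>\<zeta>. e \<zeta> * cnj (Jx (kv w) \<zeta>)) \<in> borel_measurable \<sigma>"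
        by (intro borel_measurable_times borel_measurable_integrable[OF ei] borel_measurable_cnj Jx_measurable kv_in_Kc w)
      show "(\<lambda>\<zeta>. c * (e \<zeta> * cnj (szego w \<zeta>))) \<in> borel_measurable \<sigma>"
        by (intro borel_measurable_times borel_measurable_const borel_measurable_integrable[OF ei] borel_measurable_cnj borel_sigma[OF szego_measurable])
      show "AE \<zeta> in \<sigma>. e \<zeta> * cnj (Jx (kv w) \<zeta>) = c * (e \<zeta> * cnj (szego w \<zeta>))"
        using Jx_kv[OF w] by eventually_elim (simp only: complex_cnj_mult c_def mult_ac)
    qed
    then show ?thesis using x(2)[OF kv_in_Kc[OF w]] c by (simp add: e_def)
  qed
  then interpret rif_clark_orth n p \<alpha> \<sigma> J e
    using ei generic by unfold_locales
  have "AE \<zeta> in \<sigma>. Jx x \<zeta> = h \<zeta>" using e_AE_zero by eventually_elim (simp add: e_def)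
  with h2fun_model[OF x(1)] show ?thesis by blast
qed

lemma J_onto_iff_generic:
  "(\<forall>h\<in>L2 \<sigma>. \<exists>f\<in>model_space phi. AE \<zeta> in \<sigma>. J f \<zeta> = h \<zeta>)
    \<longleftrightarrow> \<not> (\<exists>\<zeta>\<in>torus2. pe \<zeta> = 0 \<and> nt_limit phi \<zeta> \<alpha>)"
proof (cases "\<exists>\<tau>. cmod \<tau> = 1 \<and> bb \<tau> = 0")
  case True
  then obtain \<tau> where "cmod \<tau> = 1" "bb \<tau> = 0" by blast
  from not_onto_if_bb_zero[OF this] show ?thesis unfolding exceptional_iff using True by blast
next
  case False
  then show ?thesis unfolding exceptional_iff using onto_if_generic by blast
qed

end

text \<open>Unitarity appears as surjectivity, since \<open>is_clark_embedding\<close> already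
  contains linearity and the isometry. An exceptional value appears as the non-tangential limit of
  the inner function at a zero of \<open>p\<close> on the torus.\<close>

theorem theorem1p2:
  fixes n :: nat and p :: "complex poly poly" and \<alpha> :: complex
    and \<sigma> :: "(complex \<times> complex) measure"
    and J :: "(complex \<times> complex \<Rightarrow> complex) \<Rightarrow> (complex \<times> complex \<Rightarrow> complex)"
  assumes n_pos: "n \<ge> 1"
    and deg_p2: "degree p \<le> 1"
    and deg_p1: "\<forall>j. degree (coeff p j) \<le> n"
    and no_zeros: "\<forall>z\<in>bidisk. eval2 p z \<noteq> 0"
    and deg_pt2: "degree (reflect2 n p) = 1"
    and deg_pt1: "\<exists>j. degree (coeff (reflect2 n p) j) = n"
    and coprime: "coprime p (reflect2 n p)"
    and alpha: "cmod \<alpha> = 1"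
    and clark: "is_clark_measure (\<lambda>z. eval2 (reflect2 n p) z / eval2 p z) \<alpha> \<sigma>"
    and J: "is_clark_embedding (\<lambda>z. eval2 (reflect2 n p) z / eval2 p z) \<alpha> \<sigma> J"
  shows "(\<forall>f\<in>model_space (\<lambda>z. eval2 (reflect2 n p) z / eval2 p z).
            AE \<zeta> in \<sigma>. nt_limit f \<zeta> (J f \<zeta>))
       \<and> ((\<forall>h\<in>L2 \<sigma>. \<exists>f\<in>model_space (\<lambda>z. eval2 (reflect2 n p) z / eval2 p z).
              AE \<zeta> in \<sigma>. J f \<zeta> = h \<zeta>)
          \<longleftrightarrow> \<not> (\<exists>\<zeta>\<in>torus2. eval2 p \<zeta> = 0 \<and>
                   nt_limit (\<lambda>z. eval2 (reflect2 n p) z / eval2 p z) \<zeta> \<alpha>))"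
proof -
  interpret R: rif n p
    by unfold_locales fact+
  interpret C: rif_clark n p \<alpha> \<sigma> J
    using alpha clark J by unfold_locales (simp_all add: R.phi_eq)
  show ?thesis
    unfolding R.phi_eq unfolding R.pe_def[symmetric] using C.J_is_nt_boundary_value C.J_onto_iff_generic by blast
qed

end
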